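(* Let $(R,\mathfrak m,k)$ be a local domain with infinite residue field $k$. Suppose $R$ has an $S_2$-ification $S$ such that $S$ is a regular local ring. Then every MCM $R$-module is isomorphic to $S^{\oplus h}$ for some integer $h\ge 1$. Consequently, $R$ has an Ulrich module if and only if $S$ is an Ulrich module of $R$.
   Context: All rings are commutative with identity, and local rings are Noetherian. An $S_2$-ification of a local domain $R$ is a ring $S$ with $R\subseteq S\subseteq \mathrm{frac}(R)$ such that $S$ is module-finite over $R$, $S$ satisfies Serre's condition $S_2$ as an $R$-module, and for every $f\in S$ the ideal $R:_R f=\{r\in R: rf\in R\}$ has height at least $2$ (the unit ideal is considered to have infinite height). Let $M$ be a nonzero finitely generated $R$-module. Write $\nu_R(M)=\dim_k(M/\mathfrak m M)$ for the minimal number of generators of $M$, $\ell$ for length, and $e_R(M)=\delta!\,\lim_{n\to\infty}\ell(M/\mathfrak m^nM)/n^{\delta}$, with $\delta=\dim M$, for the Hilbert--Samuel multiplicity with respect to $\mathfrak m$. $M$ is maximal Cohen--Macaulay (MCM) if $\mathrm{depth}_R(M)=\dim R$. An MCM $R$-module $M$ is an Ulrich module of $R$ if $e_R(M)=\nu_R(M)$ (equivalently, $\mathfrak m M=IM$ for any minimal reduction $I\subseteq\mathfrak m$ of $\mathfrak m$). *)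

theory Defs
  imports
    Complex_Main
    "HOL-Library.Extended_Nat"
    "HOL-Algebra.Ideal_Product"
    "HOL-Algebra.QuotRing"
    "HOL-Algebra.Ring_Divisibility"
    "HOL-Algebra.Subrings"
    "Jordan_Normal_Form.Missing_VectorSpace"
begin

hide_const (open) Multiset.mult

text \<open>
  Rings and modules are the records of HOL-Algebra.  Linear combinations, spans, module
  homomorphisms and the dimension of a vector space are those of the VectorSpace library.  That
  library declares a second locale called submodule, so the one of HOL-Algebra is written
  \<open>Module.submodule\<close>.
\<close>

section \<open>Local rings, dimension and height\<close>

definition local_ring :: "('a, 'b) ring_scheme \<Rightarrow> bool" where
  "local_ring R \<longleftrightarrow> cring R \<and> noetherian_ring R \<and> (\<exists>!I. maximalideal I R)"

definition max_ideal :: "('a, 'b) ring_scheme \<Rightarrow> 'a set" where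
  "max_ideal R = (THE I. maximalideal I R)"

definition prime_chain :: "('a, 'b) ring_scheme \<Rightarrow> (nat \<Rightarrow> 'a set) \<Rightarrow> nat \<Rightarrow> bool" where
  "prime_chain R C n \<longleftrightarrow> (\<forall>i\<le>n. primeideal (C i) R) \<and> (\<forall>i<n. C i \<subset> C (Suc i))"

definition krull_dim :: "('a, 'b) ring_scheme \<Rightarrow> enat" where
  "krull_dim R = Sup {enat n | n. \<exists>C. prime_chain R C n}"

definition prime_height :: "('a, 'b) ring_scheme \<Rightarrow> 'a set \<Rightarrow> enat" where
  "prime_height R P = Sup {enat n | n. \<exists>C. prime_chain R C n \<and> C n = P}"

text \<open>The infimum over the empty set is \<open>\<infinity>\<close>, so the unit ideal has infinite height.\<close>

definition height :: "('a, 'b) ring_scheme \<Rightarrow> 'a set \<Rightarrow> enat" where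
  "height R I = Inf {prime_height R P | P. primeideal P R \<and> I \<subseteq> P}"


section \<open>Modules\<close>

text \<open>
  A ring \<open>A\<close> as a module.  The same record is an \<open>A\<close>-module and an \<open>R\<close>-module for every subring
  \<open>R\<close> of \<open>A\<close>, since the scalars are not part of a module record.
\<close>

definition ring_as_module :: "('a, 'b) ring_scheme \<Rightarrow> ('a, 'a) module" where
  "ring_as_module A = \<lparr>carrier = carrier A, mult = mult A, one = one A, zero = zero A,
     add = add A, smult = mult A\<rparr>"

definition fg_module :: "('a, 'b) ring_scheme \<Rightarrow> ('a, 'm, 'c) module_scheme \<Rightarrow> bool" where
  "fg_module R M \<longleftrightarrow>
     module R M \<and> (\<exists>X \<subseteq> carrier M. finite X \<and> module.span R M X = carrier M)"

definition module_iso ::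
  "('a, 'b) ring_scheme \<Rightarrow> ('a, 'm, 'c) module_scheme \<Rightarrow> ('a, 'n, 'd) module_scheme \<Rightarrow> bool" where
  "module_iso R M N \<longleftrightarrow> (\<exists>f \<in> module_hom R M N. bij_betw f (carrier M) (carrier N))"

text \<open>
  The direct sum of \<open>h\<close> copies of \<open>M\<close>.  Here and below the fields \<open>mult\<close> and \<open>one\<close> of a module
  record carry no meaning.
\<close>

definition power_module :: "('a, 'm, 'c) module_scheme \<Rightarrow> nat \<Rightarrow> ('a, nat \<Rightarrow> 'm) module" where
  "power_module M h = \<lparr>carrier = {..<h} \<rightarrow>\<^sub>E carrier M,
     mult = (\<lambda>f g. \<lambda>i\<in>{..<h}. \<zero>\<^bsub>M\<^esub>), one = (\<lambda>i\<in>{..<h}. \<zero>\<^bsub>M\<^esub>), zero = (\<lambda>i\<in>{..<h}. \<zero>\<^bsub>M\<^esub>),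
     add = (\<lambda>f g. \<lambda>i\<in>{..<h}. f i \<oplus>\<^bsub>M\<^esub> g i), smult = (\<lambda>r f. \<lambda>i\<in>{..<h}. r \<odot>\<^bsub>M\<^esub> f i)\<rparr>"

definition quot_module :: "('a, 'm, 'c) module_scheme \<Rightarrow> 'm set \<Rightarrow> ('a, 'm set) module" where
  "quot_module M N = \<lparr>carrier = a_rcosets\<^bsub>M\<^esub> N, mult = (\<lambda>X Y. N), one = N, zero = N,
     add = set_add M, smult = (\<lambda>r X. \<Union>x\<in>X. N +>\<^bsub>M\<^esub> (r \<odot>\<^bsub>M\<^esub> x))\<rparr>"

text \<open>The submodule \<open>I M\<close>.\<close>

definition ideal_smult ::
  "('a, 'b) ring_scheme \<Rightarrow> 'a set \<Rightarrow> ('a, 'm, 'c) module_scheme \<Rightarrow> 'm set" where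
  "ideal_smult R I M = module.span R M {a \<odot>\<^bsub>M\<^esub> x | a x. a \<in> I \<and> x \<in> carrier M}"

text \<open>The quotient \<open>M / I M\<close> as a module over \<open>R / I\<close>.\<close>

definition reduction ::
  "('a, 'b) ring_scheme \<Rightarrow> 'a set \<Rightarrow> ('a, 'm, 'c) module_scheme \<Rightarrow> ('a set, 'm set) module" where
  "reduction R I M = (let N = ideal_smult R I M in
     \<lparr>carrier = a_rcosets\<^bsub>M\<^esub> N, mult = (\<lambda>X Y. N), one = N, zero = N,
      add = set_add M, smult = (\<lambda>A X. \<Union>a\<in>A. \<Union>x\<in>X. N +>\<^bsub>M\<^esub> (a \<odot>\<^bsub>M\<^esub> x))\<rparr>)"

definition annihilator :: "('a, 'b) ring_scheme \<Rightarrow> ('a, 'm, 'c) module_scheme \<Rightarrow> 'a set" where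
  "annihilator R M = {r \<in> carrier R. \<forall>x \<in> carrier M. r \<odot>\<^bsub>M\<^esub> x = \<zero>\<^bsub>M\<^esub>}"

definition module_dim :: "('a, 'b) ring_scheme \<Rightarrow> ('a, 'm, 'c) module_scheme \<Rightarrow> enat" where
  "module_dim R M = krull_dim (R Quot annihilator R M)"

definition module_length :: "('a, 'b) ring_scheme \<Rightarrow> ('a, 'm, 'c) module_scheme \<Rightarrow> enat" where
  "module_length R M =
     Sup {enat n | n. \<exists>C. (\<forall>i\<le>n. Module.submodule (C i) R M) \<and> (\<forall>i<n. C i \<subset> C (Suc i))}"


section \<open>Minimal number of generators and multiplicity\<close>

definition num_gens :: "('a, 'b) ring_scheme \<Rightarrow> ('a, 'm, 'c) module_scheme \<Rightarrow> nat" where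
  "num_gens R M = vectorspace.dim (R Quot max_ideal R) (reduction R (max_ideal R) M)"

primrec ideal_power :: "('a, 'b) ring_scheme \<Rightarrow> 'a set \<Rightarrow> nat \<Rightarrow> 'a set" where
  "ideal_power R I 0 = carrier R"
| "ideal_power R I (Suc n) = ideal_prod R I (ideal_power R I n)"

definition multiplicity :: "('a, 'b) ring_scheme \<Rightarrow> ('a, 'm, 'c) module_scheme \<Rightarrow> real" where
  "multiplicity R M = (let d = the_enat (module_dim R M) in
     fact d * lim (\<lambda>n. real (the_enat (module_length R
         (quot_module M (ideal_smult R (ideal_power R (max_ideal R) n) M)))) / real n ^ d))"


section \<open>Depth\<close>

definition nonzerodivisor_on :: "('a, 'm, 'c) module_scheme \<Rightarrow> 'a \<Rightarrow> bool" where
  "nonzerodivisor_on M r \<longleftrightarrow> (\<forall>x \<in> carrier M. r \<odot>\<^bsub>M\<^esub> x = \<zero>\<^bsub>M\<^esub> \<longrightarrow> x = \<zero>\<^bsub>M\<^esub>)"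

definition regular_sequence ::
  "('a, 'b) ring_scheme \<Rightarrow> ('a, 'm, 'c) module_scheme \<Rightarrow> 'a list \<Rightarrow> bool" where
  "regular_sequence R M rs \<longleftrightarrow> set rs \<subseteq> carrier R \<and>
     (\<forall>i<length rs. nonzerodivisor_on
        (quot_module M (ideal_smult R (genideal R (set (take i rs))) M)) (rs ! i)) \<and>
     ideal_smult R (genideal R (set rs)) M \<noteq> carrier M"

text \<open>The zero module has depth \<open>\<infinity>\<close> by convention.\<close>

definition depth :: "('a, 'b) ring_scheme \<Rightarrow> ('a, 'm, 'c) module_scheme \<Rightarrow> enat" where
  "depth R M = (if carrier M = {\<zero>\<^bsub>M\<^esub>} then \<infinity>
     else Sup {enat (length rs) | rs. set rs \<subseteq> max_ideal R \<and> regular_sequence R M rs})"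


section \<open>Localization at a prime and Serre's conditions\<close>

text \<open>
  A fraction \<open>x / s\<close> is the equivalence class of the pair \<open>(x, s)\<close> in \<open>M \<times> (R - P)\<close>, where
  \<open>(x, s)\<close> and \<open>(y, t)\<close> are equivalent if \<open>u t x = u s y\<close> for some \<open>u\<close> outside \<open>P\<close>.
\<close>

definition loc_rel :: "('a, 'b) ring_scheme \<Rightarrow> 'a set \<Rightarrow> ('a, 'm, 'c) module_scheme \<Rightarrow>
    (('m \<times> 'a) \<times> ('m \<times> 'a)) set" where
  "loc_rel R P M = {((x, s), (y, t)). x \<in> carrier M \<and> s \<in> carrier R - P \<and>
     y \<in> carrier M \<and> t \<in> carrier R - P \<and>
     (\<exists>u \<in> carrier R - P. u \<odot>\<^bsub>M\<^esub> (t \<odot>\<^bsub>M\<^esub> x) = u \<odot>\<^bsub>M\<^esub> (s \<odot>\<^bsub>M\<^esub> y))}"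

definition loc_frac :: "('a, 'b) ring_scheme \<Rightarrow> 'a set \<Rightarrow> ('a, 'm, 'c) module_scheme \<Rightarrow>
    'm \<Rightarrow> 'a \<Rightarrow> ('m \<times> 'a) set" where
  "loc_frac R P M x s = loc_rel R P M `` {(x, s)}"

definition loc_ring :: "('a, 'b) ring_scheme \<Rightarrow> 'a set \<Rightarrow> ('a \<times> 'a) set ring" where
  "loc_ring R P = (let frac = loc_frac R P (ring_as_module R) in
     \<lparr>carrier = (carrier R \<times> (carrier R - P)) // loc_rel R P (ring_as_module R),
      mult = (\<lambda>X Y. \<Union>(a, s)\<in>X. \<Union>(b, t)\<in>Y. frac (a \<otimes>\<^bsub>R\<^esub> b) (s \<otimes>\<^bsub>R\<^esub> t)),
      one = frac \<one>\<^bsub>R\<^esub> \<one>\<^bsub>R\<^esub>, zero = frac \<zero>\<^bsub>R\<^esub> \<one>\<^bsub>R\<^esub>,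
      add = (\<lambda>X Y. \<Union>(a, s)\<in>X. \<Union>(b, t)\<in>Y. frac (t \<otimes>\<^bsub>R\<^esub> a \<oplus>\<^bsub>R\<^esub> s \<otimes>\<^bsub>R\<^esub> b) (s \<otimes>\<^bsub>R\<^esub> t))\<rparr>)"

definition loc_module :: "('a, 'b) ring_scheme \<Rightarrow> 'a set \<Rightarrow> ('a, 'm, 'c) module_scheme \<Rightarrow>
    (('a \<times> 'a) set, ('m \<times> 'a) set) module" where
  "loc_module R P M = (let frac = loc_frac R P M in
     \<lparr>carrier = (carrier M \<times> (carrier R - P)) // loc_rel R P M,
      mult = (\<lambda>X Y. frac \<zero>\<^bsub>M\<^esub> \<one>\<^bsub>R\<^esub>), one = frac \<zero>\<^bsub>M\<^esub> \<one>\<^bsub>R\<^esub>, zero = frac \<zero>\<^bsub>M\<^esub> \<one>\<^bsub>R\<^esub>,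
      add = (\<lambda>X Y. \<Union>(x, s)\<in>X. \<Union>(y, t)\<in>Y. frac (t \<odot>\<^bsub>M\<^esub> x \<oplus>\<^bsub>M\<^esub> s \<odot>\<^bsub>M\<^esub> y) (s \<otimes>\<^bsub>R\<^esub> t)),
      smult = (\<lambda>A X. \<Union>(a, s)\<in>A. \<Union>(x, t)\<in>X. frac (a \<odot>\<^bsub>M\<^esub> x) (s \<otimes>\<^bsub>R\<^esub> t))\<rparr>)"

text \<open>
  Primes outside the support of \<open>M\<close> impose no condition, because the zero module has infinite
  depth.
\<close>

definition serre_S :: "nat \<Rightarrow> ('a, 'b) ring_scheme \<Rightarrow> ('a, 'm, 'c) module_scheme \<Rightarrow> bool" where
  "serre_S n R M \<longleftrightarrow> (\<forall>P. primeideal P R \<longrightarrow>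
     depth (loc_ring R P) (loc_module R P M)
       \<ge> min (enat n) (module_dim (loc_ring R P) (loc_module R P M)))"


section \<open>The \<open>S\<^sub>2\<close>-ification\<close>

definition fraction_field :: "'a ring \<Rightarrow> 'a ring \<Rightarrow> bool" where
  "fraction_field R K \<longleftrightarrow> field K \<and> subring (carrier R) K \<and> R = K\<lparr>carrier := carrier R\<rparr> \<and>
     (\<forall>x \<in> carrier K. \<exists>a \<in> carrier R. \<exists>b \<in> carrier R - {\<zero>\<^bsub>R\<^esub>}. x = a \<otimes>\<^bsub>K\<^esub> inv\<^bsub>K\<^esub> b)"

text \<open>\<open>S\<close> is an \<open>S\<^sub>2\<close>-ification of \<open>R\<close> inside the fraction field \<open>K\<close> of \<open>R\<close>.\<close>

definition S2_ification :: "'a ring \<Rightarrow> 'a ring \<Rightarrow> 'a ring \<Rightarrow> bool" where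
  "S2_ification R K S \<longleftrightarrow>
     subring (carrier S) K \<and> S = K\<lparr>carrier := carrier S\<rparr> \<and> carrier R \<subseteq> carrier S \<and>
     fg_module R (ring_as_module S) \<and> serre_S 2 R (ring_as_module S) \<and>
     (\<forall>f \<in> carrier S. height R {r \<in> carrier R. r \<otimes>\<^bsub>S\<^esub> f \<in> carrier R} \<ge> 2)"


section \<open>Regular local rings, maximal Cohen--Macaulay and Ulrich modules\<close>

definition regular_local_ring :: "('a, 'b) ring_scheme \<Rightarrow> bool" where
  "regular_local_ring R \<longleftrightarrow> local_ring R \<and>
     enat (num_gens R ((ring_as_module R)\<lparr>carrier := max_ideal R\<rparr>)) = krull_dim R"

definition MCM :: "('a, 'b) ring_scheme \<Rightarrow> ('a, 'm, 'c) module_scheme \<Rightarrow> bool" where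
  "MCM R M \<longleftrightarrow> fg_module R M \<and> carrier M \<noteq> {\<zero>\<^bsub>M\<^esub>} \<and> depth R M = krull_dim R"

definition Ulrich :: "('a, 'b) ring_scheme \<Rightarrow> ('a, 'm, 'c) module_scheme \<Rightarrow> bool" where
  "Ulrich R M \<longleftrightarrow> MCM R M \<and> multiplicity R M = real (num_gens R M)"

text \<open>
  A quantifier cannot range over modules of all types.  Every finitely generated \<open>R\<close>-module is
  isomorphic to a quotient of some \<open>R\<^sup>n\<close>, and the elements of such a quotient are sets of
  (extensional) functions from \<open>{..<n}\<close> to \<open>R\<close>, so one type contains a copy of each of them.
\<close>

definition has_Ulrich_module :: "('a, 'b) ring_scheme \<Rightarrow> bool" where
  "has_Ulrich_module R \<longleftrightarrow> (\<exists>M :: ('a, (nat \<Rightarrow> 'a) set) module. Ulrich R M)"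

end

(*
  Let M be maximal Cohen-Macaulay of depth d = dim R.  If a regular sequence on M has length g, then
  above an ideal that kills a nonzero element there is a chain of g strict inclusions of primes, and
  above an ideal I with a homomorphism I -> M that is not multiplication by an element of M there is
  such a chain of length g - 1.  With g = d this shows that M is torsion free and, since (R : f) has
  height at least 2, that r |-> (r f) x extends to multiplication by an element f x for f in S and
  x in M.  So M is an S-module.  As S is integral over R, dim S <= dim R, and M has a regular sequence
  of length dim S, the number of generators of the maximal ideal n of S.  The Koszul cohomology of
  these generators then vanishes below degree dim S, and the syzygies Z of a minimal system of
  generators of M satisfy Z = n Z.  Hence Z = 0 and M is free over S.

  Depth, dimension and annihilator of S^h are those of S, while number of generators and
  multiplicity are h times those of S, provided that the limit that defines e(S) exists.  The length
  of m^k S / m^(k+1) S counts the standard monomials of degree k for the lexicographic order.  They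
  form the complement of an up-set of N^t, so by Dickson's lemma the Hilbert function is eventually a
  polynomial.  Its degree is at most dim S because a power of n lies in m S.
*)
theory Submission
  imports Defs "HOL-Computational_Algebra.Polynomial" "HOL-Library.List_Lexorder"
begin

hide_const (open) Polynomial.smult Factorial_Ring.multiplicity Multiset.mult

section \<open>Submodules and finite generation\<close>

text \<open>The two statements about chains of primes are the cases i = 0 and i = 1 of Ischebeck's
  theorem, that Ext^i(R/I, M) vanishes for i < depth M - dim R/I. For i = 1 a class is a
  homomorphism I -> M up to multiplications by elements of M, so no resolutions are needed. Both
  applications find room below the chain, for the zero ideal of the domain R or for two inclusions
  when (R : f) has height at least 2, so that the length would exceed dim R.

  The obstacle in an induction along a regular sequence is the passage from M to M/xM. All
  statements are therefore made modulo a submodule N of a fixed M, and N grows to N + xM. In the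
  same spirit lengths are measured on intervals of submodules.

  Freeness comes from a connecting map: for a minimal cover F -> M with kernel Z and t = dim S,
  vanishing of H^(t-1) for M makes Z/nZ -> F/nF injective, while minimality makes this map zero.

  The limit in the multiplicity has to exist because \<open>lim\<close> is unspecified on divergent
  sequences and then need not be compatible with a factor h.\<close>

definition subm :: "('a, 'b) ring_scheme \<Rightarrow> ('a, 'm, 'c) module_scheme \<Rightarrow> 'm set \<Rightarrow> bool" where
  "subm R M N \<longleftrightarrow> N \<subseteq> carrier M \<and> \<zero>\<^bsub>M\<^esub> \<in> N \<and> (\<forall>x\<in>N. \<forall>y\<in>N. x \<oplus>\<^bsub>M\<^esub> y \<in> N) \<and>
     (\<forall>r\<in>carrier R. \<forall>x\<in>N. r \<odot>\<^bsub>M\<^esub> x \<in> N)"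

definition msum :: "('a, 'm, 'c) module_scheme \<Rightarrow> 'm set \<Rightarrow> 'm set \<Rightarrow> 'm set" where
  "msum M A B = {a \<oplus>\<^bsub>M\<^esub> b | a b. a \<in> A \<and> b \<in> B}"

text \<open>Recursion on the list turns arguments with generators into inductions;
  \<open>span_set_eq_lspan\<close> identifies the result with the span of the library.\<close>

fun lspan :: "('a, 'b) ring_scheme \<Rightarrow> ('a, 'm, 'c) module_scheme \<Rightarrow> 'm list \<Rightarrow> 'm set" where
  "lspan R M [] = {\<zero>\<^bsub>M\<^esub>}"
| "lspan R M (w # ws) = {r \<odot>\<^bsub>M\<^esub> w \<oplus>\<^bsub>M\<^esub> s | r s. r \<in> carrier R \<and> s \<in> lspan R M ws}"

text \<open>For a submodule \<open>Z\<close> this is the product of the ideal generated by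
  \<open>ys\<close> with \<open>Z\<close>; \<open>ideal_smult_genideal\<close> compares it with
  \<open>ideal_smult\<close>. Nakayama's lemma and the image of the top Koszul differential are
  stated with it.\<close>

fun lcomb :: "('a, 'm, 'c) module_scheme \<Rightarrow> 'm set \<Rightarrow> 'a list \<Rightarrow> 'm set" where
  "lcomb M Z [] = {\<zero>\<^bsub>M\<^esub>}"
| "lcomb M Z (y # ys) = {y \<odot>\<^bsub>M\<^esub> z \<oplus>\<^bsub>M\<^esub> w | z w. z \<in> Z \<and> w \<in> lcomb M Z ys}"

lemma subm_subset: "subm R M N \<Longrightarrow> N \<subseteq> carrier M"
  and subm_carr: "subm R M N \<Longrightarrow> x \<in> N \<Longrightarrow> x \<in> carrier M"
  and subm_zero: "subm R M N \<Longrightarrow> \<zero>\<^bsub>M\<^esub> \<in> N"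
  and subm_add: "subm R M N \<Longrightarrow> x \<in> N \<Longrightarrow> y \<in> N \<Longrightarrow> x \<oplus>\<^bsub>M\<^esub> y \<in> N"
  and subm_smult: "subm R M N \<Longrightarrow> r \<in> carrier R \<Longrightarrow> x \<in> N \<Longrightarrow> r \<odot>\<^bsub>M\<^esub> x \<in> N"
  by (auto simp: subm_def)

lemma submI:
  assumes "N \<subseteq> carrier M" "\<zero>\<^bsub>M\<^esub> \<in> N" "\<And>x y. x \<in> N \<Longrightarrow> y \<in> N \<Longrightarrow> x \<oplus>\<^bsub>M\<^esub> y \<in> N"
    "\<And>r x. r \<in> carrier R \<Longrightarrow> x \<in> N \<Longrightarrow> r \<odot>\<^bsub>M\<^esub> x \<in> N"
  shows "subm R M N"
  using assms by (auto simp: subm_def)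

lemma msumI: "a \<in> A \<Longrightarrow> b \<in> B \<Longrightarrow> a \<oplus>\<^bsub>M\<^esub> b \<in> msum M A B"
  by (auto simp: msum_def)

lemma msum_mono: "A \<subseteq> A' \<Longrightarrow> B \<subseteq> B' \<Longrightarrow> msum M A B \<subseteq> msum M A' B'"
  by (auto simp: msum_def)

context module
begin

lemma subm_a_inv: "subm R M N \<Longrightarrow> x \<in> N \<Longrightarrow> \<ominus>\<^bsub>M\<^esub> x \<in> N"
  using subm_smult[of R M N "\<ominus> \<one>" x] subm_carr[of R M N x] by (simp add: smult_l_minus)

lemma subm_minus: "subm R M N \<Longrightarrow> x \<in> N \<Longrightarrow> y \<in> N \<Longrightarrow> x \<ominus>\<^bsub>M\<^esub> y \<in> N"
  by (simp add: a_minus_def subm_a_inv subm_add)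

lemma subm_iff: "Module.submodule N R M \<longleftrightarrow> subm R M N"
proof
  assume N: "Module.submodule N R M"
  then have "N \<noteq> {}" using submoduleE(2) by blast
  then obtain x where x: "x \<in> N" by auto
  then have xc: "x \<in> carrier M" using submoduleE(1)[OF N] by auto
  have "\<zero> \<odot>\<^bsub>M\<^esub> x \<in> N" using submoduleE(4)[OF N _ x] by simp
  then have "\<zero>\<^bsub>M\<^esub> \<in> N" using xc by simp
  then show "subm R M N" using submoduleE[OF N] by (auto simp: subm_def)
next
  assume N: "subm R M N"
  show "Module.submodule N R M"
    by (rule submoduleI) (use N subm_a_inv in \<open>auto simp: subm_def\<close>)
qed

lemma subm_carrier: "subm R M (carrier M)"
  by (auto simp: subm_def)

lemma subm_null: "subm R M {\<zero>\<^bsub>M\<^esub>}"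
  by (auto simp: subm_def)

lemma subm_msum:
  assumes "subm R M A" "subm R M B" shows "subm R M (msum M A B)"
proof (rule submI)
  note c = subm_carr[OF assms(1)] subm_carr[OF assms(2)]
  show "msum M A B \<subseteq> carrier M" by (auto simp: msum_def c)
  show "\<zero>\<^bsub>M\<^esub> \<in> msum M A B"
    using msumI[of "\<zero>\<^bsub>M\<^esub>" A "\<zero>\<^bsub>M\<^esub>" B M] subm_zero[OF assms(1)] subm_zero[OF assms(2)] by simp
  fix x y assume "x \<in> msum M A B" "y \<in> msum M A B"
  then obtain a b a' b' where *: "a \<in> A" "b \<in> B" "x = a \<oplus>\<^bsub>M\<^esub> b" "a' \<in> A" "b' \<in> B" "y = a' \<oplus>\<^bsub>M\<^esub> b'"
    by (auto simp: msum_def)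
  then have "x \<oplus>\<^bsub>M\<^esub> y = (a \<oplus>\<^bsub>M\<^esub> a') \<oplus>\<^bsub>M\<^esub> (b \<oplus>\<^bsub>M\<^esub> b')" by (simp add: c M.a_ac)
  then show "x \<oplus>\<^bsub>M\<^esub> y \<in> msum M A B"
    using * subm_add[OF assms(1)] subm_add[OF assms(2)] by (auto intro: msumI)
next
  note c = subm_carr[OF assms(1)] subm_carr[OF assms(2)]
  fix r x assume r: "r \<in> carrier R" and "x \<in> msum M A B"
  then obtain a b where *: "a \<in> A" "b \<in> B" "x = a \<oplus>\<^bsub>M\<^esub> b" by (auto simp: msum_def)
  then show "r \<odot>\<^bsub>M\<^esub> x \<in> msum M A B"
    using r subm_smult[OF assms(1)] subm_smult[OF assms(2)] by (auto simp: smult_r_distr c intro: msumI)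
qed

lemma subset_msum1: "A \<subseteq> carrier M \<Longrightarrow> \<zero>\<^bsub>M\<^esub> \<in> B \<Longrightarrow> A \<subseteq> msum M A B"
  by (force simp: msum_def)

lemma subset_msum2: "B \<subseteq> carrier M \<Longrightarrow> \<zero>\<^bsub>M\<^esub> \<in> A \<Longrightarrow> B \<subseteq> msum M A B"
  by (force simp: msum_def)

lemma msum_least: "subm R M N \<Longrightarrow> A \<subseteq> N \<Longrightarrow> B \<subseteq> N \<Longrightarrow> msum M A B \<subseteq> N"
  by (auto simp: msum_def intro: subm_add)

lemma subm_image:
  assumes "x \<in> carrier R" "subm R M A" shows "subm R M ((\<lambda>a. x \<odot>\<^bsub>M\<^esub> a) ` A)"
proof (rule submI)
  note c = subm_carr[OF assms(2)]
  show "(\<lambda>a. x \<odot>\<^bsub>M\<^esub> a) ` A \<subseteq> carrier M" using assms c by auto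
  show "\<zero>\<^bsub>M\<^esub> \<in> (\<lambda>a. x \<odot>\<^bsub>M\<^esub> a) ` A" using assms subm_zero[OF assms(2)] by force
next
  note c = subm_carr[OF assms(2)]
  fix u v assume "u \<in> (\<lambda>a. x \<odot>\<^bsub>M\<^esub> a) ` A" "v \<in> (\<lambda>a. x \<odot>\<^bsub>M\<^esub> a) ` A"
  then obtain a b where "a \<in> A" "b \<in> A" "u = x \<odot>\<^bsub>M\<^esub> a" "v = x \<odot>\<^bsub>M\<^esub> b" by auto
  then show "u \<oplus>\<^bsub>M\<^esub> v \<in> (\<lambda>a. x \<odot>\<^bsub>M\<^esub> a) ` A"
    using assms c smult_r_distr[of x a b] subm_add[OF assms(2)] by (metis imageI)
next
  note c = subm_carr[OF assms(2)]
  fix r u assume r: "r \<in> carrier R" "u \<in> (\<lambda>a. x \<odot>\<^bsub>M\<^esub> a) ` A"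
  then obtain a where a: "a \<in> A" "u = x \<odot>\<^bsub>M\<^esub> a" by auto
  have "r \<odot>\<^bsub>M\<^esub> (x \<odot>\<^bsub>M\<^esub> a) = x \<odot>\<^bsub>M\<^esub> (r \<odot>\<^bsub>M\<^esub> a)"
    using r a c assms by (metis R.m_comm smult_assoc1)
  then show "r \<odot>\<^bsub>M\<^esub> u \<in> (\<lambda>a. x \<odot>\<^bsub>M\<^esub> a) ` A"
    using a r subm_smult[OF assms(2)] by auto
qed

lemma lspan_Cons: "lspan R M (w # ws) = msum M ((\<lambda>r. r \<odot>\<^bsub>M\<^esub> w) ` carrier R) (lspan R M ws)"
  by (auto simp: msum_def)

lemma subm_cyclic: "w \<in> carrier M \<Longrightarrow> subm R M ((\<lambda>r. r \<odot>\<^bsub>M\<^esub> w) ` carrier R)"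
proof (rule submI)
  assume w: "w \<in> carrier M"
  show "(\<lambda>r. r \<odot>\<^bsub>M\<^esub> w) ` carrier R \<subseteq> carrier M" using w by auto
  show "\<zero>\<^bsub>M\<^esub> \<in> (\<lambda>r. r \<odot>\<^bsub>M\<^esub> w) ` carrier R" by (rule image_eqI[of _ _ "\<zero>"]) (use w in auto)
next
  fix x y assume "x \<in> (\<lambda>r. r \<odot>\<^bsub>M\<^esub> w) ` carrier R" "y \<in> (\<lambda>r. r \<odot>\<^bsub>M\<^esub> w) ` carrier R" and w: "w \<in> carrier M"
  then obtain r s where "r \<in> carrier R" "s \<in> carrier R" "x = r \<odot>\<^bsub>M\<^esub> w" "y = s \<odot>\<^bsub>M\<^esub> w" by auto
  then show "x \<oplus>\<^bsub>M\<^esub> y \<in> (\<lambda>r. r \<odot>\<^bsub>M\<^esub> w) ` carrier R"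
    using smult_l_distr[of r s w] w by (metis R.a_closed imageI)
next
  fix x r assume "x \<in> (\<lambda>r. r \<odot>\<^bsub>M\<^esub> w) ` carrier R" "r \<in> carrier R" and w: "w \<in> carrier M"
  then show "r \<odot>\<^bsub>M\<^esub> x \<in> (\<lambda>r. r \<odot>\<^bsub>M\<^esub> w) ` carrier R"
    using w by (auto simp flip: smult_assoc1)
qed

lemma subm_lspan: "set ws \<subseteq> carrier M \<Longrightarrow> subm R M (lspan R M ws)"
proof (induction ws)
  case Nil then show ?case by (simp add: subm_null)
next
  case (Cons w ws)
  then show ?case unfolding lspan_Cons using subm_msum subm_cyclic by simp
qed

lemma lspan_least: "subm R M N \<Longrightarrow> set ws \<subseteq> N \<Longrightarrow> lspan R M ws \<subseteq> N"
  by (induction ws) (auto intro!: subm_add subm_smult simp: subm_zero)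

lemma lspan_superset: "set ws \<subseteq> carrier M \<Longrightarrow> set ws \<subseteq> lspan R M ws"
proof (induction ws)
  case Nil then show ?case by simp
next
  case (Cons w ws)
  note s = subm_lspan[of ws]
  have "w = \<one> \<odot>\<^bsub>M\<^esub> w \<oplus>\<^bsub>M\<^esub> \<zero>\<^bsub>M\<^esub>" using Cons by simp
  then have 1: "w \<in> lspan R M (w # ws)" using Cons s subm_zero by force
  have "lspan R M ws \<subseteq> lspan R M (w # ws)"
    unfolding lspan_Cons using Cons subm_subset[OF s] subm_zero[OF subm_cyclic[of w]]
    by (intro subset_msum2) simp_all
  then show ?case using 1 Cons by auto
qed

lemma lspan_mono: "set ws \<subseteq> set vs \<Longrightarrow> set vs \<subseteq> carrier M \<Longrightarrow> lspan R M ws \<subseteq> lspan R M vs"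
  using lspan_least[OF subm_lspan] lspan_superset by (meson subset_trans)

lemma lspan_append:
  assumes "set ws \<subseteq> carrier M" "set vs \<subseteq> carrier M"
  shows "lspan R M (ws @ vs) = msum M (lspan R M ws) (lspan R M vs)"
proof
  have s: "subm R M (lspan R M ws)" "subm R M (lspan R M vs)" using assms subm_lspan by auto
  note b = subset_msum1[of "lspan R M ws" "lspan R M vs"] subset_msum2[of "lspan R M vs" "lspan R M ws"]
  show "lspan R M (ws @ vs) \<subseteq> msum M (lspan R M ws) (lspan R M vs)"
    using b lspan_superset[OF assms(1)] lspan_superset[OF assms(2)]
      subm_subset[OF s(1)] subm_subset[OF s(2)] subm_zero[OF s(1)] subm_zero[OF s(2)]
    by (intro lspan_least subm_msum s) auto
  show "msum M (lspan R M ws) (lspan R M vs) \<subseteq> lspan R M (ws @ vs)"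
    using assms by (intro msum_least subm_lspan lspan_mono) auto
qed

lemma subm_span: "X \<subseteq> carrier M \<Longrightarrow> subm R M (span X)"
  using span_is_submodule[of X] unfolding LinearCombinations.submodule_def subm_def by auto

lemma span_least: "subm R M N \<Longrightarrow> X \<subseteq> N \<Longrightarrow> span X \<subseteq> N"
  by (rule span_is_subset) (auto simp: LinearCombinations.submodule_def subm_def module_axioms)

lemma span_superset: "X \<subseteq> carrier M \<Longrightarrow> X \<subseteq> span X"
  by (rule in_own_span)

lemma span_mono': "X \<subseteq> Y \<Longrightarrow> span X \<subseteq> span Y"
  by (rule span_is_monotone)

lemma span_set_eq_lspan: "set ws \<subseteq> carrier M \<Longrightarrow> span (set ws) = lspan R M ws"
  by (simp add: antisym span_least subm_lspan lspan_superset lspan_least subm_span span_superset)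

lemma span_insert:
  assumes "X \<subseteq> carrier M" "z \<in> carrier M"
  shows "span (insert z X) = msum M ((\<lambda>r. r \<odot>\<^bsub>M\<^esub> z) ` carrier R) (span X)"
proof
  have s: "subm R M ((\<lambda>r. r \<odot>\<^bsub>M\<^esub> z) ` carrier R)" "subm R M (span X)"
    using assms subm_cyclic subm_span by auto
  have "z \<in> (\<lambda>r. r \<odot>\<^bsub>M\<^esub> z) ` carrier R" using assms(2) smult_one by (metis R.one_closed imageI)
  then show "span (insert z X) \<subseteq> msum M ((\<lambda>r. r \<odot>\<^bsub>M\<^esub> z) ` carrier R) (span X)"
    using subset_msum1[OF subm_subset[OF s(1)] subm_zero[OF s(2)]]
      subset_msum2[OF subm_subset[OF s(2)] subm_zero[OF s(1)]] span_superset[OF assms(1)]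
    by (intro span_least subm_msum s) auto
  have "(\<lambda>r. r \<odot>\<^bsub>M\<^esub> z) ` carrier R \<subseteq> span (insert z X)"
    using assms span_superset[of "insert z X"] subm_span[of "insert z X"] by (auto intro!: subm_smult)
  then show "msum M ((\<lambda>r. r \<odot>\<^bsub>M\<^esub> z) ` carrier R) (span X) \<subseteq> span (insert z X)"
    using assms by (intro msum_least subm_span span_mono') auto
qed

lemma subm_lcomb:
  "set ys \<subseteq> carrier R \<Longrightarrow> subm R M Z \<Longrightarrow> subm R M (lcomb M Z ys)"
proof (induction ys)
  case Nil then show ?case by (simp add: subm_null)
next
  case (Cons y ys)
  have "lcomb M Z (y # ys) = msum M ((\<lambda>z. y \<odot>\<^bsub>M\<^esub> z) ` Z) (lcomb M Z ys)"
    by (auto simp: msum_def)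
  then show ?case using Cons subm_msum subm_image by simp
qed

lemma lcomb_mem: "set ys \<subseteq> carrier R \<Longrightarrow> subm R M Z \<Longrightarrow> y \<in> set ys \<Longrightarrow> z \<in> Z \<Longrightarrow> y \<odot>\<^bsub>M\<^esub> z \<in> lcomb M Z ys"
proof (induction ys)
  case Nil then show ?case by simp
next
  case (Cons a ys)
  have s: "subm R M (lcomb M Z ys)" using Cons subm_lcomb by simp
  have zc: "z \<in> carrier M" using Cons subm_carr by auto
  show ?case
  proof (cases "y = a")
    case True
    have "y \<odot>\<^bsub>M\<^esub> z = y \<odot>\<^bsub>M\<^esub> z \<oplus>\<^bsub>M\<^esub> \<zero>\<^bsub>M\<^esub>" using zc Cons.prems True by simp
    then show ?thesis using True Cons subm_zero[OF s] by auto
  next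
    case False
    then have "y \<odot>\<^bsub>M\<^esub> z \<in> lcomb M Z ys" using Cons by auto
    moreover from this have "y \<odot>\<^bsub>M\<^esub> z = a \<odot>\<^bsub>M\<^esub> \<zero>\<^bsub>M\<^esub> \<oplus>\<^bsub>M\<^esub> y \<odot>\<^bsub>M\<^esub> z" using zc Cons.prems subm_carr[OF s] by simp
    ultimately show ?thesis using subm_zero[OF Cons.prems(2)] by auto
  qed
qed

end

section \<open>Noetherian and local rings\<close>

text \<open>The union of a nonempty chain of ideals is one of its members, which serves as the upper
  bound in Zorn's lemma. Maximal annihilators and maximal domains of extension are chosen by this
  lemma.\<close>

lemma (in noetherian_ring) ideals_maximal_element:
  assumes "\<S> \<noteq> {}" "\<And>I. I \<in> \<S> \<Longrightarrow> ideal I R"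
  shows "\<exists>I\<in>\<S>. \<forall>J\<in>\<S>. I \<subseteq> J \<longrightarrow> J = I"
proof (rule subset_Zorn)
  fix C assume C: "subset.chain \<S> C"
  show "\<exists>U\<in>\<S>. \<forall>X\<in>C. X \<subseteq> U"
  proof (cases "C = {}")
    case True then show ?thesis using assms by auto
  next
    case False
    have "subset.chain {I. ideal I R} C" using C assms(2) by (auto simp: subset.chain_def)
    then have "\<Union>C \<in> C" using ideal_chain_is_trivial False by blast
    then show ?thesis using C by (auto simp: subset.chain_def intro!: bexI[of _ "\<Union>C"])
  qed
qed

lemma (in noetherian_ring) proper_ideal_below_maximal:
  assumes "ideal I R" "I \<noteq> carrier R"
  shows "\<exists>J. maximalideal J R \<and> I \<subseteq> J"
proof -
  let ?S = "{J. ideal J R \<and> I \<subseteq> J \<and> J \<noteq> carrier R}"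
  have "\<exists>J\<in>?S. \<forall>K\<in>?S. J \<subseteq> K \<longrightarrow> K = J"
    by (rule ideals_maximal_element) (use assms in auto)
  then obtain J where J: "J \<in> ?S" "\<And>K. K \<in> ?S \<Longrightarrow> J \<subseteq> K \<Longrightarrow> K = J" by auto
  have "maximalideal J R"
    by (rule maximalidealI) (use J in blast)+
  then show ?thesis using J by auto
qed

locale local_noeth = cring R for R (structure) +
  assumes local: "local_ring R"
begin

sublocale noetherian_ring R
  using local by (simp add: local_ring_def)

abbreviation "\<mm> \<equiv> max_ideal R"

lemma max_ideal_maximal: "maximalideal \<mm> R"
  using local theI'[of "\<lambda>I. maximalideal I R"] by (auto simp: local_ring_def max_ideal_def)

lemma max_ideal_unique: "maximalideal I R \<Longrightarrow> I = \<mm>"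
  using local max_ideal_maximal by (auto simp: local_ring_def)

lemma max_ideal_ideal: "ideal \<mm> R"
  using max_ideal_maximal by (simp add: maximalideal_def)

lemma max_ideal_carr: "a \<in> \<mm> \<Longrightarrow> a \<in> carrier R"
  using max_ideal_ideal ideal.Icarr by metis

lemma proper_subset_max: "ideal I R \<Longrightarrow> I \<noteq> carrier R \<Longrightarrow> I \<subseteq> \<mm>"
  using proper_ideal_below_maximal max_ideal_unique by blast

lemma one_notin_max: "\<one> \<notin> \<mm>"
  using max_ideal_maximal ideal.one_imp_carrier[OF max_ideal_ideal] by (auto simp: maximalideal_def maximalideal_axioms_def)

lemma unit_iff: "a \<in> carrier R \<Longrightarrow> a \<in> Units R \<longleftrightarrow> a \<notin> \<mm>"
proof
  assume a: "a \<in> carrier R" "a \<in> Units R"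
  show "a \<notin> \<mm>"
  proof
    assume "a \<in> \<mm>"
    then have "inv a \<otimes> a \<in> \<mm>" using a by (intro ideal.I_l_closed[OF max_ideal_ideal]) auto
    then show False using a one_notin_max by simp
  qed
next
  assume a: "a \<in> carrier R" "a \<notin> \<mm>"
  have "PIdl a = carrier R"
    using proper_subset_max[OF cgenideal_ideal[OF a(1)]] a cgenideal_self[OF a(1)] by auto
  then obtain x where "x \<in> carrier R" "\<one> = x \<otimes> a" by (auto simp: cgenideal_def)
  then show "a \<in> Units R" using a by (metis Units_one_closed prod_unit_r prod_unit_l unit_factor m_comm)
qed

lemma one_minus_unit: "a \<in> \<mm> \<Longrightarrow> \<one> \<ominus> a \<in> Units R"
proof -
  assume a: "a \<in> \<mm>"
  then have ac: "a \<in> carrier R" using max_ideal_carr by auto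
  have "\<one> \<ominus> a \<notin> \<mm>"
  proof
    assume "\<one> \<ominus> a \<in> \<mm>"
    then have "(\<one> \<ominus> a) \<oplus> a \<in> \<mm>"
      using a max_ideal_ideal by (simp add: additive_subgroup.a_closed ideal.axioms(1))
    moreover have "(\<one> \<ominus> a) \<oplus> a = \<one>" using ac by algebra
    ultimately show False using one_notin_max by simp
  qed
  then show ?thesis using unit_iff ac by simp
qed

end

lemma local_noethI: "local_ring R \<Longrightarrow> local_noeth R"
  by (simp add: local_noeth_def local_noeth_axioms_def local_ring_def)

lemma (in cring) idealI2:
  assumes "I \<subseteq> carrier R" "\<zero> \<in> I" "\<And>a b. a \<in> I \<Longrightarrow> b \<in> I \<Longrightarrow> a \<oplus> b \<in> I"
    "\<And>r a. r \<in> carrier R \<Longrightarrow> a \<in> I \<Longrightarrow> r \<otimes> a \<in> I"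
  shows "ideal I R"
proof (rule idealI)
  show "ring R" ..
  have "\<ominus> a \<in> I" if "a \<in> I" for a
  proof -
    have "\<ominus> \<one> \<otimes> a \<in> I" using assms(4)[of "\<ominus> \<one>" a] that by simp
    moreover have "a \<in> carrier R" using that assms(1) by auto
    ultimately show ?thesis by (simp add: l_minus)
  qed
  then show "subgroup I (add_monoid R)"
    using assms by (intro subgroup.intro) (auto simp flip: a_inv_def)
  show "\<And>a x. a \<in> I \<Longrightarrow> x \<in> carrier R \<Longrightarrow> x \<otimes> a \<in> I" using assms by auto
  show "\<And>a x. a \<in> I \<Longrightarrow> x \<in> carrier R \<Longrightarrow> a \<otimes> x \<in> I"
    using assms by (metis m_comm subset_iff)
qed

lemma (in cring) ideal_facts:
  assumes "ideal I R"
  shows "I \<subseteq> carrier R" "\<zero> \<in> I" "\<And>a b. a \<in> I \<Longrightarrow> b \<in> I \<Longrightarrow> a \<oplus> b \<in> I"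
    "\<And>r a. r \<in> carrier R \<Longrightarrow> a \<in> I \<Longrightarrow> r \<otimes> a \<in> I" "\<And>r a. r \<in> carrier R \<Longrightarrow> a \<in> I \<Longrightarrow> a \<otimes> r \<in> I"
    "\<And>a b. a \<in> I \<Longrightarrow> b \<in> I \<Longrightarrow> a \<ominus> b \<in> I" "\<And>a. a \<in> I \<Longrightarrow> a \<in> carrier R" "\<And>a. a \<in> I \<Longrightarrow> \<ominus> a \<in> I"
proof -
  interpret I: ideal I R by fact
  show "I \<subseteq> carrier R" "\<zero> \<in> I" "\<And>a b. a \<in> I \<Longrightarrow> b \<in> I \<Longrightarrow> a \<oplus> b \<in> I"
    "\<And>r a. r \<in> carrier R \<Longrightarrow> a \<in> I \<Longrightarrow> r \<otimes> a \<in> I" "\<And>r a. r \<in> carrier R \<Longrightarrow> a \<in> I \<Longrightarrow> a \<otimes> r \<in> I"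
    "\<And>a. a \<in> I \<Longrightarrow> a \<in> carrier R"
    by (auto intro: I.I_l_closed I.I_r_closed)
  show "\<And>a. a \<in> I \<Longrightarrow> \<ominus> a \<in> I" by auto
  then show "\<And>a b. a \<in> I \<Longrightarrow> b \<in> I \<Longrightarrow> a \<ominus> b \<in> I" by (simp add: a_minus_def)
qed

lemma ring_as_module_simps [simp]:
  "carrier (ring_as_module A) = carrier A" "zero (ring_as_module A) = \<zero>\<^bsub>A\<^esub>"
  "add (ring_as_module A) = add A" "smult (ring_as_module A) = monoid.mult A"
  "one (ring_as_module A) = \<one>\<^bsub>A\<^esub>" "monoid.mult (ring_as_module A) = monoid.mult A"
  by (simp_all add: ring_as_module_def)

lemma (in cring) module_ring_as_module: "module R (ring_as_module R)"
proof (rule moduleI)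
  show "cring R" ..
  show "abelian_group (ring_as_module R)"
    by (rule abelian_groupI) (auto simp: a_ac intro!: bexI[of _ "\<ominus> _"] l_neg)
qed (auto simp: l_distr r_distr m_assoc)

lemma (in cring) subm_ring_iff: "subm R (ring_as_module R) I \<longleftrightarrow> ideal I R"
proof
  assume "subm R (ring_as_module R) I" then show "ideal I R"
    by (intro idealI2) (auto simp: subm_def)
next
  assume I: "ideal I R" show "subm R (ring_as_module R) I"
    by (rule submI) (use ideal_facts[OF I] in auto)
qed

section \<open>Direct powers, finitely generated submodules and Nakayama's lemma\<close>

lemma power_module_simps [simp]:
  "carrier (power_module M h) = {..<h} \<rightarrow>\<^sub>E carrier M" "zero (power_module M h) = (\<lambda>i\<in>{..<h}. \<zero>\<^bsub>M\<^esub>)"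
  "f \<oplus>\<^bsub>power_module M h\<^esub> g = (\<lambda>i\<in>{..<h}. f i \<oplus>\<^bsub>M\<^esub> g i)"
  "r \<odot>\<^bsub>power_module M h\<^esub> f = (\<lambda>i\<in>{..<h}. r \<odot>\<^bsub>M\<^esub> f i)"
  by (simp_all add: power_module_def)

lemma (in module) module_power_module: "module R (power_module M h)"
proof (rule moduleI)
  have c: "\<And>i. i < h \<Longrightarrow> f i \<in> carrier M" if "f \<in> carrier (power_module M h)" for f
    using that by auto
  show "cring R" ..
  show "abelian_group (power_module M h)"
  proof (rule abelian_groupI)
    fix x y z assume *: "x \<in> carrier (power_module M h)" "y \<in> carrier (power_module M h)" "z \<in> carrier (power_module M h)"
    note c' = c[OF *(1)] c[OF *(2)] c[OF *(3)]
    show "x \<oplus>\<^bsub>power_module M h\<^esub> y \<oplus>\<^bsub>power_module M h\<^esub> z = x \<oplus>\<^bsub>power_module M h\<^esub> (y \<oplus>\<^bsub>power_module M h\<^esub> z)"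
      by (simp cong: restrict_cong add: c' M.a_assoc)
    show "x \<oplus>\<^bsub>power_module M h\<^esub> y \<in> carrier (power_module M h)" using c' by auto
    show "x \<oplus>\<^bsub>power_module M h\<^esub> y = y \<oplus>\<^bsub>power_module M h\<^esub> x"
      by (simp cong: restrict_cong add: c' M.a_comm)
  next
    fix x assume x: "x \<in> carrier (power_module M h)"
    note c' = c[OF x]
    have "(\<lambda>i\<in>{..<h}. x i) = x"
      using x by (intro ext) (auto simp: restrict_def PiE_def Pi_def extensional_def)
    then show "\<zero>\<^bsub>power_module M h\<^esub> \<oplus>\<^bsub>power_module M h\<^esub> x = x"
      by (simp cong: restrict_cong add: c')
    show "\<exists>y\<in>carrier (power_module M h). y \<oplus>\<^bsub>power_module M h\<^esub> x = \<zero>\<^bsub>power_module M h\<^esub>"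
      by (intro bexI[of _ "\<lambda>i\<in>{..<h}. \<ominus>\<^bsub>M\<^esub> (x i)"]) (simp_all cong: restrict_cong add: c' M.l_neg)
  qed auto
  fix a b x y assume *: "a \<in> carrier R" "b \<in> carrier R" "x \<in> carrier (power_module M h)" "y \<in> carrier (power_module M h)"
  note c' = c[OF *(3)] c[OF *(4)]
  show "a \<odot>\<^bsub>power_module M h\<^esub> x \<in> carrier (power_module M h)" using * c' by auto
  show "(a \<oplus> b) \<odot>\<^bsub>power_module M h\<^esub> x = a \<odot>\<^bsub>power_module M h\<^esub> x \<oplus>\<^bsub>power_module M h\<^esub> b \<odot>\<^bsub>power_module M h\<^esub> x"
    using * by (simp cong: restrict_cong add: c' smult_l_distr)
  show "a \<odot>\<^bsub>power_module M h\<^esub> (x \<oplus>\<^bsub>power_module M h\<^esub> y) = a \<odot>\<^bsub>power_module M h\<^esub> x \<oplus>\<^bsub>power_module M h\<^esub> a \<odot>\<^bsub>power_module M h\<^esub> y"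
    using * by (simp cong: restrict_cong add: c' smult_r_distr)
  show "a \<otimes> b \<odot>\<^bsub>power_module M h\<^esub> x = a \<odot>\<^bsub>power_module M h\<^esub> (b \<odot>\<^bsub>power_module M h\<^esub> x)"
    using * by (simp cong: restrict_cong add: c' smult_assoc1)
next
  fix x assume x: "x \<in> carrier (power_module M h)"
  then have "\<And>i. i < h \<Longrightarrow> x i \<in> carrier M" by auto
  moreover have "(\<lambda>i\<in>{..<h}. x i) = x"
    using x by (intro ext) (auto simp: restrict_def PiE_def Pi_def extensional_def)
  ultimately show "\<one> \<odot>\<^bsub>power_module M h\<^esub> x = x"
    by (simp cong: restrict_cong)
qed

lemma (in module) hom_zero:
  assumes "module R N" "f \<in> module_hom R M N"
  shows "f \<zero>\<^bsub>M\<^esub> = \<zero>\<^bsub>N\<^esub>"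
proof -
  interpret N: module R N by fact
  have "f \<zero>\<^bsub>M\<^esub> \<in> carrier N" using module_hom_closed[OF assms(2)] by auto
  then show ?thesis using module_hom_smult[OF assms(2) R.zero_closed M.zero_closed] by simp
qed

lemma (in module) hom_vimage_subm:
  assumes "module R N" "f \<in> module_hom R M N" "subm R N W"
  shows "subm R M {x \<in> carrier M. f x \<in> W}"
  using hom_zero[OF assms(1,2)] assms(3) module_hom_add[OF assms(2)] module_hom_smult[OF assms(2)]
  by (auto simp: subm_def)

lemma (in module) hom_lspan:
  assumes "module R N" "f \<in> module_hom R M N" "set ws \<subseteq> carrier M"
  shows "f ` lspan R M ws \<subseteq> lspan R N (map f ws)"
proof -
  interpret N: module R N by fact
  have c: "set (map f ws) \<subseteq> carrier N" using module_hom_closed[OF assms(2)] assms(3) by auto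
  have "lspan R M ws \<subseteq> {x \<in> carrier M. f x \<in> lspan R N (map f ws)}"
    using assms(3) N.lspan_superset[OF c]
    by (intro lspan_least hom_vimage_subm[OF assms(1,2)] N.subm_lspan c) (auto simp: subset_iff)
  then show ?thesis by auto
qed

definition fgen :: "('a, 'b) ring_scheme \<Rightarrow> ('a, 'm, 'c) module_scheme \<Rightarrow> 'm set \<Rightarrow> bool" where
  "fgen R M N \<longleftrightarrow> (\<exists>ws. set ws \<subseteq> N \<and> N = lspan R M ws)"

lemma fgenE: "fgen R M N \<Longrightarrow> (\<And>ws. set ws \<subseteq> N \<Longrightarrow> N = lspan R M ws \<Longrightarrow> P) \<Longrightarrow> P"
  by (auto simp: fgen_def)

lemma (in module) fgen_power_module:
  assumes "fgen R M (carrier M)"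
  shows "fgen R (power_module M h) (carrier (power_module M h))"
proof -
  interpret P: module R "power_module M h" by (rule module_power_module)
  obtain ws where ws: "set ws \<subseteq> carrier M" "carrier M = lspan R M ws" using assms by (rule fgenE)
  let ?P = "power_module M h"
  let ?e = "\<lambda>i w. \<lambda>j\<in>{..<h}. if j = i then w else \<zero>\<^bsub>M\<^esub>"
  have ec: "?e i w \<in> carrier ?P" if "w \<in> carrier M" for i w using that by auto
  \<comment> \<open>Generators are collected one coordinate at a time: \<open>k\<close> bounds the
    coordinates that may be nonzero.\<close>
  have "\<exists>vs. set vs \<subseteq> carrier ?P \<and> {f \<in> carrier ?P. \<forall>j<h. j \<ge> k \<longrightarrow> f j = \<zero>\<^bsub>M\<^esub>} \<subseteq> lspan R ?P vs" if "k \<le> h" for k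
    using that
  proof (induction k)
    case 0
    have "f = (\<lambda>i\<in>{..<h}. \<zero>\<^bsub>M\<^esub>)" if "f \<in> {..<h} \<rightarrow>\<^sub>E carrier M" "\<forall>j<h. f j = \<zero>\<^bsub>M\<^esub>" for f
      using that by (intro ext) (auto simp: restrict_def PiE_def Pi_def extensional_def)
    then show ?case by (intro exI[of _ "[]"]) auto
  next
    case (Suc k)
    then obtain vs where vs: "set vs \<subseteq> carrier ?P" "{f \<in> carrier ?P. \<forall>j<h. j \<ge> k \<longrightarrow> f j = \<zero>\<^bsub>M\<^esub>} \<subseteq> lspan R ?P vs" by auto
    let ?L = "lspan R ?P (map (?e k) ws)"
    have hom: "?e k \<in> module_hom R M ?P"
      unfolding module_hom_def mem_Collect_eq
    proof (intro conjI allI impI)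
      show "?e k \<in> carrier M \<rightarrow> carrier ?P" by auto
    qed (auto intro!: restrict_ext)
    have Lc: "set (map (?e k) ws) \<subseteq> carrier ?P"
      unfolding set_map by (intro image_subsetI ec) (rule subsetD[OF ws(1)])
    have eL: "?e k w \<in> ?L" if "w \<in> carrier M" for w
      using hom_lspan[OF P.module_axioms hom ws(1)] that ws(2) by blast
    have "{f \<in> carrier ?P. \<forall>j<h. j \<ge> Suc k \<longrightarrow> f j = \<zero>\<^bsub>M\<^esub>} \<subseteq> lspan R ?P (map (?e k) ws @ vs)"
    proof
      fix f assume f: "f \<in> {f \<in> carrier ?P. \<forall>j<h. j \<ge> Suc k \<longrightarrow> f j = \<zero>\<^bsub>M\<^esub>}"
      define g where "g = (\<lambda>j\<in>{..<h}. if j = k then \<zero>\<^bsub>M\<^esub> else f j)"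
      have "g \<in> {f \<in> carrier ?P. \<forall>j<h. j \<ge> k \<longrightarrow> f j = \<zero>\<^bsub>M\<^esub>}" using f by (auto simp: g_def)
      then have 1: "g \<in> lspan R ?P vs" using vs by auto
      have "f k \<in> carrier M" using f Suc.prems by auto
      then have 2: "?e k (f k) \<in> ?L" by (rule eL)
      have "f = ?e k (f k) \<oplus>\<^bsub>?P\<^esub> g"
        using f by (intro ext) (auto simp: g_def restrict_def PiE_def Pi_def extensional_def)
      then show "f \<in> lspan R ?P (map (?e k) ws @ vs)"
          unfolding P.lspan_append[OF Lc vs(1)] using msumI[OF 2 1, of ?P] by (simp only:)
    qed
    moreover have "set (map (?e k) ws @ vs) \<subseteq> carrier ?P" using Lc vs(1) by (simp only: set_append Un_subset_iff simp_thms)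
    ultimately show ?case by blast
  qed
  from this[OF order_refl] obtain vs where vs: "set vs \<subseteq> carrier ?P"
    "{f \<in> carrier ?P. \<forall>j<h. j \<ge> h \<longrightarrow> f j = \<zero>\<^bsub>M\<^esub>} \<subseteq> lspan R ?P vs" by blast
  have "{f \<in> carrier ?P. \<forall>j<h. j \<ge> h \<longrightarrow> f j = \<zero>\<^bsub>M\<^esub>} = carrier ?P" by (auto simp del: power_module_simps)
  then have "carrier ?P = lspan R ?P vs" using vs(2) subm_subset[OF P.subm_lspan[OF vs(1)]] by (simp only: subset_antisym)
  then show ?thesis using vs(1) unfolding fgen_def by blast
qed

text \<open>The members of this ideal are the coefficients of \<open>w\<close> in those elements of
  \<open>W\<close> that lie in R w + \<open>L\<close>. Its finite generation is how the Noetherian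
  property enters \<open>fgen_submodule_lspan\<close>.\<close>

lemma (in module) colon_ideal:
  assumes "subm R M L" "subm R M W" "w \<in> carrier M"
  shows "ideal {r \<in> carrier R. \<exists>s\<in>L. r \<odot>\<^bsub>M\<^esub> w \<oplus>\<^bsub>M\<^esub> s \<in> W} R"
proof (rule idealI2)
  note c = subm_carr[OF assms(1)]
  show "\<zero> \<in> {r \<in> carrier R. \<exists>s\<in>L. r \<odot>\<^bsub>M\<^esub> w \<oplus>\<^bsub>M\<^esub> s \<in> W}"
    using subm_zero[OF assms(1)] subm_zero[OF assms(2)] assms(3) by (auto intro!: bexI[of _ "\<zero>\<^bsub>M\<^esub>"])
  fix a b assume "a \<in> {r \<in> carrier R. \<exists>s\<in>L. r \<odot>\<^bsub>M\<^esub> w \<oplus>\<^bsub>M\<^esub> s \<in> W}" "b \<in> {r \<in> carrier R. \<exists>s\<in>L. r \<odot>\<^bsub>M\<^esub> w \<oplus>\<^bsub>M\<^esub> s \<in> W}"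
  then obtain s t where *: "a \<in> carrier R" "b \<in> carrier R" "s \<in> L" "t \<in> L" "a \<odot>\<^bsub>M\<^esub> w \<oplus>\<^bsub>M\<^esub> s \<in> W" "b \<odot>\<^bsub>M\<^esub> w \<oplus>\<^bsub>M\<^esub> t \<in> W" by auto
  then have "(a \<oplus> b) \<odot>\<^bsub>M\<^esub> w \<oplus>\<^bsub>M\<^esub> (s \<oplus>\<^bsub>M\<^esub> t) = (a \<odot>\<^bsub>M\<^esub> w \<oplus>\<^bsub>M\<^esub> s) \<oplus>\<^bsub>M\<^esub> (b \<odot>\<^bsub>M\<^esub> w \<oplus>\<^bsub>M\<^esub> t)"
    using assms(3) c by (simp add: smult_l_distr M.a_ac)
  then show "a \<oplus> b \<in> {r \<in> carrier R. \<exists>s\<in>L. r \<odot>\<^bsub>M\<^esub> w \<oplus>\<^bsub>M\<^esub> s \<in> W}"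
    using * subm_add[OF assms(1)] subm_add[OF assms(2)] by (auto intro!: bexI[of _ "s \<oplus>\<^bsub>M\<^esub> t"])
next
  note c = subm_carr[OF assms(1)]
  fix r a assume r: "r \<in> carrier R" and "a \<in> {r \<in> carrier R. \<exists>s\<in>L. r \<odot>\<^bsub>M\<^esub> w \<oplus>\<^bsub>M\<^esub> s \<in> W}"
  then obtain s where *: "a \<in> carrier R" "s \<in> L" "a \<odot>\<^bsub>M\<^esub> w \<oplus>\<^bsub>M\<^esub> s \<in> W" by auto
  then have "(r \<otimes> a) \<odot>\<^bsub>M\<^esub> w \<oplus>\<^bsub>M\<^esub> r \<odot>\<^bsub>M\<^esub> s = r \<odot>\<^bsub>M\<^esub> (a \<odot>\<^bsub>M\<^esub> w \<oplus>\<^bsub>M\<^esub> s)"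
    using assms(3) c r by (simp add: smult_r_distr smult_assoc1)
  then show "r \<otimes> a \<in> {r \<in> carrier R. \<exists>s\<in>L. r \<odot>\<^bsub>M\<^esub> w \<oplus>\<^bsub>M\<^esub> s \<in> W}"
    using * r subm_smult[OF assms(1)] subm_smult[OF assms(2)] by (auto intro!: bexI[of _ "r \<odot>\<^bsub>M\<^esub> s"])
qed auto

lemma (in module) colon_ideal':
  assumes "subm R M W" "w \<in> carrier M"
  shows "ideal {r \<in> carrier R. r \<odot>\<^bsub>M\<^esub> w \<in> W} R"
proof -
  have "{r \<in> carrier R. \<exists>s\<in>{\<zero>\<^bsub>M\<^esub>}. r \<odot>\<^bsub>M\<^esub> w \<oplus>\<^bsub>M\<^esub> s \<in> W} = {r \<in> carrier R. r \<odot>\<^bsub>M\<^esub> w \<in> W}"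
    using assms(2) by auto
  then show ?thesis using colon_ideal[OF subm_null assms] by simp
qed

text \<open>Induction on the generators of the ambient span. Finitely many generators of the ideal
  of coefficients of \<open>w\<close> are lifted to elements \<open>?us\<close> of \<open>W\<close>;
  modulo their span an element of \<open>W\<close> has no \<open>w\<close> part left, so it lies in
  the intersection of \<open>W\<close> with \<open>?L\<close>, where the induction hypothesis
  applies.\<close>

lemma (in module) fgen_submodule_lspan:
  assumes noeth: "noetherian_ring R"
  shows "set ws \<subseteq> carrier M \<Longrightarrow> subm R M W \<Longrightarrow> W \<subseteq> lspan R M ws \<Longrightarrow> fgen R M W"
proof (induction ws arbitrary: W)
  case Nil
  then have "W = lspan R M []" using subm_zero by fastforce
  then show ?case unfolding fgen_def by (intro exI[of _ "[]"]) auto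
next
  case (Cons w ws)
  let ?L = "lspan R M ws"
  have w: "w \<in> carrier M" and wsc: "set ws \<subseteq> carrier M" using Cons.prems by auto
  have L: "subm R M ?L" using wsc by (rule subm_lspan)
  note Wc = subm_carr[OF Cons.prems(2)] and Lc = subm_carr[OF L]
  let ?J = "{r \<in> carrier R. \<exists>s\<in>?L. r \<odot>\<^bsub>M\<^esub> w \<oplus>\<^bsub>M\<^esub> s \<in> W}"
  obtain A where A: "A \<subseteq> carrier R" "finite A" "?J = Idl A"
    using noetherian_ring.finetely_gen[OF noeth colon_ideal[OF L Cons.prems(2) w]] by metis
  have "\<exists>as. set as = A" using A finite_list by blast
  then obtain as where as: "set as = A" ..
  have AJ: "A \<subseteq> ?J" unfolding A(3) using genideal_self[OF A(1)] .
  then have "\<forall>a\<in>A. \<exists>s. s \<in> ?L \<and> a \<odot>\<^bsub>M\<^esub> w \<oplus>\<^bsub>M\<^esub> s \<in> W" by blast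
  then obtain s where s: "\<And>a. a \<in> A \<Longrightarrow> s a \<in> ?L \<and> a \<odot>\<^bsub>M\<^esub> w \<oplus>\<^bsub>M\<^esub> s a \<in> W" by metis
  let ?us = "map (\<lambda>a. a \<odot>\<^bsub>M\<^esub> w \<oplus>\<^bsub>M\<^esub> s a) as"
  have us: "set ?us \<subseteq> W" using s as by auto
  have "subm R M (W \<inter> ?L)" using L Cons.prems(2) unfolding subm_def by auto
  from Cons.IH[OF wsc this] have "fgen R M (W \<inter> ?L)" by simp
  then obtain vs where vs: "set vs \<subseteq> W \<inter> ?L" "W \<inter> ?L = lspan R M vs" by (rule fgenE)
  have c: "set ?us \<subseteq> carrier M" "set vs \<subseteq> carrier M" using us vs Wc by blast+
  have "W \<subseteq> lspan R M (?us @ vs)"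
  proof
    fix x assume x: "x \<in> W"
    then obtain r t where rt: "r \<in> carrier R" "t \<in> ?L" "x = r \<odot>\<^bsub>M\<^esub> w \<oplus>\<^bsub>M\<^esub> t" using Cons.prems(3) by auto
    then have "r \<in> Idl A" using x A(3) by blast
    \<comment> \<open>The coefficients realized by the span of \<open>?us\<close> form an ideal that
      contains \<open>A\<close>. So the coefficient of \<open>x\<close> is also that of an element
      \<open>?x'\<close> of this span, and the difference of the two is free of
      \<open>w\<close>.\<close>
    moreover have "Idl A \<subseteq> {r \<in> carrier R. \<exists>s\<in>?L. r \<odot>\<^bsub>M\<^esub> w \<oplus>\<^bsub>M\<^esub> s \<in> lspan R M ?us}"
    proof (rule genideal_minimal[OF colon_ideal[OF L subm_lspan[OF c(1)] w]])
      show "A \<subseteq> {r \<in> carrier R. \<exists>s\<in>?L. r \<odot>\<^bsub>M\<^esub> w \<oplus>\<^bsub>M\<^esub> s \<in> lspan R M ?us}"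
      proof
        fix a assume a: "a \<in> A"
        then have "a \<odot>\<^bsub>M\<^esub> w \<oplus>\<^bsub>M\<^esub> s a \<in> lspan R M ?us" using lspan_superset[OF c(1)] as by auto
        then show "a \<in> {r \<in> carrier R. \<exists>s\<in>?L. r \<odot>\<^bsub>M\<^esub> w \<oplus>\<^bsub>M\<^esub> s \<in> lspan R M ?us}" using s a A by blast
      qed
    qed
    ultimately obtain t' where t': "t' \<in> ?L" "r \<odot>\<^bsub>M\<^esub> w \<oplus>\<^bsub>M\<^esub> t' \<in> lspan R M ?us" by auto
    let ?x' = "r \<odot>\<^bsub>M\<^esub> w \<oplus>\<^bsub>M\<^esub> t'"
    have x'W: "?x' \<in> W" using t' lspan_least[OF Cons.prems(2) us] by auto
    have eq: "x \<ominus>\<^bsub>M\<^esub> ?x' = t \<ominus>\<^bsub>M\<^esub> t'"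
      using rt t' w Lc unfolding rt(3)
      by (simp add: a_minus_def M.minus_add M.a_ac) (simp add: M.a_assoc[symmetric] M.r_neg)
    have d: "x \<ominus>\<^bsub>M\<^esub> ?x' \<in> W \<inter> ?L"
      using subm_minus[OF Cons.prems(2) x x'W] subm_minus[OF L rt(2) t'(1)] unfolding eq by auto
    have e: "?x' \<oplus>\<^bsub>M\<^esub> (x \<ominus>\<^bsub>M\<^esub> ?x') = x"
      using Wc[OF x] Wc[OF x'W] by (simp add: a_minus_def M.a_lcomm M.r_neg)
    show "x \<in> lspan R M (?us @ vs)"
      using msumI[OF t'(2) d[unfolded vs(2)], of M] unfolding lspan_append[OF c] e .
  qed
  moreover have "lspan R M (?us @ vs) \<subseteq> W" using us vs by (intro lspan_least Cons.prems) auto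
  ultimately show ?case unfolding fgen_def using us vs by (intro exI[of _ "?us @ vs"]) auto
qed

lemma (in module) lcomb_least:
  "subm R M Q \<Longrightarrow> (\<And>y z. y \<in> set ys \<Longrightarrow> z \<in> Z \<Longrightarrow> y \<odot>\<^bsub>M\<^esub> z \<in> Q) \<Longrightarrow> lcomb M Z ys \<subseteq> Q"
  by (induction ys) (auto intro!: subm_add simp: subm_zero)

lemma (in module) subm_ideal_smult_elem:
  assumes "ideal I R" "w \<in> carrier M"
  shows "subm R M ((\<lambda>a. a \<odot>\<^bsub>M\<^esub> w) ` I)"
proof (rule submI)
  note f = ideal_facts[OF assms(1)]
  show "(\<lambda>a. a \<odot>\<^bsub>M\<^esub> w) ` I \<subseteq> carrier M" using f assms by auto
  show "\<zero>\<^bsub>M\<^esub> \<in> (\<lambda>a. a \<odot>\<^bsub>M\<^esub> w) ` I" by (rule image_eqI[of _ _ \<zero>]) (use f assms in auto)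
  show "\<And>x y. x \<in> (\<lambda>a. a \<odot>\<^bsub>M\<^esub> w) ` I \<Longrightarrow> y \<in> (\<lambda>a. a \<odot>\<^bsub>M\<^esub> w) ` I \<Longrightarrow> x \<oplus>\<^bsub>M\<^esub> y \<in> (\<lambda>a. a \<odot>\<^bsub>M\<^esub> w) ` I"
    using f assms by (auto simp: smult_l_distr[symmetric])
  show "\<And>r x. r \<in> carrier R \<Longrightarrow> x \<in> (\<lambda>a. a \<odot>\<^bsub>M\<^esub> w) ` I \<Longrightarrow> r \<odot>\<^bsub>M\<^esub> x \<in> (\<lambda>a. a \<odot>\<^bsub>M\<^esub> w) ` I"
    using f assms by (auto simp: smult_assoc1[symmetric])
qed

lemma (in module) unit_smult_mem:
  assumes "subm R M N" "u \<in> Units R" "x \<in> carrier M" "u \<odot>\<^bsub>M\<^esub> x \<in> N"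
  shows "x \<in> N"
proof -
  have "inv u \<odot>\<^bsub>M\<^esub> (u \<odot>\<^bsub>M\<^esub> x) \<in> N"
    using assms by (intro subm_smult[OF assms(1) _ assms(4)]) auto
  then show ?thesis using assms by (simp flip: smult_assoc1 add: R.Units_l_inv R.Units_closed)
qed

locale local_module = module R M + local_noeth R for R (structure) and M (structure) +
  assumes fg: "fgen R M (carrier M)"
begin

lemma fgen_subm: "subm R M W \<Longrightarrow> fgen R M W"
proof -
  assume W: "subm R M W"
  obtain ws where "set ws \<subseteq> carrier M" "carrier M = lspan R M ws" using fg by (rule fgenE)
  then show ?thesis
    using fgen_submodule_lspan[OF noetherian_ring_axioms _ W, of ws] subm_subset[OF W] by simp
qed

lemma nakayama:
  assumes N: "subm R M N" and W: "subm R M W" and ys: "set ys \<subseteq> \<mm>"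
    and sub: "W \<subseteq> msum M N (lcomb M W ys)"
  shows "W \<subseteq> N"
proof -
  note m = ideal_facts[OF max_ideal_ideal]
  have "set ws \<subseteq> W \<Longrightarrow> W \<subseteq> msum M N (lspan R M ws) \<Longrightarrow> W \<subseteq> N" for ws
  proof (induction ws)
    case Nil
    have "msum M N {\<zero>\<^bsub>M\<^esub>} \<subseteq> N" by (rule msum_least) (use N subm_zero[OF N] in auto)
    then show ?case using Nil.prems by simp
  next
    case (Cons w ws)
    have wW: "w \<in> W" and w: "w \<in> carrier M" and wsc: "set ws \<subseteq> carrier M" using Cons.prems subm_carr[OF W] by auto
    let ?L = "lspan R M ws"
    have L: "subm R M ?L" using subm_lspan wsc by simp
    have mw: "subm R M ((\<lambda>a. a \<odot>\<^bsub>M\<^esub> w) ` \<mm>)" using subm_ideal_smult_elem[OF max_ideal_ideal w] .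
    \<comment> \<open>This is N + \<mm> w + span of \<open>ws\<close>. Multiplication by some
      \<open>y\<close> in \<mm> sends N + R w + span of \<open>ws\<close> into it, so that the
      coefficient of \<open>w\<close> becomes a nonunit.\<close>
    let ?Q = "msum M N (msum M ((\<lambda>a. a \<odot>\<^bsub>M\<^esub> w) ` \<mm>) ?L)"
    have Q: "subm R M ?Q" by (intro subm_msum N L mw)
    have "lcomb M W ys \<subseteq> ?Q"
    proof (rule lcomb_least[OF Q])
      fix y z assume y: "y \<in> set ys" and z: "z \<in> W"
      obtain n r s where *: "n \<in> N" "r \<in> carrier R" "s \<in> ?L" "z = n \<oplus>\<^bsub>M\<^esub> (r \<odot>\<^bsub>M\<^esub> w \<oplus>\<^bsub>M\<^esub> s)"
        using subsetD[OF Cons.prems(2) z] by (auto simp: msum_def)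
      have ym: "y \<in> \<mm>" and yc: "y \<in> carrier R" using y ys max_ideal_carr by auto
      have "y \<odot>\<^bsub>M\<^esub> z = y \<odot>\<^bsub>M\<^esub> n \<oplus>\<^bsub>M\<^esub> ((y \<otimes> r) \<odot>\<^bsub>M\<^esub> w \<oplus>\<^bsub>M\<^esub> y \<odot>\<^bsub>M\<^esub> s)"
        using * yc w subm_carr[OF N] subm_carr[OF L] by (simp add: smult_r_distr smult_assoc1)
      moreover have "y \<otimes> r \<in> \<mm>" using m(5) ym * by auto
      ultimately show "y \<odot>\<^bsub>M\<^esub> z \<in> ?Q"
        using * yc subm_smult[OF N] subm_smult[OF L] by (auto intro!: msumI)
    qed
    moreover have "N \<subseteq> ?Q" by (rule subset_msum1) (use N subm_zero[OF subm_msum[OF mw L]] in \<open>auto simp: subm_def\<close>)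
    ultimately have "W \<subseteq> ?Q" using sub msum_least[OF Q] by (meson subset_trans)
    then have "w \<in> ?Q" using wW by blast
    then obtain n a s where *: "n \<in> N" "a \<in> \<mm>" "s \<in> ?L" "w = n \<oplus>\<^bsub>M\<^esub> (a \<odot>\<^bsub>M\<^esub> w \<oplus>\<^bsub>M\<^esub> s)"
      by (auto simp: msum_def)
    have ac: "a \<in> carrier R" "n \<in> carrier M" "s \<in> carrier M"
      using * max_ideal_carr subm_carr[OF N] subm_carr[OF L] by auto
    have "(\<one> \<ominus> a) \<odot>\<^bsub>M\<^esub> w = w \<ominus>\<^bsub>M\<^esub> a \<odot>\<^bsub>M\<^esub> w"
      using w ac by (simp add: a_minus_def smult_l_distr smult_l_minus)
    also have "\<dots> = (n \<oplus>\<^bsub>M\<^esub> (a \<odot>\<^bsub>M\<^esub> w \<oplus>\<^bsub>M\<^esub> s)) \<ominus>\<^bsub>M\<^esub> a \<odot>\<^bsub>M\<^esub> w" using *(4) by simp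
    also have "\<dots> = n \<oplus>\<^bsub>M\<^esub> s" using w ac by (simp add: a_minus_def M.a_ac M.r_neg)
    finally have "(\<one> \<ominus> a) \<odot>\<^bsub>M\<^esub> w \<in> msum M N ?L" using * by (auto intro: msumI)
    then have w1: "w \<in> msum M N ?L"
      using unit_smult_mem[OF subm_msum[OF N L] one_minus_unit w] * by auto
    have "N \<subseteq> msum M N ?L" "?L \<subseteq> msum M N ?L"
      using subset_msum1[OF subm_subset[OF N] subm_zero[OF L]] subset_msum2[OF subm_subset[OF L] subm_zero[OF N]] by auto
    moreover from this have "lspan R M (w # ws) \<subseteq> msum M N ?L"
      using w1 lspan_superset[OF wsc] by (intro lspan_least subm_msum N L) auto
    ultimately have "msum M N (lspan R M (w # ws)) \<subseteq> msum M N ?L"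
      by (intro msum_least subm_msum N L) auto
    then have "W \<subseteq> msum M N ?L" using Cons.prems by (meson subset_trans)
    then show ?case using Cons by auto
  qed
  moreover obtain ws where ws: "set ws \<subseteq> W" "W = lspan R M ws" using fgen_subm[OF W] by (rule fgenE)
  moreover have "W \<subseteq> msum M N (lspan R M ws)"
    using ws subset_msum2[OF subm_subset[OF W] subm_zero[OF N]] by simp
  ultimately show ?thesis by blast
qed

end

section \<open>Regular sequences and chains of primes\<close>

text \<open>
  \<open>xs\<close> is a regular sequence on \<open>M / N\<close>, except that \<open>M / (N + xs M)\<close> may be zero.
\<close>

fun regseq :: "('a, 'm, 'c) module_scheme \<Rightarrow> 'm set \<Rightarrow> 'a list \<Rightarrow> bool" where
  "regseq M N [] \<longleftrightarrow> True"
| "regseq M N (x # xs) \<longleftrightarrow> (\<forall>m\<in>carrier M. x \<odot>\<^bsub>M\<^esub> m \<in> N \<longrightarrow> m \<in> N) \<and>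
     regseq M (msum M N ((\<lambda>m. x \<odot>\<^bsub>M\<^esub> m) ` carrier M)) xs"

lemma prime_chain_Cons:
  assumes "prime_chain R C n" "primeideal P R" "P \<subset> C 0"
  shows "prime_chain R (case_nat P C) (Suc n)"
  using assms unfolding prime_chain_def by (auto split: nat.split)

lemma prime_chain_0: "primeideal P R \<Longrightarrow> prime_chain R (\<lambda>_. P) 0"
  by (simp add: prime_chain_def)

text \<open>The prime is maximal among the annihilators modulo \<open>N\<close> of multiples of
  \<open>m\<close> outside \<open>N\<close>. If a b kills r m but b does not, then the annihilator
  of b r m contains that of r m, hence equals it, and it contains a. Restricting to multiples of
  \<open>m\<close> keeps everything that kills \<open>m\<close> inside the prime.\<close>

lemma (in local_module) associated_prime:
  assumes N: "subm R M N" and m: "m \<in> carrier M" "m \<notin> N"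
  shows "\<exists>r\<in>carrier R. r \<odot>\<^bsub>M\<^esub> m \<notin> N \<and> primeideal {a \<in> carrier R. a \<odot>\<^bsub>M\<^esub> (r \<odot>\<^bsub>M\<^esub> m) \<in> N} R"
proof -
  let ?c = "\<lambda>r. {a \<in> carrier R. a \<odot>\<^bsub>M\<^esub> (r \<odot>\<^bsub>M\<^esub> m) \<in> N}"
  let ?S = "?c ` {r \<in> carrier R. r \<odot>\<^bsub>M\<^esub> m \<notin> N}"
  have "\<exists>I\<in>?S. \<forall>J\<in>?S. I \<subseteq> J \<longrightarrow> J = I"
  proof (rule ideals_maximal_element)
    have "\<one> \<in> {r \<in> carrier R. r \<odot>\<^bsub>M\<^esub> m \<notin> N}" using m by simp
    then show "?S \<noteq> {}" by (simp only: image_is_empty) blast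
    show "\<And>I. I \<in> ?S \<Longrightarrow> ideal I R" using m colon_ideal'[OF N] by auto
  qed
  then obtain I where I: "I \<in> ?S" "\<forall>J\<in>?S. I \<subseteq> J \<longrightarrow> J = I" ..
  from I(1) obtain r where "r \<in> {r \<in> carrier R. r \<odot>\<^bsub>M\<^esub> m \<notin> N}" and Ir: "I = ?c r" by (rule imageE)
  then have r: "r \<in> carrier R" "r \<odot>\<^bsub>M\<^esub> m \<notin> N" by auto
  have mx: "?c s = ?c r" if "s \<in> carrier R" "s \<odot>\<^bsub>M\<^esub> m \<notin> N" "?c r \<subseteq> ?c s" for s
    using bspec[OF I(2) imageI[of s]] that unfolding Ir by simp
  have id: "ideal (?c r) R" using colon_ideal'[OF N] r m by auto
  have "primeideal (?c r) R"
  proof (rule primeidealI[OF id])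
    show "cring R" ..
    have "\<one> \<notin> ?c r" using r m by simp
    then show "carrier R \<noteq> ?c r" by blast
    fix a b assume a: "a \<in> carrier R" and b: "b \<in> carrier R" and ab: "a \<otimes> b \<in> ?c r"
    show "a \<in> ?c r \<or> b \<in> ?c r"
    proof (rule disjCI)
      assume nb: "b \<notin> ?c r"
      have s: "b \<otimes> r \<in> carrier R" "(b \<otimes> r) \<odot>\<^bsub>M\<^esub> m \<notin> N" using nb a b r m by (auto simp: smult_assoc1)
      have "?c r \<subseteq> ?c (b \<otimes> r)"
      proof
        fix c assume c: "c \<in> ?c r"
        then have "b \<odot>\<^bsub>M\<^esub> (c \<odot>\<^bsub>M\<^esub> (r \<odot>\<^bsub>M\<^esub> m)) \<in> N" using b by (auto intro: subm_smult[OF N])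
        moreover have "b \<odot>\<^bsub>M\<^esub> (c \<odot>\<^bsub>M\<^esub> (r \<odot>\<^bsub>M\<^esub> m)) = c \<odot>\<^bsub>M\<^esub> ((b \<otimes> r) \<odot>\<^bsub>M\<^esub> m)"
          using b c r m by (simp add: smult_assoc1[symmetric] R.m_lcomm R.m_assoc)
        ultimately show "c \<in> ?c (b \<otimes> r)" using c by simp
      qed
      from mx[OF s this] have "?c (b \<otimes> r) = ?c r" .
      moreover have "a \<in> ?c (b \<otimes> r)" using ab a b r m by (simp add: smult_assoc1[symmetric] R.m_assoc)
      ultimately show "a \<in> ?c r" by simp
    qed
  qed
  then show ?thesis using r by auto
qed

lemma (in module) subm_msum_image:
  assumes "subm R M N" "x \<in> carrier R"
  shows "subm R M (msum M N ((\<lambda>m. x \<odot>\<^bsub>M\<^esub> m) ` carrier M))"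
    and "N \<subseteq> msum M N ((\<lambda>m. x \<odot>\<^bsub>M\<^esub> m) ` carrier M)"
    and "m \<in> carrier M \<Longrightarrow> x \<odot>\<^bsub>M\<^esub> m \<in> msum M N ((\<lambda>m. x \<odot>\<^bsub>M\<^esub> m) ` carrier M)"
proof -
  have s: "subm R M ((\<lambda>m. x \<odot>\<^bsub>M\<^esub> m) ` carrier M)" using subm_image[OF assms(2) subm_carrier] .
  show "subm R M (msum M N ((\<lambda>m. x \<odot>\<^bsub>M\<^esub> m) ` carrier M))" by (rule subm_msum[OF assms(1) s])
  show "N \<subseteq> msum M N ((\<lambda>m. x \<odot>\<^bsub>M\<^esub> m) ` carrier M)"
    by (rule subset_msum1[OF subm_subset[OF assms(1)] subm_zero[OF s]])
  show "x \<odot>\<^bsub>M\<^esub> m \<in> msum M N ((\<lambda>m. x \<odot>\<^bsub>M\<^esub> m) ` carrier M)" if "m \<in> carrier M"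
    using subset_msum2[OF subm_subset[OF s] subm_zero[OF assms(1)]] that by blast
qed

text \<open>The case of Hom(R/I, M/N). Enlarge I to an associated prime \<open>P\<close> of M/N; the
  regular element \<open>x\<close> is not in \<open>P\<close>. Nakayama's lemma provides an element
  outside N + xM that \<open>P\<close> kills modulo \<open>N\<close>. Modulo N + xM it is killed by
  \<open>P\<close> and by \<open>x\<close>, so the induction hypothesis gives a chain above both,
  and \<open>P\<close> is prepended.\<close>

lemma (in local_module) prime_chain_above_annihilator:
  assumes "regseq M N xs" "set xs \<subseteq> \<mm>" "subm R M N" "m \<in> carrier M" "m \<notin> N"
    "I \<subseteq> carrier R" "\<And>a. a \<in> I \<Longrightarrow> a \<odot>\<^bsub>M\<^esub> m \<in> N"
  shows "\<exists>C. prime_chain R C (length xs) \<and> I \<subseteq> C 0"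
  using assms
proof (induction xs arbitrary: N m I)
  case Nil
  obtain r where r: "r \<in> carrier R" "primeideal {a \<in> carrier R. a \<odot>\<^bsub>M\<^esub> (r \<odot>\<^bsub>M\<^esub> m) \<in> N} R"
    using associated_prime[OF Nil.prems(3-5)] by auto
  have "I \<subseteq> {a \<in> carrier R. a \<odot>\<^bsub>M\<^esub> (r \<odot>\<^bsub>M\<^esub> m) \<in> N}"
  proof
    fix a assume a: "a \<in> I"
    then have ac: "a \<in> carrier R" using Nil.prems by auto
    have "r \<odot>\<^bsub>M\<^esub> (a \<odot>\<^bsub>M\<^esub> m) \<in> N" by (rule subm_smult[OF Nil.prems(3) r(1) Nil.prems(7)[OF a]])
    moreover have "r \<odot>\<^bsub>M\<^esub> (a \<odot>\<^bsub>M\<^esub> m) = a \<odot>\<^bsub>M\<^esub> (r \<odot>\<^bsub>M\<^esub> m)"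
      using ac r Nil.prems by (simp add: smult_assoc1[symmetric] R.m_comm)
    ultimately show "a \<in> {a \<in> carrier R. a \<odot>\<^bsub>M\<^esub> (r \<odot>\<^bsub>M\<^esub> m) \<in> N}" using ac by simp
  qed
  then show ?case using prime_chain_0[OF r(2)] by (intro exI[of _ "\<lambda>_. {a \<in> carrier R. a \<odot>\<^bsub>M\<^esub> (r \<odot>\<^bsub>M\<^esub> m) \<in> N}"]) auto
next
  case (Cons x xs)
  note N = Cons.prems(3)
  have x: "x \<in> \<mm>" "x \<in> carrier R" using Cons.prems max_ideal_carr by auto
  have reg: "\<And>m. m \<in> carrier M \<Longrightarrow> x \<odot>\<^bsub>M\<^esub> m \<in> N \<Longrightarrow> m \<in> N" using Cons.prems by auto
  let ?N' = "msum M N ((\<lambda>m. x \<odot>\<^bsub>M\<^esub> m) ` carrier M)"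
  note N' = subm_msum_image[OF N x(2)]
  obtain r where r: "r \<in> carrier R" "r \<odot>\<^bsub>M\<^esub> m \<notin> N" and P: "primeideal {a \<in> carrier R. a \<odot>\<^bsub>M\<^esub> (r \<odot>\<^bsub>M\<^esub> m) \<in> N} R"
    using associated_prime[OF Cons.prems(3-5)] by auto
  define m' where "m' = r \<odot>\<^bsub>M\<^esub> m"
  define P where "P = {a \<in> carrier R. a \<odot>\<^bsub>M\<^esub> m' \<in> N}"
  have m': "m' \<in> carrier M" "m' \<notin> N" using r Cons.prems by (auto simp: m'_def)
  have pP: "primeideal P R" using P by (simp add: P_def m'_def)
  have IP: "I \<subseteq> P"
  proof
    fix a assume a: "a \<in> I"
    then have ac: "a \<in> carrier R" using Cons.prems by auto
    have "r \<odot>\<^bsub>M\<^esub> (a \<odot>\<^bsub>M\<^esub> m) \<in> N" by (rule subm_smult[OF N r(1) Cons.prems(7)[OF a]])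
    moreover have "r \<odot>\<^bsub>M\<^esub> (a \<odot>\<^bsub>M\<^esub> m) = a \<odot>\<^bsub>M\<^esub> (r \<odot>\<^bsub>M\<^esub> m)"
      using ac r Cons.prems by (simp add: smult_assoc1[symmetric] R.m_comm)
    ultimately show "a \<in> P" using ac by (simp add: P_def m'_def)
  qed
  let ?W = "{w \<in> carrier M. \<forall>a\<in>P. a \<odot>\<^bsub>M\<^esub> w \<in> N}"
  have Pc: "P \<subseteq> carrier R" by (auto simp: P_def)
  have W: "subm R M ?W"
  proof (rule submI)
    show "\<zero>\<^bsub>M\<^esub> \<in> ?W" using Pc subm_zero[OF N] by auto
    fix u v assume "u \<in> ?W" "v \<in> ?W"
    then show "u \<oplus>\<^bsub>M\<^esub> v \<in> ?W" using Pc subm_add[OF N] by (auto simp: smult_r_distr subset_iff)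
  next
    fix s u assume s: "s \<in> carrier R" "u \<in> ?W"
    have "a \<odot>\<^bsub>M\<^esub> (s \<odot>\<^bsub>M\<^esub> u) \<in> N" if a: "a \<in> P" for a
    proof -
      have "a \<odot>\<^bsub>M\<^esub> (s \<odot>\<^bsub>M\<^esub> u) = s \<odot>\<^bsub>M\<^esub> (a \<odot>\<^bsub>M\<^esub> u)"
        using s a Pc by (auto simp: smult_assoc1[symmetric] R.m_comm subset_iff)
      then show ?thesis using s a subm_smult[OF N] by auto
    qed
    then show "s \<odot>\<^bsub>M\<^esub> u \<in> ?W" using s by auto
  qed auto
  \<comment> \<open>If every element of \<open>?W\<close> were n + x v, then v would again be in
    \<open>?W\<close> because \<open>x\<close> is regular modulo \<open>N\<close>. So
    \<open>?W\<close> would lie in N + x \<open>?W\<close> and, by Nakayama's lemma, in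
    \<open>N\<close>, although \<open>m'\<close> does not.\<close>
  have "\<not> ?W \<subseteq> ?N'"
  proof
    assume sub: "?W \<subseteq> ?N'"
    have "?W \<subseteq> msum M N (lcomb M ?W [x])"
    proof
      fix w assume w: "w \<in> ?W"
      then have "w \<in> ?N'" using sub by (rule subsetD[rotated])
      then obtain n v where *: "n \<in> N" "v \<in> carrier M" "w = n \<oplus>\<^bsub>M\<^esub> x \<odot>\<^bsub>M\<^esub> v" by (auto simp: msum_def)
      have nc: "n \<in> carrier M" using * subm_carr[OF N] by auto
      have "a \<odot>\<^bsub>M\<^esub> v \<in> N" if a: "a \<in> P" for a
      proof -
        have ac: "a \<in> carrier R" using a Pc by auto
        have "a \<odot>\<^bsub>M\<^esub> w \<ominus>\<^bsub>M\<^esub> a \<odot>\<^bsub>M\<^esub> n \<in> N" using w a subm_smult[OF N ac *(1)] by (intro subm_minus[OF N]) auto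
        moreover have "a \<odot>\<^bsub>M\<^esub> w \<ominus>\<^bsub>M\<^esub> a \<odot>\<^bsub>M\<^esub> n = a \<odot>\<^bsub>M\<^esub> (x \<odot>\<^bsub>M\<^esub> v)"
          using * nc ac x by (simp add: smult_r_distr a_minus_def M.a_ac M.r_neg2)
        moreover have "a \<odot>\<^bsub>M\<^esub> (x \<odot>\<^bsub>M\<^esub> v) = x \<odot>\<^bsub>M\<^esub> (a \<odot>\<^bsub>M\<^esub> v)"
          using * ac x by (simp add: smult_assoc1[symmetric] R.m_comm)
        ultimately show ?thesis using reg[of "a \<odot>\<^bsub>M\<^esub> v"] * ac by simp
      qed
      then have "v \<in> ?W" using * by auto
      then have "x \<odot>\<^bsub>M\<^esub> v \<in> lcomb M ?W [x]" using x by (intro lcomb_mem[OF _ W]) auto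
      then show "w \<in> msum M N (lcomb M ?W [x])" unfolding *(3) by (rule msumI[OF *(1)])
    qed
    then have "?W \<subseteq> N" using x by (intro nakayama[OF N W, of "[x]"]) auto
    moreover have "m' \<in> ?W" using m' by (auto simp: P_def)
    ultimately show False using m' by auto
  qed
  then obtain w where w: "w \<in> ?W" "w \<notin> ?N'" by auto
  have "\<exists>C. prime_chain R C (length xs) \<and> insert x P \<subseteq> C 0"
  proof (rule Cons.IH[of ?N' w])
    show "regseq M ?N' xs" "set xs \<subseteq> \<mm>" using Cons.prems by auto
    show "a \<odot>\<^bsub>M\<^esub> w \<in> ?N'" if "a \<in> insert x P" for a
      using that w N' by auto
  qed (use w N' Pc x in auto)
  then obtain C where C: "prime_chain R C (length xs)" "insert x P \<subseteq> C 0" by auto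
  have "x \<notin> P" using reg[OF m'(1)] m' by (auto simp: P_def)
  then have "prime_chain R (case_nat P C) (Suc (length xs))" using C by (intro prime_chain_Cons pP) auto
  then show ?case using IP by (intro exI[of _ "case_nat P C"]) auto
qed

section \<open>Homomorphisms from an ideal to M modulo a submodule\<close>

definition cong_mod :: "('a, 'm, 'c) module_scheme \<Rightarrow> 'm set \<Rightarrow> 'm \<Rightarrow> 'm \<Rightarrow> bool" where
  "cong_mod M N x y \<longleftrightarrow> x \<in> carrier M \<and> y \<in> carrier M \<and> x \<ominus>\<^bsub>M\<^esub> y \<in> N"

text \<open>Homomorphisms I -> M/N are represented by functions into M that are additive and linear
  modulo \<open>N\<close>. The same function also represents the composite with M/N -> M/N' for a
  larger N', which the induction along a regular sequence uses.\<close>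

definition hom_mod :: "('a, 'b) ring_scheme \<Rightarrow> ('a, 'm, 'c) module_scheme \<Rightarrow> 'm set \<Rightarrow> 'a set \<Rightarrow> ('a \<Rightarrow> 'm) \<Rightarrow> bool" where
  "hom_mod R M N I \<phi> \<longleftrightarrow> \<phi> \<in> I \<rightarrow> carrier M \<and>
     (\<forall>r\<in>I. \<forall>s\<in>I. cong_mod M N (\<phi> (r \<oplus>\<^bsub>R\<^esub> s)) (\<phi> r \<oplus>\<^bsub>M\<^esub> \<phi> s)) \<and>
     (\<forall>a\<in>carrier R. \<forall>r\<in>I. cong_mod M N (\<phi> (a \<otimes>\<^bsub>R\<^esub> r)) (a \<odot>\<^bsub>M\<^esub> \<phi> r))"

text \<open>A \<open>hom_mod\<close> map on \<open>I\<close> that violates this is a nonzero class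
  in Ext^1(R/I, M/N).\<close>

definition mult_mod :: "('a, 'm, 'c) module_scheme \<Rightarrow> 'm set \<Rightarrow> 'a set \<Rightarrow> ('a \<Rightarrow> 'm) \<Rightarrow> bool" where
  "mult_mod M N I \<phi> \<longleftrightarrow> (\<exists>m\<in>carrier M. \<forall>r\<in>I. cong_mod M N (\<phi> r) (r \<odot>\<^bsub>M\<^esub> m))"

context module
begin

lemma cong_mod_refl: "subm R M N \<Longrightarrow> x \<in> carrier M \<Longrightarrow> cong_mod M N x x"
  using subm_zero by (fastforce simp: cong_mod_def M.r_neg a_minus_def)

lemma cong_mod_sym: "subm R M N \<Longrightarrow> cong_mod M N x y \<Longrightarrow> cong_mod M N y x"
proof -
  assume N: "subm R M N" and c: "cong_mod M N x y"
  then have "\<ominus>\<^bsub>M\<^esub> (x \<ominus>\<^bsub>M\<^esub> y) \<in> N" using subm_a_inv by (auto simp: cong_mod_def)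
  then show ?thesis using c by (simp add: cong_mod_def M.minus_add a_minus_def M.a_comm)
qed

lemma cong_mod_trans: "subm R M N \<Longrightarrow> cong_mod M N x y \<Longrightarrow> cong_mod M N y z \<Longrightarrow> cong_mod M N x z"
proof -
  assume N: "subm R M N" and c: "cong_mod M N x y" "cong_mod M N y z"
  then have "(x \<ominus>\<^bsub>M\<^esub> y) \<oplus>\<^bsub>M\<^esub> (y \<ominus>\<^bsub>M\<^esub> z) \<in> N" by (auto simp: cong_mod_def intro: subm_add)
  moreover have "(x \<ominus>\<^bsub>M\<^esub> y) \<oplus>\<^bsub>M\<^esub> (y \<ominus>\<^bsub>M\<^esub> z) = x \<ominus>\<^bsub>M\<^esub> z"
    using c by (simp add: cong_mod_def a_minus_def M.a_assoc) (simp add: M.a_assoc[symmetric] M.l_neg)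
  ultimately show ?thesis using c by (simp add: cong_mod_def)
qed

lemma cong_mod_add: "subm R M N \<Longrightarrow> cong_mod M N x y \<Longrightarrow> cong_mod M N u v \<Longrightarrow> cong_mod M N (x \<oplus>\<^bsub>M\<^esub> u) (y \<oplus>\<^bsub>M\<^esub> v)"
proof -
  assume N: "subm R M N" and c: "cong_mod M N x y" "cong_mod M N u v"
  then have "(x \<ominus>\<^bsub>M\<^esub> y) \<oplus>\<^bsub>M\<^esub> (u \<ominus>\<^bsub>M\<^esub> v) \<in> N" by (auto simp: cong_mod_def intro: subm_add)
  moreover have "(x \<ominus>\<^bsub>M\<^esub> y) \<oplus>\<^bsub>M\<^esub> (u \<ominus>\<^bsub>M\<^esub> v) = (x \<oplus>\<^bsub>M\<^esub> u) \<ominus>\<^bsub>M\<^esub> (y \<oplus>\<^bsub>M\<^esub> v)"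
    using c by (simp add: cong_mod_def a_minus_def M.a_ac M.minus_add)
  ultimately show ?thesis using c by (simp add: cong_mod_def)
qed

lemma cong_mod_smult: "subm R M N \<Longrightarrow> r \<in> carrier R \<Longrightarrow> cong_mod M N x y \<Longrightarrow> cong_mod M N (r \<odot>\<^bsub>M\<^esub> x) (r \<odot>\<^bsub>M\<^esub> y)"
proof -
  assume N: "subm R M N" and r: "r \<in> carrier R" and c: "cong_mod M N x y"
  then have "r \<odot>\<^bsub>M\<^esub> (x \<ominus>\<^bsub>M\<^esub> y) \<in> N" by (auto simp: cong_mod_def intro: subm_smult)
  then show ?thesis using c r by (simp add: cong_mod_def a_minus_def smult_r_distr smult_r_minus)
qed

lemma cong_mod_mono: "cong_mod M N x y \<Longrightarrow> N \<subseteq> N' \<Longrightarrow> cong_mod M N' x y"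
  by (auto simp: cong_mod_def)

lemma cong_mod_0: "x \<in> carrier M \<Longrightarrow> cong_mod M N x \<zero>\<^bsub>M\<^esub> \<longleftrightarrow> x \<in> N"
proof -
  have "\<ominus>\<^bsub>M\<^esub> \<zero>\<^bsub>M\<^esub> = \<zero>\<^bsub>M\<^esub>" by (rule M.minus_equality) auto
  then have "x \<ominus>\<^bsub>M\<^esub> \<zero>\<^bsub>M\<^esub> = x \<oplus>\<^bsub>M\<^esub> \<zero>\<^bsub>M\<^esub>" by (simp only: M.minus_eq)
  then show "x \<in> carrier M \<Longrightarrow> ?thesis" by (simp add: cong_mod_def)
qed

lemma cong_mod_carr: "cong_mod M N x y \<Longrightarrow> x \<in> carrier M" "cong_mod M N x y \<Longrightarrow> y \<in> carrier M"
  by (auto simp: cong_mod_def)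

lemma cong_mod_mem: "subm R M N \<Longrightarrow> cong_mod M N x y \<Longrightarrow> y \<in> N \<Longrightarrow> x \<in> N"
  by (meson cong_mod_0 cong_mod_carr cong_mod_trans)

end

lemma (in module) hom_mod_facts:
  assumes "hom_mod R M N I \<phi>"
  shows "\<And>r. r \<in> I \<Longrightarrow> \<phi> r \<in> carrier M"
    "\<And>r s. r \<in> I \<Longrightarrow> s \<in> I \<Longrightarrow> cong_mod M N (\<phi> (r \<oplus> s)) (\<phi> r \<oplus>\<^bsub>M\<^esub> \<phi> s)"
    "\<And>a r. a \<in> carrier R \<Longrightarrow> r \<in> I \<Longrightarrow> cong_mod M N (\<phi> (a \<otimes> r)) (a \<odot>\<^bsub>M\<^esub> \<phi> r)"
  using assms by (auto simp: hom_mod_def)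

text \<open>Gluing: a homomorphism on J and the map r a -> r v on R a define one on J + R a as soon
  as they agree on the intersection, which is the last hypothesis.\<close>

lemma (in module) hom_mod_extend:
  assumes N: "subm R M N" and J: "ideal J R" and hom: "hom_mod R M N J \<psi>"
    and a: "a \<in> carrier R" and v: "v \<in> carrier M"
    and compat: "\<And>r. r \<in> carrier R \<Longrightarrow> r \<otimes> a \<in> J \<Longrightarrow> cong_mod M N (\<psi> (r \<otimes> a)) (r \<odot>\<^bsub>M\<^esub> v)"
  obtains J' \<psi>' where "ideal J' R" "J \<subseteq> J'" "a \<in> J'" "hom_mod R M N J' \<psi>'"
    "\<And>r. r \<in> J \<Longrightarrow> cong_mod M N (\<psi>' r) (\<psi> r)" "cong_mod M N (\<psi>' a) v"
proof -
  note f = ideal_facts[OF J] and h = hom_mod_facts[OF hom]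
  define J' where "J' = {j \<oplus> r \<otimes> a | j r. j \<in> J \<and> r \<in> carrier R}"
  \<comment> \<open>A representation y = j + r a is chosen arbitrarily; \<open>rep\<close> shows
    that modulo \<open>N\<close> the value does not depend on it.\<close>
  define \<psi>' where "\<psi>' y = (SOME w. \<exists>j r. j \<in> J \<and> r \<in> carrier R \<and> y = j \<oplus> r \<otimes> a \<and> w = \<psi> j \<oplus>\<^bsub>M\<^esub> r \<odot>\<^bsub>M\<^esub> v)" for y
  have J': "ideal J' R"
  proof (rule idealI2)
    show "J' \<subseteq> carrier R" using f a by (auto simp: J'_def)
    show "\<zero> \<in> J'" unfolding J'_def using f a by (intro CollectI exI[of _ \<zero>]) auto
    show "x \<oplus> y \<in> J'" if xy: "x \<in> J'" "y \<in> J'" for x y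
    proof -
      from xy obtain j r i s where *: "j \<in> J" "i \<in> J" "r \<in> carrier R" "s \<in> carrier R" "x = j \<oplus> r \<otimes> a" "y = i \<oplus> s \<otimes> a"
        by (auto simp: J'_def)
      then have "x \<oplus> y = (j \<oplus> i) \<oplus> (r \<oplus> s) \<otimes> a" using f(7) a by (simp add: R.l_distr R.a_ac)
      then show ?thesis using * f(3) unfolding J'_def by blast
    qed
    show "s \<otimes> x \<in> J'" if x: "s \<in> carrier R" "x \<in> J'" for s x
    proof -
      from x obtain j r where *: "j \<in> J" "r \<in> carrier R" "x = j \<oplus> r \<otimes> a" by (auto simp: J'_def)
      then have "s \<otimes> x = (s \<otimes> j) \<oplus> (s \<otimes> r) \<otimes> a" using f(7) a x by (simp add: R.r_distr R.m_assoc)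
      then show ?thesis using * f(4) x unfolding J'_def by blast
    qed
  qed
  have rep: "cong_mod M N (\<psi>' (j \<oplus> r \<otimes> a)) (\<psi> j \<oplus>\<^bsub>M\<^esub> r \<odot>\<^bsub>M\<^esub> v)" if j: "j \<in> J" and r: "r \<in> carrier R" for j r
  proof -
    have "\<exists>w. \<exists>i s. i \<in> J \<and> s \<in> carrier R \<and> j \<oplus> r \<otimes> a = i \<oplus> s \<otimes> a \<and> w = \<psi> i \<oplus>\<^bsub>M\<^esub> s \<odot>\<^bsub>M\<^esub> v" using j r by blast
    from someI_ex[OF this] obtain i s where *: "i \<in> J" "s \<in> carrier R" "j \<oplus> r \<otimes> a = i \<oplus> s \<otimes> a"
      "\<psi>' (j \<oplus> r \<otimes> a) = \<psi> i \<oplus>\<^bsub>M\<^esub> s \<odot>\<^bsub>M\<^esub> v" unfolding \<psi>'_def[symmetric] by blast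
    have c: "j \<in> carrier R" "i \<in> carrier R" using j * f(7) by auto
    have e: "(r \<ominus> s) \<otimes> a = i \<ominus> j"
    proof -
      have "(r \<ominus> s) \<otimes> a = (j \<oplus> r \<otimes> a) \<ominus> j \<ominus> s \<otimes> a" using c r *(2) a by algebra
      also have "\<dots> = i \<ominus> j" unfolding *(3) using c r *(2) a by algebra
      finally show ?thesis .
    qed
    have "cong_mod M N (\<psi> ((r \<ominus> s) \<otimes> a)) ((r \<ominus> s) \<odot>\<^bsub>M\<^esub> v)" using r * e f(6)[OF *(1) j] by (intro compat) auto
    then have 1: "cong_mod M N (\<psi> (i \<ominus> j)) ((r \<ominus> s) \<odot>\<^bsub>M\<^esub> v)" using e by simp
    have "cong_mod M N (\<psi> ((i \<ominus> j) \<oplus> j)) (\<psi> (i \<ominus> j) \<oplus>\<^bsub>M\<^esub> \<psi> j)" using h(2) f(6)[OF *(1) j] j by auto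
    moreover have "(i \<ominus> j) \<oplus> j = i" using c by algebra
    moreover have "cong_mod M N (\<psi> (i \<ominus> j) \<oplus>\<^bsub>M\<^esub> \<psi> j) ((r \<ominus> s) \<odot>\<^bsub>M\<^esub> v \<oplus>\<^bsub>M\<^esub> \<psi> j)"
      by (rule cong_mod_add[OF N 1 cong_mod_refl[OF N h(1)[OF j]]])
    ultimately have "cong_mod M N (\<psi> i) ((r \<ominus> s) \<odot>\<^bsub>M\<^esub> v \<oplus>\<^bsub>M\<^esub> \<psi> j)" using cong_mod_trans[OF N] by metis
    then have "cong_mod M N (\<psi> i \<oplus>\<^bsub>M\<^esub> s \<odot>\<^bsub>M\<^esub> v) (((r \<ominus> s) \<odot>\<^bsub>M\<^esub> v \<oplus>\<^bsub>M\<^esub> \<psi> j) \<oplus>\<^bsub>M\<^esub> s \<odot>\<^bsub>M\<^esub> v)"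
      using * v by (intro cong_mod_add[OF N] cong_mod_refl[OF N]) auto
    moreover have "((r \<ominus> s) \<odot>\<^bsub>M\<^esub> v \<oplus>\<^bsub>M\<^esub> \<psi> j) \<oplus>\<^bsub>M\<^esub> s \<odot>\<^bsub>M\<^esub> v = \<psi> j \<oplus>\<^bsub>M\<^esub> ((r \<ominus> s) \<oplus> s) \<odot>\<^bsub>M\<^esub> v"
      using r * v h(1)[OF j] by (simp add: smult_l_distr M.a_ac)
    moreover have "(r \<ominus> s) \<oplus> s = r" using r * by algebra
    ultimately show ?thesis using * by simp
  qed
  have JJ: "J \<subseteq> J'"
  proof
    fix j assume "j \<in> J"
    then show "j \<in> J'" unfolding J'_def using a f by (intro CollectI exI[of _ j] exI[of _ \<zero>]) auto
  qed
  have aJ: "a \<in> J'" unfolding J'_def using a f by (intro CollectI exI[of _ \<zero>] exI[of _ \<one>]) auto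
  have ext: "cong_mod M N (\<psi>' r) (\<psi> r)" if "r \<in> J" for r
    using rep[OF that, of \<zero>] that a v f h(1) by simp
  have "cong_mod M N (\<psi> (\<zero> \<otimes> \<zero>)) (\<zero> \<odot>\<^bsub>M\<^esub> \<psi> \<zero>)" using h(3) f by blast
  then have p0: "cong_mod M N (\<psi> \<zero>) \<zero>\<^bsub>M\<^esub>" using h(1) f by simp
  have "cong_mod M N (\<psi>' (\<zero> \<oplus> \<one> \<otimes> a)) (\<psi> \<zero> \<oplus>\<^bsub>M\<^esub> \<one> \<odot>\<^bsub>M\<^esub> v)" using rep f by blast
  moreover have "cong_mod M N (\<psi> \<zero> \<oplus>\<^bsub>M\<^esub> v) (\<zero>\<^bsub>M\<^esub> \<oplus>\<^bsub>M\<^esub> v)" by (rule cong_mod_add[OF N p0 cong_mod_refl[OF N v]])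
  ultimately have ea: "cong_mod M N (\<psi>' a) v" using a v cong_mod_trans[OF N] by simp
  have "hom_mod R M N J' \<psi>'"
    unfolding hom_mod_def
  proof (intro conjI ballI)
    show "\<psi>' \<in> J' \<rightarrow> carrier M" using rep cong_mod_carr by (fastforce simp: J'_def)
    fix x y assume "x \<in> J'" "y \<in> J'"
    then obtain j r i s where *: "j \<in> J" "i \<in> J" "r \<in> carrier R" "s \<in> carrier R" "x = j \<oplus> r \<otimes> a" "y = i \<oplus> s \<otimes> a"
      by (auto simp: J'_def)
    have xy: "x \<oplus> y = (j \<oplus> i) \<oplus> (r \<oplus> s) \<otimes> a" using * f(7) a by (simp add: R.l_distr R.a_ac)
    have c: "\<psi> j \<in> carrier M" "\<psi> i \<in> carrier M" using * h(1) by auto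
    have 1: "cong_mod M N (\<psi>' (x \<oplus> y)) (\<psi> (j \<oplus> i) \<oplus>\<^bsub>M\<^esub> (r \<oplus> s) \<odot>\<^bsub>M\<^esub> v)" unfolding xy using * f(3) by (intro rep) auto
    have 2: "cong_mod M N (\<psi> (j \<oplus> i) \<oplus>\<^bsub>M\<^esub> (r \<oplus> s) \<odot>\<^bsub>M\<^esub> v) ((\<psi> j \<oplus>\<^bsub>M\<^esub> \<psi> i) \<oplus>\<^bsub>M\<^esub> (r \<oplus> s) \<odot>\<^bsub>M\<^esub> v)"
      using * v by (intro cong_mod_add[OF N h(2)] cong_mod_refl[OF N]) auto
    have 3: "(\<psi> j \<oplus>\<^bsub>M\<^esub> \<psi> i) \<oplus>\<^bsub>M\<^esub> (r \<oplus> s) \<odot>\<^bsub>M\<^esub> v = (\<psi> j \<oplus>\<^bsub>M\<^esub> r \<odot>\<^bsub>M\<^esub> v) \<oplus>\<^bsub>M\<^esub> (\<psi> i \<oplus>\<^bsub>M\<^esub> s \<odot>\<^bsub>M\<^esub> v)"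
      using c v * by (simp add: smult_l_distr M.a_ac)
    have 4: "cong_mod M N (\<psi>' x \<oplus>\<^bsub>M\<^esub> \<psi>' y) ((\<psi> j \<oplus>\<^bsub>M\<^esub> r \<odot>\<^bsub>M\<^esub> v) \<oplus>\<^bsub>M\<^esub> (\<psi> i \<oplus>\<^bsub>M\<^esub> s \<odot>\<^bsub>M\<^esub> v))"
      unfolding *(5,6) using * by (intro cong_mod_add[OF N] rep)
    show "cong_mod M N (\<psi>' (x \<oplus> y)) (\<psi>' x \<oplus>\<^bsub>M\<^esub> \<psi>' y)"
      by (rule cong_mod_trans[OF N cong_mod_trans[OF N 1 2[unfolded 3]] cong_mod_sym[OF N 4]])
  next
    fix t x assume t: "t \<in> carrier R" and "x \<in> J'"
    then obtain j r where *: "j \<in> J" "r \<in> carrier R" "x = j \<oplus> r \<otimes> a" by (auto simp: J'_def)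
    have tx: "t \<otimes> x = (t \<otimes> j) \<oplus> (t \<otimes> r) \<otimes> a" using * f(7) a t by (simp add: R.r_distr R.m_assoc)
    have c: "\<psi> j \<in> carrier M" using * h(1) by auto
    have 1: "cong_mod M N (\<psi>' (t \<otimes> x)) (\<psi> (t \<otimes> j) \<oplus>\<^bsub>M\<^esub> (t \<otimes> r) \<odot>\<^bsub>M\<^esub> v)" unfolding tx using * f(4) t by (intro rep) auto
    have 2: "cong_mod M N (\<psi> (t \<otimes> j) \<oplus>\<^bsub>M\<^esub> (t \<otimes> r) \<odot>\<^bsub>M\<^esub> v) (t \<odot>\<^bsub>M\<^esub> \<psi> j \<oplus>\<^bsub>M\<^esub> (t \<otimes> r) \<odot>\<^bsub>M\<^esub> v)"
      using * v t by (intro cong_mod_add[OF N h(3)] cong_mod_refl[OF N]) auto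
    have 3: "t \<odot>\<^bsub>M\<^esub> \<psi> j \<oplus>\<^bsub>M\<^esub> (t \<otimes> r) \<odot>\<^bsub>M\<^esub> v = t \<odot>\<^bsub>M\<^esub> (\<psi> j \<oplus>\<^bsub>M\<^esub> r \<odot>\<^bsub>M\<^esub> v)"
      using c v * t by (simp add: smult_r_distr smult_assoc1)
    have 4: "cong_mod M N (t \<odot>\<^bsub>M\<^esub> \<psi>' x) (t \<odot>\<^bsub>M\<^esub> (\<psi> j \<oplus>\<^bsub>M\<^esub> r \<odot>\<^bsub>M\<^esub> v))"
      unfolding *(3) using * by (intro cong_mod_smult[OF N t] rep)
    show "cong_mod M N (\<psi>' (t \<otimes> x)) (t \<odot>\<^bsub>M\<^esub> \<psi>' x)"
      by (rule cong_mod_trans[OF N cong_mod_trans[OF N 1 2[unfolded 3]] cong_mod_sym[OF N 4]])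
  qed
  then show ?thesis using that J' JJ aJ ext ea by blast
qed

text \<open>Reduction of Ext^1(R/I, M/N) to a prime above I. Extend \<phi> to an ideal
  \<open>J\<close> maximal among those that admit an extension modulo \<open>N\<close>; it is
  proper, since on the whole ring every homomorphism is multiplication by its value at 1. Take an
  associated prime (J : a) of R/J and \<chi> r = \<psi> (r a). If \<chi> were multiplication by v,
  then \<psi> could be extended to J + R a with value v at a.\<close>

lemma (in local_module) prime_not_mult_mod:
  assumes N: "subm R M N" and I: "ideal I R" and hom: "hom_mod R M N I \<phi>" and nm: "\<not> mult_mod M N I \<phi>"
  obtains P \<chi> where "primeideal P R" "I \<subseteq> P" "hom_mod R M N P \<chi>" "\<not> mult_mod M N P \<chi>"
proof -
  let ?S = "{J. ideal J R \<and> I \<subseteq> J \<and> (\<exists>\<psi>. hom_mod R M N J \<psi> \<and> (\<forall>r\<in>I. cong_mod M N (\<psi> r) (\<phi> r)))}"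
  have "\<forall>r\<in>I. cong_mod M N (\<phi> r) (\<phi> r)" using hom_mod_facts(1)[OF hom] cong_mod_refl[OF N] by simp
  then have "I \<in> ?S" using I hom by blast
  then have "\<exists>J\<in>?S. \<forall>K\<in>?S. J \<subseteq> K \<longrightarrow> K = J" by (intro ideals_maximal_element) auto
  then obtain J where JS: "J \<in> ?S" and mx: "\<forall>K\<in>?S. J \<subseteq> K \<longrightarrow> K = J" ..
  from JS obtain \<psi> where J: "ideal J R" "I \<subseteq> J" and \<psi>: "hom_mod R M N J \<psi>" "\<And>r. r \<in> I \<Longrightarrow> cong_mod M N (\<psi> r) (\<phi> r)"
    by auto
  note h = hom_mod_facts[OF \<psi>(1)] and f = ideal_facts[OF J(1)]
  have "J \<noteq> carrier R"
  proof
    assume JR: "J = carrier R"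
    have "cong_mod M N (\<phi> r) (r \<odot>\<^bsub>M\<^esub> \<psi> \<one>)" if r: "r \<in> I" for r
    proof -
      have rc: "r \<in> carrier R" using r J f by auto
      then have "cong_mod M N (\<psi> r) (r \<odot>\<^bsub>M\<^esub> \<psi> \<one>)" using h(3)[of r \<one>] JR by simp
      then show ?thesis using cong_mod_trans[OF N cong_mod_sym[OF N \<psi>(2)[OF r]]] by blast
    qed
    moreover have "\<psi> \<one> \<in> carrier M" using h(1) JR by simp
    ultimately show False using nm by (auto simp: mult_mod_def)
  qed
  then have n1: "\<one> \<notin> J" using ideal.one_imp_carrier[OF J(1)] by auto
  interpret RR: local_module R "ring_as_module R"
  proof -
    interpret RM: module R "ring_as_module R" by (rule module_ring_as_module)
    have "lspan R (ring_as_module R) [\<one>] = carrier R"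
    proof
      show "lspan R (ring_as_module R) [\<one>] \<subseteq> carrier R" by auto
      show "carrier R \<subseteq> lspan R (ring_as_module R) [\<one>]"
      proof
        fix r assume "r \<in> carrier R"
        then show "r \<in> lspan R (ring_as_module R) [\<one>]" by (auto intro!: exI[of _ r])
      qed
    qed
    then have "fgen R (ring_as_module R) (carrier (ring_as_module R))"
      unfolding fgen_def by (intro exI[of _ "[\<one>]"]) auto
    then show "local_module R (ring_as_module R)"
      by unfold_locales
  qed
  obtain a where a: "a \<in> carrier R" "a \<notin> J" and P: "primeideal {r \<in> carrier R. r \<otimes> a \<in> J} R"
    using RR.associated_prime[of J \<one>] J(1) n1 subm_ring_iff by auto
  let ?P = "{r \<in> carrier R. r \<otimes> a \<in> J}"
  have IP: "I \<subseteq> ?P" using J f a(1) by auto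
  define \<chi> where "\<chi> r = \<psi> (r \<otimes> a)" for r
  have \<chi>: "hom_mod R M N ?P \<chi>"
    unfolding hom_mod_def
  proof (intro conjI ballI)
    show "\<chi> \<in> ?P \<rightarrow> carrier M" using h(1) by (auto simp: \<chi>_def)
    show "cong_mod M N (\<chi> (r \<oplus> s)) (\<chi> r \<oplus>\<^bsub>M\<^esub> \<chi> s)" if "r \<in> ?P" "s \<in> ?P" for r s
      using that h(2) a by (auto simp: \<chi>_def R.l_distr)
    show "cong_mod M N (\<chi> (c \<otimes> r)) (c \<odot>\<^bsub>M\<^esub> \<chi> r)" if "c \<in> carrier R" "r \<in> ?P" for c r
      using that h(3) a by (auto simp: \<chi>_def R.m_assoc)
  qed
  have "\<not> mult_mod M N ?P \<chi>"
  proof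
    assume "mult_mod M N ?P \<chi>"
    then obtain v where v: "v \<in> carrier M" "\<And>r. r \<in> ?P \<Longrightarrow> cong_mod M N (\<chi> r) (r \<odot>\<^bsub>M\<^esub> v)"
      by (auto simp: mult_mod_def)
    obtain J' \<psi>' where J': "ideal J' R" "J \<subseteq> J'" "a \<in> J'" "hom_mod R M N J' \<psi>'"
      "\<And>r. r \<in> J \<Longrightarrow> cong_mod M N (\<psi>' r) (\<psi> r)"
      by (rule hom_mod_extend[OF N J(1) \<psi>(1) a(1) v(1)]) (use v(2) in \<open>auto simp: \<chi>_def\<close>)
    have "\<forall>r\<in>I. cong_mod M N (\<psi>' r) (\<phi> r)"
      using J'(5) J(2) \<psi>(2) cong_mod_trans[OF N] by blast
    then have "J' \<in> ?S" using J' J(2) by blast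
    then have "J' = J" using mx J'(2) by blast
    then show False using J'(3) a by simp
  qed
  then show ?thesis using that P IP \<chi> by blast
qed

lemma (in module) hom_mod_generators:
  assumes N: "subm R M N" and A: "A \<subseteq> carrier R" and hom: "hom_mod R M N (Idl A) \<phi>"
    and m: "m \<in> carrier M" and gen: "\<And>a. a \<in> A \<Longrightarrow> cong_mod M N (\<phi> a) (a \<odot>\<^bsub>M\<^esub> m)"
    and r: "r \<in> Idl A"
  shows "cong_mod M N (\<phi> r) (r \<odot>\<^bsub>M\<^esub> m)"
proof -
  note f = ideal_facts[OF genideal_ideal[OF A]] and h = hom_mod_facts[OF hom]
  let ?K = "{r \<in> Idl A. cong_mod M N (\<phi> r) (r \<odot>\<^bsub>M\<^esub> m)}"
  have "ideal ?K R"
  proof (rule idealI2)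
    have "cong_mod M N (\<phi> (\<zero> \<otimes> \<zero>)) (\<zero> \<odot>\<^bsub>M\<^esub> \<phi> \<zero>)" using h(3) f by blast
    then show "\<zero> \<in> ?K" using f h(1) m by simp
    show "a \<oplus> b \<in> ?K" if "a \<in> ?K" "b \<in> ?K" for a b
    proof -
      have "cong_mod M N (\<phi> a \<oplus>\<^bsub>M\<^esub> \<phi> b) (a \<odot>\<^bsub>M\<^esub> m \<oplus>\<^bsub>M\<^esub> b \<odot>\<^bsub>M\<^esub> m)" using that cong_mod_add[OF N] by auto
      then have "cong_mod M N (\<phi> (a \<oplus> b)) (a \<odot>\<^bsub>M\<^esub> m \<oplus>\<^bsub>M\<^esub> b \<odot>\<^bsub>M\<^esub> m)" using h(2) that cong_mod_trans[OF N] by blast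
      then show ?thesis using that f m by (simp add: smult_l_distr)
    qed
    show "c \<otimes> a \<in> ?K" if "c \<in> carrier R" "a \<in> ?K" for c a
    proof -
      have "cong_mod M N (c \<odot>\<^bsub>M\<^esub> \<phi> a) (c \<odot>\<^bsub>M\<^esub> (a \<odot>\<^bsub>M\<^esub> m))" using that cong_mod_smult[OF N] by auto
      then have "cong_mod M N (\<phi> (c \<otimes> a)) (c \<odot>\<^bsub>M\<^esub> (a \<odot>\<^bsub>M\<^esub> m))" using h(3) that cong_mod_trans[OF N] by blast
      then show ?thesis using that f m by (simp add: smult_assoc1)
    qed
  qed (use f in auto)
  moreover have "A \<subseteq> ?K" using gen genideal_self[OF A] by auto
  ultimately have "Idl A \<subseteq> ?K" by (rule genideal_minimal)
  then show ?thesis using r by auto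
qed

lemma (in module) hom_mod_lincomb:
  assumes N: "subm R M N" and "hom_mod R M N P \<phi>" "hom_mod R M N P \<psi>"
  shows "hom_mod R M N P (\<lambda>p. \<phi> p \<oplus>\<^bsub>M\<^esub> \<psi> p)"
proof -
  note h = hom_mod_facts[OF assms(2)] and g = hom_mod_facts[OF assms(3)]
  show ?thesis unfolding hom_mod_def
  proof (intro conjI ballI)
    show "(\<lambda>p. \<phi> p \<oplus>\<^bsub>M\<^esub> \<psi> p) \<in> P \<rightarrow> carrier M" using h(1) g(1) by auto
    show "cong_mod M N (\<phi> (r \<oplus> s) \<oplus>\<^bsub>M\<^esub> \<psi> (r \<oplus> s)) (\<phi> r \<oplus>\<^bsub>M\<^esub> \<psi> r \<oplus>\<^bsub>M\<^esub> (\<phi> s \<oplus>\<^bsub>M\<^esub> \<psi> s))" if "r \<in> P" "s \<in> P" for r s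
      using cong_mod_add[OF N h(2)[OF that] g(2)[OF that]] h(1)[OF that(1)] h(1)[OF that(2)] g(1)[OF that(1)] g(1)[OF that(2)]
      by (simp add: M.a_ac)
    show "cong_mod M N (\<phi> (a \<otimes> r) \<oplus>\<^bsub>M\<^esub> \<psi> (a \<otimes> r)) (a \<odot>\<^bsub>M\<^esub> (\<phi> r \<oplus>\<^bsub>M\<^esub> \<psi> r))" if "a \<in> carrier R" "r \<in> P" for a r
      using cong_mod_add[OF N h(3)[OF that] g(3)[OF that]] h(1)[OF that(2)] g(1)[OF that(2)] that
      by (simp add: smult_r_distr)
  qed
qed

lemma (in module) hom_mod_smult:
  assumes N: "subm R M N" and "hom_mod R M N P \<phi>" and c: "c \<in> carrier R"
  shows "hom_mod R M N P (\<lambda>p. c \<odot>\<^bsub>M\<^esub> \<phi> p)"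
proof -
  note h = hom_mod_facts[OF assms(2)]
  show ?thesis unfolding hom_mod_def
  proof (intro conjI ballI)
    show "(\<lambda>p. c \<odot>\<^bsub>M\<^esub> \<phi> p) \<in> P \<rightarrow> carrier M" using h(1) c by auto
    show "cong_mod M N (c \<odot>\<^bsub>M\<^esub> \<phi> (r \<oplus> s)) (c \<odot>\<^bsub>M\<^esub> \<phi> r \<oplus>\<^bsub>M\<^esub> c \<odot>\<^bsub>M\<^esub> \<phi> s)" if "r \<in> P" "s \<in> P" for r s
      using cong_mod_smult[OF N c h(2)[OF that]] h(1)[OF that(1)] h(1)[OF that(2)] c
      by (simp add: smult_r_distr)
    show "cong_mod M N (c \<odot>\<^bsub>M\<^esub> \<phi> (a \<otimes> r)) (a \<odot>\<^bsub>M\<^esub> (c \<odot>\<^bsub>M\<^esub> \<phi> r))" if "a \<in> carrier R" "r \<in> P" for a r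
    proof -
      have "c \<odot>\<^bsub>M\<^esub> (a \<odot>\<^bsub>M\<^esub> \<phi> r) = a \<odot>\<^bsub>M\<^esub> (c \<odot>\<^bsub>M\<^esub> \<phi> r)"
        using h(1)[OF that(2)] that(1) c by (simp add: smult_assoc1[symmetric] R.m_comm)
      then show ?thesis using cong_mod_smult[OF N c h(3)[OF that]] by simp
    qed
  qed
qed

text \<open>If \<chi> is multiplication by m modulo N + xM, then \<chi> - m = x \<xi> modulo
  \<open>N\<close>, and \<xi> is again a homomorphism because \<open>x\<close> is regular.
  Nakayama's lemma removes this remainder. To have a finitely generated module to which it applies,
  homomorphisms are replaced by their values at generators \<open>ps\<close> of P: these form the
  submodule \<open>?T\<close> of a power of M, and \<open>?B\<close> consists of the values of
  multiplications up to \<open>N\<close>.\<close>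

lemma (in local_module) hom_mod_nakayama:
  assumes N: "subm R M N" and P: "ideal P R" and x: "x \<in> \<mm>"
    and reg: "\<And>m. m \<in> carrier M \<Longrightarrow> x \<odot>\<^bsub>M\<^esub> m \<in> N \<Longrightarrow> m \<in> N"
    and all: "\<And>\<chi>. hom_mod R M N P \<chi> \<Longrightarrow> mult_mod M (msum M N ((\<lambda>m. x \<odot>\<^bsub>M\<^esub> m) ` carrier M)) P \<chi>"
    and hom: "hom_mod R M N P \<phi>"
  shows "mult_mod M N P \<phi>"
proof -
  have xc: "x \<in> carrier R" using x max_ideal_carr by auto
  note f = ideal_facts[OF P] and Nc = subm_carr[OF N]
  obtain A where A: "A \<subseteq> carrier R" "finite A" "P = Idl A" using finetely_gen[OF P] by metis
  have AP: "A \<subseteq> P" using genideal_self[OF A(1)] A(3) by simp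
  obtain ps where ps: "set ps = A" using finite_list[OF A(2)] ..
  let ?k = "length ps"
  let ?Q = "power_module M ?k"
  have psP: "ps ! i \<in> P" "ps ! i \<in> carrier R" if "i < ?k" for i using that ps AP f(7) nth_mem by blast+
  interpret Q: local_module R ?Q
  proof -
    interpret Q: module R ?Q by (rule module_power_module)
    show "local_module R ?Q" by unfold_locales (rule fgen_power_module[OF fg])
  qed
  define t where "t \<chi> = (\<lambda>i\<in>{..<?k}. \<chi> (ps ! i))" for \<chi> :: "'a \<Rightarrow> 'c"
  let ?T = "{u \<in> carrier ?Q. \<exists>\<chi>. hom_mod R M N P \<chi> \<and> (\<forall>i<?k. u i = \<chi> (ps ! i))}"
  let ?B = "{u \<in> carrier ?Q. \<exists>m\<in>carrier M. \<forall>i<?k. cong_mod M N (u i) (ps ! i \<odot>\<^bsub>M\<^esub> m)}"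
  have T: "subm R ?Q ?T"
  proof (rule submI)
    have "hom_mod R M N P (\<lambda>_. \<zero>\<^bsub>M\<^esub>)" by (auto simp: hom_mod_def cong_mod_refl[OF N])
    then show "\<zero>\<^bsub>?Q\<^esub> \<in> ?T" by auto
    fix u v assume "u \<in> ?T" "v \<in> ?T"
    then obtain \<chi> \<xi> where *: "u \<in> carrier ?Q" "v \<in> carrier ?Q" "hom_mod R M N P \<chi>" "\<forall>i<?k. u i = \<chi> (ps ! i)" "hom_mod R M N P \<xi>" "\<forall>i<?k. v i = \<xi> (ps ! i)" by auto
    then show "u \<oplus>\<^bsub>?Q\<^esub> v \<in> ?T" using hom_mod_lincomb[OF N *(3) *(5)] by auto
  next
    fix r u assume r: "r \<in> carrier R" and "u \<in> ?T"
    then obtain \<chi> where *: "u \<in> carrier ?Q" "hom_mod R M N P \<chi>" "\<forall>i<?k. u i = \<chi> (ps ! i)" by auto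
    then show "r \<odot>\<^bsub>?Q\<^esub> u \<in> ?T" using hom_mod_smult[OF N *(2) r] r by auto
  qed auto
  have B: "subm R ?Q ?B"
  proof (rule submI)
    have "cong_mod M N \<zero>\<^bsub>M\<^esub> \<zero>\<^bsub>M\<^esub>" by (simp add: cong_mod_refl[OF N])
    then show "\<zero>\<^bsub>?Q\<^esub> \<in> ?B" using psP(2) by (auto intro!: bexI[of _ "\<zero>\<^bsub>M\<^esub>"])
    fix u v assume "u \<in> ?B" "v \<in> ?B"
    then obtain m n where *: "u \<in> carrier ?Q" "v \<in> carrier ?Q" "m \<in> carrier M" "n \<in> carrier M"
      "\<And>i. i < ?k \<Longrightarrow> cong_mod M N (u i) (ps ! i \<odot>\<^bsub>M\<^esub> m)" "\<And>i. i < ?k \<Longrightarrow> cong_mod M N (v i) (ps ! i \<odot>\<^bsub>M\<^esub> n)" by auto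
    have "cong_mod M N (u i \<oplus>\<^bsub>M\<^esub> v i) (ps ! i \<odot>\<^bsub>M\<^esub> (m \<oplus>\<^bsub>M\<^esub> n))" if "i < ?k" for i
      using cong_mod_add[OF N *(5)[OF that] *(6)[OF that]] * psP(2)[OF that] by (simp add: smult_r_distr)
    then show "u \<oplus>\<^bsub>?Q\<^esub> v \<in> ?B" using * by (auto intro!: bexI[of _ "m \<oplus>\<^bsub>M\<^esub> n"])
  next
    fix r u assume r: "r \<in> carrier R" and "u \<in> ?B"
    then obtain m where *: "u \<in> carrier ?Q" "m \<in> carrier M"
      "\<And>i. i < ?k \<Longrightarrow> cong_mod M N (u i) (ps ! i \<odot>\<^bsub>M\<^esub> m)" by auto
    have "cong_mod M N (r \<odot>\<^bsub>M\<^esub> u i) (ps ! i \<odot>\<^bsub>M\<^esub> (r \<odot>\<^bsub>M\<^esub> m))" if "i < ?k" for i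
    proof -
      have "r \<odot>\<^bsub>M\<^esub> (ps ! i \<odot>\<^bsub>M\<^esub> m) = ps ! i \<odot>\<^bsub>M\<^esub> (r \<odot>\<^bsub>M\<^esub> m)"
        using r * psP(2)[OF that] by (simp add: smult_assoc1[symmetric] R.m_comm)
      then show ?thesis using cong_mod_smult[OF N r *(3)[OF that]] by simp
    qed
    then show "r \<odot>\<^bsub>?Q\<^esub> u \<in> ?B" using * r by (auto intro!: bexI[of _ "r \<odot>\<^bsub>M\<^esub> m"])
  qed auto
  have "?T \<subseteq> msum ?Q ?B (lcomb ?Q ?T [x])"
  proof
    fix u assume "u \<in> ?T"
    then obtain \<chi> where u: "u \<in> carrier ?Q" "hom_mod R M N P \<chi>" "\<And>i. i < ?k \<Longrightarrow> u i = \<chi> (ps ! i)" by auto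
    note h = hom_mod_facts[OF u(2)]
    obtain m where m: "m \<in> carrier M" "\<And>p. p \<in> P \<Longrightarrow> cong_mod M (msum M N ((\<lambda>m. x \<odot>\<^bsub>M\<^esub> m) ` carrier M)) (\<chi> p) (p \<odot>\<^bsub>M\<^esub> m)"
      using all[OF u(2)] by (auto simp: mult_mod_def)
    have "\<exists>v. v \<in> carrier M \<and> cong_mod M N (\<chi> p \<ominus>\<^bsub>M\<^esub> p \<odot>\<^bsub>M\<^esub> m) (x \<odot>\<^bsub>M\<^esub> v)" if p: "p \<in> P" for p
    proof -
      obtain n v where nv: "n \<in> N" "v \<in> carrier M" "\<chi> p \<ominus>\<^bsub>M\<^esub> p \<odot>\<^bsub>M\<^esub> m = n \<oplus>\<^bsub>M\<^esub> x \<odot>\<^bsub>M\<^esub> v"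
        using m(2)[OF p] by (auto simp: cong_mod_def msum_def)
      then have "cong_mod M N (n \<oplus>\<^bsub>M\<^esub> x \<odot>\<^bsub>M\<^esub> v) (\<zero>\<^bsub>M\<^esub> \<oplus>\<^bsub>M\<^esub> x \<odot>\<^bsub>M\<^esub> v)"
        using xc Nc cong_mod_0[of n N] by (intro cong_mod_add[OF N] cong_mod_refl[OF N]) auto
      then show ?thesis using nv xc by auto
    qed
    then obtain \<xi> where \<xi>: "\<And>p. p \<in> P \<Longrightarrow> \<xi> p \<in> carrier M"
      "\<And>p. p \<in> P \<Longrightarrow> cong_mod M N (\<chi> p \<ominus>\<^bsub>M\<^esub> p \<odot>\<^bsub>M\<^esub> m) (x \<odot>\<^bsub>M\<^esub> \<xi> p)" by metis
    have xreg: "cong_mod M N y z" if "cong_mod M N (x \<odot>\<^bsub>M\<^esub> y) (x \<odot>\<^bsub>M\<^esub> z)" "y \<in> carrier M" "z \<in> carrier M" for y z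
    proof -
      have "x \<odot>\<^bsub>M\<^esub> (y \<ominus>\<^bsub>M\<^esub> z) \<in> N" using that xc by (simp add: cong_mod_def a_minus_def smult_r_distr smult_r_minus)
      then show ?thesis using reg[of "y \<ominus>\<^bsub>M\<^esub> z"] that by (simp add: cong_mod_def)
    qed
    have \<xi>hom: "hom_mod R M N P \<xi>"
      unfolding hom_mod_def
    proof (intro conjI ballI)
      show "\<xi> \<in> P \<rightarrow> carrier M" using \<xi>(1) by auto
      fix r s assume r: "r \<in> P" and s: "s \<in> P"
      have c: "r \<in> carrier R" "s \<in> carrier R" "\<chi> r \<in> carrier M" "\<chi> s \<in> carrier M" using r s f h(1) by auto
      have rs: "r \<oplus> s \<in> P" using r s f by auto
      have "cong_mod M N (\<chi> (r \<oplus> s) \<ominus>\<^bsub>M\<^esub> (r \<oplus> s) \<odot>\<^bsub>M\<^esub> m) ((\<chi> r \<oplus>\<^bsub>M\<^esub> \<chi> s) \<ominus>\<^bsub>M\<^esub> (r \<oplus> s) \<odot>\<^bsub>M\<^esub> m)"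
        unfolding a_minus_def using c m(1) by (intro cong_mod_add[OF N] h(2) r s cong_mod_refl[OF N]) auto
      moreover have "(\<chi> r \<oplus>\<^bsub>M\<^esub> \<chi> s) \<ominus>\<^bsub>M\<^esub> (r \<oplus> s) \<odot>\<^bsub>M\<^esub> m = (\<chi> r \<ominus>\<^bsub>M\<^esub> r \<odot>\<^bsub>M\<^esub> m) \<oplus>\<^bsub>M\<^esub> (\<chi> s \<ominus>\<^bsub>M\<^esub> s \<odot>\<^bsub>M\<^esub> m)"
        using c m(1) by (simp add: smult_l_distr a_minus_def M.minus_add M.a_ac)
      moreover have "cong_mod M N \<dots> (x \<odot>\<^bsub>M\<^esub> \<xi> r \<oplus>\<^bsub>M\<^esub> x \<odot>\<^bsub>M\<^esub> \<xi> s)" by (intro cong_mod_add[OF N] \<xi>(2) r s)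
      ultimately have "cong_mod M N (\<chi> (r \<oplus> s) \<ominus>\<^bsub>M\<^esub> (r \<oplus> s) \<odot>\<^bsub>M\<^esub> m) (x \<odot>\<^bsub>M\<^esub> \<xi> r \<oplus>\<^bsub>M\<^esub> x \<odot>\<^bsub>M\<^esub> \<xi> s)"
        using cong_mod_trans[OF N] by simp
      then have "cong_mod M N (x \<odot>\<^bsub>M\<^esub> \<xi> (r \<oplus> s)) (x \<odot>\<^bsub>M\<^esub> (\<xi> r \<oplus>\<^bsub>M\<^esub> \<xi> s))"
        using cong_mod_trans[OF N cong_mod_sym[OF N \<xi>(2)[OF rs]]] \<xi>(1) r s xc by (simp add: smult_r_distr)
      then show "cong_mod M N (\<xi> (r \<oplus> s)) (\<xi> r \<oplus>\<^bsub>M\<^esub> \<xi> s)" by (rule xreg) (use \<xi>(1) r s rs in auto)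
    next
      fix a r assume a: "a \<in> carrier R" and r: "r \<in> P"
      have c: "r \<in> carrier R" "\<chi> r \<in> carrier M" using r f h(1) by auto
      have ar: "a \<otimes> r \<in> P" using a r f by auto
      have "cong_mod M N (\<chi> (a \<otimes> r) \<ominus>\<^bsub>M\<^esub> (a \<otimes> r) \<odot>\<^bsub>M\<^esub> m) ((a \<odot>\<^bsub>M\<^esub> \<chi> r) \<ominus>\<^bsub>M\<^esub> (a \<otimes> r) \<odot>\<^bsub>M\<^esub> m)"
        unfolding a_minus_def using c a m(1) by (intro cong_mod_add[OF N] h(3) r a cong_mod_refl[OF N]) auto
      moreover have "(a \<odot>\<^bsub>M\<^esub> \<chi> r) \<ominus>\<^bsub>M\<^esub> (a \<otimes> r) \<odot>\<^bsub>M\<^esub> m = a \<odot>\<^bsub>M\<^esub> (\<chi> r \<ominus>\<^bsub>M\<^esub> r \<odot>\<^bsub>M\<^esub> m)"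
        using c a m(1) by (simp add: smult_assoc1 smult_r_distr smult_r_minus a_minus_def)
      moreover have "cong_mod M N \<dots> (a \<odot>\<^bsub>M\<^esub> (x \<odot>\<^bsub>M\<^esub> \<xi> r))" by (intro cong_mod_smult[OF N] \<xi>(2) r a)
      moreover have "a \<odot>\<^bsub>M\<^esub> (x \<odot>\<^bsub>M\<^esub> \<xi> r) = x \<odot>\<^bsub>M\<^esub> (a \<odot>\<^bsub>M\<^esub> \<xi> r)"
        using a xc \<xi>(1)[OF r] by (simp add: smult_assoc1[symmetric] R.m_comm)
      ultimately have "cong_mod M N (\<chi> (a \<otimes> r) \<ominus>\<^bsub>M\<^esub> (a \<otimes> r) \<odot>\<^bsub>M\<^esub> m) (x \<odot>\<^bsub>M\<^esub> (a \<odot>\<^bsub>M\<^esub> \<xi> r))"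
        using cong_mod_trans[OF N] by simp
      then have "cong_mod M N (x \<odot>\<^bsub>M\<^esub> \<xi> (a \<otimes> r)) (x \<odot>\<^bsub>M\<^esub> (a \<odot>\<^bsub>M\<^esub> \<xi> r))"
        using cong_mod_trans[OF N cong_mod_sym[OF N \<xi>(2)[OF ar]]] by blast
      then show "cong_mod M N (\<xi> (a \<otimes> r)) (a \<odot>\<^bsub>M\<^esub> \<xi> r)" by (rule xreg) (use \<xi>(1) a r ar in auto)
    qed
    let ?v = "\<lambda>i\<in>{..<?k}. \<xi> (ps ! i)"
    let ?b = "\<lambda>i\<in>{..<?k}. u i \<ominus>\<^bsub>M\<^esub> x \<odot>\<^bsub>M\<^esub> \<xi> (ps ! i)"
    have \<xi>c: "\<And>i. i < ?k \<Longrightarrow> \<xi> (ps ! i) \<in> carrier M" and uc: "\<And>i. i < ?k \<Longrightarrow> u i \<in> carrier M"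
      using \<xi>(1) psP(1) u(1) by auto
    have v: "?v \<in> ?T" using \<xi>hom \<xi>c by auto
    have "cong_mod M N (?b i) (ps ! i \<odot>\<^bsub>M\<^esub> m)" if i: "i < ?k" for i
    proof -
      have c: "ps ! i \<odot>\<^bsub>M\<^esub> m \<in> carrier M" "\<xi> (ps ! i) \<in> carrier M" "\<chi> (ps ! i) \<in> carrier M"
        using m(1) psP[OF i] \<xi>(1) h(1) by auto
      have "cong_mod M N (\<chi> (ps ! i)) (x \<odot>\<^bsub>M\<^esub> \<xi> (ps ! i) \<oplus>\<^bsub>M\<^esub> ps ! i \<odot>\<^bsub>M\<^esub> m)"
        using cong_mod_add[OF N \<xi>(2)[OF psP(1)[OF i]] cong_mod_refl[OF N c(1)]] c xc
        by (simp add: a_minus_def M.a_assoc M.l_neg)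
      from cong_mod_add[OF N this cong_mod_refl[OF N, of "\<ominus>\<^bsub>M\<^esub> (x \<odot>\<^bsub>M\<^esub> \<xi> (ps ! i))"]]
      show ?thesis using c xc i u(3)[OF i] by (simp add: a_minus_def M.a_ac M.r_neg)
    qed
    then have b: "?b \<in> ?B" using m(1) uc \<xi>c xc by auto
    have "x \<odot>\<^bsub>?Q\<^esub> ?v \<in> lcomb ?Q ?T [x]" by (rule Q.lcomb_mem[OF _ T]) (use xc v in auto)
    then have "?b \<oplus>\<^bsub>?Q\<^esub> (x \<odot>\<^bsub>?Q\<^esub> ?v) \<in> msum ?Q ?B (lcomb ?Q ?T [x])" by (rule msumI[OF b])
    moreover have "?b \<oplus>\<^bsub>?Q\<^esub> (x \<odot>\<^bsub>?Q\<^esub> ?v) = u"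
    proof
      fix i show "(?b \<oplus>\<^bsub>?Q\<^esub> (x \<odot>\<^bsub>?Q\<^esub> ?v)) i = u i"
      proof (cases "i < ?k")
        case True
        then show ?thesis using \<xi>c[OF True] uc[OF True] xc by (simp add: a_minus_def M.a_assoc M.l_neg)
      next
        case False
        then show ?thesis using u(1) by (auto simp: PiE_def extensional_def)
      qed
    qed
    ultimately show "u \<in> msum ?Q ?B (lcomb ?Q ?T [x])" by (simp only:)
  qed
  then have TB: "?T \<subseteq> ?B" using x by (intro Q.nakayama[OF B T, of "[x]"]) auto
  have tT: "t \<phi> \<in> ?T" using hom hom_mod_facts(1)[OF hom] psP by (auto simp: t_def)
  have "t \<phi> \<in> ?B" by (rule subsetD[OF TB tT])
  then obtain m where m: "m \<in> carrier M" "\<And>i. i < ?k \<Longrightarrow> cong_mod M N (\<phi> (ps ! i)) (ps ! i \<odot>\<^bsub>M\<^esub> m)"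
    by (auto simp: t_def)
  have "cong_mod M N (\<phi> a) (a \<odot>\<^bsub>M\<^esub> m)" if aA: "a \<in> A" for a
  proof -
    obtain i where "i < ?k" "ps ! i = a" using aA ps by (auto simp: in_set_conv_nth)
    then show ?thesis using m(2) by blast
  qed
  note gen = hom_mod_generators[OF N A(1) hom[unfolded A(3)] m(1) this]
  show ?thesis unfolding mult_mod_def
    by (intro bexI[OF _ m(1)] ballI gen) (simp_all add: A(3))
qed

text \<open>The case of Ext^1(R/I, M/N), with I replaced by a prime \<open>P\<close>. If x is in
  \<open>P\<close>, then \<chi> x is not in N + xM but \<open>P\<close> multiplies it into N + xM,
  and \<open>prime_chain_above_annihilator\<close> applies. If not, either some homomorphism modulo
  N + xM on an ideal containing \<open>P\<close> and x is not a multiplication, and \<open>P\<close>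
  precedes the chain from the induction hypothesis, or \<open>hom_mod_nakayama\<close> makes all
  homomorphisms on \<open>P\<close> multiplications.\<close>

lemma (in local_module) prime_chain_above_hom:
  assumes "regseq M N xs" "set xs \<subseteq> \<mm>" "subm R M N" "ideal I R" "hom_mod R M N I \<phi>" "\<not> mult_mod M N I \<phi>"
  shows "\<exists>C. prime_chain R C (length xs - 1) \<and> I \<subseteq> C 0"
  using assms
proof (induction xs arbitrary: N I \<phi>)
  case Nil
  obtain P \<chi> where P: "primeideal P R" "I \<subseteq> P" by (rule prime_not_mult_mod[OF Nil.prems(3-6)])
  then show ?case using prime_chain_0 by (intro exI[of _ "\<lambda>_. P"]) auto
next
  case (Cons x xs)
  note N = Cons.prems(3)
  have x: "x \<in> \<mm>" "x \<in> carrier R" using Cons.prems max_ideal_carr by auto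
  have reg: "\<And>m. m \<in> carrier M \<Longrightarrow> x \<odot>\<^bsub>M\<^esub> m \<in> N \<Longrightarrow> m \<in> N" using Cons.prems by auto
  let ?N' = "msum M N ((\<lambda>m. x \<odot>\<^bsub>M\<^esub> m) ` carrier M)"
  note N' = subm_msum_image[OF N x(2)]
  have xs: "regseq M ?N' xs" "set xs \<subseteq> \<mm>" using Cons.prems by auto
  obtain P \<chi> where P: "primeideal P R" "I \<subseteq> P" "hom_mod R M N P \<chi>" "\<not> mult_mod M N P \<chi>"
    by (rule prime_not_mult_mod[OF Cons.prems(3-6)])
  have Pid: "ideal P R" using P(1) by (simp add: primeideal_def)
  note f = ideal_facts[OF Pid]
  have "\<exists>C. prime_chain R C (length xs) \<and> P \<subseteq> C 0"
  \<comment> \<open>For empty \<open>xs\<close> the subtraction in the induction hypothesis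
    truncates, and prepending \<open>P\<close> would overcount. The chain that consists of
    \<open>P\<close> alone is then enough.\<close>
  proof (cases "xs = []")
    case True
    then show ?thesis using prime_chain_0[OF P(1)] by (intro exI[of _ "\<lambda>_. P"]) auto
  next
    case xs_ne: False
    show ?thesis
    proof (cases "x \<in> P")
      case True
      note h = hom_mod_facts[OF P(3)]
      have w: "\<chi> x \<in> carrier M" using h(1)[OF True] .
      \<comment> \<open>Both sides are congruent to \<chi> (r x).\<close>
      have eq: "cong_mod M N (r \<odot>\<^bsub>M\<^esub> \<chi> x) (x \<odot>\<^bsub>M\<^esub> \<chi> r)" if r: "r \<in> P" for r
      proof -
        have rc: "r \<in> carrier R" using r f by auto
        have "cong_mod M N (\<chi> (r \<otimes> x)) (r \<odot>\<^bsub>M\<^esub> \<chi> x)" "cong_mod M N (\<chi> (x \<otimes> r)) (x \<odot>\<^bsub>M\<^esub> \<chi> r)"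
          using h(3) r rc x True by auto
        then show ?thesis using R.m_comm[OF rc x(2)] cong_mod_trans[OF N cong_mod_sym[OF N]] by metis
      qed
      have "\<chi> x \<notin> ?N'"
      proof
        assume "\<chi> x \<in> ?N'"
        then obtain n m where *: "n \<in> N" "m \<in> carrier M" "\<chi> x = n \<oplus>\<^bsub>M\<^esub> x \<odot>\<^bsub>M\<^esub> m" by (auto simp: msum_def)
        have nc: "n \<in> carrier M" using * subm_carr[OF N] by auto
        have "cong_mod M N (\<chi> r) (r \<odot>\<^bsub>M\<^esub> m)" if r: "r \<in> P" for r
        proof -
          have rc: "r \<in> carrier R" and cr: "\<chi> r \<in> carrier M" using r f h(1) by auto
          have "r \<odot>\<^bsub>M\<^esub> \<chi> x = r \<odot>\<^bsub>M\<^esub> n \<oplus>\<^bsub>M\<^esub> x \<odot>\<^bsub>M\<^esub> (r \<odot>\<^bsub>M\<^esub> m)"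
            using * nc rc x by (simp add: smult_r_distr smult_assoc1[symmetric] R.m_comm)
          moreover have "cong_mod M N (r \<odot>\<^bsub>M\<^esub> n \<oplus>\<^bsub>M\<^esub> x \<odot>\<^bsub>M\<^esub> (r \<odot>\<^bsub>M\<^esub> m)) (\<zero>\<^bsub>M\<^esub> \<oplus>\<^bsub>M\<^esub> x \<odot>\<^bsub>M\<^esub> (r \<odot>\<^bsub>M\<^esub> m))"
            using nc rc x * subm_smult[OF N rc *(1)] cong_mod_0[of "r \<odot>\<^bsub>M\<^esub> n" N]
            by (intro cong_mod_add[OF N] cong_mod_refl[OF N]) auto
          ultimately have "cong_mod M N (r \<odot>\<^bsub>M\<^esub> \<chi> x) (x \<odot>\<^bsub>M\<^esub> (r \<odot>\<^bsub>M\<^esub> m))" using rc x * by simp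
          then have "cong_mod M N (x \<odot>\<^bsub>M\<^esub> \<chi> r) (x \<odot>\<^bsub>M\<^esub> (r \<odot>\<^bsub>M\<^esub> m))"
            using cong_mod_trans[OF N cong_mod_sym[OF N eq[OF r]]] by blast
          then have "x \<odot>\<^bsub>M\<^esub> (\<chi> r \<ominus>\<^bsub>M\<^esub> r \<odot>\<^bsub>M\<^esub> m) \<in> N"
            using x rc cr * by (simp add: cong_mod_def a_minus_def smult_r_distr smult_r_minus)
          then show ?thesis using reg cr rc * by (simp add: cong_mod_def)
        qed
        then show False using P(4) * by (auto simp: mult_mod_def)
      qed
      moreover have "r \<odot>\<^bsub>M\<^esub> \<chi> x \<in> ?N'" if r: "r \<in> P" for r
        using cong_mod_mem[OF N'(1) cong_mod_mono[OF eq[OF r] N'(2)]] N'(3) h(1)[OF r] by blast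
      ultimately show ?thesis
        by (intro prime_chain_above_annihilator[OF xs N'(1) w _ f(1)])
    next
      case False
      show ?thesis
      proof (rule ccontr)
        assume nochain: "\<nexists>C. prime_chain R C (length xs) \<and> P \<subseteq> C 0"
        have "mult_mod M ?N' P \<xi>" if \<xi>: "hom_mod R M N P \<xi>" for \<xi>
        proof -
          note h = hom_mod_facts[OF \<xi>]
          have \<xi>': "hom_mod R M ?N' P \<xi>"
            using \<xi> cong_mod_mono[OF _ N'(2)] unfolding hom_mod_def by blast
          obtain J' \<psi>' where J': "ideal J' R" "P \<subseteq> J'" "x \<in> J'" "hom_mod R M ?N' J' \<psi>'"
            "\<And>r. r \<in> P \<Longrightarrow> cong_mod M ?N' (\<psi>' r) (\<xi> r)"
          \<comment> \<open>The value 0 at \<open>x\<close> is compatible: if r x is in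
            \<open>P\<close> then so is r, and \<xi> (r x) is congruent to x \<xi> r, which vanishes
            modulo N + xM.\<close>
          proof (rule hom_mod_extend[OF N'(1) Pid \<xi>' x(2) M.zero_closed])
            fix r assume r: "r \<in> carrier R" "r \<otimes> x \<in> P"
            then have rP: "r \<in> P" using primeideal.I_prime[OF P(1) r(1) x(2) r(2)] False by auto
            have "cong_mod M N (\<xi> (x \<otimes> r)) (x \<odot>\<^bsub>M\<^esub> \<xi> r)" using h(3) x rP by auto
            then have 1: "cong_mod M ?N' (\<xi> (r \<otimes> x)) (x \<odot>\<^bsub>M\<^esub> \<xi> r)" using cong_mod_mono N'(2) R.m_comm r(1) x(2) by metis
            have "x \<odot>\<^bsub>M\<^esub> \<xi> r \<in> ?N'" using N'(3) h(1)[OF rP] by auto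
            then show "cong_mod M ?N' (\<xi> (r \<otimes> x)) (r \<odot>\<^bsub>M\<^esub> \<zero>\<^bsub>M\<^esub>)"
              using cong_mod_mem[OF N'(1) 1] cong_mod_0 cong_mod_carr(1)[OF 1] r(1) by simp
          qed blast
          have "mult_mod M ?N' J' \<psi>'"
          proof (rule ccontr)
            assume "\<not> mult_mod M ?N' J' \<psi>'"
            from Cons.IH[OF xs N'(1) J'(1) J'(4) this] obtain C where C: "prime_chain R C (length xs - 1)" "J' \<subseteq> C 0" by auto
            have "prime_chain R (case_nat P C) (Suc (length xs - 1))"
              using C J' False by (intro prime_chain_Cons P(1)) auto
            then show False using nochain xs_ne by auto
          qed
          then obtain m where m: "m \<in> carrier M" "\<And>r. r \<in> J' \<Longrightarrow> cong_mod M ?N' (\<psi>' r) (r \<odot>\<^bsub>M\<^esub> m)"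
            by (auto simp: mult_mod_def)
          have "cong_mod M ?N' (\<xi> r) (r \<odot>\<^bsub>M\<^esub> m)" if "r \<in> P" for r
            using cong_mod_trans[OF N'(1) cong_mod_sym[OF N'(1) J'(5)[OF that]] m(2)] that J'(2) by blast
          then show ?thesis using m(1) by (auto simp: mult_mod_def)
        qed
        from hom_mod_nakayama[OF N Pid x(1) reg this P(3)] show False using P(4) by simp
      qed
    qed
  qed
  then show ?case using P(2) by auto
qed

section \<open>Koszul cochains\<close>

text \<open>
  Cochains are families indexed by lists of Booleans of the length of \<open>ys\<close>, that is, by subsets of
  the set of generators; values at lists of another length are junk.  \<open>kd\<close> is the Koszul differential
  of \<open>ys\<close>, \<open>kh\<close> the contraction with \<open>rs\<close>, and \<open>nt\<close> the degree.
\<close>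

fun kd :: "('a, 'm, 'c) module_scheme \<Rightarrow> 'a list \<Rightarrow> (bool list \<Rightarrow> 'm) \<Rightarrow> bool list \<Rightarrow> 'm" where
  "kd M [] c bs = \<zero>\<^bsub>M\<^esub>"
| "kd M (y # ys) c [] = \<zero>\<^bsub>M\<^esub>"
| "kd M (y # ys) c (False # t) = kd M ys (\<lambda>s. c (False # s)) t"
| "kd M (y # ys) c (True # t) = y \<odot>\<^bsub>M\<^esub> c (False # t) \<oplus>\<^bsub>M\<^esub> \<ominus>\<^bsub>M\<^esub> kd M ys (\<lambda>s. c (True # s)) t"

fun kh :: "('a, 'm, 'c) module_scheme \<Rightarrow> 'a list \<Rightarrow> (bool list \<Rightarrow> 'm) \<Rightarrow> bool list \<Rightarrow> 'm" where
  "kh M [] c bs = \<zero>\<^bsub>M\<^esub>"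
| "kh M (r # rs) c [] = \<zero>\<^bsub>M\<^esub>"
| "kh M (r # rs) c (False # t) = kh M rs (\<lambda>s. c (False # s)) t \<oplus>\<^bsub>M\<^esub> r \<odot>\<^bsub>M\<^esub> c (True # t)"
| "kh M (r # rs) c (True # t) = \<ominus>\<^bsub>M\<^esub> kh M rs (\<lambda>s. c (True # s)) t"

fun dot :: "('a, 'b) ring_scheme \<Rightarrow> 'a list \<Rightarrow> 'a list \<Rightarrow> 'a" where
  "dot R (y # ys) (r # rs) = r \<otimes>\<^bsub>R\<^esub> y \<oplus>\<^bsub>R\<^esub> dot R ys rs"
| "dot R ys rs = \<zero>\<^bsub>R\<^esub>"

primrec nt :: "bool list \<Rightarrow> nat" where
  "nt [] = 0"
| "nt (b # bs) = (if b then Suc (nt bs) else nt bs)"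

lemma nt_le: "nt bs \<le> length bs"
  by (induction bs) auto

lemma nt_replicate [simp]: "nt (replicate n True) = n"
  by (induction n) auto

lemma nt_full: "length s = n \<Longrightarrow> nt s = n \<Longrightarrow> s = replicate n True"
proof (induction s arbitrary: n)
  case (Cons b s)
  with nt_le[of s] show ?case by (cases b; cases n) auto
qed simp

context module
begin

lemma kd_closed: "set ys \<subseteq> carrier R \<Longrightarrow> (\<And>s. c s \<in> carrier M) \<Longrightarrow> kd M ys c bs \<in> carrier M"
proof (induction ys arbitrary: c bs)
  case (Cons y ys)
  show ?case
  proof (cases bs)
    case Nil then show ?thesis by simp
  next
    case (Cons b t)
    then show ?thesis using Cons.IH Cons.prems by (cases b) auto
  qed
qed simp

lemma kh_closed: "set ys \<subseteq> carrier R \<Longrightarrow> (\<And>s. c s \<in> carrier M) \<Longrightarrow> kh M ys c bs \<in> carrier M"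
proof (induction ys arbitrary: c bs)
  case (Cons y ys)
  show ?case
  proof (cases bs)
    case Nil then show ?thesis by simp
  next
    case (Cons b t)
    then show ?thesis using Cons.IH Cons.prems by (cases b) auto
  qed
qed simp

lemma kd_lin:
  assumes "set ys \<subseteq> carrier R" "r \<in> carrier R" "\<And>s. c s \<in> carrier M" "\<And>s. c' s \<in> carrier M"
  shows "kd M ys (\<lambda>s. r \<odot>\<^bsub>M\<^esub> c s \<oplus>\<^bsub>M\<^esub> c' s) bs = r \<odot>\<^bsub>M\<^esub> kd M ys c bs \<oplus>\<^bsub>M\<^esub> kd M ys c' bs"
  using assms
proof (induction ys arbitrary: c c' bs)
  case (Cons y ys)
  have y: "y \<in> carrier R" "set ys \<subseteq> carrier R" using Cons.prems by auto
  show ?case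
  proof (cases bs)
    case Nil then show ?thesis using Cons.prems by simp
  next
    case (Cons b t)
    note IH = Cons.IH[OF y(2) Cons.prems(2), of "\<lambda>s. c (b # s)" "\<lambda>s. c' (b # s)", OF Cons.prems(3,4)]
    have k: "kd M ys (\<lambda>s. c (b # s)) t \<in> carrier M" "kd M ys (\<lambda>s. c' (b # s)) t \<in> carrier M"
      using kd_closed[OF y(2)] Cons.prems by auto
    have e: "y \<odot>\<^bsub>M\<^esub> (r \<odot>\<^bsub>M\<^esub> c (False # t)) = r \<odot>\<^bsub>M\<^esub> (y \<odot>\<^bsub>M\<^esub> c (False # t))"
      using y Cons.prems by (simp add: smult_assoc1[symmetric] R.m_comm)
    show ?thesis
      using Cons IH k y Cons.prems(2-4)
      by (cases b) (simp_all add: smult_r_distr M.minus_add smult_r_minus M.a_ac e)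
  qed
qed simp

lemma kh_lin:
  assumes "set ys \<subseteq> carrier R" "r \<in> carrier R" "\<And>s. c s \<in> carrier M" "\<And>s. c' s \<in> carrier M"
  shows "kh M ys (\<lambda>s. r \<odot>\<^bsub>M\<^esub> c s \<oplus>\<^bsub>M\<^esub> c' s) bs = r \<odot>\<^bsub>M\<^esub> kh M ys c bs \<oplus>\<^bsub>M\<^esub> kh M ys c' bs"
  using assms
proof (induction ys arbitrary: c c' bs)
  case (Cons y ys)
  have y: "y \<in> carrier R" "set ys \<subseteq> carrier R" using Cons.prems by auto
  show ?case
  proof (cases bs)
    case Nil then show ?thesis using Cons.prems by simp
  next
    case (Cons b t)
    note IH = Cons.IH[OF y(2) Cons.prems(2), of "\<lambda>s. c (b # s)" "\<lambda>s. c' (b # s)", OF Cons.prems(3,4)]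
    have k: "kh M ys (\<lambda>s. c (b # s)) t \<in> carrier M" "kh M ys (\<lambda>s. c' (b # s)) t \<in> carrier M"
      using kh_closed[OF y(2)] Cons.prems by auto
    have e: "y \<odot>\<^bsub>M\<^esub> (r \<odot>\<^bsub>M\<^esub> c (True # t)) = r \<odot>\<^bsub>M\<^esub> (y \<odot>\<^bsub>M\<^esub> c (True # t))"
      using y Cons.prems by (simp add: smult_assoc1[symmetric] R.m_comm)
    show ?thesis
      using Cons IH k y Cons.prems(2-4)
      by (cases b) (simp_all add: smult_r_distr M.minus_add smult_r_minus M.a_ac e)
  qed
qed simp

lemma kd_zero: "set ys \<subseteq> carrier R \<Longrightarrow> kd M ys (\<lambda>_. \<zero>\<^bsub>M\<^esub>) bs = \<zero>\<^bsub>M\<^esub>"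
proof (induction ys arbitrary: bs)
  case (Cons y ys)
  have "\<ominus>\<^bsub>M\<^esub> \<zero>\<^bsub>M\<^esub> = \<zero>\<^bsub>M\<^esub>" by (rule M.minus_equality) auto
  with Cons show ?case
  proof (cases bs)
    case (Cons b t) then show ?thesis using Cons.prems Cons.IH \<open>\<ominus>\<^bsub>M\<^esub> \<zero>\<^bsub>M\<^esub> = \<zero>\<^bsub>M\<^esub>\<close> by (cases b) auto
  qed simp
qed simp

lemma kh_zero: "set ys \<subseteq> carrier R \<Longrightarrow> kh M ys (\<lambda>_. \<zero>\<^bsub>M\<^esub>) bs = \<zero>\<^bsub>M\<^esub>"
proof (induction ys arbitrary: bs)
  case (Cons y ys)
  have "\<ominus>\<^bsub>M\<^esub> \<zero>\<^bsub>M\<^esub> = \<zero>\<^bsub>M\<^esub>" by (rule M.minus_equality) auto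
  with Cons show ?case
  proof (cases bs)
    case (Cons b t) then show ?thesis using Cons.prems Cons.IH \<open>\<ominus>\<^bsub>M\<^esub> \<zero>\<^bsub>M\<^esub> = \<zero>\<^bsub>M\<^esub>\<close> by (cases b) auto
  qed simp
qed simp

lemma kd_smult:
  assumes "set ys \<subseteq> carrier R" "r \<in> carrier R" "\<And>s. c s \<in> carrier M"
  shows "kd M ys (\<lambda>s. r \<odot>\<^bsub>M\<^esub> c s) bs = r \<odot>\<^bsub>M\<^esub> kd M ys c bs"
  using kd_lin[where c' = "\<lambda>_. \<zero>\<^bsub>M\<^esub>" and bs = bs and c = c, OF assms] assms kd_closed[OF assms(1,3)] by (simp add: kd_zero)

lemma kd_add:
  assumes "set ys \<subseteq> carrier R" "\<And>s. c s \<in> carrier M" "\<And>s. c' s \<in> carrier M"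
  shows "kd M ys (\<lambda>s. c s \<oplus>\<^bsub>M\<^esub> c' s) bs = kd M ys c bs \<oplus>\<^bsub>M\<^esub> kd M ys c' bs"
  using kd_lin[where r = \<one> and c = c and c' = c' and bs = bs, OF assms(1) R.one_closed assms(2,3)] assms kd_closed[OF assms(1,2)] by simp

lemma kd_neg:
  assumes "set ys \<subseteq> carrier R" "\<And>s. c s \<in> carrier M"
  shows "kd M ys (\<lambda>s. \<ominus>\<^bsub>M\<^esub> c s) bs = \<ominus>\<^bsub>M\<^esub> kd M ys c bs"
  using kd_smult[where r = "\<ominus> \<one>" and bs = bs and c = c, OF assms(1) _ assms(2)] assms kd_closed[OF assms] by (simp add: smult_l_minus)

lemma kh_smult:
  assumes "set ys \<subseteq> carrier R" "r \<in> carrier R" "\<And>s. c s \<in> carrier M"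
  shows "kh M ys (\<lambda>s. r \<odot>\<^bsub>M\<^esub> c s) bs = r \<odot>\<^bsub>M\<^esub> kh M ys c bs"
  using kh_lin[where c' = "\<lambda>_. \<zero>\<^bsub>M\<^esub>" and bs = bs and c = c, OF assms] assms kh_closed[OF assms(1,3)] by (simp add: kh_zero)

lemma kh_neg:
  assumes "set ys \<subseteq> carrier R" "\<And>s. c s \<in> carrier M"
  shows "kh M ys (\<lambda>s. \<ominus>\<^bsub>M\<^esub> c s) bs = \<ominus>\<^bsub>M\<^esub> kh M ys c bs"
  using kh_smult[where r = "\<ominus> \<one>" and bs = bs and c = c, OF assms(1) _ assms(2)] assms kh_closed[OF assms] by (simp add: smult_l_minus)

text \<open>The differential raises the degree by one, so a component of degree \<open>nt bs\<close>
  involves only components of degree one less. In degree 0 there are none, which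
  \<open>koszul_acyclic\<close> uses to compare with the zero cochain.\<close>

lemma kd_cong:
  assumes "\<And>s. length s = length ys \<Longrightarrow> Suc (nt s) = nt bs \<Longrightarrow> c s = c' s" "length bs = length ys"
  shows "kd M ys c bs = kd M ys c' bs"
  using assms
proof (induction ys arbitrary: bs c c')
  case (Cons y ys)
  then obtain b t where bs: "bs = b # t" "length t = length ys" by (cases bs) auto
  have "kd M ys (\<lambda>s. c (b # s)) t = kd M ys (\<lambda>s. c' (b # s)) t"
    by (rule Cons.IH[OF _ bs(2)]) (use Cons.prems(1) bs in \<open>cases b; auto\<close>)
  moreover have "b \<Longrightarrow> c (False # t) = c' (False # t)" using Cons.prems(1) bs by auto
  ultimately show ?case using bs by (cases b) auto
qed simp

lemma kd_mem:
  assumes "subm R M N" "set ys \<subseteq> carrier R"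
    "\<And>s. length s = length ys \<Longrightarrow> Suc (nt s) = nt bs \<Longrightarrow> c s \<in> N" "length bs = length ys"
  shows "kd M ys c bs \<in> N"
  using assms
proof (induction ys arbitrary: bs c)
  case Nil then show ?case using subm_zero by auto
next
  case (Cons y ys)
  then obtain b t where bs: "bs = b # t" "length t = length ys" by (cases bs) auto
  have "kd M ys (\<lambda>s. c (b # s)) t \<in> N"
    by (rule Cons.IH[OF Cons.prems(1) _ _ bs(2)]) (use Cons.prems bs in \<open>cases b; auto\<close>)+
  moreover have "b \<Longrightarrow> c (False # t) \<in> N" using Cons.prems(3) bs by auto
  ultimately show ?case using bs Cons.prems subm_a_inv[OF Cons.prems(1)]
    by (cases b) (auto intro!: subm_add[OF Cons.prems(1)] subm_smult[OF Cons.prems(1)])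
qed

lemma kh_mem:
  assumes "subm R M N" "set rs \<subseteq> carrier R"
    "\<And>s. length s = length rs \<Longrightarrow> nt s = Suc (nt bs) \<Longrightarrow> c s \<in> N" "length bs = length rs"
  shows "kh M rs c bs \<in> N"
  using assms
proof (induction rs arbitrary: bs c)
  case Nil then show ?case using subm_zero by auto
next
  case (Cons y ys)
  then obtain b t where bs: "bs = b # t" "length t = length ys" by (cases bs) auto
  have "kh M ys (\<lambda>s. c (b # s)) t \<in> N"
    by (rule Cons.IH[OF Cons.prems(1) _ _ bs(2)]) (use Cons.prems bs in \<open>cases b; auto\<close>)+
  moreover have "\<not> b \<Longrightarrow> c (True # t) \<in> N" using Cons.prems(3) bs by auto
  ultimately show ?case using bs Cons.prems subm_a_inv[OF Cons.prems(1)]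
    by (cases b) (auto intro!: subm_add[OF Cons.prems(1)] subm_smult[OF Cons.prems(1)])
qed

lemma kd_kd:
  assumes "set ys \<subseteq> carrier R" "\<And>s. c s \<in> carrier M"
  shows "kd M ys (kd M ys c) bs = \<zero>\<^bsub>M\<^esub>"
  using assms
proof (induction ys arbitrary: c bs)
  case (Cons y ys)
  have y: "y \<in> carrier R" "set ys \<subseteq> carrier R" using Cons.prems by auto
  note k = kd_closed[OF y(2)]
  show ?case
  proof (cases bs)
    case Nil then show ?thesis by simp
  next
    case (Cons b t)
    note IH = Cons.IH[OF y(2), of "\<lambda>s. c (b # s)" t, OF Cons.prems(2)]
    show ?thesis
    proof (cases b)
      case False
      then show ?thesis using IH Cons by simp
    next
      case True
      let ?c0 = "\<lambda>s. c (False # s)" and ?c1 = "\<lambda>s. c (True # s)"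
      have c: "kd M ys ?c0 s \<in> carrier M" "kd M ys ?c1 s \<in> carrier M" for s using k Cons.prems by auto
      have "kd M ys (\<lambda>s. y \<odot>\<^bsub>M\<^esub> ?c0 s \<oplus>\<^bsub>M\<^esub> \<ominus>\<^bsub>M\<^esub> kd M ys ?c1 s) t
          = y \<odot>\<^bsub>M\<^esub> kd M ys ?c0 t \<oplus>\<^bsub>M\<^esub> kd M ys (\<lambda>s. \<ominus>\<^bsub>M\<^esub> kd M ys ?c1 s) t"
        using Cons.prems c by (intro kd_lin y) auto
      also have "kd M ys (\<lambda>s. \<ominus>\<^bsub>M\<^esub> kd M ys ?c1 s) t = \<ominus>\<^bsub>M\<^esub> kd M ys (\<lambda>s. kd M ys ?c1 s) t"
        by (rule kd_neg[OF y(2) c(2)])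
      also have "kd M ys (\<lambda>s. kd M ys ?c1 s) t = \<zero>\<^bsub>M\<^esub>" using IH True by simp
      also have "\<ominus>\<^bsub>M\<^esub> \<zero>\<^bsub>M\<^esub> = \<zero>\<^bsub>M\<^esub>" by (rule M.minus_equality) auto
      finally show ?thesis using Cons True c y by (simp add: M.r_neg)
    qed
  qed
qed simp

lemma dot_closed: "set ys \<subseteq> carrier R \<Longrightarrow> set rs \<subseteq> carrier R \<Longrightarrow> dot R ys rs \<in> carrier R"
proof (induction ys arbitrary: rs)
  case (Cons y ys) then show ?case by (cases rs) auto
qed simp

lemma add_minus_cancel: "a \<in> carrier M \<Longrightarrow> b \<in> carrier M \<Longrightarrow> a \<oplus>\<^bsub>M\<^esub> (b \<oplus>\<^bsub>M\<^esub> \<ominus>\<^bsub>M\<^esub> a) = b"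
  using M.a_comm[of b "\<ominus>\<^bsub>M\<^esub> a"] by (simp add: M.r_neg2)

lemma add_swap_cancel:
  assumes "a \<in> carrier M" "x \<in> carrier M" "b \<in> carrier M" "w \<in> carrier M"
  shows "(a \<oplus>\<^bsub>M\<^esub> x) \<oplus>\<^bsub>M\<^esub> (b \<oplus>\<^bsub>M\<^esub> (w \<oplus>\<^bsub>M\<^esub> \<ominus>\<^bsub>M\<^esub> x)) = (a \<oplus>\<^bsub>M\<^esub> b) \<oplus>\<^bsub>M\<^esub> w"
proof -
  have "x \<oplus>\<^bsub>M\<^esub> (b \<oplus>\<^bsub>M\<^esub> (w \<oplus>\<^bsub>M\<^esub> \<ominus>\<^bsub>M\<^esub> x)) = b \<oplus>\<^bsub>M\<^esub> w"
    using M.a_lcomm[of x b "w \<oplus>\<^bsub>M\<^esub> \<ominus>\<^bsub>M\<^esub> x"] assms by (simp add: add_minus_cancel)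
  then show ?thesis using assms by (simp add: M.a_assoc)
qed

lemma add_swap_cancel':
  assumes c: "p \<in> carrier M" "c \<in> carrier M" "k \<in> carrier M" "q \<in> carrier M"
  shows "((p \<oplus>\<^bsub>M\<^esub> c) \<oplus>\<^bsub>M\<^esub> k) \<oplus>\<^bsub>M\<^esub> \<ominus>\<^bsub>M\<^esub> (p \<oplus>\<^bsub>M\<^esub> \<ominus>\<^bsub>M\<^esub> q) = c \<oplus>\<^bsub>M\<^esub> (k \<oplus>\<^bsub>M\<^esub> q)"
proof -
  have "\<ominus>\<^bsub>M\<^esub> (p \<oplus>\<^bsub>M\<^esub> \<ominus>\<^bsub>M\<^esub> q) = q \<oplus>\<^bsub>M\<^esub> \<ominus>\<^bsub>M\<^esub> p"
    using c M.minus_add[of p "\<ominus>\<^bsub>M\<^esub> q"] M.a_comm[of "\<ominus>\<^bsub>M\<^esub> p" q] by simp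
  then show ?thesis using c add_swap_cancel[of c p k q] M.a_comm[of p c] by (simp add: M.a_assoc)
qed

text \<open>Contraction with \<open>rs\<close> is a null homotopy of multiplication by
  \<open>dot R ys rs\<close>; hence the ideal generated by \<open>ys\<close> annihilates Koszul
  cohomology. In each case of the induction the mixed terms of the two composites cancel.\<close>

lemma koszul_homotopy:
  assumes "set ys \<subseteq> carrier R" "set rs \<subseteq> carrier R" "length rs = length ys" "\<And>s. c s \<in> carrier M" "length bs = length ys"
  shows "kd M ys (kh M rs c) bs \<oplus>\<^bsub>M\<^esub> kh M rs (kd M ys c) bs = dot R ys rs \<odot>\<^bsub>M\<^esub> c bs"
  using assms
proof (induction ys arbitrary: c bs rs)
  case Nil then show ?case by simp
next
  case (Cons y ys)
  then obtain r qs where rs: "rs = r # qs" "length qs = length ys" by (cases rs) auto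
  from Cons obtain b t where bs: "bs = b # t" "length t = length ys" by (cases bs) auto
  have y: "y \<in> carrier R" "set ys \<subseteq> carrier R" "r \<in> carrier R" "set qs \<subseteq> carrier R" using Cons.prems rs by auto
  let ?c0 = "\<lambda>s. c (False # s)" and ?c1 = "\<lambda>s. c (True # s)"
  note cc = Cons.prems(4)
  have c: "kd M ys ?c0 s \<in> carrier M" "kd M ys ?c1 s \<in> carrier M" "kh M qs ?c0 s \<in> carrier M" "kh M qs ?c1 s \<in> carrier M" for s
    using kd_closed kh_closed y cc by auto
  have d: "dot R ys qs \<in> carrier R" using dot_closed y by auto
  have kk: "kd M ys (kh M qs ?c0) t \<in> carrier M" "kh M qs (kd M ys ?c0) t \<in> carrier M"
     "kd M ys (kh M qs ?c1) t \<in> carrier M" "kh M qs (kd M ys ?c1) t \<in> carrier M"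
    using kd_closed[OF y(2)] kh_closed[OF y(4)] c by auto
  show ?case
  proof (cases b)
    case False
    have IH: "kd M ys (kh M qs ?c0) t \<oplus>\<^bsub>M\<^esub> kh M qs (kd M ys ?c0) t = dot R ys qs \<odot>\<^bsub>M\<^esub> c (False # t)"
      by (rule Cons.IH) (use y rs bs cc in auto)
    have 1: "kd M ys (\<lambda>s. kh M qs ?c0 s \<oplus>\<^bsub>M\<^esub> r \<odot>\<^bsub>M\<^esub> c (True # s)) t
        = kd M ys (kh M qs ?c0) t \<oplus>\<^bsub>M\<^esub> r \<odot>\<^bsub>M\<^esub> kd M ys ?c1 t"
      using kd_add[OF y(2), of "kh M qs ?c0" "\<lambda>s. r \<odot>\<^bsub>M\<^esub> c (True # s)" t] c cc y kd_smult[OF y(2,3), of ?c1 t] by simp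
    have "kd M (y # ys) (kh M rs c) bs \<oplus>\<^bsub>M\<^esub> kh M rs (kd M (y # ys) c) bs
      = (kd M ys (kh M qs ?c0) t \<oplus>\<^bsub>M\<^esub> r \<odot>\<^bsub>M\<^esub> kd M ys ?c1 t) \<oplus>\<^bsub>M\<^esub>
        (kh M qs (kd M ys ?c0) t \<oplus>\<^bsub>M\<^esub> r \<odot>\<^bsub>M\<^esub> (y \<odot>\<^bsub>M\<^esub> c (False # t) \<oplus>\<^bsub>M\<^esub> \<ominus>\<^bsub>M\<^esub> kd M ys ?c1 t))"
      using False bs rs 1 by simp
    also have "\<dots> = (kd M ys (kh M qs ?c0) t \<oplus>\<^bsub>M\<^esub> kh M qs (kd M ys ?c0) t) \<oplus>\<^bsub>M\<^esub> (r \<otimes> y) \<odot>\<^bsub>M\<^esub> c (False # t)"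
      using y c cc kk by (simp add: smult_r_distr smult_r_minus smult_assoc1 add_swap_cancel)
    also have "\<dots> = dot R (y # ys) rs \<odot>\<^bsub>M\<^esub> c bs"
      unfolding IH using False bs rs y d cc by (simp add: smult_l_distr M.a_comm)
    finally show ?thesis .
  next
    case True
    have IH: "kd M ys (kh M qs ?c1) t \<oplus>\<^bsub>M\<^esub> kh M qs (kd M ys ?c1) t = dot R ys qs \<odot>\<^bsub>M\<^esub> c (True # t)"
      by (rule Cons.IH) (use y rs bs cc in auto)
    have 1: "kh M qs (\<lambda>s. y \<odot>\<^bsub>M\<^esub> ?c0 s \<oplus>\<^bsub>M\<^esub> \<ominus>\<^bsub>M\<^esub> kd M ys ?c1 s) t
        = y \<odot>\<^bsub>M\<^esub> kh M qs ?c0 t \<oplus>\<^bsub>M\<^esub> \<ominus>\<^bsub>M\<^esub> kh M qs (kd M ys ?c1) t"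
      using kh_lin[OF y(4,1), of ?c0 "\<lambda>s. \<ominus>\<^bsub>M\<^esub> kd M ys ?c1 s" t] c cc y kh_neg[OF y(4), of "kd M ys ?c1" t] by simp
    have 2: "kd M ys (\<lambda>s. \<ominus>\<^bsub>M\<^esub> kh M qs ?c1 s) t = \<ominus>\<^bsub>M\<^esub> kd M ys (kh M qs ?c1) t"
      using kd_neg[OF y(2), of "kh M qs ?c1" t] c by simp
    have "kd M (y # ys) (kh M rs c) bs \<oplus>\<^bsub>M\<^esub> kh M rs (kd M (y # ys) c) bs
      = (y \<odot>\<^bsub>M\<^esub> (kh M qs ?c0 t \<oplus>\<^bsub>M\<^esub> r \<odot>\<^bsub>M\<^esub> c (True # t)) \<oplus>\<^bsub>M\<^esub> \<ominus>\<^bsub>M\<^esub> (\<ominus>\<^bsub>M\<^esub> kd M ys (kh M qs ?c1) t)) \<oplus>\<^bsub>M\<^esub>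
        \<ominus>\<^bsub>M\<^esub> (y \<odot>\<^bsub>M\<^esub> kh M qs ?c0 t \<oplus>\<^bsub>M\<^esub> \<ominus>\<^bsub>M\<^esub> kh M qs (kd M ys ?c1) t)"
      using True bs rs 1 2 by simp
    also have "\<dots> = (r \<otimes> y) \<odot>\<^bsub>M\<^esub> c (True # t) \<oplus>\<^bsub>M\<^esub> (kd M ys (kh M qs ?c1) t \<oplus>\<^bsub>M\<^esub> kh M qs (kd M ys ?c1) t)"
      using y c cc kk by (simp only: smult_r_distr smult_assoc1[symmetric] R.m_comm[of r y] M.minus_minus
        smult_closed add_swap_cancel' kh_closed R.m_closed)
    also have "\<dots> = dot R (y # ys) rs \<odot>\<^bsub>M\<^esub> c bs"
      unfolding IH using True bs rs y d cc by (simp add: smult_l_distr)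
    finally show ?thesis .
  qed
qed

lemma lspan_ring_dot:
  "set ys \<subseteq> carrier R \<Longrightarrow> x \<in> lspan R (ring_as_module R) ys \<Longrightarrow>
    \<exists>rs. length rs = length ys \<and> set rs \<subseteq> carrier R \<and> x = dot R ys rs"
proof (induction ys arbitrary: x)
  case (Cons y ys)
  then obtain r s where r: "r \<in> carrier R" "s \<in> lspan R (ring_as_module R) ys" "x = r \<otimes> y \<oplus> s" by auto
  with Cons obtain rs where "length rs = length ys" "set rs \<subseteq> carrier R" "s = dot R ys rs" by auto
  then show ?case using r by (intro exI[of _ "r # rs"]) auto
qed simp

text \<open>By the homotopy, x c is modulo N the differential of the contraction of c. That
  contraction is therefore a cocycle modulo N + xM in degree i - 1, and by induction it is a
  coboundary up to x v and an element of N. Taking differentials gives x c = x (d v) modulo N, and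
  the regular element x can be cancelled.\<close>

lemma koszul_acyclic:
  assumes "regseq M N xs" "set xs \<subseteq> lspan R (ring_as_module R) ys" "subm R M N" "set ys \<subseteq> carrier R"
    "i < length xs" "\<And>s. c s \<in> carrier M"
    "\<And>bs. length bs = length ys \<Longrightarrow> nt bs = Suc i \<Longrightarrow> kd M ys c bs \<in> N"
  shows "\<exists>b. (\<forall>s. b s \<in> carrier M) \<and> (\<forall>bs. length bs = length ys \<longrightarrow> nt bs = i \<longrightarrow> c bs \<ominus>\<^bsub>M\<^esub> kd M ys b bs \<in> N)"
  using assms
proof (induction xs arbitrary: N i c)
  case Nil then show ?case by simp
next
  case (Cons x xs)
  note N = Cons.prems(3) and ys = Cons.prems(4) and c = Cons.prems(6)
  note Nc = subm_carr[OF N]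
  obtain rs where rs: "length rs = length ys" "set rs \<subseteq> carrier R" "x = dot R ys rs"
    using lspan_ring_dot[OF ys, of x] Cons.prems(2) by auto
  have x: "x \<in> carrier R" using rs dot_closed[OF ys] by auto
  have reg: "\<And>m. m \<in> carrier M \<Longrightarrow> x \<odot>\<^bsub>M\<^esub> m \<in> N \<Longrightarrow> m \<in> N" using Cons.prems by auto
  let ?N' = "msum M N ((\<lambda>m. x \<odot>\<^bsub>M\<^esub> m) ` carrier M)"
  note N' = subm_msum_image[OF N x]
  let ?h = "kh M rs c"
  have h: "?h s \<in> carrier M" for s by (rule kh_closed[OF rs(2) c])
  have kc: "kd M ys c s \<in> carrier M" for s by (rule kd_closed[OF ys c])
  have khc: "kh M rs (kd M ys c) s \<in> carrier M" for s by (rule kh_closed[OF rs(2) kc])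
  have kdc: "kd M ys ?h s \<in> carrier M" for s by (rule kd_closed[OF ys h])
  have hom: "x \<odot>\<^bsub>M\<^esub> c bs \<ominus>\<^bsub>M\<^esub> kd M ys ?h bs \<in> N" if bs: "length bs = length ys" "nt bs = i" for bs
  proof -
    have "x \<odot>\<^bsub>M\<^esub> c bs = kd M ys ?h bs \<oplus>\<^bsub>M\<^esub> kh M rs (kd M ys c) bs"
      unfolding rs(3) using koszul_homotopy[OF ys rs(2,1) c bs(1)] by simp
    then have "x \<odot>\<^bsub>M\<^esub> c bs \<ominus>\<^bsub>M\<^esub> kd M ys ?h bs = kh M rs (kd M ys c) bs"
      using kdc khc by (simp add: a_minus_def M.a_assoc add_minus_cancel)
    moreover have "kh M rs (kd M ys c) bs \<in> N"
      by (rule kh_mem[OF N rs(2)]) (use Cons.prems(7) bs rs(1) in auto)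
    ultimately show ?thesis by simp
  qed
  have cong: "cong_mod M N (x \<odot>\<^bsub>M\<^esub> c bs) (kd M ys ?h bs)" if "length bs = length ys" "nt bs = i" for bs
    using hom[OF that] x c kdc by (simp add: cong_mod_def)
  show ?case
  proof (cases i)
    case 0
    have "c bs \<in> N" if bs: "length bs = length ys" "nt bs = i" for bs
    proof -
      \<comment> \<open>In degree 0 no component enters the differential, so the cochain may be
        replaced by zero.\<close>
      have "kd M ys ?h bs = kd M ys (\<lambda>_. \<zero>\<^bsub>M\<^esub>) bs" by (rule kd_cong) (use bs 0 in auto)
      then have "kd M ys ?h bs = \<zero>\<^bsub>M\<^esub>" using kd_zero[OF ys] by simp
      then have "x \<odot>\<^bsub>M\<^esub> c bs \<in> N" using cong[OF bs] cong_mod_0 x c by simp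
      then show ?thesis using reg c by simp
    qed
    then have "c bs \<ominus>\<^bsub>M\<^esub> kd M ys (\<lambda>_. \<zero>\<^bsub>M\<^esub>) bs \<in> N" if "length bs = length ys" "nt bs = i" for bs
      using that kd_zero[OF ys] cong_mod_0[of "c bs" N] c by (simp add: cong_mod_def)
    then show ?thesis by (intro exI[of _ "\<lambda>_. \<zero>\<^bsub>M\<^esub>"]) auto
  next
    case (Suc j)
    have "kd M ys ?h bs \<in> ?N'" if bs: "length bs = length ys" "nt bs = Suc j" for bs
    proof -
      have "cong_mod M ?N' (kd M ys ?h bs) (x \<odot>\<^bsub>M\<^esub> c bs)"
        using cong_mod_mono[OF cong_mod_sym[OF N cong] N'(2)] bs Suc by simp
      then show ?thesis using cong_mod_mem[OF N'(1)] N'(3) c by blast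
    qed
    then obtain b' where b': "\<And>s. b' s \<in> carrier M"
      "\<And>bs. length bs = length ys \<Longrightarrow> nt bs = j \<Longrightarrow> ?h bs \<ominus>\<^bsub>M\<^esub> kd M ys b' bs \<in> ?N'"
      using Cons.IH[of ?N' j ?h] Cons.prems(1,2,5) Suc N'(1) ys h by auto
    \<comment> \<open>The condition on \<open>s\<close> sits inside the existential quantifier so
      that \<open>n\<close> and \<open>v\<close> become total functions with values in
      \<open>N\<close> and \<open>M\<close>, as the rules for \<open>kd\<close> require.\<close>
    have "\<exists>n v. n \<in> N \<and> v \<in> carrier M \<and>
        (length s = length ys \<longrightarrow> nt s = j \<longrightarrow> ?h s = kd M ys b' s \<oplus>\<^bsub>M\<^esub> (x \<odot>\<^bsub>M\<^esub> v \<oplus>\<^bsub>M\<^esub> n))" for s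
    proof (cases "length s = length ys \<and> nt s = j")
      case True
      then obtain n v where nv: "n \<in> N" "v \<in> carrier M" "?h s \<ominus>\<^bsub>M\<^esub> kd M ys b' s = n \<oplus>\<^bsub>M\<^esub> x \<odot>\<^bsub>M\<^esub> v"
        using b'(2)[of s] by (auto simp: msum_def)
      have kb: "kd M ys b' s \<in> carrier M" by (rule kd_closed[OF ys b'(1)])
      have "?h s = kd M ys b' s \<oplus>\<^bsub>M\<^esub> (?h s \<ominus>\<^bsub>M\<^esub> kd M ys b' s)"
        using kb h by (simp add: a_minus_def add_minus_cancel)
      also have "\<dots> = kd M ys b' s \<oplus>\<^bsub>M\<^esub> (x \<odot>\<^bsub>M\<^esub> v \<oplus>\<^bsub>M\<^esub> n)" unfolding nv(3) using nv x Nc by (simp add: M.a_comm)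
      finally show ?thesis using nv by blast
    next
      case False
      then show ?thesis using subm_zero[OF N] by (intro exI[of _ "\<zero>\<^bsub>M\<^esub>"]) auto
    qed
    then obtain n v where nv: "\<And>s. n s \<in> N" "\<And>s. v s \<in> carrier M"
      "\<And>s. length s = length ys \<Longrightarrow> nt s = j \<Longrightarrow> ?h s = kd M ys b' s \<oplus>\<^bsub>M\<^esub> (x \<odot>\<^bsub>M\<^esub> v s \<oplus>\<^bsub>M\<^esub> n s)"
      by metis
    have "c bs \<ominus>\<^bsub>M\<^esub> kd M ys v bs \<in> N" if bs: "length bs = length ys" "nt bs = i" for bs
    proof -
      have kv: "kd M ys v s \<in> carrier M" "kd M ys b' s \<in> carrier M" "kd M ys n s \<in> carrier M" for s
        using kd_closed[OF ys] nv b' Nc by auto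
      have "kd M ys ?h bs = kd M ys (\<lambda>s. kd M ys b' s \<oplus>\<^bsub>M\<^esub> (x \<odot>\<^bsub>M\<^esub> v s \<oplus>\<^bsub>M\<^esub> n s)) bs"
        by (rule kd_cong) (use nv(3) bs Suc in auto)
      also have "\<dots> = kd M ys (kd M ys b') bs \<oplus>\<^bsub>M\<^esub> kd M ys (\<lambda>s. x \<odot>\<^bsub>M\<^esub> v s \<oplus>\<^bsub>M\<^esub> n s) bs"
        using kv nv x Nc by (intro kd_add[OF ys]) auto
      also have "kd M ys (kd M ys b') bs = \<zero>\<^bsub>M\<^esub>" by (rule kd_kd[OF ys b'(1)])
      also have "kd M ys (\<lambda>s. x \<odot>\<^bsub>M\<^esub> v s \<oplus>\<^bsub>M\<^esub> n s) bs = x \<odot>\<^bsub>M\<^esub> kd M ys v bs \<oplus>\<^bsub>M\<^esub> kd M ys n bs"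
        using nv x Nc by (intro kd_lin[OF ys]) auto
      finally have e: "kd M ys ?h bs = x \<odot>\<^bsub>M\<^esub> kd M ys v bs \<oplus>\<^bsub>M\<^esub> kd M ys n bs" using kv x by simp
      have "kd M ys n bs \<in> N" by (rule kd_mem[OF N ys nv(1) bs(1)])
      then have "cong_mod M N (x \<odot>\<^bsub>M\<^esub> kd M ys v bs \<oplus>\<^bsub>M\<^esub> kd M ys n bs) (x \<odot>\<^bsub>M\<^esub> kd M ys v bs \<oplus>\<^bsub>M\<^esub> \<zero>\<^bsub>M\<^esub>)"
        using kv x cong_mod_0[of "kd M ys n bs" N] by (intro cong_mod_add[OF N] cong_mod_refl[OF N]) auto
      then have "cong_mod M N (x \<odot>\<^bsub>M\<^esub> c bs) (x \<odot>\<^bsub>M\<^esub> kd M ys v bs)"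
        using cong_mod_trans[OF N cong[OF bs]] e kv x by simp
      then have "x \<odot>\<^bsub>M\<^esub> (c bs \<ominus>\<^bsub>M\<^esub> kd M ys v bs) \<in> N"
        using x c kv by (simp add: cong_mod_def a_minus_def smult_r_distr smult_r_minus)
      then show ?thesis using reg c kv by simp
    qed
    then show ?thesis using nv(2) by blast
  qed
qed

text \<open>In the top degree the differential is, up to signs, the sum of the products of
  \<open>ys\<close> with the components one degree lower. Together with \<open>kd_top_surj\<close>
  this says that the top cohomology of a submodule Z is Z modulo (ys) Z.\<close>

lemma kd_top_mem:
  assumes "subm R M Z" "set ys \<subseteq> carrier R" "\<And>s. length s = length ys \<Longrightarrow> Suc (nt s) = length ys \<Longrightarrow> c s \<in> Z"
  shows "kd M ys c (replicate (length ys) True) \<in> lcomb M Z ys"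
  using assms
proof (induction ys arbitrary: c)
  case (Cons y ys)
  have "kd M ys (\<lambda>s. c (True # s)) (replicate (length ys) True) \<in> lcomb M Z ys"
    by (rule Cons.IH) (use Cons.prems in auto)
  then have "\<ominus>\<^bsub>M\<^esub> kd M ys (\<lambda>s. c (True # s)) (replicate (length ys) True) \<in> lcomb M Z ys"
    using subm_a_inv subm_lcomb[of ys Z] Cons.prems by simp
  moreover have "c (False # replicate (length ys) True) \<in> Z" using Cons.prems(3) by simp
  ultimately show ?case by auto
qed simp

lemma kd_top_surj:
  assumes "subm R M Z" "set ys \<subseteq> carrier R" "a \<in> lcomb M Z ys"
  shows "\<exists>c. (\<forall>s. c s \<in> Z) \<and> kd M ys c (replicate (length ys) True) = a"
  using assms
proof (induction ys arbitrary: a)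
  case Nil then show ?case using subm_zero by (intro exI[of _ "\<lambda>_. \<zero>\<^bsub>M\<^esub>"]) auto
next
  case (Cons y ys)
  then obtain z w where a: "z \<in> Z" "w \<in> lcomb M Z ys" "a = y \<odot>\<^bsub>M\<^esub> z \<oplus>\<^bsub>M\<^esub> w" by auto
  then obtain c where c: "\<And>s. c s \<in> Z" "kd M ys c (replicate (length ys) True) = w"
    using Cons by auto
  have cc: "\<And>s. c s \<in> carrier M" using c subm_carr[OF Cons.prems(1)] by auto
  have wc: "w \<in> carrier M" using kd_closed[of ys c] cc c(2) Cons.prems(2) by auto
  \<comment> \<open>The minus sign cancels the one in the differential at lists that begin with
    \<open>True\<close>.\<close>
  let ?c = "\<lambda>s. case s of [] \<Rightarrow> \<zero>\<^bsub>M\<^esub> | b # t \<Rightarrow> if b then \<ominus>\<^bsub>M\<^esub> c t else z"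
  have "kd M ys (\<lambda>s. \<ominus>\<^bsub>M\<^esub> c s) (replicate (length ys) True) = \<ominus>\<^bsub>M\<^esub> w"
    using kd_neg[of ys c] Cons.prems cc c(2) by simp
  then have "kd M (y # ys) ?c (replicate (length (y # ys)) True) = a"
    using a wc by (simp add: M.minus_minus)
  moreover have "?c s \<in> Z" for s
    using a c subm_zero[OF Cons.prems(1)] subm_a_inv[OF Cons.prems(1)] by (auto split: list.split)
  ultimately show ?case by blast
qed

lemma kd_natural:
  assumes "module R N" "f \<in> module_hom R M N" "set ys \<subseteq> carrier R" "\<And>s. c s \<in> carrier M"
  shows "f (kd M ys c bs) = kd N ys (\<lambda>s. f (c s)) bs"
  using assms(3,4)
proof (induction ys arbitrary: c bs)
  case Nil then show ?case using hom_zero[OF assms(1,2)] by simp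
next
  case (Cons y ys)
  interpret N: module R N by fact
  have y: "y \<in> carrier R" "set ys \<subseteq> carrier R" using Cons.prems by auto
  have fc: "f u \<in> carrier N" if "u \<in> carrier M" for u using module_hom_closed[OF assms(2)] that by auto
  have neg: "f (\<ominus>\<^bsub>M\<^esub> u) = \<ominus>\<^bsub>N\<^esub> f u" if u: "u \<in> carrier M" for u
    using module_hom_smult[OF assms(2), of "\<ominus> \<one>" u] u fc[OF u] by (simp add: smult_l_minus N.smult_l_minus)
  show ?case
  proof (cases bs)
    case Nil then show ?thesis using hom_zero[OF assms(1,2)] by simp
  next
    case (Cons b t)
    note IH = Cons.IH[OF y(2), of "\<lambda>s. c (b # s)" t, OF Cons.prems(2)]
    have k: "kd M ys (\<lambda>s. c (b # s)) t \<in> carrier M" using kd_closed[OF y(2)] Cons.prems by auto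
    show ?thesis using Cons IH k y Cons.prems(2)
      by (cases b) (simp_all add: module_hom_add[OF assms(2)] module_hom_smult[OF assms(2)] neg)
  qed
qed

end

text \<open>A longer sequence would make the top Koszul cohomology of M/N vanish, that is M = N +
  \<mm> M, and then N = M by Nakayama's lemma.\<close>

lemma (in local_module) regseq_length_le:
  assumes "regseq M N xs" "set xs \<subseteq> \<mm>" "\<mm> = lspan R (ring_as_module R) ys" "set ys \<subseteq> \<mm>" "subm R M N" "N \<noteq> carrier M"
  shows "length xs \<le> length ys"
proof (rule ccontr)
  assume len: "\<not> ?thesis"
  have ysc: "set ys \<subseteq> carrier R" using assms(4) max_ideal_carr by auto
  have "carrier M \<subseteq> msum M N (lcomb M (carrier M) ys)"
  proof
    fix m assume m: "m \<in> carrier M"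
    \<comment> \<open>The constant cochain \<open>m\<close> is a cocycle in the top degree, because
      the next degree has no components.\<close>
    have "\<exists>b. (\<forall>s. b s \<in> carrier M) \<and> (\<forall>bs. length bs = length ys \<longrightarrow> nt bs = length ys \<longrightarrow> m \<ominus>\<^bsub>M\<^esub> kd M ys b bs \<in> N)"
    proof (rule koszul_acyclic[OF assms(1) _ assms(5) ysc])
      fix bs :: "bool list" assume bs: "length bs = length ys" "nt bs = Suc (length ys)"
      then show "kd M ys (\<lambda>_. m) bs \<in> N" using nt_le[of bs] by linarith
    qed (use assms len m in auto)
    then obtain b where "\<forall>s. b s \<in> carrier M"
      "\<forall>bs. length bs = length ys \<longrightarrow> nt bs = length ys \<longrightarrow> m \<ominus>\<^bsub>M\<^esub> kd M ys b bs \<in> N" by blast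
    then have b: "\<And>s. b s \<in> carrier M" "m \<ominus>\<^bsub>M\<^esub> kd M ys b (replicate (length ys) True) \<in> N"
      by simp_all
    have "kd M ys b (replicate (length ys) True) \<in> lcomb M (carrier M) ys"
      by (rule kd_top_mem[OF subm_carrier ysc]) (use b in auto)
    from msumI[OF b(2) this, of M] show "m \<in> msum M N (lcomb M (carrier M) ys)"
      using m kd_closed[OF ysc b(1)] by (simp add: a_minus_def M.a_assoc M.l_neg)
  qed
  from nakayama[OF assms(5) subm_carrier assms(4) this] show False
    using assms(6) subm_subset[OF assms(5)] by auto
qed

section \<open>Freeness of modules of maximal depth\<close>

fun lsum :: "('a, 'm, 'c) module_scheme \<Rightarrow> 'm list \<Rightarrow> (nat \<Rightarrow> 'a) \<Rightarrow> 'm" where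
  "lsum M [] a = \<zero>\<^bsub>M\<^esub>"
| "lsum M (w # ws) a = a 0 \<odot>\<^bsub>M\<^esub> w \<oplus>\<^bsub>M\<^esub> lsum M ws (\<lambda>i. a (Suc i))"

context module
begin

lemma lsum_mem: "set ws \<subseteq> carrier M \<Longrightarrow> (\<And>i. i < length ws \<Longrightarrow> a i \<in> carrier R) \<Longrightarrow> lsum M ws a \<in> lspan R M ws"
proof (induction ws arbitrary: a)
  case (Cons w ws)
  then have "lsum M ws (\<lambda>i. a (Suc i)) \<in> lspan R M ws" "a 0 \<in> carrier R" by auto
  then show ?case by auto
qed simp

lemma lsum_surj: "x \<in> lspan R M ws \<Longrightarrow> \<exists>a. (\<forall>i. a i \<in> carrier R) \<and> lsum M ws a = x"
proof (induction ws arbitrary: x)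
  case Nil then show ?case by (intro exI[of _ "\<lambda>_. \<zero>"]) auto
next
  case (Cons w ws)
  then obtain r s where r: "r \<in> carrier R" "s \<in> lspan R M ws" "x = r \<odot>\<^bsub>M\<^esub> w \<oplus>\<^bsub>M\<^esub> s" by auto
  with Cons obtain a where "\<forall>i. a i \<in> carrier R" "lsum M ws a = s" by auto
  then show ?case using r by (intro exI[of _ "case_nat r a"]) (auto split: nat.split)
qed

lemma lsum_cong: "(\<And>i. i < length ws \<Longrightarrow> a i = b i) \<Longrightarrow> lsum M ws a = lsum M ws b"
proof (induction ws arbitrary: a b)
  case (Cons w ws)
  have "lsum M ws (\<lambda>i. a (Suc i)) = lsum M ws (\<lambda>i. b (Suc i))" by (rule Cons.IH) (use Cons.prems in auto)
  then show ?case using Cons.prems[of 0] by simp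
qed simp

lemma lsum_closed: "set ws \<subseteq> carrier M \<Longrightarrow> (\<And>i. i < length ws \<Longrightarrow> a i \<in> carrier R) \<Longrightarrow> lsum M ws a \<in> carrier M"
  using lsum_mem subm_lspan subm_carr by metis

lemma lsum_add:
  "set ws \<subseteq> carrier M \<Longrightarrow> (\<And>i. i < length ws \<Longrightarrow> a i \<in> carrier R) \<Longrightarrow> (\<And>i. i < length ws \<Longrightarrow> b i \<in> carrier R) \<Longrightarrow>
    lsum M ws (\<lambda>i. a i \<oplus> b i) = lsum M ws a \<oplus>\<^bsub>M\<^esub> lsum M ws b"
proof (induction ws arbitrary: a b)
  case (Cons w ws)
  have c: "lsum M ws (\<lambda>i. a (Suc i)) \<in> carrier M" "lsum M ws (\<lambda>i. b (Suc i)) \<in> carrier M"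
    by (rule lsum_closed; use Cons.prems in auto)+
  have ab: "a 0 \<in> carrier R" "b 0 \<in> carrier R" using Cons.prems by auto
  have "lsum M ws (\<lambda>i. a (Suc i) \<oplus> b (Suc i)) = lsum M ws (\<lambda>i. a (Suc i)) \<oplus>\<^bsub>M\<^esub> lsum M ws (\<lambda>i. b (Suc i))"
    by (rule Cons.IH) (use Cons.prems in auto)
  then show ?case using c ab Cons.prems(1) by (simp add: smult_l_distr M.a_ac)
qed simp

lemma lsum_smult:
  "set ws \<subseteq> carrier M \<Longrightarrow> (\<And>i. i < length ws \<Longrightarrow> a i \<in> carrier R) \<Longrightarrow> r \<in> carrier R \<Longrightarrow>
    lsum M ws (\<lambda>i. r \<otimes> a i) = r \<odot>\<^bsub>M\<^esub> lsum M ws a"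
proof (induction ws arbitrary: a)
  case (Cons w ws)
  have c: "lsum M ws (\<lambda>i. a (Suc i)) \<in> carrier M"
    by (rule lsum_closed; use Cons.prems in auto)
  have ab: "a 0 \<in> carrier R" using Cons.prems by auto
  have "lsum M ws (\<lambda>i. r \<otimes> a (Suc i)) = r \<odot>\<^bsub>M\<^esub> lsum M ws (\<lambda>i. a (Suc i))"
    by (rule Cons.IH) (use Cons.prems in auto)
  then show ?case using c ab Cons.prems by (simp add: smult_r_distr smult_assoc1)
qed simp

lemma lsum_remove:
  assumes "set ws \<subseteq> carrier M" "\<And>i. i < length ws \<Longrightarrow> a i \<in> carrier R" "i < length ws"
  shows "\<exists>s\<in>lspan R M (take i ws @ drop (Suc i) ws). lsum M ws a = a i \<odot>\<^bsub>M\<^esub> ws ! i \<oplus>\<^bsub>M\<^esub> s"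
  using assms
proof (induction ws arbitrary: a i)
  case (Cons w ws)
  have a: "\<And>i. i < length ws \<Longrightarrow> a (Suc i) \<in> carrier R" "a 0 \<in> carrier R" using Cons.prems by auto
  have ws: "set ws \<subseteq> carrier M" "w \<in> carrier M" using Cons.prems by auto
  show ?case
  proof (cases i)
    case 0
    then show ?thesis using lsum_mem[OF ws(1) a(1)] by auto
  next
    case (Suc j)
    then obtain s where s: "s \<in> lspan R M (take j ws @ drop (Suc j) ws)"
      "lsum M ws (\<lambda>i. a (Suc i)) = a i \<odot>\<^bsub>M\<^esub> ws ! j \<oplus>\<^bsub>M\<^esub> s"
      using Cons.IH[OF ws(1), of "\<lambda>i. a (Suc i)" j, OF a(1)] Cons.prems(3) by auto
    have "set (take j ws @ drop (Suc j) ws) \<subseteq> carrier M" using ws(1) by (auto dest: in_set_takeD in_set_dropD)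
    then have sc: "s \<in> carrier M" using subm_carr[OF subm_lspan s(1)] by simp
    have wj: "ws ! j \<in> carrier M" "a i \<in> carrier R" using Suc Cons.prems by (auto simp: subset_iff)
    have "lsum M (w # ws) a = a i \<odot>\<^bsub>M\<^esub> (w # ws) ! i \<oplus>\<^bsub>M\<^esub> (a 0 \<odot>\<^bsub>M\<^esub> w \<oplus>\<^bsub>M\<^esub> s)"
      using s(2) Suc ws a(2) sc wj by (simp add: M.a_ac)
    moreover have "a 0 \<odot>\<^bsub>M\<^esub> w \<oplus>\<^bsub>M\<^esub> s \<in> lspan R M (take i (w # ws) @ drop (Suc i) (w # ws))"
      using Suc s(1) a(2) by auto
    ultimately show ?thesis by blast
  qed
qed simp

end

lemma (in module) lcomb_power_module:
  assumes "set ys \<subseteq> carrier R" "a \<in> {..<n} \<rightarrow>\<^sub>E carrier R" "\<And>i. i < n \<Longrightarrow> a i \<in> lspan R (ring_as_module R) ys"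
  shows "a \<in> lcomb (power_module (ring_as_module R) n) ({..<n} \<rightarrow>\<^sub>E carrier R) ys"
  using assms
proof (induction ys arbitrary: a)
  case Nil
  then have "a = (\<lambda>i\<in>{..<n}. \<zero>)" by (intro ext) (auto simp: PiE_def extensional_def)
  then show ?case by (simp add: restrict_def)
next
  case (Cons y ys)
  interpret RM: module R "ring_as_module R" by (rule module_ring_as_module)
  have "\<forall>i. \<exists>r s. i < n \<longrightarrow> r \<in> carrier R \<and> s \<in> lspan R (ring_as_module R) ys \<and> a i = r \<otimes> y \<oplus> s"
    using Cons.prems(3) by auto
  then obtain r s where rs: "\<And>i. i < n \<Longrightarrow> r i \<in> carrier R" "\<And>i. i < n \<Longrightarrow> s i \<in> lspan R (ring_as_module R) ys"
    "\<And>i. i < n \<Longrightarrow> a i = r i \<otimes> y \<oplus> s i" by metis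
  have y: "y \<in> carrier R" using Cons.prems by auto
  have "subm R (ring_as_module R) (lspan R (ring_as_module R) ys)" by (rule RM.subm_lspan) (use Cons.prems in auto)
  then have sc: "\<And>i. i < n \<Longrightarrow> s i \<in> carrier R" using rs(2) subm_carr by fastforce
  let ?r = "\<lambda>i\<in>{..<n}. r i" and ?s = "\<lambda>i\<in>{..<n}. s i"
  have "?s \<in> lcomb (power_module (ring_as_module R) n) ({..<n} \<rightarrow>\<^sub>E carrier R) ys"
    by (rule Cons.IH) (use Cons.prems rs sc in auto)
  moreover have "?r \<in> {..<n} \<rightarrow>\<^sub>E carrier R" using rs by auto
  moreover have "a = y \<odot>\<^bsub>power_module (ring_as_module R) n\<^esub> ?r \<oplus>\<^bsub>power_module (ring_as_module R) n\<^esub> ?s"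
  proof
    fix i show "a i = (y \<odot>\<^bsub>power_module (ring_as_module R) n\<^esub> ?r \<oplus>\<^bsub>power_module (ring_as_module R) n\<^esub> ?s) i"
    proof (cases "i < n")
      case True
      then show ?thesis using rs y by (simp add: R.m_comm)
    next
      case False
      then show ?thesis using Cons.prems(2) by (auto simp: PiE_def extensional_def)
    qed
  qed
  ultimately show ?case by (simp only: lcomb.simps) blast
qed

text \<open>Let Z be the kernel of a minimal cover F -> M. Its elements have entries in \<mm>, so
  each is the top differential of a cochain \<open>c\<close> of F. The image of \<open>c\<close> in
  M is a cocycle one degree lower, where cohomology vanishes because \<open>xs\<close> is as long as
  \<open>ys\<close>. Lifting a primitive \<open>b\<close> of it to F and subtracting its
  differential from \<open>c\<close> gives a cochain with values in Z and the same top differential.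
  Thus Z lies in \<mm> Z.\<close>

lemma (in local_module) free_of_maximal_depth:
  assumes xs: "regseq M {\<zero>\<^bsub>M\<^esub>} xs" "set xs \<subseteq> \<mm>" and ys: "\<mm> = lspan R (ring_as_module R) ys" "set ys \<subseteq> \<mm>"
    and len: "length xs = length ys"
  shows "\<exists>n f. f \<in> module_hom R (power_module (ring_as_module R) n) M \<and>
    bij_betw f (carrier (power_module (ring_as_module R) n)) (carrier M)"
proof -
  have ysc: "set ys \<subseteq> carrier R" using ys(2) max_ideal_carr by auto
  let ?Q = "\<lambda>n. \<exists>ws. length ws = n \<and> set ws \<subseteq> carrier M \<and> carrier M = lspan R M ws"
  have "\<exists>n. ?Q n" using fg by (auto simp: fgen_def)
  then have Q: "?Q (LEAST n. ?Q n)" by (rule LeastI_ex)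
  have least: "\<And>k. ?Q k \<Longrightarrow> (LEAST n. ?Q n) \<le> k" by (rule Least_le)
  define n where "n = (LEAST n. ?Q n)"
  from Q obtain ws where ws: "length ws = n" "set ws \<subseteq> carrier M" "carrier M = lspan R M ws"
    unfolding n_def by blast
  let ?F = "power_module (ring_as_module R) n"
  interpret RM: module R "ring_as_module R" by (rule module_ring_as_module)
  interpret F: local_module R ?F
  proof -
    interpret F: module R ?F by (rule RM.module_power_module)
    have "lspan R (ring_as_module R) [\<one>] = carrier R"
    proof
      show "carrier R \<subseteq> lspan R (ring_as_module R) [\<one>]"
      proof
        fix r assume "r \<in> carrier R"
        then show "r \<in> lspan R (ring_as_module R) [\<one>]" by (auto intro!: exI[of _ r])
      qed
    qed auto
    then have "fgen R (ring_as_module R) (carrier (ring_as_module R))"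
      unfolding fgen_def by (intro exI[of _ "[\<one>]"]) auto
    then show "local_module R ?F"
      by unfold_locales (rule RM.fgen_power_module)
  qed
  have Fc: "carrier ?F = {..<n} \<rightarrow>\<^sub>E carrier R" by simp
  define \<epsilon> where "\<epsilon> = lsum M ws"
  have \<epsilon>: "\<epsilon> \<in> module_hom R ?F M"
    unfolding module_hom_def mem_Collect_eq
  proof (intro conjI allI impI)
    show "\<epsilon> \<in> carrier ?F \<rightarrow> carrier M" using ws(1,2) by (auto simp: \<epsilon>_def intro!: lsum_closed)
    fix a b assume "a \<in> carrier ?F \<and> b \<in> carrier ?F"
    then have ab: "\<And>i. i < n \<Longrightarrow> a i \<in> carrier R" "\<And>i. i < n \<Longrightarrow> b i \<in> carrier R" by auto
    have "\<epsilon> (a \<oplus>\<^bsub>?F\<^esub> b) = lsum M ws (\<lambda>i. a i \<oplus> b i)"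
      unfolding \<epsilon>_def by (rule lsum_cong) (use ws in auto)
    then show "\<epsilon> (a \<oplus>\<^bsub>?F\<^esub> b) = \<epsilon> a \<oplus>\<^bsub>M\<^esub> \<epsilon> b" unfolding \<epsilon>_def using ab ws lsum_add by simp
  next
    fix r a assume ra: "r \<in> carrier R \<and> a \<in> carrier ?F"
    then have a: "\<And>i. i < n \<Longrightarrow> a i \<in> carrier R" by auto
    have "\<epsilon> (r \<odot>\<^bsub>?F\<^esub> a) = lsum M ws (\<lambda>i. r \<otimes> a i)"
      unfolding \<epsilon>_def by (rule lsum_cong) (use ws in auto)
    then show "\<epsilon> (r \<odot>\<^bsub>?F\<^esub> a) = r \<odot>\<^bsub>M\<^esub> \<epsilon> a" unfolding \<epsilon>_def using a ra ws lsum_smult by simp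
  qed
  have surj: "\<exists>a\<in>carrier ?F. \<epsilon> a = m" if m: "m \<in> carrier M" for m
  proof -
    obtain a where a: "\<And>i. a i \<in> carrier R" "lsum M ws a = m" using lsum_surj[of m ws] ws(3) m by auto
    have "\<epsilon> (\<lambda>i\<in>{..<n}. a i) = lsum M ws a" unfolding \<epsilon>_def by (rule lsum_cong) (use ws in auto)
    then show ?thesis using a by (intro bexI[of _ "\<lambda>i\<in>{..<n}. a i"]) auto
  qed
  let ?Z = "{a \<in> carrier ?F. \<epsilon> a \<in> {\<zero>\<^bsub>M\<^esub>}}"
  have Z: "subm R ?F ?Z" by (rule F.hom_vimage_subm[OF module_axioms \<epsilon> subm_null])
  \<comment> \<open>A unit entry would express one generator through the others, against the minimal
    length of \<open>ws\<close>.\<close>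
  have Zm: "a i \<in> \<mm>" if a: "a \<in> ?Z" and i: "i < n" for a i
  proof (rule ccontr)
    assume nm: "a i \<notin> \<mm>"
    have ac: "\<And>i. i < length ws \<Longrightarrow> a i \<in> carrier R" using a ws by auto
    let ?vs = "take i ws @ drop (Suc i) ws"
    have vs: "set ?vs \<subseteq> carrier M" using ws(2) by (auto dest: in_set_takeD in_set_dropD)
    obtain s where s: "s \<in> lspan R M ?vs" "lsum M ws a = a i \<odot>\<^bsub>M\<^esub> ws ! i \<oplus>\<^bsub>M\<^esub> s"
      using lsum_remove[where i = i and a = a, OF ws(2) ac] i ws(1) by auto
    have L: "subm R M (lspan R M ?vs)" by (rule subm_lspan[OF vs])
    have sc: "s \<in> carrier M" using s subm_carr[OF L] by auto
    have wi: "ws ! i \<in> carrier M" "a i \<in> carrier R" using i ws ac by (auto simp: subset_iff)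
    have "a i \<odot>\<^bsub>M\<^esub> ws ! i = \<ominus>\<^bsub>M\<^esub> s"
      using a s(2) wi sc by (intro M.minus_equality[symmetric]) (auto simp: \<epsilon>_def)
    then have "a i \<odot>\<^bsub>M\<^esub> ws ! i \<in> lspan R M ?vs" using subm_a_inv[OF L s(1)] by simp
    then have wm: "ws ! i \<in> lspan R M ?vs" using unit_smult_mem[OF L _ wi(1)] nm unit_iff wi by auto
    have "ws = take i ws @ ws ! i # drop (Suc i) ws" using i ws by (simp add: id_take_nth_drop)
    then have "set ws = insert (ws ! i) (set ?vs)" by (metis Un_insert_right list.simps(15) set_append)
    then have "set ws \<subseteq> lspan R M ?vs" using wm lspan_superset[OF vs] by simp
    then have "carrier M \<subseteq> lspan R M ?vs" using lspan_least[OF L] ws(3) by simp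
    then have "carrier M = lspan R M ?vs" using subm_subset[OF L] by auto
    moreover have "length ?vs = n - 1" using i ws by simp
    ultimately have "n \<le> n - 1" using vs least[of "n - 1"] unfolding n_def by blast
    then show False using i by simp
  qed
  have "?Z \<subseteq> msum ?F {\<zero>\<^bsub>?F\<^esub>} (lcomb ?F ?Z ys)"
  proof
    fix a assume a: "a \<in> ?Z"
    have aF: "a \<in> lcomb ?F (carrier ?F) ys"
      unfolding Fc by (rule lcomb_power_module[OF ysc]) (use a Zm ys(1) in auto)
    then obtain c where c: "\<And>s. c s \<in> carrier ?F" "kd ?F ys c (replicate (length ys) True) = a"
      using F.kd_top_surj[OF F.subm_carrier ysc] by blast
    have "a \<in> lcomb ?F ?Z ys"
    \<comment> \<open>Without generators there is no degree \<open>length ys - 1\<close>; both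
      products are then the zero submodule.\<close>
    proof (cases "ys = []")
      case True then show ?thesis using aF by simp
    next
      case False
      have \<epsilon>c: "\<epsilon> u \<in> carrier M" if "u \<in> carrier ?F" for u using module_hom_closed[OF \<epsilon>] that by auto
      have "\<exists>b. (\<forall>s. b s \<in> carrier M) \<and>
        (\<forall>bs. length bs = length ys \<longrightarrow> nt bs = length ys - 1 \<longrightarrow> \<epsilon> (c bs) \<ominus>\<^bsub>M\<^esub> kd M ys b bs \<in> {\<zero>\<^bsub>M\<^esub>})"
      proof (rule koszul_acyclic[OF xs(1) _ subm_null ysc])
        show "set xs \<subseteq> lspan R (ring_as_module R) ys" using xs ys by simp
        show "length ys - 1 < length xs" using len False by simp
        show "\<epsilon> (c s) \<in> carrier M" for s using \<epsilon>c c(1) by blast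
        fix bs :: "bool list" assume bs: "length bs = length ys" "nt bs = Suc (length ys - 1)"
        then have "bs = replicate (length ys) True" using nt_full[of bs] False by simp
        then have "kd M ys (\<lambda>s. \<epsilon> (c s)) bs = \<epsilon> a"
          using F.kd_natural[where c = c and bs = bs, OF module_axioms \<epsilon> ysc c(1)] c(2) by simp
        then show "kd M ys (\<lambda>s. \<epsilon> (c s)) bs \<in> {\<zero>\<^bsub>M\<^esub>}" using a by simp
      qed
      then obtain b where b: "\<And>s. b s \<in> carrier M"
        "\<And>bs. length bs = length ys \<Longrightarrow> nt bs = length ys - 1 \<Longrightarrow> \<epsilon> (c bs) \<ominus>\<^bsub>M\<^esub> kd M ys b bs = \<zero>\<^bsub>M\<^esub>" by auto
      have "\<forall>s. \<exists>u. u \<in> carrier ?F \<and> \<epsilon> u = b s" using surj b(1) by blast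
      then obtain b' where b': "\<And>s. b' s \<in> carrier ?F" "\<And>s. \<epsilon> (b' s) = b s" by metis
      have kb: "kd ?F ys b' s \<in> carrier ?F" for s by (rule F.kd_closed[OF ysc b'(1)])
      \<comment> \<open>The corrected cochain c - d b', with the sign written as multiplication by
        -1 so that \<open>kd_lin\<close> applies.\<close>
      let ?c = "\<lambda>s. \<ominus> \<one> \<odot>\<^bsub>?F\<^esub> kd ?F ys b' s \<oplus>\<^bsub>?F\<^esub> c s"
      have cF: "?c s \<in> carrier ?F" for s by (intro F.M.a_closed F.smult_closed kb c(1)) simp
      have "kd ?F ys ?c (replicate (length ys) True) \<in> lcomb ?F ?Z ys"
      proof (rule F.kd_top_mem[OF Z ysc])
        fix s :: "bool list" assume s: "length s = length ys" "Suc (nt s) = length ys"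
        have "\<epsilon> (?c s) = \<ominus> \<one> \<odot>\<^bsub>M\<^esub> \<epsilon> (kd ?F ys b' s) \<oplus>\<^bsub>M\<^esub> \<epsilon> (c s)"
          using module_hom_add[OF \<epsilon> F.smult_closed[OF _ kb] c(1)] module_hom_smult[OF \<epsilon> _ kb] by simp
        also have "\<epsilon> (kd ?F ys b' s) = kd M ys b s"
          using F.kd_natural[where c = b' and bs = s, OF module_axioms \<epsilon> ysc b'(1)] b'(2) by simp
        also have "\<ominus> \<one> \<odot>\<^bsub>M\<^esub> kd M ys b s \<oplus>\<^bsub>M\<^esub> \<epsilon> (c s) = \<epsilon> (c s) \<ominus>\<^bsub>M\<^esub> kd M ys b s"
          using kd_closed[OF ysc b(1)] \<epsilon>c[OF c(1)] by (simp add: smult_l_minus a_minus_def M.a_comm)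
        also have "\<dots> = \<zero>\<^bsub>M\<^esub>" using b(2)[of s] s by simp
        finally show "?c s \<in> ?Z" using cF by blast
      qed
      moreover have "kd ?F ys ?c (replicate (length ys) True) = a"
        using F.kd_lin[where r = "\<ominus> \<one>" and bs = "replicate (length ys) True" and c = "kd ?F ys b'" and c' = c, OF ysc _ kb c(1)]
          F.kd_kd[where c = b' and bs = "replicate (length ys) True", OF ysc b'(1)] c(2)
          F.smult_r_null[of "\<ominus> \<one>"] F.M.l_zero[of a] a by (simp del: power_module_simps)
      ultimately show ?thesis by simp
    qed
    then show "a \<in> msum ?F {\<zero>\<^bsub>?F\<^esub>} (lcomb ?F ?Z ys)"
      using msumI[of "\<zero>\<^bsub>?F\<^esub>" "{\<zero>\<^bsub>?F\<^esub>}" a "lcomb ?F ?Z ys" ?F] F.M.l_zero[of a] a by (simp del: power_module_simps)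
  qed
  from F.nakayama[OF F.subm_null Z ys(2) this] have Z0: "?Z \<subseteq> {\<zero>\<^bsub>?F\<^esub>}" .
  have "inj_on \<epsilon> (carrier ?F)"
  proof (rule inj_onI)
    fix a b assume ab: "a \<in> carrier ?F" "b \<in> carrier ?F" "\<epsilon> a = \<epsilon> b"
    have bm: "\<ominus> \<one> \<odot>\<^bsub>?F\<^esub> b \<in> carrier ?F" using F.smult_closed[OF _ ab(2)] by simp
    have "\<epsilon> (a \<oplus>\<^bsub>?F\<^esub> \<ominus> \<one> \<odot>\<^bsub>?F\<^esub> b) = \<epsilon> a \<oplus>\<^bsub>M\<^esub> \<ominus> \<one> \<odot>\<^bsub>M\<^esub> \<epsilon> b"
      using module_hom_add[OF \<epsilon> ab(1) bm] module_hom_smult[OF \<epsilon> _ ab(2)] by simp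
    also have "\<dots> = \<zero>\<^bsub>M\<^esub>" using ab(3) module_hom_closed[OF \<epsilon>] ab by (auto simp: smult_l_minus M.r_neg Pi_def)
    finally have "a \<oplus>\<^bsub>?F\<^esub> \<ominus> \<one> \<odot>\<^bsub>?F\<^esub> b \<in> ?Z" using F.M.a_closed[OF ab(1) bm] by blast
    then have "a \<oplus>\<^bsub>?F\<^esub> \<ominus> \<one> \<odot>\<^bsub>?F\<^esub> b = \<zero>\<^bsub>?F\<^esub>" using Z0 by blast
    then have e: "a \<oplus>\<^bsub>?F\<^esub> \<ominus>\<^bsub>?F\<^esub> b = \<zero>\<^bsub>?F\<^esub>"
      by (simp only: F.smult_l_minus[OF R.one_closed ab(2)] F.smult_one[OF ab(2)])
    show "a = b" using e ab by (metis F.M.minus_unique F.M.a_inv_closed F.M.a_comm F.M.minus_minus F.M.minus_equality)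
  qed
  moreover have "\<epsilon> ` carrier ?F = carrier M" using surj module_hom_closed[OF \<epsilon>] by blast
  ultimately show ?thesis using \<epsilon> unfolding bij_betw_def by blast
qed

section \<open>Quotient modules\<close>

text \<open>\<open>V\<close> is not assumed to be a module: the axioms are carried over along the
  surjection \<open>p\<close>. One locale thus serves M/N over R, M/\<mm>M over R/\<mm>, the
  projections of a direct power and the copy of S in \<open>Ulrich_copy\<close>.\<close>

locale semilinear_surj = M: module R M + K: cring K
  for R :: "('a, 'b) ring_scheme" (structure) and M :: "('a, 'm, 'c) module_scheme" (structure)
    and K :: "('k, 'd) ring_scheme" and V :: "('k, 'v, 'e) module_scheme"
    and q :: "'a \<Rightarrow> 'k" and p :: "'m \<Rightarrow> 'v" +
  assumes q_surj: "q ` carrier R = carrier K" and p_surj: "p ` carrier M = carrier V"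
    and q_add: "\<And>a b. a \<in> carrier R \<Longrightarrow> b \<in> carrier R \<Longrightarrow> q (a \<oplus>\<^bsub>R\<^esub> b) = q a \<oplus>\<^bsub>K\<^esub> q b"
    and q_mult: "\<And>a b. a \<in> carrier R \<Longrightarrow> b \<in> carrier R \<Longrightarrow> q (a \<otimes>\<^bsub>R\<^esub> b) = q a \<otimes>\<^bsub>K\<^esub> q b"
    and q_one: "q \<one>\<^bsub>R\<^esub> = \<one>\<^bsub>K\<^esub>"
    and p_add: "\<And>x y. x \<in> carrier M \<Longrightarrow> y \<in> carrier M \<Longrightarrow> p (x \<oplus>\<^bsub>M\<^esub> y) = p x \<oplus>\<^bsub>V\<^esub> p y"
    and p_smult: "\<And>a x. a \<in> carrier R \<Longrightarrow> x \<in> carrier M \<Longrightarrow> p (a \<odot>\<^bsub>M\<^esub> x) = q a \<odot>\<^bsub>V\<^esub> p x"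
    and p_zero: "p \<zero>\<^bsub>M\<^esub> = \<zero>\<^bsub>V\<^esub>"
begin

lemma p_carr: "x \<in> carrier M \<Longrightarrow> p x \<in> carrier V"
  using p_surj by blast

lemma q_carr: "a \<in> carrier R \<Longrightarrow> q a \<in> carrier K"
  using q_surj by blast

lemma V_ex: "v \<in> carrier V \<Longrightarrow> \<exists>x\<in>carrier M. v = p x"
  using p_surj by blast

lemma K_ex: "v \<in> carrier K \<Longrightarrow> \<exists>x\<in>carrier R. v = q x"
  using q_surj by blast

lemma module_V: "module K V"
proof (rule moduleI)
  show "cring K" ..
  show "abelian_group V"
  proof (rule abelian_groupI)
    fix u v w assume "u \<in> carrier V" "v \<in> carrier V" "w \<in> carrier V"
    then obtain x y z where *: "x \<in> carrier M" "y \<in> carrier M" "z \<in> carrier M" "u = p x" "v = p y" "w = p z"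
      using V_ex by metis
    show "u \<oplus>\<^bsub>V\<^esub> v \<in> carrier V" using * p_carr by (simp flip: p_add)
    show "u \<oplus>\<^bsub>V\<^esub> v \<oplus>\<^bsub>V\<^esub> w = u \<oplus>\<^bsub>V\<^esub> (v \<oplus>\<^bsub>V\<^esub> w)"
      using * by (simp flip: p_add add: M.M.a_assoc)
    show "u \<oplus>\<^bsub>V\<^esub> v = v \<oplus>\<^bsub>V\<^esub> u" using * by (simp flip: p_add add: M.M.a_comm)
  next
    show "\<zero>\<^bsub>V\<^esub> \<in> carrier V" using p_carr[of "\<zero>\<^bsub>M\<^esub>"] p_zero by simp
    fix u assume "u \<in> carrier V"
    then obtain x where *: "x \<in> carrier M" "u = p x" using V_ex by metis
    show "\<zero>\<^bsub>V\<^esub> \<oplus>\<^bsub>V\<^esub> u = u" using * by (simp flip: p_zero p_add)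
    show "\<exists>y\<in>carrier V. y \<oplus>\<^bsub>V\<^esub> u = \<zero>\<^bsub>V\<^esub>"
      using * p_carr by (intro bexI[of _ "p (\<ominus>\<^bsub>M\<^esub> x)"]) (auto simp flip: p_zero p_add simp: M.M.l_neg)
  qed
  fix a b u v assume "a \<in> carrier K" "b \<in> carrier K" "u \<in> carrier V" "v \<in> carrier V"
  then obtain r s x y where *: "r \<in> carrier R" "s \<in> carrier R" "x \<in> carrier M" "y \<in> carrier M" "a = q r" "b = q s" "u = p x" "v = p y"
    using V_ex K_ex by metis
  show "a \<odot>\<^bsub>V\<^esub> u \<in> carrier V" using * p_carr by (simp flip: p_smult)
  show "(a \<oplus>\<^bsub>K\<^esub> b) \<odot>\<^bsub>V\<^esub> u = a \<odot>\<^bsub>V\<^esub> u \<oplus>\<^bsub>V\<^esub> b \<odot>\<^bsub>V\<^esub> u"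
    using * by (simp flip: q_add p_smult p_add add: M.smult_l_distr)
  show "a \<odot>\<^bsub>V\<^esub> (u \<oplus>\<^bsub>V\<^esub> v) = a \<odot>\<^bsub>V\<^esub> u \<oplus>\<^bsub>V\<^esub> a \<odot>\<^bsub>V\<^esub> v"
    using * by (simp flip: q_add p_smult p_add add: M.smult_r_distr)
  show "(a \<otimes>\<^bsub>K\<^esub> b) \<odot>\<^bsub>V\<^esub> u = a \<odot>\<^bsub>V\<^esub> (b \<odot>\<^bsub>V\<^esub> u)"
    using * by (simp flip: q_mult p_smult p_add add: M.smult_assoc1)
next
  fix u assume "u \<in> carrier V"
  then obtain x where *: "x \<in> carrier M" "u = p x" using V_ex by metis
  then show "\<one>\<^bsub>K\<^esub> \<odot>\<^bsub>V\<^esub> u = u" by (simp flip: q_one p_smult)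
qed

lemma image_lspan: "set ws \<subseteq> carrier M \<Longrightarrow> p ` lspan R M ws = lspan K V (map p ws)"
proof (induction ws)
  case Nil then show ?case using p_zero by simp
next
  case (Cons w ws)
  have L: "subm R M (lspan R M ws)" by (rule M.subm_lspan) (use Cons in auto)
  have IH: "p ` lspan R M ws = lspan K V (map p ws)" using Cons by simp
  show ?case
  proof (intro equalityI subsetI)
    fix v assume "v \<in> p ` lspan R M (w # ws)"
    then obtain r s where *: "r \<in> carrier R" "s \<in> lspan R M ws" "v = p (r \<odot>\<^bsub>M\<^esub> w \<oplus>\<^bsub>M\<^esub> s)" by auto
    then have "v = q r \<odot>\<^bsub>V\<^esub> p w \<oplus>\<^bsub>V\<^esub> p s" using Cons subm_carr[OF L] by (simp add: p_add p_smult)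
    then show "v \<in> lspan K V (map p (w # ws))" using * IH q_carr by auto
  next
    fix v assume "v \<in> lspan K V (map p (w # ws))"
    then obtain a t where *: "a \<in> carrier K" "t \<in> lspan K V (map p ws)" "v = a \<odot>\<^bsub>V\<^esub> p w \<oplus>\<^bsub>V\<^esub> t" by auto
    obtain r where r: "r \<in> carrier R" "a = q r" using * K_ex by blast
    have "t \<in> p ` lspan R M ws" using * IH by simp
    then obtain s where s: "s \<in> lspan R M ws" "t = p s" by blast
    note rs = r s
    then have "v = p (r \<odot>\<^bsub>M\<^esub> w \<oplus>\<^bsub>M\<^esub> s)" using * Cons subm_carr[OF L] by (simp add: p_add p_smult)
    then show "v \<in> p ` lspan R M (w # ws)" using rs by auto
  qed
qed

end

context module
begin

lemma coset_eq_iff: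
  assumes "subm R M N" "x \<in> carrier M" "y \<in> carrier M"
  shows "N +>\<^bsub>M\<^esub> x = N +>\<^bsub>M\<^esub> y \<longleftrightarrow> x \<ominus>\<^bsub>M\<^esub> y \<in> N"
proof
  note Nc = subm_carr[OF assms(1)]
  assume "N +>\<^bsub>M\<^esub> x = N +>\<^bsub>M\<^esub> y"
  moreover have "x \<in> N +>\<^bsub>M\<^esub> x" using assms subm_zero[OF assms(1)] by (force simp: a_r_coset_def')
  ultimately obtain n where "n \<in> N" "x = n \<oplus>\<^bsub>M\<^esub> y" by (auto simp: a_r_coset_def')
  then show "x \<ominus>\<^bsub>M\<^esub> y \<in> N" using assms Nc by (simp add: a_minus_def M.a_assoc M.r_neg)
next
  note Nc = subm_carr[OF assms(1)]
  assume d: "x \<ominus>\<^bsub>M\<^esub> y \<in> N"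
  show "N +>\<^bsub>M\<^esub> x = N +>\<^bsub>M\<^esub> y"
  proof (intro equalityI subsetI)
    fix z assume "z \<in> N +>\<^bsub>M\<^esub> x"
    then obtain n where n: "n \<in> N" "z = n \<oplus>\<^bsub>M\<^esub> x" by (auto simp: a_r_coset_def')
    then have "z = (n \<oplus>\<^bsub>M\<^esub> (x \<ominus>\<^bsub>M\<^esub> y)) \<oplus>\<^bsub>M\<^esub> y" using Nc assms by (simp add: a_minus_def M.a_assoc M.l_neg)
    then show "z \<in> N +>\<^bsub>M\<^esub> y" using subm_add[OF assms(1) n(1) d] by (auto simp: a_r_coset_def')
  next
    fix z assume "z \<in> N +>\<^bsub>M\<^esub> y"
    then obtain n where n: "n \<in> N" "z = n \<oplus>\<^bsub>M\<^esub> y" by (auto simp: a_r_coset_def')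
    then have "z = (n \<oplus>\<^bsub>M\<^esub> \<ominus>\<^bsub>M\<^esub> (x \<ominus>\<^bsub>M\<^esub> y)) \<oplus>\<^bsub>M\<^esub> x"
      using Nc assms by (simp add: a_minus_def M.minus_add M.a_ac M.r_neg M.r_neg2 add_minus_cancel)
    then show "z \<in> N +>\<^bsub>M\<^esub> x"
      using subm_add[OF assms(1) n(1) subm_a_inv[OF assms(1) d]] by (auto simp: a_r_coset_def')
  qed
qed

lemma coset_self: "subm R M N \<Longrightarrow> x \<in> carrier M \<Longrightarrow> x \<in> N +>\<^bsub>M\<^esub> x"
  using subm_zero[of R M N] by (auto simp: a_r_coset_def' intro!: bexI[of _ "\<zero>\<^bsub>M\<^esub>"])

lemma coset_mem: "subm R M N \<Longrightarrow> x \<in> carrier M \<Longrightarrow> y \<in> N +>\<^bsub>M\<^esub> x \<Longrightarrow> y \<in> carrier M \<and> y \<ominus>\<^bsub>M\<^esub> x \<in> N"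
  using subm_carr[of R M N] by (auto simp: a_r_coset_def' a_minus_def M.a_assoc M.r_neg)

lemma coset_zero: "subm R M N \<Longrightarrow> N +>\<^bsub>M\<^esub> \<zero>\<^bsub>M\<^esub> = N"
  using subm_carr[of R M N] by (force simp: a_r_coset_def')

lemma coset_eq_self: "subm R M N \<Longrightarrow> x \<in> carrier M \<Longrightarrow> N +>\<^bsub>M\<^esub> x = N \<longleftrightarrow> x \<in> N"
  using coset_eq_iff[of N x "\<zero>\<^bsub>M\<^esub>"] coset_zero[of N] cong_mod_0[of x N] by (simp add: cong_mod_def)

lemma coset_add:
  assumes N: "subm R M N" "x \<in> carrier M" "y \<in> carrier M"
  shows "set_add M (N +>\<^bsub>M\<^esub> x) (N +>\<^bsub>M\<^esub> y) = N +>\<^bsub>M\<^esub> (x \<oplus>\<^bsub>M\<^esub> y)"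
proof (intro equalityI subsetI)
  note Nc = subm_carr[OF N(1)]
  fix z assume "z \<in> set_add M (N +>\<^bsub>M\<^esub> x) (N +>\<^bsub>M\<^esub> y)"
  then obtain n m where *: "n \<in> N" "m \<in> N" "z = (n \<oplus>\<^bsub>M\<^esub> x) \<oplus>\<^bsub>M\<^esub> (m \<oplus>\<^bsub>M\<^esub> y)" by (auto simp: a_r_coset_def' set_add_def')
  then have "z = (n \<oplus>\<^bsub>M\<^esub> m) \<oplus>\<^bsub>M\<^esub> (x \<oplus>\<^bsub>M\<^esub> y)" using Nc N by (simp add: M.a_ac)
  then show "z \<in> N +>\<^bsub>M\<^esub> (x \<oplus>\<^bsub>M\<^esub> y)" using subm_add[OF N(1) *(1,2)] by (auto simp: a_r_coset_def')
next
  note Nc = subm_carr[OF N(1)]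
  fix z assume "z \<in> N +>\<^bsub>M\<^esub> (x \<oplus>\<^bsub>M\<^esub> y)"
  then obtain n where *: "n \<in> N" "z = n \<oplus>\<^bsub>M\<^esub> (x \<oplus>\<^bsub>M\<^esub> y)" by (auto simp: a_r_coset_def')
  then have "z = (n \<oplus>\<^bsub>M\<^esub> x) \<oplus>\<^bsub>M\<^esub> y" using Nc N by (simp add: M.a_ac)
  moreover have "n \<oplus>\<^bsub>M\<^esub> x \<in> N +>\<^bsub>M\<^esub> x" using * by (auto simp: a_r_coset_def')
  ultimately show "z \<in> set_add M (N +>\<^bsub>M\<^esub> x) (N +>\<^bsub>M\<^esub> y)" using coset_self[OF N(1,3)] by (auto simp: set_add_def')
qed

lemma coset_smult:
  assumes N: "subm R M N" and r: "r \<in> carrier R" and x: "x \<in> carrier M"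
  shows "(\<Union>y\<in>N +>\<^bsub>M\<^esub> x. N +>\<^bsub>M\<^esub> (r \<odot>\<^bsub>M\<^esub> y)) = N +>\<^bsub>M\<^esub> (r \<odot>\<^bsub>M\<^esub> x)"
proof -
  have "N +>\<^bsub>M\<^esub> (r \<odot>\<^bsub>M\<^esub> y) = N +>\<^bsub>M\<^esub> (r \<odot>\<^bsub>M\<^esub> x)" if "y \<in> N +>\<^bsub>M\<^esub> x" for y
  proof -
    have "cong_mod M N y x" using coset_mem[OF N x that] x by (simp add: cong_mod_def)
    from cong_mod_smult[OF N r this] show ?thesis
      by (subst coset_eq_iff[OF N]) (simp_all add: cong_mod_def)
  qed
  then show ?thesis using coset_self[OF N x] by blast
qed

lemma quot_module_surj:
  assumes N: "subm R M N"
  shows "semilinear_surj R M R (quot_module M N) (\<lambda>a. a) (\<lambda>x. N +>\<^bsub>M\<^esub> x)"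
proof unfold_locales
  show "(\<lambda>x. N +>\<^bsub>M\<^esub> x) ` carrier M = carrier (quot_module M N)"
    by (auto simp: quot_module_def A_RCOSETS_def' )
qed (use N coset_add coset_smult coset_zero in \<open>auto simp: quot_module_def\<close>)

section \<open>Regular sequences and depth in terms of submodules\<close>

lemma nonzerodivisor_quot:
  assumes N: "subm R M N" and r: "r \<in> carrier R"
  shows "nonzerodivisor_on (quot_module M N) r \<longleftrightarrow> (\<forall>m\<in>carrier M. r \<odot>\<^bsub>M\<^esub> m \<in> N \<longrightarrow> m \<in> N)"
proof -
  interpret Q: semilinear_surj R M R "quot_module M N" "\<lambda>a. a" "\<lambda>x. N +>\<^bsub>M\<^esub> x" by (rule quot_module_surj[OF N])
  have z: "\<zero>\<^bsub>quot_module M N\<^esub> = N" by (simp add: quot_module_def)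
  have "nonzerodivisor_on (quot_module M N) r \<longleftrightarrow>
    (\<forall>m\<in>carrier M. r \<odot>\<^bsub>quot_module M N\<^esub> (N +>\<^bsub>M\<^esub> m) = N \<longrightarrow> N +>\<^bsub>M\<^esub> m = N)"
    unfolding nonzerodivisor_on_def z Q.p_surj[symmetric] by (simp only: ball_simps)
  also have "\<dots> \<longleftrightarrow> (\<forall>m\<in>carrier M. r \<odot>\<^bsub>M\<^esub> m \<in> N \<longrightarrow> m \<in> N)"
    using r by (intro ball_cong refl) (simp flip: Q.p_smult add: coset_eq_self[OF N])
  finally show ?thesis .
qed

lemma ideal_smult_subset: "I \<subseteq> carrier R \<Longrightarrow> {a \<odot>\<^bsub>M\<^esub> x | a x. a \<in> I \<and> x \<in> carrier M} \<subseteq> carrier M"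
  by auto

lemma subm_ideal_smult: "I \<subseteq> carrier R \<Longrightarrow> subm R M (ideal_smult R I M)"
  unfolding ideal_smult_def by (rule subm_span[OF ideal_smult_subset])

lemma ideal_smult_mem: "I \<subseteq> carrier R \<Longrightarrow> a \<in> I \<Longrightarrow> x \<in> carrier M \<Longrightarrow> a \<odot>\<^bsub>M\<^esub> x \<in> ideal_smult R I M"
  unfolding ideal_smult_def using span_superset[OF ideal_smult_subset] by blast

lemma ideal_smult_least:
  "subm R M N \<Longrightarrow> (\<And>a x. a \<in> I \<Longrightarrow> x \<in> carrier M \<Longrightarrow> a \<odot>\<^bsub>M\<^esub> x \<in> N) \<Longrightarrow> ideal_smult R I M \<subseteq> N"
  unfolding ideal_smult_def by (rule span_least) auto

lemma ideal_smult_genideal: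
  assumes "set rs \<subseteq> carrier R"
  shows "ideal_smult R (genideal R (set rs)) M = lcomb M (carrier M) rs"
proof
  have I: "ideal (Idl (set rs)) R" by (rule genideal_ideal[OF assms])
  note f = ideal_facts[OF I]
  have L: "subm R M (lcomb M (carrier M) rs)" by (rule subm_lcomb[OF assms subm_carrier])
  note Lc = subm_carr[OF L]
  show "lcomb M (carrier M) rs \<subseteq> ideal_smult R (Idl (set rs)) M"
    using genideal_self[OF assms] by (intro lcomb_least subm_ideal_smult ideal_smult_mem f) auto
  let ?K = "{a \<in> carrier R. \<forall>x\<in>carrier M. a \<odot>\<^bsub>M\<^esub> x \<in> lcomb M (carrier M) rs}"
  have "ideal ?K R"
  proof (rule idealI2)
    show "\<zero> \<in> ?K" using subm_zero[OF L] by auto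
    show "\<And>a b. a \<in> ?K \<Longrightarrow> b \<in> ?K \<Longrightarrow> a \<oplus> b \<in> ?K" using subm_add[OF L] by (auto simp: smult_l_distr)
    show "\<And>a b. a \<in> carrier R \<Longrightarrow> b \<in> ?K \<Longrightarrow> a \<otimes> b \<in> ?K" using subm_smult[OF L] by (auto simp: smult_assoc1)
  qed auto
  moreover have "set rs \<subseteq> ?K" using lcomb_mem[OF assms subm_carrier] assms by auto
  ultimately have "Idl (set rs) \<subseteq> ?K" by (rule genideal_minimal)
  then show "ideal_smult R (Idl (set rs)) M \<subseteq> lcomb M (carrier M) rs"
    by (intro ideal_smult_least[OF L]) auto
qed

lemma msum_assoc:
  assumes "A \<subseteq> carrier M" "B \<subseteq> carrier M" "C \<subseteq> carrier M"
  shows "msum M (msum M A B) C = msum M A (msum M B C)"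
proof (intro equalityI subsetI)
  fix x assume "x \<in> msum M (msum M A B) C"
  then obtain a b c where *: "a \<in> A" "b \<in> B" "c \<in> C" "x = a \<oplus>\<^bsub>M\<^esub> b \<oplus>\<^bsub>M\<^esub> c" by (auto simp: msum_def)
  then have "x = a \<oplus>\<^bsub>M\<^esub> (b \<oplus>\<^bsub>M\<^esub> c)" using assms by (simp add: M.a_assoc subset_iff)
  then show "x \<in> msum M A (msum M B C)" using * by (auto intro!: msumI)
next
  fix x assume "x \<in> msum M A (msum M B C)"
  then obtain a b c where *: "a \<in> A" "b \<in> B" "c \<in> C" "x = a \<oplus>\<^bsub>M\<^esub> (b \<oplus>\<^bsub>M\<^esub> c)" by (auto simp: msum_def)
  then have "x = a \<oplus>\<^bsub>M\<^esub> b \<oplus>\<^bsub>M\<^esub> c" using assms by (simp add: M.a_assoc subset_iff)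
  then show "x \<in> msum M (msum M A B) C" using * by (auto intro!: msumI)
qed

lemma msum_null: "A \<subseteq> carrier M \<Longrightarrow> msum M A {\<zero>\<^bsub>M\<^esub>} = A" "A \<subseteq> carrier M \<Longrightarrow> msum M {\<zero>\<^bsub>M\<^esub>} A = A"
  by (force simp: msum_def subset_iff)+

text \<open>\<open>regseq\<close> absorbs x M into the submodule at each step, while
  \<open>regular_sequence\<close> uses the ideals generated by initial segments. Unrolled, each
  condition is modulo N plus the product of an initial segment with M, by associativity of
  \<open>msum\<close>.\<close>

lemma regseq_iff:
  assumes "subm R M N" "set xs \<subseteq> carrier R"
  shows "regseq M N xs \<longleftrightarrow> (\<forall>i<length xs. \<forall>m\<in>carrier M.
    xs ! i \<odot>\<^bsub>M\<^esub> m \<in> msum M N (lcomb M (carrier M) (take i xs)) \<longrightarrow> m \<in> msum M N (lcomb M (carrier M) (take i xs)))"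
  using assms
proof (induction xs arbitrary: N)
  case (Cons x xs)
  have x: "x \<in> carrier R" "set xs \<subseteq> carrier R" using Cons.prems by auto
  let ?N' = "msum M N ((\<lambda>m. x \<odot>\<^bsub>M\<^esub> m) ` carrier M)"
  have N': "subm R M ?N'" by (rule subm_msum_image[OF Cons.prems(1) x(1)])
  have e: "msum M N (lcomb M (carrier M) (x # take i xs)) = msum M ?N' (lcomb M (carrier M) (take i xs))" for i
  proof -
    have "set (take i xs) \<subseteq> carrier R" using x(2) by (auto dest: in_set_takeD)
    then have s: "lcomb M (carrier M) (take i xs) \<subseteq> carrier M" using subm_lcomb[OF _ subm_carrier] subm_subset by blast
    have l: "lcomb M (carrier M) (x # take i xs) = msum M ((\<lambda>m. x \<odot>\<^bsub>M\<^esub> m) ` carrier M) (lcomb M (carrier M) (take i xs))"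
      by (auto simp: msum_def)
    show ?thesis unfolding l using subm_subset[OF Cons.prems(1)] s x(1) by (intro msum_assoc[symmetric]) auto
  qed
  have n: "msum M N (lcomb M (carrier M) []) = N" using msum_null[OF subm_subset[OF Cons.prems(1)]] by simp
  show ?case
    unfolding regseq.simps Cons.IH[OF N' x(2)] length_Cons All_less_Suc2
    by (simp add: e n del: lcomb.simps)
qed simp

lemma regular_sequence_iff:
  assumes "set rs \<subseteq> carrier R"
  shows "regular_sequence R M rs \<longleftrightarrow> regseq M {\<zero>\<^bsub>M\<^esub>} rs \<and> lcomb M (carrier M) rs \<noteq> carrier M"
proof -
  have t: "set (take i rs) \<subseteq> carrier R" for i using assms by (auto dest: in_set_takeD)
  have l: "subm R M (lcomb M (carrier M) (take i rs))" for i by (rule subm_lcomb[OF t subm_carrier])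
  show ?thesis
    unfolding regular_sequence_def regseq_iff[OF subm_null assms]
    using assms by (simp add: ideal_smult_genideal[OF t] ideal_smult_genideal[OF assms] nonzerodivisor_quot[OF l]
        msum_null[OF subm_subset[OF l]] subset_iff)
qed

lemma regseq_take: "regseq M N xs \<Longrightarrow> regseq M N (take n xs)"
  by (induction xs arbitrary: n N) (auto simp: take_Cons split: nat.split)

end

lemma (in module) depth_regseq:
  assumes "enat n \<le> depth R M" "carrier M \<noteq> {\<zero>\<^bsub>M\<^esub>}" "max_ideal R \<subseteq> carrier R"
  shows "\<exists>xs. length xs = n \<and> set xs \<subseteq> max_ideal R \<and> regseq M {\<zero>\<^bsub>M\<^esub>} xs"
proof (cases n)
  case 0 then show ?thesis by (intro exI[of _ "[]"]) auto
next
  case (Suc k)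
  let ?A = "{enat (length rs) | rs. set rs \<subseteq> max_ideal R \<and> regular_sequence R M rs}"
  have "\<exists>a\<in>?A. enat n \<le> a"
  proof (rule ccontr)
    assume neg: "\<not> (\<exists>a\<in>?A. enat n \<le> a)"
    have "Sup ?A \<le> enat k"
    proof (rule Sup_least)
      fix a assume "a \<in> ?A"
      then have "\<not> enat n \<le> a" using neg by blast
      then show "a \<le> enat k" using Suc by (cases a) auto
    qed
    moreover have "Sup ?A = depth R M" using assms(2) by (simp add: depth_def)
    ultimately have "enat n \<le> enat k" using assms(1) by (simp del: enat_ord_simps)
    then show False using Suc by simp
  qed
  then obtain rs where rs: "set rs \<subseteq> max_ideal R" "regular_sequence R M rs" "n \<le> length rs" by auto
  then have "regseq M {\<zero>\<^bsub>M\<^esub>} rs" using regular_sequence_iff[of rs] assms(3) by auto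
  then show ?thesis using rs by (intro exI[of _ "take n rs"]) (auto intro: regseq_take dest: in_set_takeD)
qed

lemma (in cring) ideal_generators_list:
  assumes "noetherian_ring R" "ideal I R"
  shows "\<exists>ys. set ys \<subseteq> I \<and> I = lspan R (ring_as_module R) ys"
proof -
  interpret RM: module R "ring_as_module R" by (rule module_ring_as_module)
  obtain A where A: "A \<subseteq> carrier R" "finite A" "I = Idl A"
    using noetherian_ring.finetely_gen[OF assms] by metis
  obtain ys where ys: "set ys = A" using finite_list[OF A(2)] ..
  have sub: "set ys \<subseteq> I" using genideal_self[OF A(1)] ys A by simp
  have c: "set ys \<subseteq> carrier (ring_as_module R)" using ys A by simp
  have L: "ideal (lspan R (ring_as_module R) ys) R" using RM.subm_lspan[OF c] subm_ring_iff by simp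
  have "I \<subseteq> lspan R (ring_as_module R) ys"
    unfolding A(3) using RM.lspan_superset[OF c] ys by (intro genideal_minimal[OF L]) simp
  moreover have "lspan R (ring_as_module R) ys \<subseteq> I"
    using sub assms(2) subm_ring_iff by (intro RM.lspan_least) auto
  ultimately show ?thesis using sub by (intro exI[of _ ys]) auto
qed

text \<open>The bound is the length of a list of generators of the maximal ideal. It makes dim R
  finite in \<open>dim_R\<close>, where the depth equals the dimension.\<close>

lemma (in local_module) depth_finite:
  assumes "carrier M \<noteq> {\<zero>\<^bsub>M\<^esub>}"
  shows "\<exists>k. depth R M \<le> enat k"
proof -
  obtain ys where ys: "set ys \<subseteq> \<mm>" "\<mm> = lspan R (ring_as_module R) ys"
    using ideal_generators_list[OF noetherian_ring_axioms max_ideal_ideal] by auto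
  have "length rs \<le> length ys" if "set rs \<subseteq> \<mm>" "regular_sequence R M rs" for rs
    using that max_ideal_carr assms ys
    by (intro regseq_length_le[OF _ that(1) ys(2,1) subm_null]) (auto simp: regular_sequence_iff subset_iff)
  then have "depth R M \<le> enat (length ys)"
    using assms unfolding depth_def by (auto intro!: Sup_least)
  then show ?thesis ..
qed

section \<open>Minimal numbers of generators\<close>

context local_module
begin

abbreviation "mM \<equiv> ideal_smult R \<mm> M"

lemma max_ideal_subset: "\<mm> \<subseteq> carrier R"
  using max_ideal_carr by auto

lemma subm_mM: "subm R M mM"
  by (rule subm_ideal_smult[OF max_ideal_subset])

lemma reduction_surj:
  "semilinear_surj R M (R Quot \<mm>) (reduction R \<mm> M) (\<lambda>a. \<mm> +> a) (\<lambda>x. mM +>\<^bsub>M\<^esub> x)"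
proof -
  interpret I: ideal "\<mm>" R by (rule max_ideal_ideal)
  interpret RM: module R "ring_as_module R" by (rule module_ring_as_module)
  have sI: "subm R (ring_as_module R) \<mm>" using max_ideal_ideal subm_ring_iff by simp
  interpret Q: cring "R Quot \<mm>" by (rule I.quotient_is_cring) (rule cring_axioms)
  show ?thesis
  proof unfold_locales
    show "(\<lambda>a. \<mm> +> a) ` carrier R = carrier (R Quot \<mm>)"
      by (auto simp: FactRing_def A_RCOSETS_def')
    show "(\<lambda>x. mM +>\<^bsub>M\<^esub> x) ` carrier M = carrier (reduction R \<mm> M)"
      by (auto simp: reduction_def Let_def A_RCOSETS_def')
    fix a b assume ab: "a \<in> carrier R" "b \<in> carrier R"
    show "\<mm> +> (a \<oplus> b) = (\<mm> +> a) \<oplus>\<^bsub>R Quot \<mm>\<^esub> (\<mm> +> b)"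
      using ab by (simp add: FactRing_def I.a_rcos_sum)
    show "\<mm> +> (a \<otimes> b) = (\<mm> +> a) \<otimes>\<^bsub>R Quot \<mm>\<^esub> (\<mm> +> b)"
      using ab by (simp add: FactRing_def I.rcoset_mult_add)
  next
    show "\<mm> +> \<one> = \<one>\<^bsub>R Quot \<mm>\<^esub>" by (simp add: FactRing_def)
    show "mM +>\<^bsub>M\<^esub> \<zero>\<^bsub>M\<^esub> = \<zero>\<^bsub>reduction R \<mm> M\<^esub>" using coset_zero[OF subm_mM] by (simp add: reduction_def Let_def)
    fix x y assume xy: "x \<in> carrier M" "y \<in> carrier M"
    show "mM +>\<^bsub>M\<^esub> (x \<oplus>\<^bsub>M\<^esub> y) = (mM +>\<^bsub>M\<^esub> x) \<oplus>\<^bsub>reduction R \<mm> M\<^esub> (mM +>\<^bsub>M\<^esub> y)"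
      using coset_add[OF subm_mM xy] by (simp add: reduction_def Let_def)
  next
    fix a x assume ax: "a \<in> carrier R" "x \<in> carrier M"
    have "mM +>\<^bsub>M\<^esub> (b \<odot>\<^bsub>M\<^esub> x) = mM +>\<^bsub>M\<^esub> (a \<odot>\<^bsub>M\<^esub> x)" if b: "b \<in> \<mm> +> a" for b
    proof -
      obtain c where c: "c \<in> \<mm>" "b = c \<oplus> a" using b by (auto simp: a_r_coset_def')
      have cc: "c \<in> carrier R" using c max_ideal_carr by auto
      have "b \<odot>\<^bsub>M\<^esub> x \<ominus>\<^bsub>M\<^esub> a \<odot>\<^bsub>M\<^esub> x = c \<odot>\<^bsub>M\<^esub> x"
        using c cc ax by (simp add: smult_l_distr a_minus_def M.a_assoc M.r_neg)
      then have "b \<odot>\<^bsub>M\<^esub> x \<ominus>\<^bsub>M\<^esub> a \<odot>\<^bsub>M\<^esub> x \<in> mM" using ideal_smult_mem[OF max_ideal_subset c(1) ax(2)] by simp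
      then show ?thesis using c cc ax by (subst coset_eq_iff[OF subm_mM]) auto
    qed
    moreover have "(\<Union>y\<in>mM +>\<^bsub>M\<^esub> x. mM +>\<^bsub>M\<^esub> (b \<odot>\<^bsub>M\<^esub> y)) = mM +>\<^bsub>M\<^esub> (b \<odot>\<^bsub>M\<^esub> x)" if "b \<in> \<mm> +> a" for b
    proof (rule coset_smult[OF subm_mM _ ax(2)])
      show "b \<in> carrier R" using that ax max_ideal_carr by (auto simp: a_r_coset_def')
    qed
    ultimately have e: "(\<Union>y\<in>mM +>\<^bsub>M\<^esub> x. mM +>\<^bsub>M\<^esub> (b \<odot>\<^bsub>M\<^esub> y)) = mM +>\<^bsub>M\<^esub> (a \<odot>\<^bsub>M\<^esub> x)"
      if "b \<in> \<mm> +> a" for b using that by simp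
    have "a \<in> \<mm> +> a" using RM.coset_self[OF sI] ax by (simp add: a_r_coset_def')
    then have "(\<Union>b\<in>\<mm> +> a. \<Union>y\<in>mM +>\<^bsub>M\<^esub> x. mM +>\<^bsub>M\<^esub> (b \<odot>\<^bsub>M\<^esub> y)) = mM +>\<^bsub>M\<^esub> (a \<odot>\<^bsub>M\<^esub> x)"
      by (intro SUP_eq_const e) auto
    then show "mM +>\<^bsub>M\<^esub> (a \<odot>\<^bsub>M\<^esub> x) = (\<mm> +> a) \<odot>\<^bsub>reduction R \<mm> M\<^esub> (mM +>\<^bsub>M\<^esub> x)"
      by (simp add: reduction_def Let_def)
  qed
qed

text \<open>The dimension of a vector space is the least size of a finite spanning set, so every
  list that generates M modulo \<mm> M bounds \<open>num_gens\<close>. Conversely, representatives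
  of a spanning set of least size generate M by Nakayama's lemma.\<close>

lemma num_gens_char:
  shows "\<exists>ws. length ws = num_gens R M \<and> set ws \<subseteq> carrier M \<and> carrier M = lspan R M ws"
    and "set ws \<subseteq> carrier M \<Longrightarrow> carrier M = msum M mM (lspan R M ws) \<Longrightarrow> num_gens R M \<le> length ws"
proof -
  let ?k = "R Quot \<mm>" and ?V = "reduction R \<mm> M" and ?p = "\<lambda>x. mM +>\<^bsub>M\<^esub> x"
  interpret V: semilinear_surj R M ?k ?V "\<lambda>a. \<mm> +> a" ?p by (rule reduction_surj)
  interpret VM: module ?k ?V by (rule V.module_V)
  have "vectorspace ?k ?V"
    unfolding vectorspace_def using maximalideal.quotient_is_field[OF max_ideal_maximal cring_axioms] VM.module_axioms by simp
  note dim = vectorspace.dim_def[OF this]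
  let ?P = "\<lambda>n. \<exists>A. finite A \<and> card A = n \<and> A \<subseteq> carrier ?V \<and> VM.span A = carrier ?V"
  have ng: "num_gens R M = (LEAST n. ?P n)" unfolding num_gens_def dim by simp
  have gen: "?P (card (set (map ?p ws)))" if ws: "set ws \<subseteq> carrier M" "carrier M = msum M mM (lspan R M ws)" for ws
  proof -
    have c: "set (map ?p ws) \<subseteq> carrier ?V" using ws V.p_carr by auto
    have L: "subm R M (lspan R M ws)" by (rule subm_lspan[OF ws(1)])
    have "VM.span (set (map ?p ws)) = ?p ` lspan R M ws"
      using VM.span_set_eq_lspan[OF c] V.image_lspan[OF ws(1)] by simp
    also have "\<dots> = carrier ?V"
    proof
      show "?p ` lspan R M ws \<subseteq> carrier ?V" using V.p_carr subm_carr[OF L] by auto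
      show "carrier ?V \<subseteq> ?p ` lspan R M ws"
      proof
        fix v assume "v \<in> carrier ?V"
        then obtain x where x: "x \<in> carrier M" "v = ?p x" using V.V_ex by auto
        then obtain n s where ns: "n \<in> mM" "s \<in> lspan R M ws" "x = n \<oplus>\<^bsub>M\<^esub> s" using ws(2) by (auto simp: msum_def)
        have c: "n \<in> carrier M" "s \<in> carrier M" using ns subm_carr[OF subm_mM] subm_carr[OF L] by auto
        then have "x \<ominus>\<^bsub>M\<^esub> s \<in> mM" using ns by (simp add: a_minus_def M.a_assoc M.r_neg)
        then have "?p x = ?p s" using coset_eq_iff[OF subm_mM x(1) c(2)] by simp
        then show "v \<in> ?p ` lspan R M ws" using x ns by auto
      qed
    qed
    finally show ?thesis using c by blast
  qed
  show "num_gens R M \<le> length ws" if "set ws \<subseteq> carrier M" "carrier M = msum M mM (lspan R M ws)"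
  proof -
    have "(LEAST n. ?P n) \<le> card (set (map ?p ws))" by (rule Least_le) (rule gen[OF that])
    also have "\<dots> \<le> length ws" using card_length[of "map ?p ws"] by simp
    finally show ?thesis by (simp add: ng)
  qed
  obtain ws0 where ws0: "set ws0 \<subseteq> carrier M" "carrier M = lspan R M ws0" using fg by (rule fgenE)
  have "carrier M = msum M mM (lspan R M ws0)"
    using ws0(2) msum_least[OF subm_carrier subm_subset[OF subm_mM] order_refl]
      subset_msum2[OF order_refl subm_zero[OF subm_mM]] by auto
  from gen[OF ws0(1) this] have "?P (num_gens R M)" unfolding ng by (rule LeastI)
  then obtain A where A: "finite A" "card A = num_gens R M" "A \<subseteq> carrier ?V" "VM.span A = carrier ?V" by blast
  obtain as where as: "set as = A" "length as = num_gens R M" using A finite_distinct_list distinct_card by metis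
  have "\<forall>v\<in>A. \<exists>x. x \<in> carrier M \<and> ?p x = v" using A(3) V.V_ex by blast
  then obtain g where g: "\<And>v. v \<in> A \<Longrightarrow> g v \<in> carrier M" "\<And>v. v \<in> A \<Longrightarrow> ?p (g v) = v" by metis
  let ?ws = "map g as"
  have ws: "set ?ws \<subseteq> carrier M" using g as by auto
  have pm: "map ?p ?ws = as" unfolding map_map by (rule map_idI) (use g as in auto)
  have L: "subm R M (lspan R M ?ws)" by (rule subm_lspan[OF ws])
  have im: "?p ` lspan R M ?ws = carrier ?V"
    using V.image_lspan[OF ws] VM.span_set_eq_lspan[of as] A as pm by simp
  \<comment> \<open>The lifts generate M modulo \<mm> M; this is put into the form that
    \<open>nakayama\<close> expects.\<close>
  have "carrier M \<subseteq> msum M (lspan R M ?ws) (lcomb M (carrier M) ys)" if ys: "set ys \<subseteq> \<mm>" "\<mm> = lspan R (ring_as_module R) ys" for ys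
  proof
    fix x assume x: "x \<in> carrier M"
    then have "?p x \<in> ?p ` lspan R M ?ws" using im V.p_carr by simp
    then obtain s where s: "s \<in> lspan R M ?ws" "?p x = ?p s" by blast
    have sc: "s \<in> carrier M" using s subm_carr[OF L] by auto
    have "x \<ominus>\<^bsub>M\<^esub> s \<in> mM" using coset_eq_iff[OF subm_mM x sc] s by simp
    moreover have "mM \<subseteq> lcomb M (carrier M) ys"
    proof -
      have c: "set ys \<subseteq> carrier R" using ys max_ideal_carr by auto
      have "Idl (set ys) = \<mm>"
      proof
        show "Idl (set ys) \<subseteq> \<mm>" by (rule genideal_minimal[OF max_ideal_ideal ys(1)])
        interpret RM: module R "ring_as_module R" by (rule module_ring_as_module)
        show "\<mm> \<subseteq> Idl (set ys)" 
          using genideal_self[OF c] genideal_ideal[OF c] subm_ring_iff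
          by (subst ys(2)) (intro RM.lspan_least, auto)
      qed
      then show ?thesis using ideal_smult_genideal[OF c] by simp
    qed
    ultimately have "s \<oplus>\<^bsub>M\<^esub> (x \<ominus>\<^bsub>M\<^esub> s) \<in> msum M (lspan R M ?ws) (lcomb M (carrier M) ys)"
      using s by (intro msumI) auto
    then show "x \<in> msum M (lspan R M ?ws) (lcomb M (carrier M) ys)"
      using x sc by (simp add: a_minus_def add_minus_cancel)
  qed
  moreover obtain ys where ys: "set ys \<subseteq> \<mm>" "\<mm> = lspan R (ring_as_module R) ys"
    using ideal_generators_list[OF noetherian_ring_axioms max_ideal_ideal] by auto
  ultimately have "carrier M \<subseteq> lspan R M ?ws" by (intro nakayama[OF L subm_carrier ys(1)]) auto
  then have "carrier M = lspan R M ?ws" using subm_subset[OF L] by auto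
  then show "\<exists>ws. length ws = num_gens R M \<and> set ws \<subseteq> carrier M \<and> carrier M = lspan R M ws"
    using ws as by (intro exI[of _ ?ws]) auto
qed

end

section \<open>Finite birational extensions\<close>

lemma fg_module_fgen: "fg_module R M \<Longrightarrow> module R M \<and> fgen R M (carrier M)"
proof
  assume fg: "fg_module R M"
  then show "module R M" by (simp add: fg_module_def)
  then interpret module R M .
  obtain X where X: "X \<subseteq> carrier M" "finite X" "span X = carrier M" using fg by (auto simp: fg_module_def)
  obtain ws where "set ws = X" using finite_list[OF X(2)] ..
  then show "fgen R M (carrier M)" using X span_set_eq_lspan[of ws] unfolding fgen_def by auto
qed

lemma (in module) diff_zero_iff:
  assumes "x \<in> carrier M" "y \<in> carrier M"
  shows "x \<ominus>\<^bsub>M\<^esub> y = \<zero>\<^bsub>M\<^esub> \<longleftrightarrow> x = y"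
proof
  assume e: "x \<ominus>\<^bsub>M\<^esub> y = \<zero>\<^bsub>M\<^esub>"
  have "x = (x \<ominus>\<^bsub>M\<^esub> y) \<oplus>\<^bsub>M\<^esub> y" using assms by (simp add: a_minus_def M.a_assoc M.l_neg)
  then show "x = y" using assms by (simp add: e)
qed (use assms in \<open>simp add: a_minus_def M.r_neg\<close>)

lemma (in module) fgen_fg_module: "fgen R M (carrier M) \<Longrightarrow> fg_module R M"
  unfolding fg_module_def
proof (elim fgenE, intro conjI module_axioms)
  fix ws assume ws: "set ws \<subseteq> carrier M" "carrier M = lspan R M ws"
  then have "span (set ws) = carrier M" using span_set_eq_lspan by simp
  then show "\<exists>X\<subseteq>carrier M. finite X \<and> span X = carrier M" using ws(1) by blast
qed

lemma Sup_chain_ge: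
  assumes "enat n \<le> Sup {enat k | k. P k}" "0 < n"
  shows "\<exists>k\<ge>n. P k"
proof (rule ccontr)
  assume neg: "\<not> ?thesis"
  have "Sup {enat k | k. P k} \<le> enat (n - 1)"
  proof (rule Sup_least)
    fix a assume "a \<in> {enat k | k. P k}"
    then obtain k where k: "a = enat k" "P k" by auto
    then have "\<not> n \<le> k" using neg by blast
    then show "a \<le> enat (n - 1)" using k by simp
  qed
  then have "enat n \<le> enat (n - 1)" using assms(1) order_trans by blast
  then show False using assms(2) by simp
qed

lemma prime_chain_le_dim: "prime_chain R C n \<Longrightarrow> enat n \<le> krull_dim R"
  unfolding krull_dim_def by (rule Sup_upper) auto

lemma prime_chain_append:
  assumes "prime_chain R C n" "prime_chain R D m" "C n = D 0"
  shows "prime_chain R (\<lambda>i. if i \<le> n then C i else D (i - n)) (n + m)"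
  unfolding prime_chain_def
proof (intro conjI allI impI)
  fix i assume "i \<le> n + m"
  then show "primeideal (if i \<le> n then C i else D (i - n)) R"
    using assms unfolding prime_chain_def by auto
next
  fix i assume i: "i < n + m"
  show "(if i \<le> n then C i else D (i - n)) \<subset> (if Suc i \<le> n then C (Suc i) else D (Suc i - n))"
  proof (cases "i < n")
    case True then show ?thesis using assms unfolding prime_chain_def by auto
  next
    case False
    then have "D (i - n) \<subset> D (Suc (i - n))" using assms(2) i unfolding prime_chain_def by auto
    moreover have "Suc (i - n) = Suc i - n" using False by simp
    ultimately show ?thesis using False assms(3) by (cases "i = n") auto
  qed
qed

locale S2_setting =
  fixes R K S :: "'a ring"
  assumes R_local: "local_ring R" and R_domain: "domain R"
    and frac: "fraction_field R K" and S2: "S2_ification R K S" and S_regular: "regular_local_ring S"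
begin

sublocale K: field K using frac unfolding fraction_field_def by blast
sublocale R: local_noeth R using local_noethI[OF R_local] .
sublocale S: local_noeth S using local_noethI S_regular by (auto simp: regular_local_ring_def)

section \<open>R and S as subrings of the field K\<close>

lemma R_eq: "R = K\<lparr>carrier := carrier R\<rparr>" using frac unfolding fraction_field_def by blast
lemma S_eq: "S = K\<lparr>carrier := carrier S\<rparr>" using S2 unfolding S2_ification_def by blast

text \<open>R, K and S share their operations and differ only in the carrier. Rewriting with these
  equations moves statements that mix R and S to K.\<close>

lemma R_ops: "monoid.mult R = monoid.mult K" "add R = add K" "\<one>\<^bsub>R\<^esub> = \<one>\<^bsub>K\<^esub>" "\<zero>\<^bsub>R\<^esub> = \<zero>\<^bsub>K\<^esub>"
  using arg_cong[OF R_eq, of monoid.mult] arg_cong[OF R_eq, of add] arg_cong[OF R_eq, of one] arg_cong[OF R_eq, of zero]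
  by simp_all

lemma S_ops: "monoid.mult S = monoid.mult K" "add S = add K" "\<one>\<^bsub>S\<^esub> = \<one>\<^bsub>K\<^esub>" "\<zero>\<^bsub>S\<^esub> = \<zero>\<^bsub>K\<^esub>"
  using arg_cong[OF S_eq, of monoid.mult] arg_cong[OF S_eq, of add] arg_cong[OF S_eq, of one] arg_cong[OF S_eq, of zero]
  by simp_all

lemma R_sub_S: "carrier R \<subseteq> carrier S" using S2 unfolding S2_ification_def by blast
lemma S_sub_K: "carrier S \<subseteq> carrier K"
proof -
  have "subring (carrier S) K" using S2 unfolding S2_ification_def by blast
  then show ?thesis by (rule subringE(1))
qed
lemma in_S: "x \<in> carrier R \<Longrightarrow> x \<in> carrier S" using R_sub_S by auto
lemma in_K: "x \<in> carrier S \<Longrightarrow> x \<in> carrier K" using S_sub_K by auto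

lemma S_closed: "x \<in> carrier S \<Longrightarrow> y \<in> carrier S \<Longrightarrow> x \<otimes>\<^bsub>K\<^esub> y \<in> carrier S"
  "x \<in> carrier S \<Longrightarrow> y \<in> carrier S \<Longrightarrow> x \<oplus>\<^bsub>K\<^esub> y \<in> carrier S" "\<zero>\<^bsub>K\<^esub> \<in> carrier S" "\<one>\<^bsub>K\<^esub> \<in> carrier S"
  using S.m_closed[of x y] S.a_closed[of x y] S.zero_closed S.one_closed by (simp_all add: S_ops)

lemma R_closed: "x \<in> carrier R \<Longrightarrow> y \<in> carrier R \<Longrightarrow> x \<otimes>\<^bsub>K\<^esub> y \<in> carrier R"
  "x \<in> carrier R \<Longrightarrow> y \<in> carrier R \<Longrightarrow> x \<oplus>\<^bsub>K\<^esub> y \<in> carrier R" "\<zero>\<^bsub>K\<^esub> \<in> carrier R" "\<one>\<^bsub>K\<^esub> \<in> carrier R"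
  using R.m_closed[of x y] R.a_closed[of x y] R.zero_closed R.one_closed by (simp_all add: R_ops)

lemma module_S: "module R (ring_as_module S)" "fgen R (ring_as_module S) (carrier S)"
proof -
  have "fg_module R (ring_as_module S)" using S2 unfolding S2_ification_def by blast
  from fg_module_fgen[OF this] show "module R (ring_as_module S)" "fgen R (ring_as_module S) (carrier S)" by auto
qed

sublocale SR: local_module R "ring_as_module S"
proof -
  interpret module R "ring_as_module S" by (rule module_S)
  show "local_module R (ring_as_module S)" by unfold_locales (simp add: module_S)
qed

lemma denominator:
  assumes "f \<in> carrier K"
  shows "\<exists>r\<in>carrier R. r \<noteq> \<zero>\<^bsub>K\<^esub> \<and> r \<otimes>\<^bsub>K\<^esub> f \<in> carrier R"
proof -
  obtain a b where "a \<in> carrier R" "b \<in> carrier R - {\<zero>\<^bsub>R\<^esub>}" "f = a \<otimes>\<^bsub>K\<^esub> inv\<^bsub>K\<^esub> b"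
    using frac assms unfolding fraction_field_def by blast
  then have ab: "a \<in> carrier R" "b \<in> carrier R" "b \<noteq> \<zero>\<^bsub>K\<^esub>" "f = a \<otimes>\<^bsub>K\<^esub> inv\<^bsub>K\<^esub> b"
    by (auto simp: R_ops)
  have c: "a \<in> carrier K" "b \<in> carrier K" using ab in_S in_K by auto
  have u: "b \<in> Units K" using c ab by (simp add: K.field_Units)
  have "b \<otimes>\<^bsub>K\<^esub> f = a \<otimes>\<^bsub>K\<^esub> (b \<otimes>\<^bsub>K\<^esub> inv\<^bsub>K\<^esub> b)" using ab c u by (simp add: K.m_lcomm)
  then have "b \<otimes>\<^bsub>K\<^esub> f = a" using c u by simp
  then show ?thesis using ab by auto
qed

text \<open>If an element r of the maximal ideal of R were a unit of S, then S = r S, and Nakayama's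
  lemma over R would give S = 0.\<close>

lemma max_R_sub_S: "max_ideal R \<subseteq> max_ideal S"
proof
  fix r assume r: "r \<in> max_ideal R"
  then have rR: "r \<in> carrier R" using R.max_ideal_carr by auto
  show "r \<in> max_ideal S"
  proof (rule ccontr)
    assume "r \<notin> max_ideal S"
    then have u: "r \<in> Units S" using S.unit_iff in_S[OF rR] by auto
    have "carrier S \<subseteq> msum (ring_as_module S) {\<zero>\<^bsub>S\<^esub>} (lcomb (ring_as_module S) (carrier S) [r])"
    proof
      fix s assume s: "s \<in> carrier S"
      have "r \<otimes>\<^bsub>S\<^esub> inv\<^bsub>S\<^esub> r \<otimes>\<^bsub>S\<^esub> s = r \<otimes>\<^bsub>S\<^esub> (inv\<^bsub>S\<^esub> r \<otimes>\<^bsub>S\<^esub> s)"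
        by (rule S.m_assoc) (use s u in auto)
      then have e: "r \<odot>\<^bsub>ring_as_module S\<^esub> (inv\<^bsub>S\<^esub> r \<otimes>\<^bsub>S\<^esub> s) = s" using s u by simp
      have "r \<odot>\<^bsub>ring_as_module S\<^esub> (inv\<^bsub>S\<^esub> r \<otimes>\<^bsub>S\<^esub> s) \<in> lcomb (ring_as_module S) (carrier S) [r]"
        by (rule SR.lcomb_mem[OF _ _ _]) (use rR s u SR.subm_carrier in auto)
      from msumI[of "\<zero>\<^bsub>S\<^esub>" "{\<zero>\<^bsub>S\<^esub>}", OF _ this[unfolded e], of "ring_as_module S"]
      show "s \<in> msum (ring_as_module S) {\<zero>\<^bsub>S\<^esub>} (lcomb (ring_as_module S) (carrier S) [r])"
        using s by simp
    qed
    then have "carrier S \<subseteq> {\<zero>\<^bsub>S\<^esub>}"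
      using SR.nakayama[of "{\<zero>\<^bsub>S\<^esub>}" "carrier S" "[r]"] SR.subm_null SR.subm_carrier r by simp
    then have "\<one>\<^bsub>K\<^esub> = \<zero>\<^bsub>K\<^esub>" using S_closed by (auto simp: S_ops)
    then show False by simp
  qed
qed

section \<open>Integrality of S over R and comparison of dimensions\<close>

text \<open>
  The values at \<open>q\<close> of the polynomials of degree less than \<open>n\<close> with coefficients in \<open>R\<close>.
\<close>

fun wpoly :: "'a \<Rightarrow> nat \<Rightarrow> 'a set" where
  "wpoly q 0 = {\<zero>\<^bsub>K\<^esub>}"
| "wpoly q (Suc n) = {q \<otimes>\<^bsub>K\<^esub> w \<oplus>\<^bsub>K\<^esub> r | w r. w \<in> wpoly q n \<and> r \<in> carrier R}"

lemma subm_wpoly: "q \<in> carrier S \<Longrightarrow> subm R (ring_as_module S) (wpoly q n)"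
proof (induction n)
  case 0 then show ?case using SR.subm_null by (simp add: S_ops)
next
  case (Suc n)
  then have IH: "subm R (ring_as_module S) (wpoly q n)" by simp
  have wc: "w \<in> carrier S" "w \<in> carrier K" if "w \<in> wpoly q n" for w using subm_carr[OF IH that] in_K by auto
  have q: "q \<in> carrier K" "q \<in> carrier S" using Suc in_K by auto
  show ?case
  proof (rule submI)
    show "wpoly q (Suc n) \<subseteq> carrier (ring_as_module S)" using wc q in_S S_closed by auto
    have "\<zero>\<^bsub>K\<^esub> = q \<otimes>\<^bsub>K\<^esub> \<zero>\<^bsub>K\<^esub> \<oplus>\<^bsub>K\<^esub> \<zero>\<^bsub>K\<^esub>" using q by simp
    then show "\<zero>\<^bsub>ring_as_module S\<^esub> \<in> wpoly q (Suc n)" using subm_zero[OF IH] R_closed(3) by (auto simp: S_ops)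
    fix x y assume "x \<in> wpoly q (Suc n)" "y \<in> wpoly q (Suc n)"
    then obtain w r v s where *: "w \<in> wpoly q n" "v \<in> wpoly q n" "r \<in> carrier R" "s \<in> carrier R" "x = q \<otimes>\<^bsub>K\<^esub> w \<oplus>\<^bsub>K\<^esub> r" "y = q \<otimes>\<^bsub>K\<^esub> v \<oplus>\<^bsub>K\<^esub> s" by auto
    have "x \<oplus>\<^bsub>K\<^esub> y = q \<otimes>\<^bsub>K\<^esub> (w \<oplus>\<^bsub>K\<^esub> v) \<oplus>\<^bsub>K\<^esub> (r \<oplus>\<^bsub>K\<^esub> s)"
      using * wc q in_S in_K by (simp add: K.r_distr K.a_ac)
    then show "x \<oplus>\<^bsub>ring_as_module S\<^esub> y \<in> wpoly q (Suc n)"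
      using subm_add[OF IH *(1,2)] R_closed(2)[OF *(3,4)] by (auto simp: S_ops)
  next
    fix a x assume a: "a \<in> carrier R" and "x \<in> wpoly q (Suc n)"
    then obtain w r where *: "w \<in> wpoly q n" "r \<in> carrier R" "x = q \<otimes>\<^bsub>K\<^esub> w \<oplus>\<^bsub>K\<^esub> r" by auto
    have "a \<otimes>\<^bsub>K\<^esub> x = q \<otimes>\<^bsub>K\<^esub> (a \<otimes>\<^bsub>K\<^esub> w) \<oplus>\<^bsub>K\<^esub> (a \<otimes>\<^bsub>K\<^esub> r)"
      using * wc q in_S in_K a by (simp add: K.r_distr K.m_lcomm)
    then show "a \<odot>\<^bsub>ring_as_module S\<^esub> x \<in> wpoly q (Suc n)"
      using subm_smult[OF IH a *(1)] R_closed(1)[OF a *(2)] by (auto simp: S_ops)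
  qed
qed

lemma wpoly_Suc: "q \<in> carrier S \<Longrightarrow> wpoly q n \<subseteq> wpoly q (Suc n)"
proof (induction n)
  case 0
  then have "\<zero>\<^bsub>K\<^esub> = q \<otimes>\<^bsub>K\<^esub> \<zero>\<^bsub>K\<^esub> \<oplus>\<^bsub>K\<^esub> \<zero>\<^bsub>K\<^esub>" using in_K by simp
  then show ?case using R_closed(3) by auto
next
  case (Suc n)
  then have "wpoly q n \<subseteq> wpoly q (Suc n)" by simp
  then show ?case by (subst wpoly.simps(2), subst wpoly.simps(2)) blast
qed

lemma wpoly_mono: "q \<in> carrier S \<Longrightarrow> m \<le> n \<Longrightarrow> wpoly q m \<subseteq> wpoly q n"
  by (rule lift_Suc_mono_le[of "wpoly q"]) (use wpoly_Suc in auto)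

lemma pow_in_wpoly: "q \<in> carrier S \<Longrightarrow> q [^]\<^bsub>K\<^esub> n \<in> wpoly q (Suc n)"
proof (induction n)
  case 0
  then have "\<one>\<^bsub>K\<^esub> = q \<otimes>\<^bsub>K\<^esub> \<zero>\<^bsub>K\<^esub> \<oplus>\<^bsub>K\<^esub> \<one>\<^bsub>K\<^esub>" using in_K by simp
  then show ?case using R_closed(4) by auto
next
  case (Suc n)
  then have "q [^]\<^bsub>K\<^esub> Suc n = q \<otimes>\<^bsub>K\<^esub> (q [^]\<^bsub>K\<^esub> n) \<oplus>\<^bsub>K\<^esub> \<zero>\<^bsub>K\<^esub>" using in_K by (simp add: K.m_comm)
  then show ?case using R_closed(3) Suc by (subst wpoly.simps(2)) blast
qed

text \<open>The sets \<open>wpoly q n\<close> increase with n, and their union is a submodule of the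
  finitely generated R-module S, hence equal to one of them. So q^n is the value of a polynomial of
  degree less than n.\<close>

lemma integral_over_R:
  assumes q: "q \<in> carrier S"
  shows "\<exists>n. \<exists>w\<in>wpoly q n. q [^]\<^bsub>K\<^esub> n \<oplus>\<^bsub>K\<^esub> w = \<zero>\<^bsub>K\<^esub>"
proof -
  let ?U = "\<Union>n. wpoly q n"
  note s = subm_wpoly[OF q]
  have Ui: "\<And>x n. x \<in> wpoly q n \<Longrightarrow> x \<in> ?U" by blast
  have "subm R (ring_as_module S) ?U"
  proof (rule submI)
    show "?U \<subseteq> carrier (ring_as_module S)" by (intro UN_least subm_subset[OF s])
    show "\<zero>\<^bsub>ring_as_module S\<^esub> \<in> ?U" by (rule Ui[OF subm_zero[OF s[of 0]]])
    fix x y assume "x \<in> ?U" "y \<in> ?U"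
    then obtain m n where "x \<in> wpoly q m" "y \<in> wpoly q n" by auto
    then have "x \<in> wpoly q (max m n)" "y \<in> wpoly q (max m n)" using wpoly_mono[OF q] by (meson max.cobounded1 max.cobounded2 subsetD)+
    then show "x \<oplus>\<^bsub>ring_as_module S\<^esub> y \<in> ?U" by (intro Ui[OF subm_add[OF s]])
  next
    fix r x assume r: "r \<in> carrier R" and "x \<in> ?U"
    then obtain n where "x \<in> wpoly q n" by auto
    then show "r \<odot>\<^bsub>ring_as_module S\<^esub> x \<in> ?U" by (intro Ui[OF subm_smult[OF s r]])
  qed
  from SR.fgen_subm[OF this] obtain vs where vs: "set vs \<subseteq> ?U" "?U = lspan R (ring_as_module S) vs" by (rule fgenE)
  have "\<exists>n. set ws \<subseteq> wpoly q n" if "set ws \<subseteq> ?U" for ws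
    using that
  proof (induction ws)
    case (Cons w ws)
    then obtain m n where "set ws \<subseteq> wpoly q n" "w \<in> wpoly q m" by auto
    then have "set (w # ws) \<subseteq> wpoly q (max m n)"
      using wpoly_mono[OF q max.cobounded1[of m n]] wpoly_mono[OF q max.cobounded2[of n m]] by auto
    then show ?case by blast
  qed simp
  from this[OF vs(1)] obtain n where "set vs \<subseteq> wpoly q n" by auto
  then have "lspan R (ring_as_module S) vs \<subseteq> wpoly q n" by (rule SR.lspan_least[OF s])
  then have U: "?U \<subseteq> wpoly q n" by (simp only: vs(2))
  have p: "q [^]\<^bsub>K\<^esub> n \<in> wpoly q n" using pow_in_wpoly[OF q] U by blast
  have pS: "q [^]\<^bsub>K\<^esub> n \<in> carrier S" using subm_carr[OF s p] by simp
  have "\<ominus>\<^bsub>ring_as_module S\<^esub> (q [^]\<^bsub>K\<^esub> n) \<in> wpoly q n" by (rule SR.subm_a_inv[OF s p])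
  moreover have "q [^]\<^bsub>K\<^esub> n \<oplus>\<^bsub>K\<^esub> \<ominus>\<^bsub>ring_as_module S\<^esub> (q [^]\<^bsub>K\<^esub> n) = \<zero>\<^bsub>K\<^esub>"
    using SR.M.r_neg[of "q [^]\<^bsub>K\<^esub> n"] pS by (simp add: S_ops)
  ultimately show ?thesis by blast
qed

lemma contraction_prime:
  assumes "primeideal P S" shows "primeideal (P \<inter> carrier R) R"
proof -
  interpret P: primeideal P S by fact
  note f = S.ideal_facts[OF P.is_ideal]
  have "ideal (P \<inter> carrier R) R"
  proof (rule R.idealI2)
    show "\<zero>\<^bsub>R\<^esub> \<in> P \<inter> carrier R" using f(2) by (simp add: R_ops S_ops R_closed)
    show "\<And>a b. a \<in> P \<inter> carrier R \<Longrightarrow> b \<in> P \<inter> carrier R \<Longrightarrow> a \<oplus>\<^bsub>R\<^esub> b \<in> P \<inter> carrier R"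
      using f(3) by (simp add: R_ops S_ops R_closed)
    show "\<And>r a. r \<in> carrier R \<Longrightarrow> a \<in> P \<inter> carrier R \<Longrightarrow> r \<otimes>\<^bsub>R\<^esub> a \<in> P \<inter> carrier R"
      using f(4) in_S by (simp add: R_ops S_ops R_closed)
  qed auto
  then show ?thesis
  proof (rule primeidealI)
    show "cring R" by (rule R.is_cring)
    have "\<one>\<^bsub>S\<^esub> \<notin> P" using P.I_notcarr ideal.one_imp_carrier[OF P.is_ideal] by auto
    then show "carrier R \<noteq> P \<inter> carrier R" using R_closed(4) by (auto simp: S_ops)
    fix a b assume "a \<in> carrier R" "b \<in> carrier R" "a \<otimes>\<^bsub>R\<^esub> b \<in> P \<inter> carrier R"
    then show "a \<in> P \<inter> carrier R \<or> b \<in> P \<inter> carrier R"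
      using P.I_prime[of a b] in_S by (auto simp: R_ops S_ops)
  qed
qed

text \<open>Incomparability for integral extensions. For q in Q outside P take a monic polynomial
  over R of least degree whose value at q lies in P. Its constant term r is in Q because q is. If r
  were in P, then q times the value of a monic polynomial of smaller degree would be in P, hence
  that value itself, as q is not in P.\<close>

lemma contraction_strict:
  assumes P: "primeideal P S" and Q: "primeideal Q S" and PQ: "P \<subset> Q"
  shows "P \<inter> carrier R \<subset> Q \<inter> carrier R"
proof -
  interpret P: primeideal P S by fact
  interpret Q: primeideal Q S by fact
  note fP = S.ideal_facts[OF P.is_ideal] and fQ = S.ideal_facts[OF Q.is_ideal]
  obtain q where q: "q \<in> Q" "q \<notin> P" using PQ by auto
  have qS: "q \<in> carrier S" using fQ q by auto
  note s = subm_wpoly[OF qS]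
  let ?E = "\<lambda>n. \<exists>w\<in>wpoly q n. q [^]\<^bsub>K\<^esub> n \<oplus>\<^bsub>K\<^esub> w \<in> P"
  have "\<exists>n. ?E n" using integral_over_R[OF qS] fP(2) by (metis S_ops(4))
  then have E: "?E (LEAST n. ?E n)" by (rule LeastI_ex)
  have min: "\<And>k. ?E k \<Longrightarrow> (LEAST n. ?E n) \<le> k" by (rule Least_le)
  obtain k where k: "(LEAST n. ?E n) = Suc k"
  proof (cases "LEAST n. ?E n")
    case 0
    then have "\<one>\<^bsub>S\<^esub> \<in> P" using E by (simp add: S_ops)
    then show ?thesis using P.I_notcarr ideal.one_imp_carrier[OF P.is_ideal] by auto
  qed
  obtain w r where w: "w \<in> wpoly q k" "r \<in> carrier R" "q [^]\<^bsub>K\<^esub> Suc k \<oplus>\<^bsub>K\<^esub> (q \<otimes>\<^bsub>K\<^esub> w \<oplus>\<^bsub>K\<^esub> r) \<in> P"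
    using E unfolding k by auto
  have pS: "q [^]\<^bsub>K\<^esub> k \<in> carrier S" using subm_carr[OF s pow_in_wpoly[OF qS]] by simp
  have wS: "w \<in> carrier S" using subm_carr[OF s w(1)] by simp
  let ?u = "q [^]\<^bsub>K\<^esub> k \<oplus>\<^bsub>K\<^esub> w"
  have uS: "?u \<in> carrier S" using pS wS S_closed by simp
  have e: "q [^]\<^bsub>K\<^esub> Suc k \<oplus>\<^bsub>K\<^esub> (q \<otimes>\<^bsub>K\<^esub> w \<oplus>\<^bsub>K\<^esub> r) = q \<otimes>\<^bsub>S\<^esub> ?u \<oplus>\<^bsub>S\<^esub> r"
    using in_K[OF qS] in_K[OF wS] in_K[OF pS] in_K[OF in_S[OF w(2)]] by (simp add: S_ops K.r_distr K.m_comm K.a_ac)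
  have rS: "r \<in> carrier S" using w in_S by auto
  have r': "(q \<otimes>\<^bsub>S\<^esub> ?u \<oplus>\<^bsub>S\<^esub> r) \<ominus>\<^bsub>S\<^esub> q \<otimes>\<^bsub>S\<^esub> ?u = r"
    using qS uS rS by (simp add: a_minus_def S.a_ac S.r_neg S.r_neg2 S.r_neg1)
  have "q \<otimes>\<^bsub>S\<^esub> ?u \<oplus>\<^bsub>S\<^esub> r \<in> Q" using w(3) PQ unfolding e by auto
  then have rQ: "r \<in> Q" using fQ(6)[of "q \<otimes>\<^bsub>S\<^esub> ?u \<oplus>\<^bsub>S\<^esub> r" "q \<otimes>\<^bsub>S\<^esub> ?u"] fQ(5)[OF uS q(1)] r' by simp
  have "r \<notin> P"
  proof
    assume rP: "r \<in> P"
    have "(q \<otimes>\<^bsub>S\<^esub> ?u \<oplus>\<^bsub>S\<^esub> r) \<ominus>\<^bsub>S\<^esub> r \<in> P" using fP(6)[OF _ rP] w(3) unfolding e by simp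
    moreover have "(q \<otimes>\<^bsub>S\<^esub> ?u \<oplus>\<^bsub>S\<^esub> r) \<ominus>\<^bsub>S\<^esub> r = q \<otimes>\<^bsub>S\<^esub> ?u"
      using qS uS rS by (simp add: a_minus_def S.a_assoc S.r_neg)
    ultimately have "?u \<in> P" using P.I_prime[OF qS uS] q by simp
    then have "?E k" using w(1) by blast
    then show False using min[of k] k by simp
  qed
  then show ?thesis using rQ w(2) PQ by blast
qed

lemma dim_S_le: "krull_dim S \<le> krull_dim R"
  unfolding krull_dim_def[of S]
proof (rule Sup_least)
  fix a assume "a \<in> {enat n | n. \<exists>C. prime_chain S C n}"
  then obtain n C where C: "a = enat n" "prime_chain S C n" by auto
  then have "prime_chain R (\<lambda>i. C i \<inter> carrier R) n"
    unfolding prime_chain_def using contraction_prime contraction_strict by simp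
  then show "a \<le> krull_dim R" using prime_chain_le_dim C by simp
qed

lemma lspan_carrier_update: "lspan A (M\<lparr>carrier := X\<rparr>) ws = lspan A M ws"
  by (induction ws) auto

text \<open>Regularity counts generators of the maximal ideal as a module of its own, given by a
  changed carrier. As \<open>lspan\<close> does not depend on the carrier of the module, they
  generate the ideal inside S as well.\<close>

lemma regular_generators:
  obtains ys where "set ys \<subseteq> max_ideal S" "max_ideal S = lspan S (ring_as_module S) ys" "enat (length ys) = krull_dim S"
proof -
  let ?M = "(ring_as_module S)\<lparr>carrier := max_ideal S\<rparr>"
  interpret SS: module S "ring_as_module S" by (rule S.module_ring_as_module)
  have "Module.submodule (max_ideal S) S (ring_as_module S)"
    using S.max_ideal_ideal by (simp add: SS.subm_iff S.subm_ring_iff)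
  then have mod: "module S ?M" using Module.submodule.submodule_is_module SS.module_axioms by blast
  obtain us where us: "set us \<subseteq> max_ideal S" "max_ideal S = lspan S (ring_as_module S) us"
    using S.ideal_generators_list[OF S.noetherian_ring_axioms S.max_ideal_ideal] by auto
  interpret MM: local_module S ?M
  proof -
    interpret module S ?M by (rule mod)
    have "fgen S ?M (carrier ?M)"
      unfolding fgen_def lspan_carrier_update using us by auto
    then show "local_module S ?M" by unfold_locales
  qed
  obtain ys where "length ys = num_gens S ?M" "set ys \<subseteq> carrier ?M" "carrier ?M = lspan S ?M ys"
    using MM.num_gens_char(1) by auto
  then show ?thesis using that[of ys] S_regular unfolding lspan_carrier_update by (simp add: regular_local_ring_def)
qed

end

section \<open>Maximal Cohen--Macaulay modules\<close>

text \<open>Used to regard a regular sequence from R on M as one on the S-module \<open>MS\<close>,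
  which differs from M only in the scalar multiplication.\<close>

lemma regseq_cong:
  assumes "carrier M = carrier M'" "add M = add M'"
    "\<And>x m. x \<in> set xs \<Longrightarrow> m \<in> carrier M \<Longrightarrow> x \<odot>\<^bsub>M\<^esub> m = x \<odot>\<^bsub>M'\<^esub> m"
  shows "regseq M N xs \<longleftrightarrow> regseq M' N xs"
  using assms(3)
proof (induction xs arbitrary: N)
  case (Cons x xs)
  have x: "\<And>m. m \<in> carrier M \<Longrightarrow> x \<odot>\<^bsub>M\<^esub> m = x \<odot>\<^bsub>M'\<^esub> m" using Cons by auto
  have im: "(\<lambda>m. x \<odot>\<^bsub>M\<^esub> m) ` carrier M = (\<lambda>m. x \<odot>\<^bsub>M'\<^esub> m) ` carrier M'"
    unfolding assms(1)[symmetric] by (rule image_cong[OF refl x])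
  have ms: "msum M A B = msum M' A B" for A B using assms(2) by (simp add: msum_def)
  have b: "(\<forall>m\<in>carrier M. x \<odot>\<^bsub>M\<^esub> m \<in> N \<longrightarrow> m \<in> N) \<longleftrightarrow> (\<forall>m\<in>carrier M'. x \<odot>\<^bsub>M'\<^esub> m \<in> N \<longrightarrow> m \<in> N)"
    unfolding assms(1)[symmetric] by (rule ball_cong[OF refl]) (simp add: x)
  show ?case unfolding regseq.simps im ms b using Cons by simp
qed simp

locale MCM_setting = S2_setting R K S for R K S :: "'a ring" +
  fixes M :: "('a, 'm) module"
  assumes MCM_M: "MCM R M"
begin

sublocale M: local_module R M
proof -
  have "module R M" "fgen R M (carrier M)" using MCM_M fg_module_fgen by (auto simp: MCM_def)
  interpret module R M by fact
  show "local_module R M" by unfold_locales fact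
qed

definition d :: nat where "d = the_enat (krull_dim R)"

lemma M_nonzero: "carrier M \<noteq> {\<zero>\<^bsub>M\<^esub>}" using MCM_M by (simp add: MCM_def)

lemma dim_R: "krull_dim R = enat d"
proof -
  obtain k where "depth R M \<le> enat k" using M.depth_finite[OF M_nonzero] by auto
  moreover have "depth R M = krull_dim R" using MCM_M by (simp add: MCM_def)
  ultimately show ?thesis unfolding d_def by (cases "krull_dim R") auto
qed

lemma chain_le_d: "prime_chain R C n \<Longrightarrow> n \<le> d"
  using prime_chain_le_dim[of R C n] dim_R by simp

lemma max_regseq: "\<exists>xs. length xs = d \<and> set xs \<subseteq> max_ideal R \<and> regseq M {\<zero>\<^bsub>M\<^esub>} xs"
proof (rule M.depth_regseq)
  show "enat d \<le> depth R M" using MCM_M dim_R by (simp add: MCM_def)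
qed (use M_nonzero R.max_ideal_carr in auto)

section \<open>Torsion freeness and the action of S on M\<close>

lemma torsion_free:
  assumes "r \<in> carrier R" "r \<noteq> \<zero>\<^bsub>R\<^esub>" "m \<in> carrier M" "r \<odot>\<^bsub>M\<^esub> m = \<zero>\<^bsub>M\<^esub>"
  shows "m = \<zero>\<^bsub>M\<^esub>"
proof (rule ccontr)
  assume "m \<noteq> \<zero>\<^bsub>M\<^esub>"
  obtain xs where xs: "length xs = d" "set xs \<subseteq> max_ideal R" "regseq M {\<zero>\<^bsub>M\<^esub>} xs" using max_regseq by auto
  have "\<exists>C. prime_chain R C (length xs) \<and> {r} \<subseteq> C 0"
    by (rule M.prime_chain_above_annihilator[OF xs(3,2) M.subm_null assms(3)]) (use assms \<open>m \<noteq> \<zero>\<^bsub>M\<^esub>\<close> in auto)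
  then obtain C where C: "prime_chain R C d" "r \<in> C 0" using xs by auto
  have p0: "primeideal {\<zero>\<^bsub>R\<^esub>} R" by (rule domain.zeroprimeideal[OF R_domain])
  have "ideal (C 0) R" using C by (simp add: prime_chain_def primeideal_def)
  \<comment> \<open>The chain of length \<open>d\<close> starts above the nonzero element
    \<open>r\<close>, so the zero ideal, a prime since \<open>R\<close> is a domain, fits strictly
    below it. This gives a chain longer than the dimension.\<close>
  then have "{\<zero>\<^bsub>R\<^esub>} \<subset> C 0" using C assms R.ideal_facts(2) by blast
  from chain_le_d[OF prime_chain_Cons[OF C(1) p0 this]] show False by simp
qed

lemma torsion_free_cancel:
  assumes "r \<in> carrier R" "r \<noteq> \<zero>\<^bsub>R\<^esub>" "m \<in> carrier M" "m' \<in> carrier M" "r \<odot>\<^bsub>M\<^esub> m = r \<odot>\<^bsub>M\<^esub> m'"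
  shows "m = m'"
proof -
  have "r \<odot>\<^bsub>M\<^esub> (m \<ominus>\<^bsub>M\<^esub> m') = \<zero>\<^bsub>M\<^esub>" using assms by (simp add: a_minus_def M.smult_r_distr M.smult_r_minus M.M.r_neg)
  then have "m \<ominus>\<^bsub>M\<^esub> m' = \<zero>\<^bsub>M\<^esub>" using torsion_free assms by simp
  then show ?thesis using assms by (simp add: M.diff_zero_iff)
qed

text \<open>The map r -> (r f) x is a homomorphism from the ideal (R : f) to M. Were it not a
  multiplication, a chain of length d - 1 would start at a prime above (R : f). The height of that
  prime is at least 2, so a chain of length at least 2 ends there, and the composed chain is longer
  than dim R.\<close>

lemma action_exists:
  assumes f: "f \<in> carrier S" and x: "x \<in> carrier M"
  shows "\<exists>m\<in>carrier M. \<forall>r\<in>carrier R. r \<otimes>\<^bsub>K\<^esub> f \<in> carrier R \<longrightarrow> r \<odot>\<^bsub>M\<^esub> m = (r \<otimes>\<^bsub>K\<^esub> f) \<odot>\<^bsub>M\<^esub> x"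
proof -
  let ?I = "{r \<in> carrier R. r \<otimes>\<^bsub>K\<^esub> f \<in> carrier R}"
  let ?\<phi> = "\<lambda>r. (r \<otimes>\<^bsub>K\<^esub> f) \<odot>\<^bsub>M\<^esub> x"
  have fK: "f \<in> carrier K" using f in_K by auto
  have RK: "r \<in> carrier K" if "r \<in> carrier R" for r using that in_S in_K by auto
  have I: "ideal ?I R"
  proof (rule R.idealI2)
    show "\<zero>\<^bsub>R\<^esub> \<in> ?I" using fK R_closed by (simp add: R_ops)
    show "\<And>a b. a \<in> ?I \<Longrightarrow> b \<in> ?I \<Longrightarrow> a \<oplus>\<^bsub>R\<^esub> b \<in> ?I" using fK RK R_closed by (simp add: R_ops K.l_distr)
    show "\<And>r a. r \<in> carrier R \<Longrightarrow> a \<in> ?I \<Longrightarrow> r \<otimes>\<^bsub>R\<^esub> a \<in> ?I" using fK RK R_closed by (simp add: R_ops K.m_assoc)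
  qed auto
  have hom: "hom_mod R M {\<zero>\<^bsub>M\<^esub>} ?I ?\<phi>"
    unfolding hom_mod_def
  proof (intro conjI ballI)
    show "?\<phi> \<in> ?I \<rightarrow> carrier M" using x by auto
    fix r s assume rs: "r \<in> ?I" "s \<in> ?I"
    then have "?\<phi> (r \<oplus>\<^bsub>R\<^esub> s) = ?\<phi> r \<oplus>\<^bsub>M\<^esub> ?\<phi> s"
      using M.smult_l_distr[of "r \<otimes>\<^bsub>K\<^esub> f" "s \<otimes>\<^bsub>K\<^esub> f" x] x fK RK by (simp add: R_ops K.l_distr)
    then show "cong_mod M {\<zero>\<^bsub>M\<^esub>} (?\<phi> (r \<oplus>\<^bsub>R\<^esub> s)) (?\<phi> r \<oplus>\<^bsub>M\<^esub> ?\<phi> s)"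
      using M.cong_mod_refl[OF M.subm_null] rs x by simp
  next
    fix a r assume ar: "a \<in> carrier R" "r \<in> ?I"
    then have "?\<phi> (a \<otimes>\<^bsub>R\<^esub> r) = a \<odot>\<^bsub>M\<^esub> ?\<phi> r"
      using M.smult_assoc1[of a "r \<otimes>\<^bsub>K\<^esub> f" x] x fK RK by (simp add: R_ops K.m_assoc)
    then show "cong_mod M {\<zero>\<^bsub>M\<^esub>} (?\<phi> (a \<otimes>\<^bsub>R\<^esub> r)) (a \<odot>\<^bsub>M\<^esub> ?\<phi> r)"
      using M.cong_mod_refl[OF M.subm_null] ar x by simp
  qed
  have "mult_mod M {\<zero>\<^bsub>M\<^esub>} ?I ?\<phi>"
  proof (rule ccontr)
    assume nm: "\<not> ?thesis"
    obtain xs where xs: "length xs = d" "set xs \<subseteq> max_ideal R" "regseq M {\<zero>\<^bsub>M\<^esub>} xs" using max_regseq by auto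
    obtain C where C: "prime_chain R C (d - 1)" "?I \<subseteq> C 0"
      using M.prime_chain_above_hom[OF xs(3,2) M.subm_null I hom nm] xs(1) by auto
    have "\<forall>f\<in>carrier S. height R {r \<in> carrier R. r \<otimes>\<^bsub>S\<^esub> f \<in> carrier R} \<ge> 2"
      using S2 unfolding S2_ification_def by (elim conjE)
    from bspec[OF this f] have "2 \<le> height R ?I" by (simp only: S_ops)
    also have "\<dots> \<le> prime_height R (C 0)"
      unfolding height_def using C by (intro Inf_lower) (auto simp: prime_chain_def)
    finally have "enat 2 \<le> Sup {enat n | n. \<exists>D. prime_chain R D n \<and> D n = C 0}"
      by (simp add: prime_height_def numeral_eq_enat)
    from Sup_chain_ge[OF this] obtain n D where D: "2 \<le> n" "prime_chain R D n" "D n = C 0" by auto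
    \<comment> \<open>This covers d = 0 as well: the truncation of d - 1 only lengthens the
      chain.\<close>
    from chain_le_d[OF prime_chain_append[OF D(2) C(1) D(3)]] D(1) show False by simp
  qed
  then obtain m where m: "m \<in> carrier M" "\<And>r. r \<in> ?I \<Longrightarrow> cong_mod M {\<zero>\<^bsub>M\<^esub>} (?\<phi> r) (r \<odot>\<^bsub>M\<^esub> m)"
    by (auto simp: mult_mod_def)
  have "r \<odot>\<^bsub>M\<^esub> m = (r \<otimes>\<^bsub>K\<^esub> f) \<odot>\<^bsub>M\<^esub> x" if "r \<in> carrier R" "r \<otimes>\<^bsub>K\<^esub> f \<in> carrier R" for r
    using m(2)[of r] that m(1) x by (auto simp: cong_mod_def M.diff_zero_iff)
  then show ?thesis by (intro bexI[OF _ m(1)] ballI impI)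
qed

text \<open>By torsion freeness the chosen element is the only one, and \<open>act_eqI\<close>
  recognizes it by a single nonzero denominator r of f.\<close>

definition act :: "'a \<Rightarrow> 'm \<Rightarrow> 'm" where
  "act f x = (SOME m. m \<in> carrier M \<and> (\<forall>r\<in>carrier R. r \<otimes>\<^bsub>K\<^esub> f \<in> carrier R \<longrightarrow> r \<odot>\<^bsub>M\<^esub> m = (r \<otimes>\<^bsub>K\<^esub> f) \<odot>\<^bsub>M\<^esub> x))"

lemma act:
  assumes "f \<in> carrier S" "x \<in> carrier M"
  shows "act f x \<in> carrier M" "\<And>r. r \<in> carrier R \<Longrightarrow> r \<otimes>\<^bsub>K\<^esub> f \<in> carrier R \<Longrightarrow> r \<odot>\<^bsub>M\<^esub> act f x = (r \<otimes>\<^bsub>K\<^esub> f) \<odot>\<^bsub>M\<^esub> x"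
proof -
  have "\<exists>m. m \<in> carrier M \<and> (\<forall>r\<in>carrier R. r \<otimes>\<^bsub>K\<^esub> f \<in> carrier R \<longrightarrow> r \<odot>\<^bsub>M\<^esub> m = (r \<otimes>\<^bsub>K\<^esub> f) \<odot>\<^bsub>M\<^esub> x)"
    using action_exists[OF assms] by (simp only: Bex_def)
  from someI_ex[OF this] show "act f x \<in> carrier M"
    "\<And>r. r \<in> carrier R \<Longrightarrow> r \<otimes>\<^bsub>K\<^esub> f \<in> carrier R \<Longrightarrow> r \<odot>\<^bsub>M\<^esub> act f x = (r \<otimes>\<^bsub>K\<^esub> f) \<odot>\<^bsub>M\<^esub> x"
    unfolding act_def by auto
qed

lemma act_eqI:
  assumes "f \<in> carrier S" "x \<in> carrier M" "m \<in> carrier M" "r \<in> carrier R" "r \<noteq> \<zero>\<^bsub>K\<^esub>" "r \<otimes>\<^bsub>K\<^esub> f \<in> carrier R"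
    "r \<odot>\<^bsub>M\<^esub> m = (r \<otimes>\<^bsub>K\<^esub> f) \<odot>\<^bsub>M\<^esub> x"
  shows "act f x = m"
  using torsion_free_cancel[of r "act f x" m] act[OF assms(1,2)] assms by (simp add: R_ops)

lemma common_denominator:
  assumes "f \<in> carrier S" "g \<in> carrier S"
  shows "\<exists>r\<in>carrier R. r \<noteq> \<zero>\<^bsub>K\<^esub> \<and> r \<otimes>\<^bsub>K\<^esub> f \<in> carrier R \<and> r \<otimes>\<^bsub>K\<^esub> g \<in> carrier R"
proof -
  have c: "f \<in> carrier K" "g \<in> carrier K" using assms in_K by auto
  obtain r s where rs: "r \<in> carrier R" "r \<noteq> \<zero>\<^bsub>K\<^esub>" "r \<otimes>\<^bsub>K\<^esub> f \<in> carrier R" "s \<in> carrier R" "s \<noteq> \<zero>\<^bsub>K\<^esub>" "s \<otimes>\<^bsub>K\<^esub> g \<in> carrier R"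
    using denominator c by metis
  have rsK: "r \<in> carrier K" "s \<in> carrier K" using rs in_S in_K by auto
  have "(r \<otimes>\<^bsub>K\<^esub> s) \<otimes>\<^bsub>K\<^esub> f = s \<otimes>\<^bsub>K\<^esub> (r \<otimes>\<^bsub>K\<^esub> f)" using rsK c by (simp add: K.m_ac)
  moreover have "(r \<otimes>\<^bsub>K\<^esub> s) \<otimes>\<^bsub>K\<^esub> g = r \<otimes>\<^bsub>K\<^esub> (s \<otimes>\<^bsub>K\<^esub> g)" using rsK c by (simp add: K.m_ac)
  moreover have "r \<otimes>\<^bsub>K\<^esub> s \<noteq> \<zero>\<^bsub>K\<^esub>" using rs rsK K.integral by blast
  ultimately show ?thesis using rs R_closed by (intro bexI[of _ "r \<otimes>\<^bsub>K\<^esub> s"]) auto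
qed

definition MS :: "('a, 'm) module" where "MS = M\<lparr>smult := act\<rparr>"

lemma MS_simps [simp]: "carrier MS = carrier M" "add MS = add M" "zero MS = zero M" "smult MS = act"
  by (simp_all add: MS_def)

lemma act_R: "r \<in> carrier R \<Longrightarrow> x \<in> carrier M \<Longrightarrow> act r x = r \<odot>\<^bsub>M\<^esub> x"
  using act_eqI[of r x "r \<odot>\<^bsub>M\<^esub> x" "\<one>\<^bsub>K\<^esub>"] in_S in_K R_closed M.smult_one[of "r \<odot>\<^bsub>M\<^esub> x"] by (simp add: R_ops)

text \<open>Each law is verified after multiplication by a common denominator r, which turns scalars
  from S into scalars from R and can be cancelled by torsion freeness.\<close>

lemma module_MS: "module S MS"
proof (rule moduleI)
  show "cring S" by (rule S.is_cring)
  show "abelian_group MS"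
    by (rule abelian_groupI) (auto simp: M.M.a_ac intro!: bexI[of _ "\<ominus>\<^bsub>M\<^esub> _"] M.M.l_neg)
  fix f g x y assume *: "f \<in> carrier S" "g \<in> carrier S" "x \<in> carrier MS" "y \<in> carrier MS"
  then have xy: "x \<in> carrier M" "y \<in> carrier M" by auto
  have c: "f \<in> carrier K" "g \<in> carrier K" using * in_K by auto
  obtain r where r: "r \<in> carrier R" "r \<noteq> \<zero>\<^bsub>K\<^esub>" "r \<otimes>\<^bsub>K\<^esub> f \<in> carrier R" "r \<otimes>\<^bsub>K\<^esub> g \<in> carrier R"
    using common_denominator *(1,2) by blast
  have rK: "r \<in> carrier K" using r in_S in_K by auto
  note af = act[OF *(1) xy(1)] and ag = act[OF *(2) xy(1)] and afy = act[OF *(1) xy(2)]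
  show "f \<odot>\<^bsub>MS\<^esub> x \<in> carrier MS" using af by simp
  have "act (f \<oplus>\<^bsub>K\<^esub> g) x = act f x \<oplus>\<^bsub>M\<^esub> act g x"
  proof (rule act_eqI[OF _ xy(1) _ r(1,2)])
    have e: "r \<otimes>\<^bsub>K\<^esub> (f \<oplus>\<^bsub>K\<^esub> g) = r \<otimes>\<^bsub>K\<^esub> f \<oplus>\<^bsub>K\<^esub> r \<otimes>\<^bsub>K\<^esub> g" using rK c by (simp add: K.r_distr)
    then show "r \<otimes>\<^bsub>K\<^esub> (f \<oplus>\<^bsub>K\<^esub> g) \<in> carrier R" using r R_closed by simp
    show "r \<odot>\<^bsub>M\<^esub> (act f x \<oplus>\<^bsub>M\<^esub> act g x) = (r \<otimes>\<^bsub>K\<^esub> (f \<oplus>\<^bsub>K\<^esub> g)) \<odot>\<^bsub>M\<^esub> x"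
      using e M.smult_l_distr[OF r(3,4) xy(1)] M.smult_r_distr[OF r(1) af(1) ag(1)] af(2) ag(2) r by (simp add: R_ops)
  qed (use * S_closed af ag in auto)
  then show "(f \<oplus>\<^bsub>S\<^esub> g) \<odot>\<^bsub>MS\<^esub> x = f \<odot>\<^bsub>MS\<^esub> x \<oplus>\<^bsub>MS\<^esub> g \<odot>\<^bsub>MS\<^esub> x" by (simp add: S_ops)
  have "act f (x \<oplus>\<^bsub>M\<^esub> y) = act f x \<oplus>\<^bsub>M\<^esub> act f y"
  proof (rule act_eqI[OF *(1) _ _ r(1,2,3)])
    show "r \<odot>\<^bsub>M\<^esub> (act f x \<oplus>\<^bsub>M\<^esub> act f y) = (r \<otimes>\<^bsub>K\<^esub> f) \<odot>\<^bsub>M\<^esub> (x \<oplus>\<^bsub>M\<^esub> y)"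
      using M.smult_r_distr[OF r(1) af(1) afy(1)] M.smult_r_distr[OF r(3) xy] af(2) afy(2) r by simp
  qed (use xy af afy in auto)
  then show "f \<odot>\<^bsub>MS\<^esub> (x \<oplus>\<^bsub>MS\<^esub> y) = f \<odot>\<^bsub>MS\<^esub> x \<oplus>\<^bsub>MS\<^esub> f \<odot>\<^bsub>MS\<^esub> y" by simp
  have agf: "act f (act g x) \<in> carrier M" using act[OF *(1) ag(1)] by simp
  have "act (f \<otimes>\<^bsub>K\<^esub> g) x = act f (act g x)"
  \<comment> \<open>Each of the two factors of the product consumes one denominator, hence r
    twice.\<close>
  proof (rule act_eqI[OF _ xy(1) agf, of _ "r \<otimes>\<^bsub>K\<^esub> r"])
    have e: "(r \<otimes>\<^bsub>K\<^esub> r) \<otimes>\<^bsub>K\<^esub> (f \<otimes>\<^bsub>K\<^esub> g) = (r \<otimes>\<^bsub>K\<^esub> f) \<otimes>\<^bsub>K\<^esub> (r \<otimes>\<^bsub>K\<^esub> g)" using rK c by (simp add: K.m_ac)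
    then show "(r \<otimes>\<^bsub>K\<^esub> r) \<otimes>\<^bsub>K\<^esub> (f \<otimes>\<^bsub>K\<^esub> g) \<in> carrier R" using r R_closed by simp
    show "r \<otimes>\<^bsub>K\<^esub> r \<noteq> \<zero>\<^bsub>K\<^esub>" using rK r K.integral by blast
    have "(r \<otimes>\<^bsub>K\<^esub> r) \<odot>\<^bsub>M\<^esub> act f (act g x) = r \<odot>\<^bsub>M\<^esub> (r \<odot>\<^bsub>M\<^esub> act f (act g x))"
      using M.smult_assoc1[OF r(1,1) agf] by (simp add: R_ops)
    also have "\<dots> = r \<odot>\<^bsub>M\<^esub> ((r \<otimes>\<^bsub>K\<^esub> f) \<odot>\<^bsub>M\<^esub> act g x)" using act(2)[OF *(1) ag(1) r(1,3)] by simp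
    also have "\<dots> = (r \<otimes>\<^bsub>K\<^esub> f) \<odot>\<^bsub>M\<^esub> (r \<odot>\<^bsub>M\<^esub> act g x)"
      using M.smult_assoc1[OF r(1,3) ag(1)] M.smult_assoc1[OF r(3,1) ag(1)] R.m_comm[OF r(1,3)] by simp
    also have "\<dots> = ((r \<otimes>\<^bsub>K\<^esub> f) \<otimes>\<^bsub>K\<^esub> (r \<otimes>\<^bsub>K\<^esub> g)) \<odot>\<^bsub>M\<^esub> x"
      using ag(2)[OF r(1,4)] M.smult_assoc1[OF r(3,4) xy(1)] by (simp add: R_ops)
    finally show "(r \<otimes>\<^bsub>K\<^esub> r) \<odot>\<^bsub>M\<^esub> act f (act g x) = ((r \<otimes>\<^bsub>K\<^esub> r) \<otimes>\<^bsub>K\<^esub> (f \<otimes>\<^bsub>K\<^esub> g)) \<odot>\<^bsub>M\<^esub> x" using e by simp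
  qed (use * S_closed r R_closed in auto)
  then show "(f \<otimes>\<^bsub>S\<^esub> g) \<odot>\<^bsub>MS\<^esub> x = f \<odot>\<^bsub>MS\<^esub> (g \<odot>\<^bsub>MS\<^esub> x)" by (simp add: S_ops)
next
  fix x assume "x \<in> carrier MS"
  then show "\<one>\<^bsub>S\<^esub> \<odot>\<^bsub>MS\<^esub> x = x" using act_R[of "\<one>\<^bsub>R\<^esub>" x] by (simp add: R_ops S_ops R_closed) (simp flip: R_ops)
qed

text \<open>\<open>act\<close> extends the multiplication by R, so generators and regular sequences
  over R carry over to the S-module \<open>MS\<close>, and an isomorphism over S is also one over R.
  The number of summands is positive because M is nonzero.\<close>

lemma M_free: "\<exists>h\<ge>1. module_iso R M (power_module (ring_as_module S) h)"
proof -
  interpret MS: module S MS by (rule module_MS)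
  obtain ws where ws: "set ws \<subseteq> carrier M" "carrier M = lspan R M ws" using M.fg by (rule fgenE)
  have "lspan R M ws' \<subseteq> lspan S MS ws'" if "set ws' \<subseteq> carrier M" for ws'
    using that
  proof (induction ws')
    case (Cons w ws')
    show ?case
    proof
      fix x assume "x \<in> lspan R M (w # ws')"
      then obtain r s where "r \<in> carrier R" "s \<in> lspan R M ws'" "x = r \<odot>\<^bsub>M\<^esub> w \<oplus>\<^bsub>M\<^esub> s" by auto
      then show "x \<in> lspan S MS (w # ws')" using Cons act_R in_S by (auto intro!: exI[of _ r])
    qed
  qed simp
  from this[OF ws(1)] have "carrier M \<subseteq> lspan S MS ws" by (simp only: ws(2)[symmetric])
  moreover have "lspan S MS ws \<subseteq> carrier MS" by (rule subm_subset[OF MS.subm_lspan]) (simp add: ws(1))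
  ultimately have "carrier MS = lspan S MS ws" by (simp only: MS_simps subset_antisym)
  then have "fgen S MS (carrier MS)" unfolding fgen_def using ws(1) by auto
  then interpret MS: local_module S MS by unfold_locales
  obtain ys where ys: "set ys \<subseteq> max_ideal S" "max_ideal S = lspan S (ring_as_module S) ys" "enat (length ys) = krull_dim S"
    by (rule regular_generators)
  obtain xs where xs: "length xs = d" "set xs \<subseteq> max_ideal R" "regseq M {\<zero>\<^bsub>M\<^esub>} xs" using max_regseq by auto
  \<comment> \<open>Since dim S \<le> dim R, the regular sequence of length \<open>d\<close> can be
    cut to the number of generators of the maximal ideal of S; \<open>free_of_maximal_depth\<close>
    needs equal lengths.\<close>
  have len: "length ys \<le> d" using dim_S_le unfolding ys(3)[symmetric] dim_R by simp
  let ?xs = "take (length ys) xs"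
  have "regseq M {\<zero>\<^bsub>M\<^esub>} ?xs" by (rule M.regseq_take[OF xs(3)])
  moreover have "regseq M {\<zero>\<^bsub>M\<^esub>} ?xs \<longleftrightarrow> regseq MS {\<zero>\<^bsub>M\<^esub>} ?xs"
    by (rule regseq_cong) (use xs R.max_ideal_carr act_R in \<open>auto dest!: in_set_takeD\<close>)
  ultimately have reg: "regseq MS {\<zero>\<^bsub>MS\<^esub>} ?xs" by simp
  have "set ?xs \<subseteq> max_ideal S" using xs max_R_sub_S by (auto dest!: in_set_takeD)
  then obtain n f where f: "f \<in> module_hom S (power_module (ring_as_module S) n) MS"
    "bij_betw f (carrier (power_module (ring_as_module S) n)) (carrier MS)"
    using MS.free_of_maximal_depth[OF reg _ ys(2,1)] xs(1) len by auto
  let ?F = "power_module (ring_as_module S) n"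
  interpret SS: module S "ring_as_module S" by (rule S.module_ring_as_module)
  interpret F: module S ?F by (rule SS.module_power_module)
  let ?g = "the_inv_into (carrier ?F) f"
  have inj: "inj_on f (carrier ?F)" and im: "f ` carrier ?F = carrier M" using f(2) by (auto simp: bij_betw_def)
  have g: "?g x \<in> carrier ?F" "f (?g x) = x" if "x \<in> carrier M" for x
    using the_inv_into_into[OF inj _ order_refl, of x] f_the_inv_into_f[OF inj, of x] that im by auto
  have gf: "?g (f a) = a" if "a \<in> carrier ?F" for a using the_inv_into_f_f[OF inj that] .
  have "?g \<in> module_hom R M ?F"
    unfolding module_hom_def mem_Collect_eq
  proof (intro conjI allI impI)
    show "?g \<in> carrier M \<rightarrow> carrier ?F" using g by blast
    fix x y assume xy: "x \<in> carrier M \<and> y \<in> carrier M"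
    have "f (?g x \<oplus>\<^bsub>?F\<^esub> ?g y) = x \<oplus>\<^bsub>M\<^esub> y" using module_hom_add[OF f(1) g(1) g(1)] g(2) xy by simp
    then show "?g (x \<oplus>\<^bsub>M\<^esub> y) = ?g x \<oplus>\<^bsub>?F\<^esub> ?g y" using gf[of "?g x \<oplus>\<^bsub>?F\<^esub> ?g y"] F.M.a_closed g(1) xy by metis
  next
    fix r x assume rx: "r \<in> carrier R \<and> x \<in> carrier M"
    have "f (r \<odot>\<^bsub>?F\<^esub> ?g x) = r \<odot>\<^bsub>M\<^esub> x" using module_hom_smult[OF f(1) _ g(1), of r x] g(2) rx in_S act_R by simp
    then show "?g (r \<odot>\<^bsub>M\<^esub> x) = r \<odot>\<^bsub>?F\<^esub> ?g x" using gf[of "r \<odot>\<^bsub>?F\<^esub> ?g x"] F.smult_closed g(1) rx in_S by metis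
  qed
  moreover have "bij_betw ?g (carrier M) (carrier ?F)" using bij_betw_the_inv_into[OF f(2)] by simp
  ultimately have iso: "module_iso R M ?F" unfolding module_iso_def by blast
  have "n \<noteq> 0"
  proof
    assume "n = 0"
    then have "carrier ?F = {\<zero>\<^bsub>?F\<^esub>}" by auto
    then have "carrier M = {f \<zero>\<^bsub>?F\<^esub>}" using im by simp
    then show False using M_nonzero M.M.zero_closed by auto
  qed
  then show ?thesis using iso by (intro exI[of _ n]) auto
qed

end

section \<open>Lengths of intervals of submodules\<close>

definition subm_chain :: "('a, 'b) ring_scheme \<Rightarrow> ('a, 'm, 'c) module_scheme \<Rightarrow> 'm set \<Rightarrow> 'm set \<Rightarrow> (nat \<Rightarrow> 'm set) \<Rightarrow> nat \<Rightarrow> bool" where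
  "subm_chain R M A B C n \<longleftrightarrow> (\<forall>i\<le>n. subm R M (C i)) \<and> (\<forall>i<n. C i \<subset> C (Suc i)) \<and> A \<subseteq> C 0 \<and> C n \<subseteq> B"

text \<open>
  The length of \<open>B / A\<close>, in terms of the submodules of \<open>M\<close> between \<open>A\<close> and \<open>B\<close>.
\<close>

definition has_len :: "('a, 'b) ring_scheme \<Rightarrow> ('a, 'm, 'c) module_scheme \<Rightarrow> 'm set \<Rightarrow> 'm set \<Rightarrow> nat \<Rightarrow> bool" where
  "has_len R M A B k \<longleftrightarrow> (\<exists>C. subm_chain R M A B C k) \<and> (\<forall>C n. subm_chain R M A B C n \<longrightarrow> n \<le> k)"

lemma has_len_unique: "has_len R M A B k \<Longrightarrow> has_len R M A B l \<Longrightarrow> k = l"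
  unfolding has_len_def by (meson order_antisym)

lemma has_len_le: "has_len R M A B k \<Longrightarrow> subm_chain R M A B C n \<Longrightarrow> n \<le> k"
  unfolding has_len_def by blast

lemma chain_weaken: "subm_chain R M A B C n \<Longrightarrow> A' \<subseteq> A \<Longrightarrow> B \<subseteq> B' \<Longrightarrow> subm_chain R M A' B' C n"
  unfolding subm_chain_def by (meson order_trans)

lemma chain_mono: "subm_chain R M A B C n \<Longrightarrow> i \<le> j \<Longrightarrow> j \<le> n \<Longrightarrow> C i \<subseteq> C j"
proof (induction j)
  case (Suc j)
  show ?case
  proof (cases "i = Suc j")
    case False
    then have "C i \<subseteq> C j" using Suc by auto
    moreover have "C j \<subset> C (Suc j)" using Suc by (auto simp: subm_chain_def)
    ultimately show ?thesis by blast
  qed simp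
qed simp

lemma (in module) module_length_eq:
  assumes "has_len R M {\<zero>\<^bsub>M\<^esub>} (carrier M) k"
  shows "module_length R M = enat k"
proof -
  have iff: "(\<exists>C. (\<forall>i\<le>n. Module.submodule (C i) R M) \<and> (\<forall>i<n. C i \<subset> C (Suc i))) \<longleftrightarrow>
    (\<exists>C. subm_chain R M {\<zero>\<^bsub>M\<^esub>} (carrier M) C n)" for n
  proof -
    have "(\<forall>i\<le>n. subm R M (C i)) \<and> (\<forall>i<n. C i \<subset> C (Suc i)) \<longleftrightarrow> subm_chain R M {\<zero>\<^bsub>M\<^esub>} (carrier M) C n" for C
      using subm_zero[of R M "C 0"] subm_subset[of R M "C n"] by (auto simp: subm_chain_def)
    then show ?thesis unfolding subm_iff by simp
  qed
  show ?thesis unfolding module_length_def iff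
  proof (rule antisym)
    show "Sup {enat n | n. \<exists>C. subm_chain R M {\<zero>\<^bsub>M\<^esub>} (carrier M) C n} \<le> enat k"
      using assms by (intro Sup_least) (auto simp: has_len_def)
    show "enat k \<le> Sup {enat n | n. \<exists>C. subm_chain R M {\<zero>\<^bsub>M\<^esub>} (carrier M) C n}"
      using assms by (intro Sup_upper) (auto simp: has_len_def)
  qed
qed

lemma has_len_refl: "subm R M A \<Longrightarrow> has_len R M A A 0"
  unfolding has_len_def
proof (intro conjI allI impI)
  assume A: "subm R M A"
  show "\<exists>C. subm_chain R M A A C 0" by (rule exI[of _ "\<lambda>_. A"]) (simp add: subm_chain_def A)
  fix C n assume c: "subm_chain R M A A C n"
  show "n \<le> 0"
  proof (rule ccontr)
    assume "\<not> n \<le> 0"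
    then have "C 0 \<subset> C 1" "C 1 \<subseteq> C n" using c chain_mono[OF c, of 1 n] by (auto simp: subm_chain_def)
    then show False using c by (auto simp: subm_chain_def)
  qed
qed

text \<open>Deletes the repetitions from a weakly increasing chain; the cardinality counts the
  strict steps that remain.\<close>

lemma strictify_chain:
  assumes "\<And>i. i \<le> n \<Longrightarrow> subm R M (E i)" "\<And>i. i < n \<Longrightarrow> E i \<subseteq> E (Suc i)"
  shows "\<exists>C. subm_chain R M (E 0) (E n) C (card {i. i < n \<and> E i \<noteq> E (Suc i)}) \<and> C (card {i. i < n \<and> E i \<noteq> E (Suc i)}) = E n"
  using assms
proof (induction n)
  case 0 then show ?case by (intro exI[of _ "\<lambda>_. E 0"]) (simp add: subm_chain_def)
next
  case (Suc n)
  let ?k = "card {i. i < n \<and> E i \<noteq> E (Suc i)}"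
  obtain C where C: "subm_chain R M (E 0) (E n) C ?k" "C ?k = E n" using Suc by auto
  show ?case
  proof (cases "E n = E (Suc n)")
    case True
    then have "{i. i < Suc n \<and> E i \<noteq> E (Suc i)} = {i. i < n \<and> E i \<noteq> E (Suc i)}" by (auto simp: less_Suc_eq)
    then show ?thesis using C True by auto
  next
    case False
    then have "{i. i < Suc n \<and> E i \<noteq> E (Suc i)} = insert n {i. i < n \<and> E i \<noteq> E (Suc i)}" by (auto simp: less_Suc_eq)
    then have card: "card {i. i < Suc n \<and> E i \<noteq> E (Suc i)} = Suc ?k" by simp
    have "E n \<subset> E (Suc n)" using False Suc.prems(2)[of n] by auto
    then have "subm_chain R M (E 0) (E (Suc n)) (C(Suc ?k := E (Suc n))) (Suc ?k)"
      using C Suc.prems(1)[of "Suc n"] unfolding subm_chain_def by (auto simp: le_Suc_eq less_Suc_eq)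
    moreover define C' where "C' = C(Suc ?k := E (Suc n))"
    ultimately have "subm_chain R M (E 0) (E (Suc n)) C' (Suc ?k)" "C' (Suc ?k) = E (Suc n)" by simp_all
    then show ?thesis unfolding card by blast
  qed
qed

lemma (in module) subm_Int: "subm R M A \<Longrightarrow> subm R M B \<Longrightarrow> subm R M (A \<inter> B)"
  by (auto simp: subm_def)

text \<open>For the upper bound, a chain from A to C is intersected with B and summed with B. By the
  modular law a strict step stays strict in at least one of the two resulting chains, whose strict
  steps number at most k and l.\<close>

lemma (in module) has_len_add:
  assumes A: "subm R M A" and B: "subm R M B" and C: "subm R M C" and AB: "A \<subseteq> B" and BC: "B \<subseteq> C"
    and k: "has_len R M A B k" and l: "has_len R M B C l"
  shows "has_len R M A C (k + l)"
  unfolding has_len_def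
proof (intro conjI allI impI)
  obtain D where D: "subm_chain R M A B D k" using k by (auto simp: has_len_def)
  obtain E where E: "subm_chain R M B C E l" using l by (auto simp: has_len_def)
  let ?F = "\<lambda>i. if i < k then D i else E (i - k)"
  have "subm_chain R M A C ?F (k + l)"
    unfolding subm_chain_def
  proof (intro conjI allI impI)
    show "i \<le> k + l \<Longrightarrow> subm R M (?F i)" for i using D E by (auto simp: subm_chain_def)
    show "A \<subseteq> ?F 0" using D E AB by (auto simp: subm_chain_def)
    show "?F (k + l) \<subseteq> C" using E by (auto simp: subm_chain_def)
    fix i assume i: "i < k + l"
    consider "Suc i < k" | "Suc i = k" | "k \<le> i" by linarith
    then show "?F i \<subset> ?F (Suc i)"
    proof cases
      case 2
      then have "D i \<subset> D k" "D k \<subseteq> B" "B \<subseteq> E 0" using D E by (auto simp: subm_chain_def)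
      then show ?thesis using 2 by auto
    next
      case 3
      then have "E (i - k) \<subset> E (Suc (i - k))" using E i by (auto simp: subm_chain_def)
      then show ?thesis using 3 by (simp add: Suc_diff_le)
    qed (use D in \<open>auto simp: subm_chain_def\<close>)
  qed
  then show "\<exists>F. subm_chain R M A C F (k + l)" by blast
next
  fix D n assume D: "subm_chain R M A C D n"
  have Ds: "subm R M (D i)" if "i \<le> n" for i using D that by (auto simp: subm_chain_def)
  have Dm: "D i \<subset> D (Suc i)" if "i < n" for i using D that by (auto simp: subm_chain_def)
  let ?E = "\<lambda>i. D i \<inter> B" and ?F = "\<lambda>i. msum M B (D i)"
  let ?X = "{i. i < n \<and> ?E i \<noteq> ?E (Suc i)}" and ?Y = "{i. i < n \<and> ?F i \<noteq> ?F (Suc i)}"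
  have "\<exists>G. subm_chain R M (?E 0) (?E n) G (card ?X) \<and> G (card ?X) = ?E n"
    by (rule strictify_chain) (use Ds Dm subm_Int B in auto)
  then obtain G where "subm_chain R M (?E 0) (?E n) G (card ?X)" by blast
  moreover have "A \<subseteq> ?E 0" using D AB by (auto simp: subm_chain_def)
  ultimately have "subm_chain R M A B G (card ?X)" by (rule chain_weaken) simp
  then have 1: "card ?X \<le> k" using has_len_le[OF k] by blast
  have Fs: "subm R M (?F i)" if "i \<le> n" for i by (rule subm_msum[OF B Ds[OF that]])
  have "\<exists>G. subm_chain R M (?F 0) (?F n) G (card ?Y) \<and> G (card ?Y) = ?F n"
  proof (rule strictify_chain)
    show "?F i \<subseteq> ?F (Suc i)" if "i < n" for i using Dm[OF that] by (intro msum_mono) auto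
  qed (rule Fs)
  moreover have "B \<subseteq> ?F 0" by (rule subset_msum1[OF subm_subset[OF B] subm_zero[OF Ds]]) simp
  moreover have "?F n \<subseteq> C" using D by (intro msum_least[OF C BC]) (auto simp: subm_chain_def)
  ultimately have "\<exists>G. subm_chain R M B C G (card ?Y)" using chain_weaken by blast
  then have 2: "card ?Y \<le> l" using has_len_le[OF l] by blast
  have "{..<n} \<subseteq> ?X \<union> ?Y"
  proof
    fix i assume i: "i \<in> {..<n}"
    show "i \<in> ?X \<union> ?Y"
    proof (rule ccontr)
      assume "i \<notin> ?X \<union> ?Y"
      then have e: "?E i = ?E (Suc i)" "?F i = ?F (Suc i)" using i by auto
      \<comment> \<open>Modular law: nested submodules with the same intersection with
        \<open>B\<close> and the same sum with \<open>B\<close> are equal.\<close>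
      have "D (Suc i) \<subseteq> D i"
      proof
        fix x assume x: "x \<in> D (Suc i)"
        have Si: "subm R M (D (Suc i))" and Di: "subm R M (D i)" using Ds i by auto
        have "x \<in> ?F i" unfolding e(2) using subset_msum2[OF subm_subset[OF Si] subm_zero[OF B]] x by blast
        then obtain b y where by': "b \<in> B" "y \<in> D i" "x = b \<oplus>\<^bsub>M\<^esub> y" by (auto simp: msum_def)
        have c: "b \<in> carrier M" "y \<in> carrier M" using by' subm_carr[OF B] subm_carr[OF Di] by auto
        have "y \<in> D (Suc i)" using by' Dm i by auto
        then have "x \<ominus>\<^bsub>M\<^esub> y \<in> D (Suc i)" by (rule subm_minus[OF Si x])
        moreover have "x \<ominus>\<^bsub>M\<^esub> y = b" using by' c by (simp add: a_minus_def M.a_assoc M.r_neg)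
        ultimately have "b \<in> D i" using by' e(1) by auto
        then show "x \<in> D i" using by' subm_add[OF Di] by simp
      qed
      then show False using Dm i by auto
    qed
  qed
  then have "card {..<n} \<le> card (?X \<union> ?Y)" by (intro card_mono) auto
  also have "\<dots> \<le> card ?X + card ?Y" by (rule card_Un_le)
  finally show "n \<le> k + l" using 1 2 by simp
qed

text \<open>The quotient is cyclic and killed by the maximal ideal, hence simple or zero: a
  submodule strictly above A contains some r z + a with r outside \<mm>, a unit, and therefore
  contains z.\<close>

lemma (in module) has_len_step:
  assumes mx: "maximalideal \<mm> R" and units: "\<And>r. r \<in> carrier R \<Longrightarrow> r \<notin> \<mm> \<Longrightarrow> r \<in> Units R"
    and A: "subm R M A" and z: "z \<in> carrier M" and mz: "\<And>r. r \<in> \<mm> \<Longrightarrow> r \<odot>\<^bsub>M\<^esub> z \<in> A"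
  shows "has_len R M A (msum M ((\<lambda>r. r \<odot>\<^bsub>M\<^esub> z) ` carrier R) A) (if z \<in> A then 0 else 1)"
proof (cases "z \<in> A")
  case True
  then have "(\<lambda>r. r \<odot>\<^bsub>M\<^esub> z) ` carrier R \<subseteq> A" using subm_smult[OF A] by auto
  then have "msum M ((\<lambda>r. r \<odot>\<^bsub>M\<^esub> z) ` carrier R) A \<subseteq> A" by (rule msum_least[OF A _ order_refl])
  moreover have "A \<subseteq> msum M ((\<lambda>r. r \<odot>\<^bsub>M\<^esub> z) ` carrier R) A"
    by (rule subset_msum2[OF subm_subset[OF A] subm_zero[OF subm_cyclic[OF z]]])
  ultimately have "msum M ((\<lambda>r. r \<odot>\<^bsub>M\<^esub> z) ` carrier R) A = A" by blast
  then show ?thesis using True has_len_refl[OF A] by simp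
next
  case False
  let ?B = "msum M ((\<lambda>r. r \<odot>\<^bsub>M\<^esub> z) ` carrier R) A"
  have B: "subm R M ?B" by (rule subm_msum[OF subm_cyclic[OF z] A])
  have AB: "A \<subseteq> ?B" by (rule subset_msum2[OF subm_subset[OF A] subm_zero[OF subm_cyclic[OF z]]])
  have "\<one> \<odot>\<^bsub>M\<^esub> z \<oplus>\<^bsub>M\<^esub> \<zero>\<^bsub>M\<^esub> \<in> ?B" by (rule msumI[OF _ subm_zero[OF A]]) auto
  then have zB: "z \<in> ?B" using z by simp
  have key: "D = ?B" if D: "subm R M D" "A \<subset> D" "D \<subseteq> ?B" for D
  proof -
    obtain d where d: "d \<in> D" "d \<notin> A" using D by auto
    then obtain r a where ra: "r \<in> carrier R" "a \<in> A" "d = r \<odot>\<^bsub>M\<^esub> z \<oplus>\<^bsub>M\<^esub> a" using D(3) by (auto simp: msum_def)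
    have ac: "a \<in> carrier M" using ra subm_carr[OF A] by auto
    have "r \<notin> \<mm>" using d ra mz subm_add[OF A] by auto
    then have u: "r \<in> Units R" using units ra by simp
    have "d \<ominus>\<^bsub>M\<^esub> a \<in> D" using d ra D by (intro subm_minus[OF D(1)]) auto
    moreover have "d \<ominus>\<^bsub>M\<^esub> a = r \<odot>\<^bsub>M\<^esub> z" using ra ac z by (simp add: a_minus_def M.a_assoc M.r_neg)
    ultimately have "z \<in> D" using unit_smult_mem[OF D(1) u z] by simp
    then have "(\<lambda>r. r \<odot>\<^bsub>M\<^esub> z) ` carrier R \<subseteq> D" using subm_smult[OF D(1)] by auto
    then have "?B \<subseteq> D" using D by (intro msum_least) auto
    then show ?thesis using D by auto
  qed
  have "subm_chain R M A ?B (\<lambda>i. if i = 0 then A else ?B) 1"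
    using A B AB zB False by (auto simp: subm_chain_def)
  moreover have "n \<le> 1" if c: "subm_chain R M A ?B C n" for C n
  proof (rule ccontr)
    assume n: "\<not> n \<le> 1"
    have 0: "C 0 \<subset> C 1" "C 1 \<subset> C 2" "C 2 \<subseteq> ?B" "subm R M (C 1)" "A \<subseteq> C 0"
      using c n chain_mono[OF c, of 2 n] by (auto simp: subm_chain_def numeral_2_eq_2)
    then have "A \<subset> C 1" "C 1 \<subseteq> ?B" by auto
    then have "C 1 = ?B" using key[of "C 1"] 0 by blast
    then show False using 0 by auto
  qed
  ultimately show ?thesis using False unfolding has_len_def by auto
qed

section \<open>Transfer of lengths along surjections\<close>

context semilinear_surj
begin

lemma p_neg: "x \<in> carrier M \<Longrightarrow> p (\<ominus>\<^bsub>M\<^esub> x) = \<ominus>\<^bsub>V\<^esub> p x"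
proof -
  interpret V: module K V by (rule module_V)
  assume x: "x \<in> carrier M"
  have "p (\<ominus>\<^bsub>M\<^esub> x) \<oplus>\<^bsub>V\<^esub> p x = \<zero>\<^bsub>V\<^esub>" using x by (simp flip: p_add p_zero add: M.M.l_neg)
  then show ?thesis using x p_carr by (intro V.M.minus_equality[symmetric]) auto
qed

lemma image_subm: "subm R M W \<Longrightarrow> subm K V (p ` W)"
proof (rule submI)
  assume W: "subm R M W"
  note c = subm_carr[OF W]
  show "p ` W \<subseteq> carrier V" using c p_carr by auto
  show "\<zero>\<^bsub>V\<^esub> \<in> p ` W" using subm_zero[OF W] by (simp flip: p_zero)
next
  fix x y assume W: "subm R M W" and "x \<in> p ` W" "y \<in> p ` W"
  then show "x \<oplus>\<^bsub>V\<^esub> y \<in> p ` W" using subm_carr[OF W] subm_add[OF W] by (auto simp flip: p_add)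
next
  fix r x assume W: "subm R M W" and "r \<in> carrier K" "x \<in> p ` W"
  moreover from this obtain a where "a \<in> carrier R" "r = q a" using K_ex by blast
  ultimately show "r \<odot>\<^bsub>V\<^esub> x \<in> p ` W" using subm_carr[OF W] subm_smult[OF W] by (auto simp flip: p_smult)
qed

lemma vimage_subm: "subm R M B \<Longrightarrow> subm K V W \<Longrightarrow> subm R M {x \<in> B. p x \<in> W}"
proof (rule submI)
  assume B: "subm R M B" and W: "subm K V W"
  show "{x \<in> B. p x \<in> W} \<subseteq> carrier M" using subm_carr[OF B] by auto
  show "\<zero>\<^bsub>M\<^esub> \<in> {x \<in> B. p x \<in> W}" using subm_zero[OF B] subm_zero[OF W] p_zero by auto
next
  fix x y assume "subm R M B" "subm K V W" "x \<in> {x \<in> B. p x \<in> W}" "y \<in> {x \<in> B. p x \<in> W}"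
  then show "x \<oplus>\<^bsub>M\<^esub> y \<in> {x \<in> B. p x \<in> W}" using subm_carr[of R M B] by (auto simp: p_add intro: subm_add)
next
  fix r x assume "subm R M B" "subm K V W" "r \<in> carrier R" "x \<in> {x \<in> B. p x \<in> W}"
  then show "r \<odot>\<^bsub>M\<^esub> x \<in> {x \<in> B. p x \<in> W}" using subm_carr[of R M B] q_carr by (auto simp: p_smult intro: subm_smult)
qed

text \<open>Images and preimages match chains between A and B with chains between A' and the image
  of B. Strictness survives taking images because A contains every element of B that
  \<open>p\<close> sends to zero.\<close>

lemma has_len_transfer:
  assumes B: "subm R M B" and A': "subm K V A'" and A'B': "A' \<subseteq> p ` B" and A: "A = {x \<in> B. p x \<in> A'}"
  shows "has_len R M A B k \<longleftrightarrow> has_len K V A' (p ` B) k"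
proof -
  interpret V: module K V by (rule module_V)
  have As: "subm R M A" unfolding A by (rule vimage_subm[OF B A'])
  have 1: "\<exists>D. subm_chain K V A' (p ` B) D n" if C: "subm_chain R M A B C n" for C n
  proof -
    have Cs: "subm R M (C i)" if "i \<le> n" for i using C that by (auto simp: subm_chain_def)
    have CB: "C i \<subseteq> B" "A \<subseteq> C i" if "i \<le> n" for i
      using chain_mono[OF C that order_refl] chain_mono[OF C le0 that] C by (auto simp: subm_chain_def)
    have "subm_chain K V A' (p ` B) (\<lambda>i. p ` C i) n"
      unfolding subm_chain_def
    proof (intro conjI allI impI)
      show "subm K V (p ` C i)" if "i \<le> n" for i by (rule image_subm[OF Cs[OF that]])
      show "p ` C n \<subseteq> p ` B" using CB[of n] by auto
      show "A' \<subseteq> p ` C 0"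
      proof
        fix a assume a: "a \<in> A'"
        then obtain b where b: "b \<in> B" "a = p b" using A'B' by auto
        then have "b \<in> C 0" using a A CB(2)[of 0] by auto
        then show "a \<in> p ` C 0" using b by simp
      qed
      fix i assume i: "i < n"
      have sub: "C i \<subset> C (Suc i)" using C i by (auto simp: subm_chain_def)
      show "p ` C i \<subset> p ` C (Suc i)"
      proof (rule ccontr)
        assume "\<not> ?thesis"
        then have e: "p ` C (Suc i) \<subseteq> p ` C i" using sub by blast
        have "C (Suc i) \<subseteq> C i"
        proof
          fix x assume x: "x \<in> C (Suc i)"
          then have "p x \<in> p ` C i" using e by blast
          then obtain c where c: "c \<in> C i" "p x = p c" by blast
          have cS: "c \<in> C (Suc i)" using c sub by auto
          have Si: "subm R M (C (Suc i))" using Cs i by simp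
          have cc: "x \<in> carrier M" "c \<in> carrier M" using x cS subm_carr[OF Si] by auto
          have xc: "x \<ominus>\<^bsub>M\<^esub> c \<in> C (Suc i)" using M.subm_minus[OF Cs x cS] i by auto
          have "p (x \<ominus>\<^bsub>M\<^esub> c) = \<zero>\<^bsub>V\<^esub>" using cc c p_carr by (simp add: a_minus_def p_add p_neg V.M.r_neg)
          then have "x \<ominus>\<^bsub>M\<^esub> c \<in> A" using xc CB(1)[of "Suc i"] i subm_zero[OF A'] by (auto simp: A)
          then have "x \<ominus>\<^bsub>M\<^esub> c \<in> C i" using CB(2)[of i] i by auto
          then have "(x \<ominus>\<^bsub>M\<^esub> c) \<oplus>\<^bsub>M\<^esub> c \<in> C i" using subm_add[OF Cs _ c(1)] i by auto
          then show "x \<in> C i" using cc by (simp add: a_minus_def M.M.a_assoc M.M.l_neg)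
        qed
        then show False using sub by auto
      qed
    qed
    then show ?thesis by blast
  qed
  have 2: "\<exists>D. subm_chain R M A B D n" if C: "subm_chain K V A' (p ` B) C n" for C n
  proof -
    have Cs: "subm K V (C i)" if "i \<le> n" for i using C that by (auto simp: subm_chain_def)
    have CB: "C i \<subseteq> p ` B" if "i \<le> n" for i
      using chain_mono[OF C that order_refl] C by (auto simp: subm_chain_def)
    have "subm_chain R M A B (\<lambda>i. {x \<in> B. p x \<in> C i}) n"
      unfolding subm_chain_def
    proof (intro conjI allI impI)
      show "subm R M {x \<in> B. p x \<in> C i}" if "i \<le> n" for i by (rule vimage_subm[OF B Cs[OF that]])
      show "A \<subseteq> {x \<in> B. p x \<in> C 0}" using C by (auto simp: A subm_chain_def)
      fix i assume i: "i < n"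
      have sub: "C i \<subset> C (Suc i)" using C i by (auto simp: subm_chain_def)
      then obtain v where v: "v \<in> C (Suc i)" "v \<notin> C i" by auto
      then obtain b where "b \<in> B" "v = p b" using CB[of "Suc i"] i by auto
      then show "{x \<in> B. p x \<in> C i} \<subset> {x \<in> B. p x \<in> C (Suc i)}" using v sub by auto
    qed auto
    then show ?thesis by blast
  qed
  show ?thesis unfolding has_len_def using 1 2 by blast
qed

end

lemma (in module) quot_module_length:
  assumes N: "subm R M N" and k: "has_len R M N (carrier M) k"
  shows "module_length R (quot_module M N) = enat k"
proof -
  interpret Q: semilinear_surj R M R "quot_module M N" "\<lambda>a. a" "\<lambda>x. N +>\<^bsub>M\<^esub> x" by (rule quot_module_surj[OF N])
  interpret QM: module R "quot_module M N" by (rule Q.module_V)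
  have z: "\<zero>\<^bsub>quot_module M N\<^esub> = N" by (simp add: quot_module_def)
  have "N = {x \<in> carrier M. N +>\<^bsub>M\<^esub> x \<in> {\<zero>\<^bsub>quot_module M N\<^esub>}}"
    unfolding z using coset_eq_self[OF N] subm_carr[OF N] by auto
  from Q.has_len_transfer[OF subm_carrier QM.subm_null _ this] have
    "has_len R (quot_module M N) {\<zero>\<^bsub>quot_module M N\<^esub>} (carrier (quot_module M N)) k"
    using k QM.M.zero_closed unfolding Q.p_surj by blast
  then show ?thesis by (rule QM.module_length_eq)
qed

text \<open>The members of a minimal generating list are adjoined to \<mm> M one by one. No step is
  trivial, since a generator in the span of \<mm> M and the later ones could be dropped, against
  \<open>num_gens_char\<close>. Expressed as a length, the number of generators becomes
  multiplicative on direct powers.\<close>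

lemma (in local_module) num_gens_length: "has_len R M mM (carrier M) (num_gens R M)"
proof -
  obtain ws where ws: "length ws = num_gens R M" "set ws \<subseteq> carrier M" "carrier M = lspan R M ws"
    using num_gens_char(1) by blast
  have ind: "w \<notin> msum M mM (lspan R M us')" if split: "ws = us @ w # us'" for us w us'
  proof
    assume w: "w \<in> msum M mM (lspan R M us')"
    let ?v = "us @ us'"
    have c: "set ?v \<subseteq> carrier M" "set us' \<subseteq> carrier M" using ws split by auto
    let ?T = "msum M mM (lspan R M ?v)"
    have L: "subm R M (lspan R M ?v)" by (rule subm_lspan[OF c(1)])
    have T: "subm R M ?T" by (rule subm_msum[OF subm_mM L])
    have vT: "lspan R M ?v \<subseteq> ?T" by (rule subset_msum2[OF subm_subset[OF L] subm_zero[OF subm_mM]])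
    have "msum M mM (lspan R M us') \<subseteq> ?T" by (intro msum_mono lspan_mono c) auto
    then have "set ws \<subseteq> ?T" using w lspan_superset[OF c(1)] vT split by auto
    then have "carrier M \<subseteq> ?T" unfolding ws(3) by (rule lspan_least[OF T])
    then have "carrier M = ?T" using subm_subset[OF T] by auto
    from num_gens_char(2)[OF c(1) this] show False using ws(1) split by simp
  qed
  have "has_len R M mM (msum M mM (lspan R M vs)) (length vs)" if "ws = us @ vs" for us vs
    using that
  proof (induction vs arbitrary: us)
    case Nil
    have "msum M mM {\<zero>\<^bsub>M\<^esub>} = mM" by (rule msum_null[OF subm_subset[OF subm_mM]])
    then show ?case using has_len_refl[OF subm_mM] by simp
  next
    case (Cons w vs)
    have c: "w \<in> carrier M" "set vs \<subseteq> carrier M" using ws(2) Cons.prems by auto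
    let ?A = "msum M mM (lspan R M vs)"
    have L: "subm R M (lspan R M vs)" by (rule subm_lspan[OF c(2)])
    have A: "subm R M ?A" by (rule subm_msum[OF subm_mM L])
    have mA: "mM \<subseteq> ?A" by (rule subset_msum1[OF subm_subset[OF subm_mM] subm_zero[OF L]])
    have IH: "has_len R M mM ?A (length vs)" using Cons.IH[of "us @ [w]"] Cons.prems by simp
    let ?W = "(\<lambda>r. r \<odot>\<^bsub>M\<^esub> w) ` carrier R"
    have W: "subm R M ?W" by (rule subm_cyclic[OF c(1)])
    have e: "msum M mM (lspan R M (w # vs)) = msum M ?W ?A"
    proof -
      have "msum M mM (msum M ?W (lspan R M vs)) = msum M (msum M mM ?W) (lspan R M vs)"
        by (rule msum_assoc[symmetric]) (use subm_subset[OF subm_mM] subm_subset[OF W] subm_subset[OF L] in auto)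
      also have "msum M mM ?W = msum M ?W mM"
        using subm_carr[OF subm_mM] subm_carr[OF W] by (auto simp: msum_def) (metis M.a_comm image_eqI subm_carr[OF W])+
      also have "msum M (msum M ?W mM) (lspan R M vs) = msum M ?W ?A"
        by (rule msum_assoc) (use subm_subset[OF subm_mM] subm_subset[OF W] subm_subset[OF L] in auto)
      finally show ?thesis unfolding lspan_Cons .
    qed
    have "has_len R M ?A (msum M ?W ?A) (if w \<in> ?A then 0 else 1)"
      by (rule has_len_step[OF max_ideal_maximal _ A c(1)])
        (use mA ideal_smult_mem[OF max_ideal_subset _ c(1)] unit_iff in auto)
    then have st: "has_len R M ?A (msum M ?W ?A) 1" using ind[OF Cons.prems] by simp
    have "has_len R M mM (msum M ?W ?A) (length vs + 1)"
      by (rule has_len_add[OF subm_mM A subm_msum[OF W A] mA subset_msum2[OF subm_subset[OF A] subm_zero[OF W]] IH st])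
    then show ?case unfolding e by simp
  qed
  from this[of "[]" ws] have "has_len R M mM (msum M mM (carrier M)) (num_gens R M)" using ws by simp
  moreover have "msum M mM (carrier M) = carrier M"
    using msum_least[OF subm_carrier subm_subset[OF subm_mM] order_refl]
      subset_msum2[OF order_refl subm_zero[OF subm_mM]] by auto
  ultimately show ?thesis by simp
qed

section \<open>Direct powers\<close>

text \<open>
  \<open>M\<close> is the direct sum of \<open>h\<close> copies of \<open>N\<close>, with projections \<open>p\<close> and injections \<open>q\<close>.
\<close>

locale power_decomp = M: module R M + N: module R N
  for R (structure) and M :: "('a, 'm, 'c) module_scheme" and N :: "('a, 'n, 'd) module_scheme" +
  fixes h :: nat and p :: "nat \<Rightarrow> 'm \<Rightarrow> 'n" and q :: "nat \<Rightarrow> 'n \<Rightarrow> 'm"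
  assumes p: "j < h \<Longrightarrow> p j \<in> module_hom R M N" and q: "j < h \<Longrightarrow> q j \<in> module_hom R N M"
    and pq: "j < h \<Longrightarrow> k < h \<Longrightarrow> y \<in> carrier N \<Longrightarrow> p j (q k y) = (if j = k then y else \<zero>\<^bsub>N\<^esub>)"
    and separating: "x \<in> carrier M \<Longrightarrow> (\<And>j. j < h \<Longrightarrow> p j x = \<zero>\<^bsub>N\<^esub>) \<Longrightarrow> x = \<zero>\<^bsub>M\<^esub>"
    and h: "h \<ge> 1"
begin

lemma p_carr: "j < h \<Longrightarrow> x \<in> carrier M \<Longrightarrow> p j x \<in> carrier N"
  using module_hom_closed[OF p] by auto

lemma q_carr: "j < h \<Longrightarrow> y \<in> carrier N \<Longrightarrow> q j y \<in> carrier M"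
  using module_hom_closed[OF q] by auto

lemma hom_neg: "module R A \<Longrightarrow> module R B \<Longrightarrow> f \<in> module_hom R A B \<Longrightarrow> x \<in> carrier A \<Longrightarrow> f (\<ominus>\<^bsub>A\<^esub> x) = \<ominus>\<^bsub>B\<^esub> f x"
proof -
  assume "module R A" "module R B" and f: "f \<in> module_hom R A B" and x: "x \<in> carrier A"
  then interpret A: module R A + B: module R B by auto
  show ?thesis using module_hom_smult[OF f, of "\<ominus> \<one>" x] module_hom_closed[OF f] x
    by (auto simp: A.smult_l_minus B.smult_l_minus Pi_def)
qed

text \<open>Replaces the formula that x is the sum of the q j (p j x). Components are removed one at
  a time, and in the induction \<open>k\<close> bounds the indices of the nonzero ones.\<close>

lemma mem_of_components:
  assumes W: "subm R M W" and x: "x \<in> carrier M" and W_mem: "\<And>j. j < h \<Longrightarrow> q j (p j x) \<in> W"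
  shows "x \<in> W"
proof -
  have "x \<in> W" if "k \<le> h" "x \<in> carrier M" "\<And>j. j < h \<Longrightarrow> q j (p j x) \<in> W" "\<And>j. k \<le> j \<Longrightarrow> j < h \<Longrightarrow> p j x = \<zero>\<^bsub>N\<^esub>" for k x
    using that
  proof (induction k arbitrary: x)
    case 0
    then show ?case using separating[of x] subm_zero[OF W] by auto
  next
    case (Suc k)
    have k: "k < h" using Suc by auto
    let ?u = "q k (p k x)"
    have u: "?u \<in> carrier M" "p k x \<in> carrier N" using p_carr[OF k Suc.prems(2)] q_carr[OF k] by auto
    let ?x = "x \<oplus>\<^bsub>M\<^esub> \<ominus>\<^bsub>M\<^esub> ?u"
    have xc: "?x \<in> carrier M" using u(1) Suc.prems(2) by simp
    have px: "p j ?x = (if j = k then \<zero>\<^bsub>N\<^esub> else p j x)" if j: "j < h" for j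
    proof -
      have "p j ?x = p j x \<oplus>\<^bsub>N\<^esub> \<ominus>\<^bsub>N\<^esub> p j ?u"
        using module_hom_add[OF p[OF j]] hom_neg[OF M.module_axioms N.module_axioms p[OF j]] u Suc by simp
      also have "p j ?u = (if j = k then p k x else \<zero>\<^bsub>N\<^esub>)" using pq[OF j k u(2)] by simp
      moreover have "\<ominus>\<^bsub>N\<^esub> \<zero>\<^bsub>N\<^esub> = \<zero>\<^bsub>N\<^esub>" by (rule N.M.minus_equality) auto
      ultimately show ?thesis using p_carr[OF j Suc.prems(2)] by (auto simp: N.M.r_neg)
    qed
    have q0: "q j \<zero>\<^bsub>N\<^esub> = \<zero>\<^bsub>M\<^esub>" if "j < h" for j by (rule N.hom_zero[OF M.module_axioms q[OF that]])
    have "?x \<in> W"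
    proof (rule Suc.IH)
      show "q j (p j ?x) \<in> W" if "j < h" for j using px[OF that] Suc.prems(3)[OF that] q0[OF that] subm_zero[OF W] by auto
      show "p j ?x = \<zero>\<^bsub>N\<^esub>" if "k \<le> j" "j < h" for j using px[OF that(2)] Suc.prems(4)[of j] that by auto
    qed (use k xc in auto)
    then have "?x \<oplus>\<^bsub>M\<^esub> ?u \<in> W" using Suc.prems(3)[OF k] by (rule subm_add[OF W])
    then show ?case using u(1) Suc.prems(2) by (simp add: M.M.a_assoc M.M.l_neg)
  qed
  from this[of h x] show ?thesis using x W_mem by auto
qed

lemma ideal_smult_iff:
  assumes I: "I \<subseteq> carrier R"
  shows "x \<in> ideal_smult R I M \<longleftrightarrow> x \<in> carrier M \<and> (\<forall>j<h. p j x \<in> ideal_smult R I N)"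
proof
  assume x: "x \<in> ideal_smult R I M"
  have "ideal_smult R I M \<subseteq> {x \<in> carrier M. p j x \<in> ideal_smult R I N}" if j: "j < h" for j
  proof (rule M.ideal_smult_least[OF M.hom_vimage_subm[OF N.module_axioms p[OF j] N.subm_ideal_smult[OF I]]])
    fix a x assume ax: "a \<in> I" "x \<in> carrier M"
    then have "p j (a \<odot>\<^bsub>M\<^esub> x) = a \<odot>\<^bsub>N\<^esub> p j x" using module_hom_smult[OF p[OF j]] I by auto
    then show "a \<odot>\<^bsub>M\<^esub> x \<in> {x \<in> carrier M. p j x \<in> ideal_smult R I N}"
      using ax I N.ideal_smult_mem[OF I ax(1) p_carr[OF j ax(2)]] by auto
  qed
  then show "x \<in> carrier M \<and> (\<forall>j<h. p j x \<in> ideal_smult R I N)"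
    using x subm_carr[OF M.subm_ideal_smult[OF I]] by auto
next
  assume x: "x \<in> carrier M \<and> (\<forall>j<h. p j x \<in> ideal_smult R I N)"
  have "ideal_smult R I N \<subseteq> {y \<in> carrier N. q j y \<in> ideal_smult R I M}" if j: "j < h" for j
  proof (rule N.ideal_smult_least[OF N.hom_vimage_subm[OF M.module_axioms q[OF j] M.subm_ideal_smult[OF I]]])
    fix a y assume ax: "a \<in> I" "y \<in> carrier N"
    then have "q j (a \<odot>\<^bsub>N\<^esub> y) = a \<odot>\<^bsub>M\<^esub> q j y" using module_hom_smult[OF q[OF j]] I by auto
    then show "a \<odot>\<^bsub>N\<^esub> y \<in> {y \<in> carrier N. q j y \<in> ideal_smult R I M}"
      using ax I M.ideal_smult_mem[OF I ax(1) q_carr[OF j ax(2)]] by auto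
  qed
  note qI = this
  show "x \<in> ideal_smult R I M"
  proof (rule mem_of_components[OF M.subm_ideal_smult[OF I]])
    fix j assume j: "j < h"
    then have "p j x \<in> ideal_smult R I N" using x by simp
    from subsetD[OF qI[OF j] this] show "q j (p j x) \<in> ideal_smult R I M" by simp
  qed (use x in simp)
qed

lemma carrier_nontrivial: "carrier M = {\<zero>\<^bsub>M\<^esub>} \<longleftrightarrow> carrier N = {\<zero>\<^bsub>N\<^esub>}"
proof
  have h0: "0 < h" using h by simp
  assume M0: "carrier M = {\<zero>\<^bsub>M\<^esub>}"
  have "y = \<zero>\<^bsub>N\<^esub>" if y: "y \<in> carrier N" for y
  proof -
    have "q 0 y = \<zero>\<^bsub>M\<^esub>" using q_carr[OF h0 y] M0 by simp
    then show ?thesis using pq[OF h0 h0 y] M.hom_zero[OF N.module_axioms p[OF h0]] by simp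
  qed
  then show "carrier N = {\<zero>\<^bsub>N\<^esub>}" by auto
next
  assume "carrier N = {\<zero>\<^bsub>N\<^esub>}"
  note N0 = this
  have "x = \<zero>\<^bsub>M\<^esub>" if "x \<in> carrier M" for x
  proof (rule separating[OF that])
    fix j assume "j < h"
    from p_carr[OF this that] show "p j x = \<zero>\<^bsub>N\<^esub>" unfolding N0 by simp
  qed
  then show "carrier M = {\<zero>\<^bsub>M\<^esub>}" by auto
qed

lemma annihilator_eq: "annihilator R M = annihilator R N"
proof (intro equalityI subsetI)
  have h0: "0 < h" using h by simp
  fix r assume "r \<in> annihilator R M"
  then have r: "r \<in> carrier R" "\<And>x. x \<in> carrier M \<Longrightarrow> r \<odot>\<^bsub>M\<^esub> x = \<zero>\<^bsub>M\<^esub>" by (auto simp: annihilator_def)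
  have "r \<odot>\<^bsub>N\<^esub> y = \<zero>\<^bsub>N\<^esub>" if y: "y \<in> carrier N" for y
    using module_hom_smult[OF p[OF h0] r(1) q_carr[OF h0 y]] pq[OF h0 h0 y] r(2)[OF q_carr[OF h0 y]]
      M.hom_zero[OF N.module_axioms p[OF h0]] by simp
  then show "r \<in> annihilator R N" using r by (auto simp: annihilator_def)
next
  fix r assume "r \<in> annihilator R N"
  then have r: "r \<in> carrier R" "\<And>x. x \<in> carrier N \<Longrightarrow> r \<odot>\<^bsub>N\<^esub> x = \<zero>\<^bsub>N\<^esub>" by (auto simp: annihilator_def)
  have "r \<odot>\<^bsub>M\<^esub> x = \<zero>\<^bsub>M\<^esub>" if x: "x \<in> carrier M" for x
  proof (rule separating)
    fix j assume j: "j < h"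
    show "p j (r \<odot>\<^bsub>M\<^esub> x) = \<zero>\<^bsub>N\<^esub>" using module_hom_smult[OF p[OF j] r(1) x] r(2)[OF p_carr[OF j x]] by simp
  qed (use r x in simp)
  then show "r \<in> annihilator R M" using r by (auto simp: annihilator_def)
qed

lemma regular_sequence_eq: "regular_sequence R M rs \<longleftrightarrow> regular_sequence R N rs"
proof -
  have h0: "0 < h" using h by simp
  have I: "genideal R (set (take i rs)) \<subseteq> carrier R" if "set rs \<subseteq> carrier R" for i
    using ideal.Icarr[OF M.R.genideal_ideal] that set_take_subset[of i rs] by blast
  have nz: "nonzerodivisor_on (quot_module M (ideal_smult R J M)) r \<longleftrightarrow> nonzerodivisor_on (quot_module N (ideal_smult R J N)) r"
    if J: "J \<subseteq> carrier R" and r: "r \<in> carrier R" for J r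
    unfolding M.nonzerodivisor_quot[OF M.subm_ideal_smult[OF J] r] N.nonzerodivisor_quot[OF N.subm_ideal_smult[OF J] r]
  proof (intro iffI ballI impI)
    fix y assume *: "\<forall>m\<in>carrier M. r \<odot>\<^bsub>M\<^esub> m \<in> ideal_smult R J M \<longrightarrow> m \<in> ideal_smult R J M"
      and y: "y \<in> carrier N" "r \<odot>\<^bsub>N\<^esub> y \<in> ideal_smult R J N"
    have "r \<odot>\<^bsub>M\<^esub> q 0 y \<in> ideal_smult R J M"
      unfolding ideal_smult_iff[OF J]
    proof (intro conjI allI impI)
      show "r \<odot>\<^bsub>M\<^esub> q 0 y \<in> carrier M" using r q_carr[OF h0 y(1)] by simp
      fix j assume j: "j < h"
      have "p j (r \<odot>\<^bsub>M\<^esub> q 0 y) = r \<odot>\<^bsub>N\<^esub> p j (q 0 y)" using module_hom_smult[OF p[OF j] r q_carr[OF h0 y(1)]] .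
      then show "p j (r \<odot>\<^bsub>M\<^esub> q 0 y) \<in> ideal_smult R J N"
        using pq[OF j h0 y(1)] y(2) subm_zero[OF N.subm_ideal_smult[OF J]] r by simp
    qed
    then have "q 0 y \<in> ideal_smult R J M" using * q_carr[OF h0 y(1)] by auto
    then have "p 0 (q 0 y) \<in> ideal_smult R J N" using ideal_smult_iff[OF J] h0 by auto
    then show "y \<in> ideal_smult R J N" using pq[OF h0 h0 y(1)] by simp
  next
    fix m assume *: "\<forall>m\<in>carrier N. r \<odot>\<^bsub>N\<^esub> m \<in> ideal_smult R J N \<longrightarrow> m \<in> ideal_smult R J N"
      and m: "m \<in> carrier M" "r \<odot>\<^bsub>M\<^esub> m \<in> ideal_smult R J M"
    have "p j m \<in> ideal_smult R J N" if j: "j < h" for j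
    proof -
      have "p j (r \<odot>\<^bsub>M\<^esub> m) \<in> ideal_smult R J N" using m(2) ideal_smult_iff[OF J] j by auto
      then have "r \<odot>\<^bsub>N\<^esub> p j m \<in> ideal_smult R J N" using module_hom_smult[OF p[OF j] r m(1)] by simp
      then show ?thesis using * p_carr[OF j m(1)] by auto
    qed
    then show "m \<in> ideal_smult R J M" using ideal_smult_iff[OF J] m by auto
  qed
  have full: "ideal_smult R J M = carrier M \<longleftrightarrow> ideal_smult R J N = carrier N" if J: "J \<subseteq> carrier R" for J
  proof
    assume e: "ideal_smult R J M = carrier M"
    have "y \<in> ideal_smult R J N" if y: "y \<in> carrier N" for y
    proof -
      have "q 0 y \<in> ideal_smult R J M" using e q_carr[OF h0 y] by simp
      then have "p 0 (q 0 y) \<in> ideal_smult R J N" using ideal_smult_iff[OF J] h0 by auto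
      then show ?thesis using pq[OF h0 h0 y] by simp
    qed
    then show "ideal_smult R J N = carrier N" using subm_subset[OF N.subm_ideal_smult[OF J]] by auto
  next
    assume e: "ideal_smult R J N = carrier N"
    have "x \<in> ideal_smult R J M" if "x \<in> carrier M" for x unfolding ideal_smult_iff[OF J] e using p_carr that by simp
    then show "ideal_smult R J M = carrier M" using subm_subset[OF M.subm_ideal_smult[OF J]] by auto
  qed
  show ?thesis
  proof (cases "set rs \<subseteq> carrier R")
    case True
    have "\<forall>i<length rs. rs ! i \<in> carrier R" using True by (auto simp: subset_iff)
    then show ?thesis unfolding regular_sequence_def
      using nz[OF I[OF True]] full[OF I[OF True, of "length rs"]] True by auto
  qed (simp add: regular_sequence_def)
qed

lemma depth_eq: "depth R M = depth R N"
  unfolding depth_def regular_sequence_eq carrier_nontrivial ..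

lemma projection_surj: "j < h \<Longrightarrow> semilinear_surj R M R N (\<lambda>a. a) (p j)"
proof unfold_locales
  assume j: "j < h"
  show "p j ` carrier M = carrier N"
  proof
    show "carrier N \<subseteq> p j ` carrier M"
    proof
      fix y assume y: "y \<in> carrier N"
      then have "y = p j (q j y)" using pq[OF j j y] by simp
      then show "y \<in> p j ` carrier M" using q_carr[OF j y] by blast
    qed
  qed (use p_carr[OF j] in auto)
  show "p j \<zero>\<^bsub>M\<^esub> = \<zero>\<^bsub>N\<^esub>" by (rule M.hom_zero[OF N.module_axioms p[OF j]])
  show "\<And>x y. x \<in> carrier M \<Longrightarrow> y \<in> carrier M \<Longrightarrow> p j (x \<oplus>\<^bsub>M\<^esub> y) = p j x \<oplus>\<^bsub>N\<^esub> p j y"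
    by (rule module_hom_add[OF p[OF j]])
  show "\<And>a x. a \<in> carrier R \<Longrightarrow> x \<in> carrier M \<Longrightarrow> p j (a \<odot>\<^bsub>M\<^esub> x) = a \<odot>\<^bsub>N\<^esub> p j x"
    by (rule module_hom_smult[OF p[OF j]])
qed auto

text \<open>The elements whose components from index i on lie in N' form a filtration with h steps;
  \<open>has_len_transfer\<close> along the i-th projection identifies each step with N/N'.\<close>

lemma has_len_power:
  assumes N': "subm R N N'" and k: "has_len R N N' (carrier N) k"
  shows "has_len R M {x \<in> carrier M. \<forall>j<h. p j x \<in> N'} (carrier M) (h * k)"
proof -
  let ?A = "\<lambda>i. {x \<in> carrier M. \<forall>j<h. i \<le> j \<longrightarrow> p j x \<in> N'}"
  have vs: "subm R M {x \<in> carrier M. p j x \<in> N'}" if "j < h" for j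
    by (rule M.hom_vimage_subm[OF N.module_axioms p[OF that] N'])
  have A: "subm R M (?A i)" for i
  proof (rule submI)
    show "\<zero>\<^bsub>M\<^esub> \<in> ?A i" using subm_zero[OF vs] by auto
    show "\<And>x y. x \<in> ?A i \<Longrightarrow> y \<in> ?A i \<Longrightarrow> x \<oplus>\<^bsub>M\<^esub> y \<in> ?A i" using subm_add[OF vs] by auto
    show "\<And>r x. r \<in> carrier R \<Longrightarrow> x \<in> ?A i \<Longrightarrow> r \<odot>\<^bsub>M\<^esub> x \<in> ?A i" using subm_smult[OF vs] by auto
  qed auto
  have mono: "?A i \<subseteq> ?A (Suc i)" for i by auto
  have "has_len R M (?A 0) (?A i) (i * k)" if "i \<le> h" for i
    using that
  proof (induction i)
    case 0 then show ?case using has_len_refl[OF A[of 0]] by simp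
  next
    case (Suc i)
    then have i: "i < h" by simp
    interpret P: semilinear_surj R M R N "\<lambda>a. a" "p i" by (rule projection_surj[OF i])
    have im: "p i ` ?A (Suc i) = carrier N"
    proof
      show "carrier N \<subseteq> p i ` ?A (Suc i)"
      proof
        fix y assume y: "y \<in> carrier N"
        have "p j (q i y) \<in> N'" if "j < h" "Suc i \<le> j" for j using pq[OF that(1) i y] that subm_zero[OF N'] by simp
        then have "q i y \<in> ?A (Suc i)" using q_carr[OF i y] by simp
        moreover have "y = p i (q i y)" using pq[OF i i y] by simp
        ultimately show "y \<in> p i ` ?A (Suc i)" by blast
      qed
    qed (use p_carr[OF i] in auto)
    have "(\<forall>j<h. i \<le> j \<longrightarrow> p j x \<in> N') \<longleftrightarrow> (\<forall>j<h. Suc i \<le> j \<longrightarrow> p j x \<in> N') \<and> p i x \<in> N'" for x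
      using i by (auto simp: Suc_le_eq le_less)
    then have "?A i = {x \<in> ?A (Suc i). p i x \<in> N'}" by auto
    from P.has_len_transfer[OF A[of "Suc i"] N' _ this] have "has_len R M (?A i) (?A (Suc i)) k"
      using k subm_subset[OF N'] unfolding im by blast
    moreover have "?A 0 \<subseteq> ?A i" by auto
    ultimately have "has_len R M (?A 0) (?A (Suc i)) (i * k + k)"
      using Suc.IH i by (intro M.has_len_add[OF A[of 0] A[of i] A[of "Suc i"] _ mono]) auto
    then show ?case by (simp add: add.commute)
  qed
  from this[of h] show ?thesis by simp
qed

end

section \<open>Eventually polynomial functions\<close>

definition evpoly :: "(nat \<Rightarrow> real) \<Rightarrow> bool" where
  "evpoly f \<longleftrightarrow> (\<exists>p. \<forall>\<^sub>F n in sequentially. f n = poly p (real n))"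

lemma evpoly_cong: "evpoly f \<Longrightarrow> \<forall>\<^sub>F n in sequentially. g n = f n \<Longrightarrow> evpoly g"
proof -
  assume f: "evpoly f" and g: "\<forall>\<^sub>F n in sequentially. g n = f n"
  from f obtain p where "\<forall>\<^sub>F n in sequentially. f n = poly p (real n)" unfolding evpoly_def ..
  with g have "\<forall>\<^sub>F n in sequentially. g n = poly p (real n)" by eventually_elim simp
  then show ?thesis unfolding evpoly_def ..
qed

lemma evpoly_const: "evpoly (\<lambda>n. c)"
proof -
  have "\<forall>\<^sub>F n in sequentially. c = poly [:c:] (real n)" by (rule always_eventually) simp
  then show ?thesis unfolding evpoly_def ..
qed

lemma evpoly_add:
  assumes "evpoly f" "evpoly g" shows "evpoly (\<lambda>n. f n + g n)"
proof -
  obtain p q where "\<forall>\<^sub>F n in sequentially. f n = poly p (real n)" "\<forall>\<^sub>F n in sequentially. g n = poly q (real n)"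
    using assms by (auto simp: evpoly_def)
  then have "\<forall>\<^sub>F n in sequentially. f n + g n = poly (p + q) (real n)"
    by eventually_elim simp
  then show ?thesis unfolding evpoly_def ..
qed

lemma evpoly_sum: "finite A \<Longrightarrow> (\<And>i. i \<in> A \<Longrightarrow> evpoly (f i)) \<Longrightarrow> evpoly (\<lambda>n. \<Sum>i\<in>A. f i n)"
  by (induction A rule: finite_induct) (auto intro: evpoly_add evpoly_const)

lemma evpoly_shift:
  assumes "evpoly f" shows "evpoly (\<lambda>n. f (n - k))"
proof -
  obtain p where "\<forall>\<^sub>F n in sequentially. f n = poly p (real n)" using assms by (auto simp: evpoly_def)
  then obtain N where N: "\<And>n. n \<ge> N \<Longrightarrow> f n = poly p (real n)" by (auto simp: eventually_sequentially)
  have "f (n - k) = poly (pcompose p [:- real k, 1:]) (real n)" if "n \<ge> N + k" for n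
    using N[of "n - k"] that by (simp add: poly_pcompose of_nat_diff)
  then show ?thesis unfolding evpoly_def eventually_sequentially by blast
qed

text \<open>Induction on the degree: subtracting the difference of a suitable monomial removes the
  leading term of p. Partial sums of eventually polynomial functions are eventually polynomial by
  this lemma.\<close>

lemma poly_antidifference: "\<exists>q :: real poly. \<forall>x. poly q (x + 1) - poly q x = poly p x"
proof (induction "degree p" arbitrary: p rule: less_induct)
  case less
  define n where "n = degree p"
  \<comment> \<open>The difference of c x^(n+1) has coefficient c (n + 1) in degree n, so this
    choice matches the leading coefficient of \<open>p\<close>.\<close>
  define c where "c = lead_coeff p / real (Suc n)"
  define D where "D = (\<Sum>k\<le>n. monom (c * real (Suc n choose k)) k)"
  define q0 where "q0 = monom c (Suc n)"
  have D: "poly q0 (x + 1) - poly q0 x = poly D x" for x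
  proof -
    have "(x + 1) ^ Suc n = (\<Sum>k\<le>Suc n. real (Suc n choose k) * x ^ k)"
      by (subst binomial_ring) simp
    also have "\<dots> = (\<Sum>k\<le>n. real (Suc n choose k) * x ^ k) + x ^ Suc n" by simp
    finally have "poly q0 (x + 1) - poly q0 x = c * (\<Sum>k\<le>n. real (Suc n choose k) * x ^ k)"
      by (simp add: q0_def poly_monom algebra_simps)
    then show ?thesis by (simp add: D_def poly_sum poly_monom sum_distrib_left mult.assoc)
  qed
  have cD: "coeff D i = (if i \<le> n then c * real (Suc n choose i) else 0)" for i
    by (simp add: D_def coeff_sum)
  have top: "coeff (p - D) n = 0" using cD[of n] by (simp add: c_def n_def)
  have high: "coeff (p - D) i = 0" if "i > n" for i using cD[of i] that by (simp add: n_def coeff_eq_0)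
  show ?case
  proof (cases "n = 0")
    case True
    then have "p - D = 0" using top high by (intro poly_eqI) (metis coeff_0 neq0_conv)
    then show ?thesis using D by auto
  next
    case False
    have "degree (p - D) < degree p"
    proof -
      have "degree (p - D) \<le> n - 1"
        using top high by (intro degree_le) (metis False Suc_pred' bot_nat_0.not_eq_extremum not_less_eq not_less_iff_gr_or_eq)
      then show ?thesis using False n_def by simp
    qed
    from less[OF this] obtain q1 where q1: "\<forall>x. poly q1 (x + 1) - poly q1 x = poly (p - D) x" ..
    have "poly (q0 + q1) (x + 1) - poly (q0 + q1) x = poly p x" for x
      using D[of x] spec[OF q1, of x] by simp
    then show ?thesis by blast
  qed
qed

lemma evpoly_partial_sums:
  assumes "evpoly f" shows "evpoly (\<lambda>n. \<Sum>i<n. f i)"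
proof -
  obtain p where "\<forall>\<^sub>F n in sequentially. f n = poly p (real n)" using assms by (auto simp: evpoly_def)
  then obtain N where N: "\<And>n. n \<ge> N \<Longrightarrow> f n = poly p (real n)" by (auto simp: eventually_sequentially)
  obtain q where q: "\<And>x. poly q (x + 1) - poly q x = poly p x" using poly_antidifference by blast
  let ?c = "(\<Sum>i<N. f i) - poly q (real N)"
  have "(\<Sum>i<n. f i) = poly (q + [:?c:]) (real n)" if "n \<ge> N" for n
    using that
  proof (induction n rule: dec_induct)
    case (step n)
    then show ?case using N[of n] q[of "real n"] by (simp add: algebra_simps)
  qed simp
  then show ?thesis unfolding evpoly_def eventually_sequentially by blast
qed

text \<open>If the polynomial had degree D above d, the bound would force its values divided by n^D,
  and thus its leading coefficient, to tend to 0. With degree at most d the quotient converges, to 0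
  unless the degree is d.\<close>

lemma evpoly_bounded_convergent:
  assumes f: "evpoly f" and bound: "\<And>n. n \<ge> 1 \<Longrightarrow> \<bar>f n\<bar> \<le> C * real n ^ d"
  shows "convergent (\<lambda>n. f n / real n ^ d)"
proof -
  obtain p where p: "\<forall>\<^sub>F n in sequentially. f n = poly p (real n)" using f by (auto simp: evpoly_def)
  let ?D = "degree p"
  have lim: "(\<lambda>n. poly p (real n) / real n ^ ?D) \<longlonglongrightarrow> lead_coeff p"
    by (rule filterlim_compose[OF poly_divide_tendsto_aux
      filterlim_mono[OF filterlim_real_sequentially at_top_le_at_infinity order_refl]])
  have pos: "\<forall>\<^sub>F n in sequentially. (n::nat) \<ge> 1" by (rule eventually_ge_at_top)
  consider "?D \<le> d" | "d < ?D" by linarith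
  then show ?thesis
  proof cases
    case 1
    have "convergent (\<lambda>n. 1 / real n ^ (d - ?D))"
    proof (cases "d = ?D")
      case False
      then have "(\<lambda>n. inverse (real n) ^ (d - ?D)) \<longlonglongrightarrow> 0 ^ (d - ?D)"
        by (intro tendsto_power lim_inverse_n)
      then show ?thesis unfolding convergent_def by (auto simp: divide_inverse power_inverse)
    qed (simp add: convergent_const)
    then obtain L where "(\<lambda>n. 1 / real n ^ (d - ?D)) \<longlonglongrightarrow> L" by (auto simp: convergent_def)
    from tendsto_mult[OF lim this]
    have "(\<lambda>n. poly p (real n) / real n ^ ?D * (1 / real n ^ (d - ?D))) \<longlonglongrightarrow> lead_coeff p * L" .
    moreover have "\<forall>\<^sub>F n in sequentially. poly p (real n) / real n ^ ?D * (1 / real n ^ (d - ?D)) = f n / real n ^ d"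
      using p pos by eventually_elim (simp add: 1 flip: power_add)
    ultimately have "(\<lambda>n. f n / real n ^ d) \<longlonglongrightarrow> lead_coeff p * L" by (rule Lim_transform_eventually)
    then show ?thesis by (auto simp: convergent_def)
  next
    case 2
    have z: "(\<lambda>n. C * inverse (real n) ^ (?D - d)) \<longlonglongrightarrow> C * 0 ^ (?D - d)"
      by (intro tendsto_intros lim_inverse_n)
    have "(\<lambda>n. poly p (real n) / real n ^ ?D) \<longlonglongrightarrow> 0"
    proof (rule tendsto_rabs_zero_cancel, rule tendsto_sandwich[OF _ _ tendsto_const])
      show "\<forall>\<^sub>F n in sequentially. 0 \<le> \<bar>poly p (real n) / real n ^ ?D\<bar>" by simp
      show "(\<lambda>n. C * inverse (real n) ^ (?D - d)) \<longlonglongrightarrow> 0" using z 2 by (simp add: power_0_left)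
      show "\<forall>\<^sub>F n in sequentially. \<bar>poly p (real n) / real n ^ ?D\<bar> \<le> C * inverse (real n) ^ (?D - d)"
        using p pos
      proof eventually_elim
        case (elim n)
        have "\<bar>poly p (real n)\<bar> / real n ^ ?D \<le> C * real n ^ d / real n ^ ?D"
          using bound[of n] elim by (intro divide_right_mono) auto
        also have "real n ^ ?D = real n ^ d * real n ^ (?D - d)" using 2 by (simp flip: power_add)
        also have "C * real n ^ d / (real n ^ d * real n ^ (?D - d)) = C * inverse (real n) ^ (?D - d)"
          using elim by (simp add: field_simps)
        finally show ?case using 2 by (simp add: abs_divide flip: power_add)
      qed
    qed
    then have "lead_coeff p = 0" using lim LIMSEQ_unique by blast
    then show ?thesis using 2 by simp
  qed
qed

section \<open>Monomials\<close>

lemma mono_subseq_nat: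
  fixes a :: "nat \<Rightarrow> nat"
  shows "\<exists>\<psi> :: nat \<Rightarrow> nat. strict_mono \<psi> \<and> (\<forall>i j. i \<le> j \<longrightarrow> a (\<psi> i) \<le> a (\<psi> j))"
proof -
  obtain \<psi> where \<psi>: "strict_mono \<psi>" "monoseq (\<lambda>n. a (\<psi> n))" using seq_monosub[of a] by auto
  show ?thesis
  proof (cases "\<forall>m. \<forall>n\<ge>m. a (\<psi> m) \<le> a (\<psi> n)")
    case True then show ?thesis using \<psi> by blast
  next
    case False
    then have dec: "\<And>m n. m \<le> n \<Longrightarrow> a (\<psi> n) \<le> a (\<psi> m)" using \<psi>(2) by (auto simp: monoseq_def)
    \<comment> \<open>A nonincreasing subsequence of natural numbers attains its minimum
      \<open>k\<close> and is constant from there on; a shift makes it nondecreasing.\<close>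
    define k where "k = (LEAST v. \<exists>n. a (\<psi> n) = v)"
    have "\<exists>n. a (\<psi> n) = k" unfolding k_def by (rule LeastI_ex) blast
    then obtain m where m: "a (\<psi> m) = k" ..
    have "a (\<psi> (n + m)) = k" for n
    proof (rule antisym)
      show "a (\<psi> (n + m)) \<le> k" using dec[of m "n + m"] m by simp
      show "k \<le> a (\<psi> (n + m))" unfolding k_def by (rule Least_le) blast
    qed
    moreover have "strict_mono (\<lambda>n. \<psi> (n + m))" using \<psi>(1) by (simp add: strict_mono_def)
    ultimately show ?thesis by (intro exI[of _ "\<lambda>n. \<psi> (n + m)"]) simp
  qed
qed

text \<open>Induction on the length: a subsequence along which the tails are nondecreasing is
  thinned once more so that the heads are nondecreasing too.\<close>

lemma dickson:
  fixes f :: "nat \<Rightarrow> nat list"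
  assumes "\<And>n. length (f n) = t"
  shows "\<exists>\<phi> :: nat \<Rightarrow> nat. strict_mono \<phi> \<and> (\<forall>i j. i \<le> j \<longrightarrow> list_all2 (\<le>) (f (\<phi> i)) (f (\<phi> j)))"
  using assms
proof (induction t arbitrary: f)
  case 0 then show ?case by (intro exI[of _ id]) (simp add: strict_mono_def)
next
  case (Suc t)
  have "\<And>n. length (tl (f n)) = t" using Suc.prems by simp
  from Suc.IH[of "\<lambda>n. tl (f n)", OF this] obtain \<phi> :: "nat \<Rightarrow> nat" where \<phi>: "strict_mono \<phi>" "\<And>i j. i \<le> j \<Longrightarrow> list_all2 (\<le>) (tl (f (\<phi> i))) (tl (f (\<phi> j)))" by auto
  obtain \<psi> :: "nat \<Rightarrow> nat" where \<psi>: "strict_mono \<psi>" "\<And>i j. i \<le> j \<Longrightarrow> hd (f (\<phi> (\<psi> i))) \<le> hd (f (\<phi> (\<psi> j)))"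
    using mono_subseq_nat[of "\<lambda>n. hd (f (\<phi> n))"] by auto
  have ne: "f n \<noteq> []" for n using Suc.prems[of n] by auto
  have "list_all2 (\<le>) (f (\<phi> (\<psi> i))) (f (\<phi> (\<psi> j)))" if "i \<le> j" for i j
  proof -
    have "\<psi> i \<le> \<psi> j" using \<psi>(1) that by (simp add: strict_mono_less_eq)
    then have "list_all2 (\<le>) (hd (f (\<phi> (\<psi> i))) # tl (f (\<phi> (\<psi> i)))) (hd (f (\<phi> (\<psi> j))) # tl (f (\<phi> (\<psi> j))))"
      using \<psi>(2)[OF that] \<phi>(2) by simp
    then show ?thesis using ne by simp
  qed
  moreover have "strict_mono (\<lambda>n. \<phi> (\<psi> n))" using \<phi>(1) \<psi>(1) by (simp add: strict_mono_def)
  ultimately show ?case by blast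
qed

section \<open>Counting exponent vectors outside a monomial ideal\<close>

definition upset :: "nat \<Rightarrow> nat list set \<Rightarrow> bool" where
  "upset t U \<longleftrightarrow> (\<forall>\<alpha>\<in>U. \<forall>\<beta>. length \<alpha> = t \<longrightarrow> list_all2 (\<le>) \<alpha> \<beta> \<longrightarrow> \<beta> \<in> U)"

definition exps :: "nat \<Rightarrow> nat \<Rightarrow> nat list set" where
  "exps t k = {\<alpha>. length \<alpha> = t \<and> sum_list \<alpha> = k}"

lemma exps_subset: "exps t k \<subseteq> {\<alpha>. set \<alpha> \<subseteq> {..k} \<and> length \<alpha> = t}"
  using member_le_sum_list by (fastforce simp: exps_def)

lemma finite_exps: "finite (exps t k)"
  by (rule finite_subset[OF exps_subset finite_lists_length_eq]) simp

lemma exps_Suc: "exps (Suc t) k = (\<Union>j\<le>k. (\<lambda>\<beta>. j # \<beta>) ` exps t (k - j))"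
proof (intro equalityI subsetI)
  fix \<alpha> assume "\<alpha> \<in> exps (Suc t) k"
  then obtain j \<beta> where "\<alpha> = j # \<beta>" "length \<beta> = t" "j + sum_list \<beta> = k" by (cases \<alpha>) (auto simp: exps_def)
  then have "j \<in> {..k}" "\<beta> \<in> exps t (k - j)" "\<alpha> = j # \<beta>" by (auto simp: exps_def)
  then show "\<alpha> \<in> (\<Union>j\<le>k. (\<lambda>\<beta>. j # \<beta>) ` exps t (k - j))" by blast
qed (auto simp: exps_def)

text \<open>Exponent vectors of degree less than m have all entries less than m, so they lie in a
  cube with m^t points.\<close>

lemma count_exps: "(\<Sum>k<m. card (exps t k)) \<le> m ^ t"
proof -
  have "(\<Sum>k<m. card (exps t k)) = card (\<Union>k<m. exps t k)"
    by (rule card_UN_disjoint[symmetric]) (auto simp: finite_exps, auto simp: exps_def)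
  also have "\<dots> \<le> card {\<alpha>. set \<alpha> \<subseteq> {..<m} \<and> length \<alpha> = t}"
  proof (rule card_mono[OF finite_lists_length_eq])
    show "(\<Union>k<m. exps t k) \<subseteq> {\<alpha>. set \<alpha> \<subseteq> {..<m} \<and> length \<alpha> = t}"
    proof
      fix \<alpha> assume "\<alpha> \<in> (\<Union>k<m. exps t k)"
      then obtain k where k: "k < m" "\<alpha> \<in> exps t k" by auto
      then have "set \<alpha> \<subseteq> {..k}" "length \<alpha> = t" using exps_subset by blast+
      then show "\<alpha> \<in> {\<alpha>. set \<alpha> \<subseteq> {..<m} \<and> length \<alpha> = t}" using k by auto
    qed
  qed simp
  also have "\<dots> = m ^ t" by (simp add: card_lists_length_eq)
  finally show ?thesis .
qed

text \<open>Otherwise there are increasing indices s i and elements of V (s (i+1)) outside V (s i).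
  By Dickson's lemma an earlier one of these is below a later one, which then already belongs to the
  set that it was chosen to avoid.\<close>

lemma upset_chain_stabilizes:
  assumes up: "\<And>j. upset t (V j)" and len: "\<And>j \<alpha>. \<alpha> \<in> V j \<Longrightarrow> length \<alpha> = t" and mono: "\<And>j. V j \<subseteq> V (Suc j)"
  shows "\<exists>J. \<forall>j\<ge>J. V j = V J"
proof (rule ccontr)
  assume neg: "\<not> ?thesis"
  have m: "V i \<subseteq> V j" if "i \<le> j" for i j using lift_Suc_mono_le[of V, OF mono that] .
  have "\<forall>J. \<exists>j \<alpha>. j > J \<and> \<alpha> \<in> V j \<and> \<alpha> \<notin> V J"
  proof
    fix J obtain j where j: "j \<ge> J" "V j \<noteq> V J" using neg by blast
    then have "j > J" "\<exists>\<alpha>. \<alpha> \<in> V j \<and> \<alpha> \<notin> V J" using m[OF j(1)] by (auto simp: le_less)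
    then show "\<exists>j \<alpha>. j > J \<and> \<alpha> \<in> V j \<and> \<alpha> \<notin> V J" by blast
  qed
  then obtain nx el where nx: "\<And>J. nx J > J" "\<And>J. el J \<in> V (nx J)" "\<And>J. el J \<notin> V J" by metis
  define s where "s i = (nx ^^ i) 0" for i
  have sS: "s (Suc i) = nx (s i)" for i by (simp add: s_def)
  have sm: "strict_mono s" unfolding strict_mono_Suc_iff sS using nx(1) by blast
  have "length (el (s i)) = t" for i using len[OF nx(2)] .
  from dickson[of "\<lambda>i. el (s i)", OF this] obtain \<phi> :: "nat \<Rightarrow> nat" where \<phi>: "strict_mono \<phi>" "\<And>i j. i \<le> j \<Longrightarrow> list_all2 (\<le>) (el (s (\<phi> i))) (el (s (\<phi> j)))"
    by blast
  have "el (s (\<phi> 0)) \<in> V (s (Suc (\<phi> 0)))" using nx(2) sS by simp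
  moreover have "Suc (\<phi> 0) \<le> \<phi> 1" using \<phi>(1) by (simp add: strict_mono_def Suc_leI)
  then have "s (Suc (\<phi> 0)) \<le> s (\<phi> 1)" using sm by (simp add: strict_mono_less_eq)
  ultimately have "el (s (\<phi> 0)) \<in> V (s (\<phi> 1))" using m by blast
  moreover have "list_all2 (\<le>) (el (s (\<phi> 0))) (el (s (\<phi> 1)))" by (rule \<phi>(2)) simp
  ultimately have "el (s (\<phi> 1)) \<in> V (s (\<phi> 1))" using up len unfolding upset_def by blast
  then show False using nx(3) by blast
qed

text \<open>Slice by the first exponent j. The slices \<open>V j\<close> increase with j and are
  constant from some J on, so the count is a sum of finitely many shifted counts in t variables and
  one partial sum of the count for \<open>V J\<close>, all eventually polynomial by
  induction.\<close>

lemma evpoly_count: "upset t U \<Longrightarrow> evpoly (\<lambda>k. real (card (exps t k - U)))"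
proof (induction t arbitrary: U)
  case 0
  have "\<forall>\<^sub>F k in sequentially. real (card (exps 0 k - U)) = 0"
    using eventually_gt_at_top[of 0] by eventually_elim (auto simp: exps_def)
  then show ?case by (rule evpoly_cong[OF evpoly_const[of 0]])
next
  case (Suc t)
  define V where "V j = {\<beta>. length \<beta> = t \<and> j # \<beta> \<in> U}" for j
  have up: "upset t (V j)" for j
    unfolding upset_def
  proof (intro ballI allI impI)
    fix \<alpha> \<beta> assume *: "\<alpha> \<in> V j" "length \<alpha> = t" "list_all2 (\<le>) \<alpha> \<beta>"
    then have "list_all2 (\<le>) (j # \<alpha>) (j # \<beta>)" "length (j # \<alpha>) = Suc t" "j # \<alpha> \<in> U" by (auto simp: V_def)
    then have "j # \<beta> \<in> U" using Suc.prems unfolding upset_def by blast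
    then show "\<beta> \<in> V j" using * list_all2_lengthD by (force simp: V_def)
  qed
  have "V j \<subseteq> V (Suc j)" for j
  proof
    fix \<beta> assume "\<beta> \<in> V j"
    then have *: "j # \<beta> \<in> U" "length \<beta> = t" by (auto simp: V_def)
    have "list_all2 (\<le>) (j # \<beta>) (Suc j # \<beta>)" by (simp add: list_all2_refl)
    then show "\<beta> \<in> V (Suc j)" using * Suc.prems unfolding upset_def V_def by auto
  qed
  from upset_chain_stabilizes[of t V, OF up _ this] obtain J where J: "\<And>j. j \<ge> J \<Longrightarrow> V j = V J"
    by (auto simp: V_def)
  let ?c = "\<lambda>j k. real (card (exps t k - V j))"
  have c: "evpoly (?c j)" for j by (rule Suc.IH[OF up])
  have "real (card (exps (Suc t) k - U)) = (\<Sum>j<J. ?c j (k - j)) + (\<Sum>i<Suc (k - J). ?c J i)" if k: "k \<ge> J" for k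
  proof -
    have "exps (Suc t) k - U = (\<Union>j\<le>k. (\<lambda>\<beta>. j # \<beta>) ` (exps t (k - j) - V j))"
      unfolding exps_Suc by (auto simp: V_def exps_def)
    also have "card \<dots> = (\<Sum>j\<le>k. card ((\<lambda>\<beta>. j # \<beta>) ` (exps t (k - j) - V j)))"
      by (rule card_UN_disjoint) (auto simp: finite_exps)
    also have "\<dots> = (\<Sum>j\<le>k. card (exps t (k - j) - V j))"
      by (intro sum.cong refl card_image) (simp add: inj_on_def)
    finally have "real (card (exps (Suc t) k - U)) = (\<Sum>j\<le>k. ?c j (k - j))" by simp
    also have "{..k} = {..<J} \<union> {J..k}" using k by auto
    also have "(\<Sum>j\<in>{..<J} \<union> {J..k}. ?c j (k - j)) = (\<Sum>j<J. ?c j (k - j)) + (\<Sum>j\<in>{J..k}. ?c j (k - j))"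
      by (rule sum.union_disjoint) auto
    also have "(\<Sum>j\<in>{J..k}. ?c j (k - j)) = (\<Sum>i<Suc (k - J). ?c J i)"
    proof (rule sum.reindex_bij_witness[of _ "\<lambda>i. k - i" "\<lambda>j. k - j"])
      fix j assume "j \<in> {J..k}"
      then show "?c J (k - j) = ?c j (k - j)" using J[of j] by simp
    qed (use k in auto)
    finally show ?thesis .
  qed
  then have "\<forall>\<^sub>F k in sequentially. real (card (exps (Suc t) k - U)) = (\<Sum>j<J. ?c j (k - j)) + (\<Sum>i<Suc (k - J). ?c J i)"
    unfolding eventually_sequentially by blast
  moreover have "evpoly (\<lambda>k. (\<Sum>j<J. ?c j (k - j)) + (\<Sum>i<Suc (k - J). ?c J i))"
  proof (intro evpoly_add evpoly_sum)
    show "finite {..<J}" by simp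
    show "evpoly (\<lambda>k. ?c j (k - j))" for j by (rule evpoly_shift[OF c])
    have "evpoly (\<lambda>n. (\<Sum>i<n. ?c J i) + ?c J n)" by (intro evpoly_add evpoly_partial_sums c)
    then have "evpoly (\<lambda>n. \<Sum>i<Suc n. ?c J i)" by simp
    from evpoly_shift[OF this, of J] show "evpoly (\<lambda>k. \<Sum>i<Suc (k - J). ?c J i)" .
  qed
  ultimately show ?case by (rule evpoly_cong[rotated])
qed

section \<open>Filtrations by monomials\<close>

text \<open>The operators in the first list act as the variables of a polynomial ring, and the
  second list is an exponent vector. The last equation covers the empty monomial, and lists of
  unequal length for totality.\<close>

fun monomial_op :: "('m \<Rightarrow> 'm) list \<Rightarrow> nat list \<Rightarrow> 'm \<Rightarrow> 'm" where
  "monomial_op (f # fs) (a # \<alpha>) x = (f ^^ a) (monomial_op fs \<alpha> x)"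
| "monomial_op _ _ x = x"

lemma funpow_closed: "(\<And>x. x \<in> W \<Longrightarrow> f x \<in> W) \<Longrightarrow> x \<in> W \<Longrightarrow> (f ^^ a) x \<in> W"
  by (induction a) auto

lemma monomial_op_closed:
  "(\<And>f x. f \<in> set fs \<Longrightarrow> x \<in> W \<Longrightarrow> f x \<in> W) \<Longrightarrow> x \<in> W \<Longrightarrow> monomial_op fs \<alpha> x \<in> W"
proof (induction fs \<alpha> x rule: monomial_op.induct)
  case (1 f fs a \<alpha> x)
  have "monomial_op fs \<alpha> x \<in> W" using 1 by simp
  moreover have "\<And>y. y \<in> W \<Longrightarrow> f y \<in> W" using 1(2) by simp
  ultimately show ?case by (simp add: funpow_closed)
qed auto

lemma funpow_commute:
  assumes "\<And>x. x \<in> W \<Longrightarrow> f x \<in> W" "\<And>x. x \<in> W \<Longrightarrow> g (f x) = f (g x)" "x \<in> W"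
  shows "g ((f ^^ a) x) = (f ^^ a) (g x)"
proof (induction a)
  case (Suc a)
  have "(f ^^ a) x \<in> W" using assms(1,3) by (rule funpow_closed)
  then show ?case using Suc assms(2) by simp
qed simp

lemma monomial_op_commute:
  assumes "\<And>f x. f \<in> set fs \<Longrightarrow> x \<in> W \<Longrightarrow> f x \<in> W" "\<And>f x. f \<in> set fs \<Longrightarrow> x \<in> W \<Longrightarrow> g (f x) = f (g x)" "x \<in> W"
  shows "g (monomial_op fs \<alpha> x) = monomial_op fs \<alpha> (g x)"
  using assms
proof (induction fs \<alpha> x rule: monomial_op.induct)
  case (1 f fs a \<alpha> x)
  have *: "monomial_op fs \<alpha> x \<in> W" by (rule monomial_op_closed) (use 1 in auto)
  have "g ((f ^^ a) (monomial_op fs \<alpha> x)) = (f ^^ a) (g (monomial_op fs \<alpha> x))"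
    by (rule funpow_commute[of W]) (use 1(2,3) * in auto)
  also have "g (monomial_op fs \<alpha> x) = monomial_op fs \<alpha> (g x)" by (rule 1(1)) (use 1 in auto)
  finally show ?case by simp
qed auto

lemma monomial_op_add:
  assumes "\<And>f x. f \<in> set fs \<Longrightarrow> x \<in> W \<Longrightarrow> f x \<in> W"
    "\<And>f g x. f \<in> set fs \<Longrightarrow> g \<in> set fs \<Longrightarrow> x \<in> W \<Longrightarrow> g (f x) = f (g x)" "x \<in> W"
    "length \<alpha> = length fs" "length \<gamma> = length fs"
  shows "monomial_op fs (map2 (+) \<gamma> \<alpha>) x = monomial_op fs \<gamma> (monomial_op fs \<alpha> x)"
  using assms
proof (induction fs arbitrary: \<alpha> \<gamma>)
  case (Cons f fs)
  obtain a \<alpha>' c \<gamma>' where ac: "\<alpha> = a # \<alpha>'" "\<gamma> = c # \<gamma>'"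
    using Cons.prems(4,5) by (auto simp: length_Suc_conv)
  have f: "\<And>x. x \<in> W \<Longrightarrow> f x \<in> W" using Cons.prems(1) by simp
  have fs: "\<And>g x. g \<in> set fs \<Longrightarrow> x \<in> W \<Longrightarrow> g x \<in> W" using Cons.prems(1) by simp
  have y: "monomial_op fs \<alpha>' x \<in> W" using fs Cons.prems(3) by (rule monomial_op_closed)
  have fc: "(f ^^ a) (g z) = g ((f ^^ a) z)" if "g \<in> set fs" "z \<in> W" for g z
    by (rule funpow_commute[symmetric, of W]) (use Cons.prems(1,2) that in auto)
  have "monomial_op fs (map2 (+) \<gamma>' \<alpha>') x = monomial_op fs \<gamma>' (monomial_op fs \<alpha>' x)"
    by (rule Cons.IH) (use Cons.prems ac in auto)
  then have "monomial_op (f # fs) (map2 (+) \<gamma> \<alpha>) x = (f ^^ c) ((f ^^ a) (monomial_op fs \<gamma>' (monomial_op fs \<alpha>' x)))"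
    by (simp add: ac funpow_add)
  also have "(f ^^ a) (monomial_op fs \<gamma>' (monomial_op fs \<alpha>' x)) = monomial_op fs \<gamma>' ((f ^^ a) (monomial_op fs \<alpha>' x))"
    by (rule monomial_op_commute[of fs W "f ^^ a" "monomial_op fs \<alpha>' x" \<gamma>']) (fact fs fc y)+
  finally show ?case by (simp add: ac)
qed simp

text \<open>Pigeonhole: when the degree exceeds c times the number of operators, some exponent is at
  least c. That power leads from V into W, and the remaining operators preserve V and W.\<close>

lemma monomial_op_power_mem:
  assumes "\<And>f x. f \<in> set fs \<Longrightarrow> x \<in> V \<Longrightarrow> f x \<in> V" "\<And>f x. f \<in> set fs \<Longrightarrow> x \<in> W \<Longrightarrow> f x \<in> W"
    "\<And>f x. f \<in> set fs \<Longrightarrow> x \<in> V \<Longrightarrow> (f ^^ c) x \<in> W" "x \<in> V" "length \<alpha> = length fs" "sum_list \<alpha> > c * length fs"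
  shows "monomial_op fs \<alpha> x \<in> W"
  using assms
proof (induction fs arbitrary: \<alpha>)
  case (Cons f fs)
  obtain a \<alpha>' where ac: "\<alpha> = a # \<alpha>'" using Cons.prems(5) by (auto simp: length_Suc_conv)
  have f: "\<And>x. x \<in> W \<Longrightarrow> f x \<in> W" using Cons.prems(2) by simp
  show ?case
  proof (cases "c \<le> a")
    case True
    have y: "monomial_op fs \<alpha>' x \<in> V" by (rule monomial_op_closed) (use Cons.prems(1,4) in auto)
    then have "(f ^^ c) (monomial_op fs \<alpha>' x) \<in> W" using Cons.prems(3) by simp
    with f have "(f ^^ (a - c)) ((f ^^ c) (monomial_op fs \<alpha>' x)) \<in> W" by (rule funpow_closed)
    then show ?thesis using True by (simp add: ac flip: funpow_add[unfolded o_def, THEN fun_cong])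
  next
    case False
    have "monomial_op fs \<alpha>' x \<in> W" by (rule Cons.IH) (use Cons.prems ac False in auto)
    with f show ?thesis by (simp add: ac funpow_closed)
  qed
qed simp

lemma monomial_op_zero: "monomial_op fs (replicate (length fs) 0) x = x"
  by (induction fs) auto

lemma monomial_op_unit:
  "f \<in> set fs \<Longrightarrow> \<exists>\<beta>\<in>exps (length fs) 1. \<forall>x. monomial_op fs \<beta> x = f x"
proof (induction fs)
  case (Cons g fs)
  show ?case
  proof (cases "f = g")
    case True
    have "1 # replicate (length fs) 0 \<in> exps (length (g # fs)) 1" by (simp add: exps_def)
    then show ?thesis using True monomial_op_zero[of fs] by (intro bexI[rotated]) auto
  next
    case False
    then obtain \<beta> where "\<beta> \<in> exps (length fs) 1" "\<forall>x. monomial_op fs \<beta> x = f x" using Cons by auto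
    then show ?thesis by (intro bexI[of _ "0 # \<beta>"]) (auto simp: exps_def)
  qed
qed simp

lemma monomial_op_unit_conv:
  "length \<beta> = length fs \<Longrightarrow> sum_list \<beta> = 1 \<Longrightarrow> \<exists>f\<in>set fs. \<forall>x. monomial_op fs \<beta> x = f x"
proof (induction fs arbitrary: \<beta>)
  case (Cons g fs)
  then obtain a \<beta>' where b: "\<beta> = a # \<beta>'" "length \<beta>' = length fs" by (auto simp: length_Suc_conv)
  show ?case
  proof (cases "a = 0")
    case True then show ?thesis using Cons b by auto
  next
    case False
    then have "a = 1" "sum_list \<beta>' = 0" using Cons.prems(2) unfolding b(1) sum_list.Cons by linarith+
    then have "\<beta>' = replicate (length fs) 0" using b(2) by (auto simp: sum_list_eq_0_iff intro: replicate_eqI)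
    then show ?thesis using \<open>a = 1\<close> b monomial_op_zero[of fs] by auto
  qed
qed simp

lemma exps_split:
  "length \<alpha> = t \<Longrightarrow> sum_list \<alpha> = e + m \<Longrightarrow>
    \<exists>\<beta>\<in>exps t e. \<exists>\<gamma>\<in>exps t m. \<alpha> = map2 (+) \<beta> \<gamma>"
proof (induction t arbitrary: \<alpha> e m)
  case 0 then show ?case by (auto simp: exps_def)
next
  case (Suc t)
  then obtain a \<alpha>' where a: "\<alpha> = a # \<alpha>'" "length \<alpha>' = t" by (auto simp: length_Suc_conv)
  define b where "b = min a e"
  define c where "c = a - b"
  have "sum_list \<alpha>' = (e - b) + (m - c)" "b \<le> e" "c \<le> m" using Suc.prems(2) a by (auto simp: b_def c_def)
  with Suc.IH[OF a(2), of "e - b" "m - c"] obtain \<beta> \<gamma> where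
    "\<beta> \<in> exps t (e - b)" "\<gamma> \<in> exps t (m - c)" "\<alpha>' = map2 (+) \<beta> \<gamma>" by auto
  with \<open>b \<le> e\<close> \<open>c \<le> m\<close> have "b # \<beta> \<in> exps (Suc t) e" "c # \<gamma> \<in> exps (Suc t) m" "\<alpha> = map2 (+) (b # \<beta>) (c # \<gamma>)"
    by (auto simp: exps_def a b_def c_def)
  then show ?case by blast
qed

lemma sum_list_map2_add: "length \<alpha> = length \<beta> \<Longrightarrow> sum_list (map2 (+) \<alpha> \<beta>) = sum_list \<alpha> + (sum_list \<beta> :: nat)"
  by (induction \<alpha> \<beta> rule: list_induct2) auto

lemma exps_add: "\<beta> \<in> exps t e \<Longrightarrow> \<gamma> \<in> exps t m \<Longrightarrow> map2 (+) \<beta> \<gamma> \<in> exps t (e + m)"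
  by (auto simp: exps_def sum_list_map2_add)

text \<open>Invariance under translation makes the lexicographic order a monomial order;
  \<open>upset_nonstandard\<close> rests on it.\<close>

lemma map2_add_less: "length \<alpha> = length \<beta> \<Longrightarrow> length \<gamma> = length \<alpha> \<Longrightarrow> \<alpha> < \<beta> \<Longrightarrow> map2 (+) \<gamma> \<alpha> < map2 (+) \<gamma> (\<beta> :: nat list)"
proof (induction \<alpha> \<beta> arbitrary: \<gamma> rule: list_induct2)
  case (Cons a \<alpha> b \<beta>)
  then obtain c \<gamma>' where "\<gamma> = c # \<gamma>'" by (auto simp: length_Suc_conv)
  then show ?case using Cons by auto
qed simp

lemma list_all2_le_diff: "list_all2 (\<le>) \<alpha> (\<beta> :: nat list) \<Longrightarrow> \<beta> = map2 (+) (map2 (-) \<beta> \<alpha>) \<alpha>"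
  by (induction rule: list_all2_induct) auto

lemma (in module) monomial_op_hom:
  "(\<And>f. f \<in> set fs \<Longrightarrow> f \<in> module_hom R M M) \<Longrightarrow> monomial_op fs \<alpha> \<in> module_hom R M M"
proof (induction fs arbitrary: \<alpha>)
  case Nil
  have "monomial_op [] \<alpha> = (\<lambda>x. x)" by (rule ext) simp
  then show ?case by (simp add: module_hom_def)
next
  case (Cons f fs)
  show ?case
  proof (cases \<alpha>)
    case Nil
    then have "monomial_op (f # fs) \<alpha> = (\<lambda>x. x)" by (intro ext) simp
    then show ?thesis by (simp add: module_hom_def)
  next
    case (Cons a \<alpha>')
    have f: "f \<in> module_hom R M M" and g: "monomial_op fs \<alpha>' \<in> module_hom R M M" using Cons.IH Cons.prems by auto
    have "(\<lambda>x. (f ^^ a) (monomial_op fs \<alpha>' x)) \<in> module_hom R M M"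
      using f g by (induction a) (auto simp: module_hom_def Pi_def)
    moreover have "monomial_op (f # fs) \<alpha> = (\<lambda>x. (f ^^ a) (monomial_op fs \<alpha>' x))" by (intro ext) (simp add: Cons)
    ultimately show ?thesis by simp
  qed
qed

text \<open>The elements are adjoined to A from the largest index downwards. Each step has length 0
  or 1 by \<open>has_len_step\<close>, and it is 1 when z \<mu> is not in the span of A and the
  elements with larger index.\<close>

lemma (in local_module) filtration_step_length:
  fixes z :: "'i :: linorder \<Rightarrow> 'c"
  assumes "finite X" and A: "subm R M A" and "\<And>\<mu>. \<mu> \<in> X \<Longrightarrow> z \<mu> \<in> carrier M"
    and "\<And>r \<mu>. r \<in> \<mm> \<Longrightarrow> \<mu> \<in> X \<Longrightarrow> r \<odot>\<^bsub>M\<^esub> z \<mu> \<in> A"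
  shows "has_len R M A (span (A \<union> z ` X)) (card {\<mu> \<in> X. z \<mu> \<notin> span (A \<union> z ` {\<nu> \<in> X. \<mu> < \<nu>})})"
  using assms(1,3,4)
\<comment> \<open>This rule inserts an index below all others, so those already present are exactly
  the larger ones.\<close>
proof (induction X rule: finite_linorder_min_induct)
  case empty
  have "span A = A" using span_least[OF A order_refl] span_superset[OF subm_subset[OF A]] by blast
  then show ?case using has_len_refl[OF A] by simp
next
  case (insert \<mu> Y)
  let ?B = "span (A \<union> z ` Y)"
  have c: "A \<union> z ` Y \<subseteq> carrier M" and zc: "z \<mu> \<in> carrier M" using insert.prems(1) subm_subset[OF A] by auto
  have AB: "A \<subseteq> ?B" using span_superset[OF c] by blast
  have IH: "has_len R M A ?B (card {\<nu> \<in> Y. z \<nu> \<notin> span (A \<union> z ` {\<xi> \<in> Y. \<nu> < \<xi>})})"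
    by (rule insert.IH) (use insert.prems in auto)
  have eq: "span (A \<union> z ` insert \<mu> Y) = msum M ((\<lambda>r. r \<odot>\<^bsub>M\<^esub> z \<mu>) ` carrier R) ?B"
    using span_insert[OF c zc] by simp
  have step: "has_len R M ?B (span (A \<union> z ` insert \<mu> Y)) (if z \<mu> \<in> ?B then 0 else 1)"
    unfolding eq by (rule has_len_step[OF max_ideal_maximal _ subm_span[OF c] zc]) (use unit_iff AB insert.prems(2) in auto)
  have c': "A \<union> z ` insert \<mu> Y \<subseteq> carrier M" using c zc by auto
  have BC: "?B \<subseteq> span (A \<union> z ` insert \<mu> Y)" by (rule span_mono') auto
  have len: "has_len R M A (span (A \<union> z ` insert \<mu> Y))
      (card {\<nu> \<in> Y. z \<nu> \<notin> span (A \<union> z ` {\<xi> \<in> Y. \<nu> < \<xi>})} + (if z \<mu> \<in> ?B then 0 else 1))"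
    by (rule has_len_add[OF A subm_span[OF c] subm_span[OF c'] AB BC IH step])
  have m: "{\<xi> \<in> insert \<mu> Y. \<mu> < \<xi>} = Y" "\<And>\<nu>. \<nu> \<in> Y \<Longrightarrow> {\<xi> \<in> insert \<mu> Y. \<nu> < \<xi>} = {\<xi> \<in> Y. \<nu> < \<xi>}"
    using insert.hyps(2) by (auto simp: not_less_iff_gr_or_eq)
  define G where "G \<nu> = span (A \<union> z ` {\<xi> \<in> insert \<mu> Y. \<nu> < \<xi>})" for \<nu>
  define G' where "G' \<nu> = span (A \<union> z ` {\<xi> \<in> Y. \<nu> < \<xi>})" for \<nu>
  have "G \<mu> = ?B" "\<And>\<nu>. \<nu> \<in> Y \<Longrightarrow> G \<nu> = G' \<nu>" unfolding G_def G'_def by (simp_all only: m)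
  then have "{\<nu> \<in> insert \<mu> Y. z \<nu> \<notin> G \<nu>} = (if z \<mu> \<in> ?B then {} else {\<mu>}) \<union> {\<nu> \<in> Y. z \<nu> \<notin> G' \<nu>}"
    by auto
  then have "{\<nu> \<in> insert \<mu> Y. z \<nu> \<notin> span (A \<union> z ` {\<xi> \<in> insert \<mu> Y. \<nu> < \<xi>})} =
      (if z \<mu> \<in> ?B then {} else {\<mu>}) \<union> {\<nu> \<in> Y. z \<nu> \<notin> span (A \<union> z ` {\<xi> \<in> Y. \<nu> < \<xi>})}"
    unfolding G_def G'_def .
  also have "card \<dots> = (if z \<mu> \<in> ?B then 0 else 1) + card {\<nu> \<in> Y. z \<nu> \<notin> span (A \<union> z ` {\<xi> \<in> Y. \<nu> < \<xi>})}"
    using insert.hyps by (subst card_Un_disjoint) auto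
  finally show ?case using len by (simp only: add.commute)
qed


lemma (in module) hom_span_subset:
  assumes "f \<in> module_hom R M M" "X \<subseteq> carrier M" "subm R M W" "f ` X \<subseteq> W"
  shows "f ` span X \<subseteq> W"
proof -
  have "span X \<subseteq> {x \<in> carrier M. f x \<in> W}"
    using assms by (intro span_least hom_vimage_subm[OF module_axioms assms(1)]) auto
  then show ?thesis by auto
qed

text \<open>Through the commuting operators \<open>fs\<close>, M becomes a module over a polynomial
  ring with coefficients in R, and \<open>us\<close> generates it already over R. The levels are
  then the powers of the ideal of the variables applied to M. The locale is used for generators of
  the maximal ideal of R and for those of the maximal ideal of S.\<close>

locale monomial_filtration = local_module R M
  for R :: "('a, 'b) ring_scheme" (structure) and M :: "('a, 'm, 'c) module_scheme" (structure) +
  fixes fs :: "('m \<Rightarrow> 'm) list" and us :: "'m list"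
  assumes op: "f \<in> set fs \<Longrightarrow> f \<in> module_hom R M M"
    and comm: "f \<in> set fs \<Longrightarrow> g \<in> set fs \<Longrightarrow> x \<in> carrier M \<Longrightarrow> g (f x) = f (g x)"
    and us: "set us \<subseteq> carrier M" and gen: "carrier M = lspan R M us"
begin

abbreviation "t \<equiv> length fs"

text \<open>The head is the position of a generator in \<open>us\<close> and the tail an exponent
  vector, so the lexicographic order of lists compares the generators first.\<close>

definition idx :: "nat \<Rightarrow> nat list set" where
  "idx k = {i # \<alpha> | i \<alpha>. i < length us \<and> \<alpha> \<in> exps t k}"

definition z :: "nat list \<Rightarrow> 'm" where
  "z \<mu> = monomial_op fs (tl \<mu>) (us ! hd \<mu>)"

definition level :: "nat \<Rightarrow> 'm set" where
  "level k = span (z ` idx k)"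

lemma op_closed: "f \<in> set fs \<Longrightarrow> x \<in> carrier M \<Longrightarrow> f x \<in> carrier M"
  using op module_hom_closed by fast

lemma mono_hom: "monomial_op fs \<alpha> \<in> module_hom R M M"
  by (rule monomial_op_hom[OF op])

lemma mono_closed: "x \<in> carrier M \<Longrightarrow> monomial_op fs \<alpha> x \<in> carrier M"
  by (rule monomial_op_closed[where W = "carrier M"]) (rule op_closed)

lemma mono_add:
  "x \<in> carrier M \<Longrightarrow> length \<alpha> = t \<Longrightarrow> length \<gamma> = t \<Longrightarrow>
    monomial_op fs (map2 (+) \<gamma> \<alpha>) x = monomial_op fs \<gamma> (monomial_op fs \<alpha> x)"
  by (rule monomial_op_add[where W = "carrier M"]) (assumption | rule op_closed comm)+

lemma idx_eq: "idx k = (\<Union>i<length us. (\<lambda>\<alpha>. i # \<alpha>) ` exps t k)"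
  by (auto simp: idx_def)

lemma finite_idx: "finite (idx k)"
  by (simp add: idx_eq finite_exps)

lemma z_carr: "\<mu> \<in> idx k \<Longrightarrow> z \<mu> \<in> carrier M"
  using us nth_mem unfolding z_def by (intro mono_closed) (auto simp: idx_def)

lemma z_image_carr: "z ` idx k \<subseteq> carrier M"
  using z_carr by auto

lemma subm_level: "subm R M (level k)"
  unfolding level_def by (rule subm_span[OF z_image_carr])

lemma level_carr: "x \<in> level k \<Longrightarrow> x \<in> carrier M"
  by (rule subm_carr[OF subm_level])

lemma z_level: "\<mu> \<in> idx k \<Longrightarrow> z \<mu> \<in> level k"
  unfolding level_def using span_superset[OF z_image_carr] by blast

lemma z_add:
  assumes "i # \<alpha> \<in> idx k" "\<gamma> \<in> exps t m"
  shows "z (i # map2 (+) \<gamma> \<alpha>) = monomial_op fs \<gamma> (z (i # \<alpha>))" "i # map2 (+) \<gamma> \<alpha> \<in> idx (m + k)"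
proof -
  have *: "i < length us" "\<alpha> \<in> exps t k" using assms by (auto simp: idx_def)
  then have "us ! i \<in> carrier M" using us nth_mem by blast
  then show "z (i # map2 (+) \<gamma> \<alpha>) = monomial_op fs \<gamma> (z (i # \<alpha>))"
    using * assms(2) by (simp add: z_def mono_add exps_def)
  show "i # map2 (+) \<gamma> \<alpha> \<in> idx (m + k)" using * exps_add[OF assms(2) *(2)] by (simp add: idx_def)
qed

lemma mono_level:
  assumes "\<gamma> \<in> exps t m" "x \<in> level k"
  shows "monomial_op fs \<gamma> x \<in> level (m + k)"
proof -
  have "monomial_op fs \<gamma> ` z ` idx k \<subseteq> level (m + k)"
    unfolding image_image
  proof (intro image_subsetI)
    fix \<mu> assume \<mu>: "\<mu> \<in> idx k"
    then obtain i \<alpha> where "\<mu> = i # \<alpha>" by (auto simp: idx_def)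
    then show "monomial_op fs \<gamma> (z \<mu>) \<in> level (m + k)"
      using z_add[of i \<alpha> k \<gamma> m] \<mu> assms(1) z_level by metis
  qed
  from hom_span_subset[OF mono_hom z_image_carr subm_level this] show ?thesis
    using assms(2) unfolding level_def by blast
qed

lemma level_least:
  assumes W: "subm R M W" and "\<And>\<beta> x. \<beta> \<in> exps t m \<Longrightarrow> x \<in> level k \<Longrightarrow> monomial_op fs \<beta> x \<in> W"
  shows "level (m + k) \<subseteq> W"
  unfolding level_def
proof (rule span_least[OF W], intro image_subsetI)
  fix \<mu> assume "\<mu> \<in> idx (m + k)"
  then obtain i \<alpha> where \<mu>: "\<mu> = i # \<alpha>" "i < length us" "length \<alpha> = t" "sum_list \<alpha> = m + k" by (auto simp: idx_def exps_def)
  from exps_split[OF \<mu>(3,4)] obtain \<beta> \<gamma> where *: "\<beta> \<in> exps t m" "\<gamma> \<in> exps t k" "\<alpha> = map2 (+) \<beta> \<gamma>" by auto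
  then have "i # \<gamma> \<in> idx k" using \<mu>(2) by (simp add: idx_def)
  from z_add(1)[OF this *(1)] assms(2)[OF *(1) z_level[OF this]] show "z \<mu> \<in> W" using \<mu>(1) *(3) by simp
qed

lemma op_level: "f \<in> set fs \<Longrightarrow> x \<in> level k \<Longrightarrow> f x \<in> level (Suc k)"
proof -
  assume f: "f \<in> set fs" and x: "x \<in> level k"
  from monomial_op_unit[OF f] obtain \<beta> where "\<beta> \<in> exps t 1" "monomial_op fs \<beta> x = f x" by blast
  then show ?thesis using mono_level[of \<beta> 1 x k] x by simp
qed

lemma level_Suc_least:
  assumes W: "subm R M W" and "\<And>f x. f \<in> set fs \<Longrightarrow> x \<in> level k \<Longrightarrow> f x \<in> W"
  shows "level (Suc k) \<subseteq> W"
proof -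
  have "level (1 + k) \<subseteq> W"
  proof (rule level_least[OF W])
    fix \<beta> x assume "\<beta> \<in> exps t 1" "x \<in> level k"
    then show "monomial_op fs \<beta> x \<in> W"
      using monomial_op_unit_conv[of \<beta> fs] assms(2) by (auto simp: exps_def)
  qed
  then show ?thesis by simp
qed

lemma level_0: "level 0 = carrier M"
proof
  show "level 0 \<subseteq> carrier M" using level_carr by auto
  have "u \<in> level 0" if "u \<in> set us" for u
  proof -
    obtain i where i: "i < length us" "u = us ! i" using \<open>u \<in> set us\<close> by (auto simp: in_set_conv_nth)
    have "i # replicate t 0 \<in> idx 0" using i by (simp add: idx_def exps_def)
    from z_level[OF this] show ?thesis using i monomial_op_zero[of fs] by (simp add: z_def)
  qed
  then show "carrier M \<subseteq> level 0" unfolding gen by (intro lspan_least[OF subm_level]) auto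
qed

text \<open>Applied to the operators themselves this shows that the levels decrease; applied to
  multiplications by elements of S it makes the levels in S ideals of S.\<close>

lemma level_closed:
  assumes g: "g \<in> module_hom R M M" and gc: "\<And>f x. f \<in> set fs \<Longrightarrow> x \<in> carrier M \<Longrightarrow> g (f x) = f (g x)"
  shows "x \<in> level k \<Longrightarrow> g x \<in> level k"
proof (induction k arbitrary: x)
  case 0
  then show ?case using level_0 module_hom_closed[OF g] by blast
next
  case (Suc k)
  have "level (Suc k) \<subseteq> {x \<in> carrier M. g x \<in> level (Suc k)}"
  proof (rule level_Suc_least)
    show "subm R M {x \<in> carrier M. g x \<in> level (Suc k)}" by (rule hom_vimage_subm[OF module_axioms g subm_level])
    fix f x assume f: "f \<in> set fs" and x: "x \<in> level k"
    then have "f (g x) \<in> level (Suc k)" using op_level Suc.IH by blast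
    then show "f x \<in> {x \<in> carrier M. g x \<in> level (Suc k)}"
      using f level_carr[OF x] op_closed gc by auto
  qed
  then show ?case using Suc.prems by blast
qed

lemma level_antimono: "level (Suc k) \<subseteq> level k"
proof (rule level_Suc_least[OF subm_level])
  fix f x assume f: "f \<in> set fs" and x: "x \<in> level k"
  show "f x \<in> level k" by (rule level_closed[of f, OF op[OF f] _ x]) (rule comm[OF _ f])
qed

text \<open>
  The exponents of the monomials that are redundant modulo the next level: a standard monomial is not
  a combination of larger ones of the same degree.
\<close>

definition nonstandard :: "nat \<Rightarrow> nat list set" where
  "nonstandard i = {\<alpha>. length \<alpha> = t \<and>
     z (i # \<alpha>) \<in> span (level (Suc (sum_list \<alpha>)) \<union> z ` {\<nu> \<in> idx (sum_list \<alpha>). i # \<alpha> < \<nu>})}"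

definition len :: "nat \<Rightarrow> nat" where
  "len n = (\<Sum>k<n. \<Sum>i<length us. card (exps t k - nonstandard i))"

text \<open>The relation that expresses z (i # \<alpha>) by larger monomials modulo the next level
  is multiplied by the monomial with exponent \<beta> - \<alpha>. Larger monomials stay larger, and
  degrees and levels shift by the same amount, so it becomes such a relation for \<beta>.\<close>

lemma upset_nonstandard: "i < length us \<Longrightarrow> upset t (nonstandard i)"
  unfolding upset_def
proof (intro ballI allI impI)
  fix \<alpha> \<beta> assume i: "i < length us" and a: "\<alpha> \<in> nonstandard i" "length \<alpha> = t" "list_all2 (\<le>) \<alpha> \<beta>"
  define \<gamma> where "\<gamma> = map2 (-) \<beta> \<alpha>"
  define m where "m = sum_list \<gamma>"
  define k where "k = sum_list \<alpha>"
  have lb: "length \<beta> = t" using a list_all2_lengthD by metis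
  have b: "\<beta> = map2 (+) \<gamma> \<alpha>" unfolding \<gamma>_def by (rule list_all2_le_diff[OF a(3)])
  have g: "\<gamma> \<in> exps t m" using lb a(2) by (simp add: \<gamma>_def m_def exps_def)
  have ia: "i # \<alpha> \<in> idx k" using i a(2) by (simp add: idx_def exps_def k_def)
  have sb: "sum_list \<beta> = m + k" unfolding b using g a(2) by (simp add: sum_list_map2_add exps_def m_def k_def)
  let ?X = "level (Suc k) \<union> z ` {\<nu> \<in> idx k. i # \<alpha> < \<nu>}"
  let ?Y = "level (Suc (m + k)) \<union> z ` {\<nu> \<in> idx (m + k). i # \<beta> < \<nu>}"
  have X: "?X \<subseteq> carrier M" and Y: "?Y \<subseteq> carrier M" using level_carr z_carr by auto
  have "monomial_op fs \<gamma> ` ?X \<subseteq> span ?Y"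
  proof (intro image_subsetI)
    fix x assume "x \<in> ?X"
    then have "monomial_op fs \<gamma> x \<in> ?Y"
    proof
      assume "x \<in> level (Suc k)"
      then show ?thesis using mono_level[OF g, of x "Suc k"] by simp
    next
      assume "x \<in> z ` {\<nu> \<in> idx k. i # \<alpha> < \<nu>}"
      then obtain \<nu> where n: "\<nu> \<in> idx k" "i # \<alpha> < \<nu>" "x = z \<nu>" by auto
      then obtain j \<delta> where j: "\<nu> = j # \<delta>" "length \<delta> = t" by (auto simp: idx_def exps_def)
      have "i # \<beta> < j # map2 (+) \<gamma> \<delta>"
        using n(2) map2_add_less[of \<alpha> \<delta> \<gamma>] a(2) j(2) g unfolding b j(1) by (auto simp: exps_def)
      moreover have "j # \<delta> \<in> idx k" using n(1) j(1) by simp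
      ultimately have "j # map2 (+) \<gamma> \<delta> \<in> {\<nu> \<in> idx (m + k). i # \<beta> < \<nu>}" "monomial_op fs \<gamma> x = z (j # map2 (+) \<gamma> \<delta>)"
        using z_add[of j \<delta> k \<gamma> m] n(3) j(1) g by simp_all
      then show ?thesis by (metis UnI2 imageI)
    qed
    then show "monomial_op fs \<gamma> x \<in> span ?Y" by (rule subsetD[OF span_superset[OF Y]])
  qed
  from hom_span_subset[OF mono_hom X subm_span[OF Y] this]
  have hs: "x \<in> span ?X \<Longrightarrow> monomial_op fs \<gamma> x \<in> span ?Y" for x by blast
  have "z (i # \<alpha>) \<in> span ?X" using a(1) by (simp add: nonstandard_def k_def)
  from hs[OF this] have "monomial_op fs \<gamma> (z (i # \<alpha>)) \<in> span ?Y" .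
  then show "\<beta> \<in> nonstandard i" using z_add(1)[OF ia g] lb sb unfolding nonstandard_def b[symmetric] by simp
qed

lemma evpoly_len: "evpoly (\<lambda>n. real (len n))"
proof -
  have "evpoly (\<lambda>n. \<Sum>k<n. \<Sum>i<length us. real (card (exps t k - nonstandard i)))"
    by (intro evpoly_partial_sums evpoly_sum evpoly_count upset_nonstandard) auto
  then show ?thesis by (simp add: len_def)
qed

text \<open>The exponent is the number of operators; with dim S operators this bounds the degree of
  the Hilbert polynomial in \<open>hilbert_growth\<close>.\<close>

lemma len_le: "len n \<le> length us * n ^ t"
proof -
  have "len n \<le> (\<Sum>k<n. \<Sum>i<length us. card (exps t k))"
    unfolding len_def by (intro sum_mono card_mono finite_exps) auto
  also have "\<dots> = length us * (\<Sum>k<n. card (exps t k))" by (simp add: sum_distrib_left)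
  also have "\<dots> \<le> length us * n ^ t" by (intro mult_le_mono2 count_exps)
  finally show ?thesis .
qed

text \<open>By \<open>shift\<close> the maximal ideal kills the quotients of consecutive levels.
  Hence \<open>filtration_step_length\<close> counts the standard monomials in each degree, and the
  lengths add up.\<close>

lemma level_length:
  assumes shift: "\<And>r x k. r \<in> \<mm> \<Longrightarrow> x \<in> level k \<Longrightarrow> r \<odot>\<^bsub>M\<^esub> x \<in> level (Suc k)"
  shows "has_len R M (level n) (carrier M) (len n)"
proof (induction n)
  case 0
  then show ?case using has_len_refl[OF subm_level[of 0]] by (simp add: len_def level_0)
next
  case (Suc n)
  let ?A = "level (Suc n)"
  have "has_len R M ?A (span (?A \<union> z ` idx n)) (card {\<mu> \<in> idx n. z \<mu> \<notin> span (?A \<union> z ` {\<nu> \<in> idx n. \<mu> < \<nu>})})"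
    by (rule filtration_step_length[OF finite_idx subm_level z_carr]) (auto intro: shift z_level)
  moreover have "span (?A \<union> z ` idx n) = level n"
  proof
    show "span (?A \<union> z ` idx n) \<subseteq> level n"
      using level_antimono[of n] z_level by (intro span_least[OF subm_level]) auto
    show "level n \<subseteq> span (?A \<union> z ` idx n)" unfolding level_def by (rule span_mono') auto
  qed
  moreover have "card {\<mu> \<in> idx n. z \<mu> \<notin> span (?A \<union> z ` {\<nu> \<in> idx n. \<mu> < \<nu>})} = (\<Sum>i<length us. card (exps t n - nonstandard i))"
  proof -
    have "{\<mu> \<in> idx n. z \<mu> \<notin> span (?A \<union> z ` {\<nu> \<in> idx n. \<mu> < \<nu>})} = (\<Union>i<length us. (\<lambda>\<alpha>. i # \<alpha>) ` (exps t n - nonstandard i))"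
      by (auto simp: idx_def nonstandard_def exps_def)
    also have "card \<dots> = (\<Sum>i<length us. card ((\<lambda>\<alpha>. i # \<alpha>) ` (exps t n - nonstandard i)))"
      by (rule card_UN_disjoint) (auto simp: finite_exps)
    also have "\<dots> = (\<Sum>i<length us. card (exps t n - nonstandard i))"
      by (intro sum.cong refl card_image) (simp add: inj_on_def)
    finally show ?thesis .
  qed
  ultimately have "has_len R M ?A (level n) (\<Sum>i<length us. card (exps t n - nonstandard i))" by simp
  from has_len_add[OF subm_level subm_level _ level_antimono _ this Suc.IH]
  have "has_len R M ?A (carrier M) ((\<Sum>i<length us. card (exps t n - nonstandard i)) + len n)"
    using subm_level[of 0] level_carr[of _ n] level_0 by auto
  then show ?case by (simp add: len_def add.commute)
qed

end

section \<open>Hilbert functions\<close>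

lemma (in cring) ideal_power_ideal: "ideal I R \<Longrightarrow> ideal (ideal_power R I k) R"
  by (induction k) (simp_all add: oneideal ideal_prod_is_ideal)

context module
begin

lemma smult_hom: "r \<in> carrier R \<Longrightarrow> (\<lambda>x. r \<odot>\<^bsub>M\<^esub> x) \<in> module_hom R M M"
  unfolding module_hom_def mem_Collect_eq
  by (auto simp: smult_r_distr R.m_comm simp flip: smult_assoc1)

lemma ideal_lspan_smult:
  assumes ts: "set ts \<subseteq> carrier R" and x: "x \<in> carrier M" and W: "subm R M W"
    and t: "\<And>t. t \<in> set ts \<Longrightarrow> t \<odot>\<^bsub>M\<^esub> x \<in> W" and r: "r \<in> lspan R (ring_as_module R) ts"
  shows "r \<odot>\<^bsub>M\<^esub> x \<in> W"
proof -
  interpret RM: module R "ring_as_module R" by (rule R.module_ring_as_module)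
  have "lspan R (ring_as_module R) ts \<subseteq> {r \<in> carrier R. r \<odot>\<^bsub>M\<^esub> x \<in> W}"
    by (rule RM.lspan_least) (use colon_ideal'[OF W x] R.subm_ring_iff ts t in auto)
  then show ?thesis using r by auto
qed

lemma ideal_prod_smult:
  assumes I: "I \<subseteq> carrier R" and J: "J \<subseteq> carrier R" and x: "x \<in> carrier M" and W: "subm R M W"
    and ab: "\<And>a b. a \<in> I \<Longrightarrow> b \<in> J \<Longrightarrow> a \<odot>\<^bsub>M\<^esub> (b \<odot>\<^bsub>M\<^esub> x) \<in> W" and c: "c \<in> ideal_prod R I J"
  shows "c \<odot>\<^bsub>M\<^esub> x \<in> W"
proof -
  from c have "c \<in> carrier R \<and> c \<odot>\<^bsub>M\<^esub> x \<in> W"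
  proof (induction rule: ideal_prod.induct)
    case (prod a b)
    then have "a \<in> carrier R" "b \<in> carrier R" using I J by auto
    then show ?case using ab[OF prod] x by (simp add: smult_assoc1)
  next
    case (sum a b)
    then show ?case using x subm_add[OF W] by (simp add: smult_l_distr)
  qed
  then show ?thesis ..
qed

end

context local_module
begin

abbreviation "adic n \<equiv> ideal_smult R (ideal_power R \<mm> n) M"

lemma ideal_power_carr: "ideal_power R \<mm> n \<subseteq> carrier R"
  using ideal_facts(1)[OF ideal_power_ideal[OF max_ideal_ideal]] .

lemma subm_adic: "subm R M (adic n)"
  by (rule subm_ideal_smult[OF ideal_power_carr])

lemma adic_0: "adic 0 = carrier M"
proof
  show "adic 0 \<subseteq> carrier M" by (rule subm_subset[OF subm_adic])
  have "x \<in> adic 0" if "x \<in> carrier M" for x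
    using ideal_smult_mem[of "carrier R" \<one> x] that by simp
  then show "carrier M \<subseteq> adic 0" by auto
qed

lemma adic_Suc_mem: "a \<in> \<mm> \<Longrightarrow> x \<in> adic n \<Longrightarrow> a \<odot>\<^bsub>M\<^esub> x \<in> adic (Suc n)"
proof -
  assume a: "a \<in> \<mm>" and x: "x \<in> adic n"
  have ac: "a \<in> carrier R" using a max_ideal_carr by auto
  have "adic n \<subseteq> {x \<in> carrier M. a \<odot>\<^bsub>M\<^esub> x \<in> adic (Suc n)}"
  proof (rule ideal_smult_least[OF hom_vimage_subm[OF module_axioms smult_hom[OF ac] subm_adic]])
    fix b y assume b: "b \<in> ideal_power R \<mm> n" and y: "y \<in> carrier M"
    have bc: "b \<in> carrier R" using b ideal_power_carr by auto
    have "a \<otimes> b \<in> ideal_power R \<mm> (Suc n)" using ideal_prod.prod[OF a b] by simp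
    from ideal_smult_mem[OF ideal_power_carr this y]
    show "b \<odot>\<^bsub>M\<^esub> y \<in> {x \<in> carrier M. a \<odot>\<^bsub>M\<^esub> x \<in> adic (Suc n)}"
      using ac bc y by (simp add: smult_assoc1 del: ideal_power.simps)
  qed
  then show ?thesis using x by auto
qed

text \<open>The operators are the multiplications by generators of \<mm>, and the levels are the
  powers of \<mm> applied to M. Here \<open>len_le\<close> bounds the degree only by the number of
  these generators, so the bound by dim S needs the second instance, in
  \<open>hilbert_growth\<close>.\<close>

lemma hilbert_function: "\<exists>f. (\<forall>n. has_len R M (adic n) (carrier M) (f n)) \<and> evpoly (\<lambda>n. real (f n))"
proof -
  obtain us where us: "set us \<subseteq> carrier M" "carrier M = lspan R M us" using fg by (rule fgenE)
  obtain ts where ts: "set ts \<subseteq> \<mm>" "\<mm> = lspan R (ring_as_module R) ts"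
    using ideal_generators_list[OF noetherian_ring_axioms max_ideal_ideal] by auto
  have tc: "\<And>t. t \<in> set ts \<Longrightarrow> t \<in> carrier R" using ts(1) max_ideal_carr by auto
  interpret F: monomial_filtration R M "map (\<lambda>t x. t \<odot>\<^bsub>M\<^esub> x) ts" us
  proof
    fix f assume "f \<in> set (map (\<lambda>t x. t \<odot>\<^bsub>M\<^esub> x) ts)"
    then show "f \<in> module_hom R M M" using smult_hom tc by auto
  next
    fix f g x assume "f \<in> set (map (\<lambda>t x. t \<odot>\<^bsub>M\<^esub> x) ts)" "g \<in> set (map (\<lambda>t x. t \<odot>\<^bsub>M\<^esub> x) ts)" and x: "x \<in> carrier M"
    then obtain s t where "s \<in> carrier R" "t \<in> carrier R" "f = (\<lambda>x. s \<odot>\<^bsub>M\<^esub> x)" "g = (\<lambda>x. t \<odot>\<^bsub>M\<^esub> x)" using tc by auto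
    then show "g (f x) = f (g x)" using x by (simp add: R.m_comm flip: smult_assoc1)
  qed (fact us)+
  have shift: "r \<odot>\<^bsub>M\<^esub> x \<in> F.level (Suc k)" if "r \<in> \<mm>" "x \<in> F.level k" for r x k
  proof (rule ideal_lspan_smult[OF _ F.level_carr[OF that(2)] F.subm_level])
    show "set ts \<subseteq> carrier R" using tc by auto
    show "r \<in> lspan R (ring_as_module R) ts" using that(1) ts(2) by simp
    show "t \<odot>\<^bsub>M\<^esub> x \<in> F.level (Suc k)" if "t \<in> set ts" for t
      using F.op_level[of "\<lambda>x. t \<odot>\<^bsub>M\<^esub> x" x k] that \<open>x \<in> F.level k\<close> by auto
  qed
  have "F.level n = adic n" for n
  proof (induction n)
    case 0 show ?case by (simp only: F.level_0 adic_0)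
  next
    case (Suc n)
    show ?case
    proof
      show "F.level (Suc n) \<subseteq> adic (Suc n)"
      proof (rule F.level_Suc_least[OF subm_adic])
        fix f x assume "f \<in> set (map (\<lambda>t x. t \<odot>\<^bsub>M\<^esub> x) ts)" "x \<in> F.level n"
        then show "f x \<in> adic (Suc n)" using adic_Suc_mem[of _ x n] ts(1) Suc by auto
      qed
      show "adic (Suc n) \<subseteq> F.level (Suc n)"
      proof (rule ideal_smult_least[OF F.subm_level])
        fix c x assume c: "c \<in> ideal_power R \<mm> (Suc n)" and x: "x \<in> carrier M"
        show "c \<odot>\<^bsub>M\<^esub> x \<in> F.level (Suc n)"
        proof (rule ideal_prod_smult[OF max_ideal_subset ideal_power_carr x F.subm_level])
          show "c \<in> ideal_prod R \<mm> (ideal_power R \<mm> n)" using c by simp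
          fix a b assume "a \<in> \<mm>" "b \<in> ideal_power R \<mm> n"
          then show "a \<odot>\<^bsub>M\<^esub> (b \<odot>\<^bsub>M\<^esub> x) \<in> F.level (Suc n)"
            using shift ideal_smult_mem[OF ideal_power_carr _ x] Suc by blast
        qed
      qed
    qed
  qed
  then have "has_len R M (adic n) (carrier M) (F.len n)" for n using F.level_length[OF shift, of n] by simp
  then show ?thesis using F.evpoly_len by blast
qed

end

section \<open>Growth of the Hilbert function of the \<open>S\<^sub>2\<close>-ification\<close>

context S2_setting
begin

abbreviation "A \<equiv> ring_as_module S"

lemma mult_hom: "s \<in> carrier S \<Longrightarrow> (\<lambda>x. s \<otimes>\<^bsub>S\<^esub> x) \<in> module_hom R A A"
  unfolding module_hom_def mem_Collect_eq
  using in_S by (auto simp: S.r_distr S.m_lcomm)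

lemma S_closed_ideal_smult:
  assumes "I \<subseteq> carrier R" "s \<in> carrier S" "x \<in> ideal_smult R I A"
  shows "s \<otimes>\<^bsub>S\<^esub> x \<in> ideal_smult R I A"
proof -
  have "ideal_smult R I A \<subseteq> {x \<in> carrier A. s \<otimes>\<^bsub>S\<^esub> x \<in> ideal_smult R I A}"
  proof (rule SR.ideal_smult_least)
    show "subm R A {x \<in> carrier A. s \<otimes>\<^bsub>S\<^esub> x \<in> ideal_smult R I A}"
      by (rule SR.hom_vimage_subm[OF SR.module_axioms mult_hom[OF assms(2)] SR.subm_ideal_smult[OF assms(1)]])
    fix a x assume a: "a \<in> I" and x: "x \<in> carrier A"
    have aS: "a \<in> carrier S" using a assms(1) in_S by auto
    have "a \<odot>\<^bsub>A\<^esub> (s \<otimes>\<^bsub>S\<^esub> x) \<in> ideal_smult R I A"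
      by (rule SR.ideal_smult_mem[OF assms(1) a]) (use assms(2) x in simp)
    then show "a \<odot>\<^bsub>A\<^esub> x \<in> {x \<in> carrier A. s \<otimes>\<^bsub>S\<^esub> x \<in> ideal_smult R I A}"
      using aS x assms(2) by (simp add: S.m_lcomm)
  qed
  then show ?thesis using assms(3) by auto
qed

text \<open>
  \<open>c\<close> is the least degree in which the monic polynomial has a unit of \<open>R\<close> as its coefficient: the
  terms of higher degree turn it into a unit of \<open>S\<close>, and those of lower degree are in \<open>\<mm> S\<close>.
\<close>

lemma wpoly_unit_form:
  assumes q: "q \<in> max_ideal S"
  shows "w \<in> wpoly q n \<Longrightarrow> \<exists>c :: nat. \<exists>u\<in>Units S. \<exists>m\<in>SR.mM. q [^]\<^bsub>S\<^esub> n \<oplus>\<^bsub>S\<^esub> w = q [^]\<^bsub>S\<^esub> c \<otimes>\<^bsub>S\<^esub> u \<oplus>\<^bsub>S\<^esub> m"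
proof (induction n arbitrary: w)
  case 0
  then have "q [^]\<^bsub>S\<^esub> (0::nat) \<oplus>\<^bsub>S\<^esub> w = q [^]\<^bsub>S\<^esub> (0::nat) \<otimes>\<^bsub>S\<^esub> \<one>\<^bsub>S\<^esub> \<oplus>\<^bsub>S\<^esub> \<zero>\<^bsub>S\<^esub>" by (simp add: S_ops(4))
  moreover have "\<zero>\<^bsub>S\<^esub> \<in> SR.mM" using subm_zero[OF SR.subm_mM] by simp
  ultimately show ?case using S.Units_one_closed by blast
next
  case (Suc n)
  have qS: "q \<in> carrier S" using q S.max_ideal_carr by auto
  from Suc.prems obtain v r where vr: "v \<in> wpoly q n" "r \<in> carrier R" "w = q \<otimes>\<^bsub>S\<^esub> v \<oplus>\<^bsub>S\<^esub> r" by (auto simp: S_ops)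
  have vS: "v \<in> carrier S" using subm_carr[OF subm_wpoly[OF qS] vr(1)] by simp
  have rS: "r \<in> carrier S" using vr(2) in_S by auto
  let ?y = "q [^]\<^bsub>S\<^esub> n \<oplus>\<^bsub>S\<^esub> v"
  have yS: "?y \<in> carrier S" using qS vS by simp
  have eq: "q [^]\<^bsub>S\<^esub> Suc n \<oplus>\<^bsub>S\<^esub> w = q \<otimes>\<^bsub>S\<^esub> ?y \<oplus>\<^bsub>S\<^esub> r"
    using qS vS rS by (simp add: vr(3) S.r_distr S.a_assoc S.m_comm S.nat_pow_Suc)
  show ?case
  proof (cases "r \<in> max_ideal R")
    case True
    from Suc.IH[OF vr(1)] obtain c :: nat and u m where c: "u \<in> Units S" "m \<in> SR.mM" "?y = q [^]\<^bsub>S\<^esub> c \<otimes>\<^bsub>S\<^esub> u \<oplus>\<^bsub>S\<^esub> m" by auto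
    have uS: "u \<in> carrier S" "m \<in> carrier S" using c(1) subm_carr[OF SR.subm_mM c(2)] by auto
    have "r \<in> SR.mM" using SR.ideal_smult_mem[OF SR.max_ideal_subset True, of "\<one>\<^bsub>S\<^esub>"] rS by simp
    then have m': "q \<otimes>\<^bsub>S\<^esub> m \<oplus>\<^bsub>S\<^esub> r \<in> SR.mM"
      using subm_add[OF SR.subm_mM S_closed_ideal_smult[OF SR.max_ideal_subset qS c(2)]] by simp
    have "q [^]\<^bsub>S\<^esub> Suc n \<oplus>\<^bsub>S\<^esub> w = q [^]\<^bsub>S\<^esub> Suc c \<otimes>\<^bsub>S\<^esub> u \<oplus>\<^bsub>S\<^esub> (q \<otimes>\<^bsub>S\<^esub> m \<oplus>\<^bsub>S\<^esub> r)"
      unfolding eq c(3) using qS uS rS by (simp add: S.r_distr S.a_assoc S.m_comm S.m_lcomm S.nat_pow_Suc)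
    then show ?thesis using c(1) m' by blast
  next
    case False
    have "r \<in> Units R" using R.unit_iff[OF vr(2)] False by simp
    then obtain i where i: "i \<in> carrier R" "r \<otimes>\<^bsub>R\<^esub> i = \<one>\<^bsub>R\<^esub>" by (auto simp: Units_def R.m_comm)
    have "r \<notin> max_ideal S"
    proof
      assume "r \<in> max_ideal S"
      then have "r \<otimes>\<^bsub>S\<^esub> i \<in> max_ideal S" using ideal.I_r_closed[OF S.max_ideal_ideal] in_S i(1) by blast
      then show False using i(2) S.one_notin_max by (simp add: S_ops R_ops)
    qed
    moreover have "q \<otimes>\<^bsub>S\<^esub> ?y \<in> max_ideal S" using ideal.I_r_closed[OF S.max_ideal_ideal q yS] .
    ultimately have "q \<otimes>\<^bsub>S\<^esub> ?y \<oplus>\<^bsub>S\<^esub> r \<notin> max_ideal S"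
      using S.ideal_facts(3)[OF S.max_ideal_ideal, of "q \<otimes>\<^bsub>S\<^esub> ?y \<oplus>\<^bsub>S\<^esub> r" "\<ominus>\<^bsub>S\<^esub> (q \<otimes>\<^bsub>S\<^esub> ?y)"]
        additive_subgroup.a_inv_closed[OF ideal.axioms(1)[OF S.max_ideal_ideal], of "q \<otimes>\<^bsub>S\<^esub> ?y"] qS yS rS
      by (auto simp: S.a_comm[of "q \<otimes>\<^bsub>S\<^esub> ?y"] S.a_assoc S.r_neg)
    then have "q [^]\<^bsub>S\<^esub> Suc n \<oplus>\<^bsub>S\<^esub> w \<in> Units S" unfolding eq using S.unit_iff qS yS rS by simp
    moreover have "q [^]\<^bsub>S\<^esub> Suc n \<oplus>\<^bsub>S\<^esub> w = q [^]\<^bsub>S\<^esub> (0::nat) \<otimes>\<^bsub>S\<^esub> (q [^]\<^bsub>S\<^esub> Suc n \<oplus>\<^bsub>S\<^esub> w) \<oplus>\<^bsub>S\<^esub> \<zero>\<^bsub>S\<^esub>"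
      unfolding eq using qS yS rS by simp
    moreover have "\<zero>\<^bsub>S\<^esub> \<in> SR.mM" using subm_zero[OF SR.subm_mM] by simp
    ultimately show ?thesis by blast
  qed
qed

text \<open>By \<open>wpoly_unit_form\<close> an integral equation of q reads q^c u + m = 0 with u a
  unit and m in \<mm> S. Membership for all large exponents lets one exponent serve finitely many
  elements.\<close>

lemma power_mem_mM:
  assumes q: "q \<in> max_ideal S"
  shows "\<forall>\<^sub>F c in sequentially. q [^]\<^bsub>S\<^esub> (c::nat) \<in> SR.mM"
proof -
  have qS: "q \<in> carrier S" using q S.max_ideal_carr by auto
  have pow: "q [^]\<^bsub>K\<^esub> n = q [^]\<^bsub>S\<^esub> n" for n :: nat by (induction n) (simp_all add: S_ops)
  from integral_over_R[OF qS] obtain n w where w: "w \<in> wpoly q n" "q [^]\<^bsub>S\<^esub> n \<oplus>\<^bsub>S\<^esub> w = \<zero>\<^bsub>S\<^esub>"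
    unfolding pow S_ops by blast
  from wpoly_unit_form[OF q w(1)] w(2) obtain c :: nat and u m where c: "u \<in> Units S" "m \<in> SR.mM" "q [^]\<^bsub>S\<^esub> c \<otimes>\<^bsub>S\<^esub> u \<oplus>\<^bsub>S\<^esub> m = \<zero>\<^bsub>S\<^esub>" by metis
  have mS: "u \<in> carrier S" "m \<in> carrier S" using c(1) subm_carr[OF SR.subm_mM c(2)] by auto
  have "\<ominus>\<^bsub>S\<^esub> m = q [^]\<^bsub>S\<^esub> c \<otimes>\<^bsub>S\<^esub> u" using S.minus_equality[OF c(3)] mS qS by simp
  moreover have "\<ominus>\<^bsub>S\<^esub> m = (\<ominus>\<^bsub>S\<^esub> \<one>\<^bsub>S\<^esub>) \<otimes>\<^bsub>S\<^esub> m" using mS by (simp add: S.l_minus)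
  moreover have "(\<ominus>\<^bsub>S\<^esub> \<one>\<^bsub>S\<^esub>) \<otimes>\<^bsub>S\<^esub> m \<in> SR.mM" by (rule S_closed_ideal_smult[OF SR.max_ideal_subset _ c(2)]) simp
  ultimately have qc: "q [^]\<^bsub>S\<^esub> c \<otimes>\<^bsub>S\<^esub> u \<in> SR.mM" by simp
  have "inv\<^bsub>S\<^esub> u \<otimes>\<^bsub>S\<^esub> (q [^]\<^bsub>S\<^esub> c \<otimes>\<^bsub>S\<^esub> u) \<in> SR.mM"
    by (rule S_closed_ideal_smult[OF SR.max_ideal_subset S.Units_inv_closed[OF c(1)] qc])
  moreover have "inv\<^bsub>S\<^esub> u \<otimes>\<^bsub>S\<^esub> (q [^]\<^bsub>S\<^esub> c \<otimes>\<^bsub>S\<^esub> u) = q [^]\<^bsub>S\<^esub> c"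
    using S.m_lcomm[of "inv\<^bsub>S\<^esub> u" "q [^]\<^bsub>S\<^esub> c" u] c(1) mS qS by simp
  ultimately have *: "q [^]\<^bsub>S\<^esub> c \<in> SR.mM" by simp
  have "q [^]\<^bsub>S\<^esub> k \<in> SR.mM" if "k \<ge> c" for k :: nat
  proof -
    have "q [^]\<^bsub>S\<^esub> k = q [^]\<^bsub>S\<^esub> (k - c) \<otimes>\<^bsub>S\<^esub> q [^]\<^bsub>S\<^esub> c" using that qS by (simp add: S.nat_pow_mult)
    then show ?thesis using S_closed_ideal_smult[OF SR.max_ideal_subset _ *] qS by simp
  qed
  then show ?thesis unfolding eventually_sequentially by blast
qed

text \<open>The operators are now the multiplications by dim S generators of the maximal ideal of S,
  while lengths remain over R. Some power e of that ideal lies in \<mm> S, so level e n is contained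
  in the n-th adic submodule. Lengths down to the latter are thus at most a constant times (e n)^t
  with t = dim S.\<close>

lemma hilbert_growth:
  obtains C t where "enat t = krull_dim S"
    "\<And>n k. has_len R A (SR.adic n) (carrier S) k \<Longrightarrow> k \<le> C * n ^ t"
proof -
  obtain us where us: "set us \<subseteq> carrier A" "carrier A = lspan R A us" using SR.fg by (rule fgenE)
  obtain ys where ys: "set ys \<subseteq> max_ideal S" "max_ideal S = lspan S A ys" "enat (length ys) = krull_dim S"
    by (rule regular_generators)
  have yS: "\<And>y. y \<in> set ys \<Longrightarrow> y \<in> carrier S" using ys(1) S.max_ideal_carr by auto
  let ?fs = "map (\<lambda>y x. y \<otimes>\<^bsub>S\<^esub> x) ys"
  have fsE: "\<exists>y\<in>set ys. f = (\<lambda>x. y \<otimes>\<^bsub>S\<^esub> x)" if "f \<in> set ?fs" for f using that by auto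
  interpret F: monomial_filtration R A ?fs us
  proof
    fix f assume "f \<in> set ?fs"
    then show "f \<in> module_hom R A A" using mult_hom yS by auto
  next
    fix f g x assume "f \<in> set ?fs" "g \<in> set ?fs" and x: "x \<in> carrier A"
    then obtain y y' where "y \<in> carrier S" "y' \<in> carrier S" "f = (\<lambda>x. y \<otimes>\<^bsub>S\<^esub> x)" "g = (\<lambda>x. y' \<otimes>\<^bsub>S\<^esub> x)" using yS by auto
    then show "g (f x) = f (g x)" using x by (simp add: S.m_lcomm)
  qed (fact us)+
  have level_S: "s \<otimes>\<^bsub>S\<^esub> x \<in> F.level k" if "s \<in> carrier S" "x \<in> F.level k" for s x k
  proof (rule F.level_closed[OF mult_hom[OF that(1)] _ that(2)])
    fix f x assume "f \<in> set ?fs" "x \<in> carrier A"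
    then show "s \<otimes>\<^bsub>S\<^esub> f x = f (s \<otimes>\<^bsub>S\<^esub> x)" using yS that(1) by (auto simp: S.m_lcomm)
  qed
  interpret SS: module S A by (rule S.module_ring_as_module)
  have sub_S: "subm S A (F.level k)" for k
    using F.subm_level[of k] level_S unfolding subm_def by simp
  have shift: "r \<odot>\<^bsub>A\<^esub> x \<in> F.level (Suc k)" if "r \<in> max_ideal R" "x \<in> F.level k" for r x k
  proof (rule SS.ideal_lspan_smult[OF _ F.level_carr[OF that(2)] sub_S])
    show "set ys \<subseteq> carrier S" using yS by auto
    show "r \<in> lspan S (ring_as_module S) ys" using that(1) max_R_sub_S ys(2) by auto
    show "y \<odot>\<^bsub>A\<^esub> x \<in> F.level (Suc k)" if "y \<in> set ys" for y
      using F.op_level[of "\<lambda>x. y \<otimes>\<^bsub>S\<^esub> x" x k] that \<open>x \<in> F.level k\<close> by simp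
  qed
  have "\<forall>\<^sub>F c in sequentially. \<forall>y\<in>set ys. y [^]\<^bsub>S\<^esub> (c::nat) \<in> SR.mM"
    by (rule eventually_ball_finite) (use ys(1) power_mem_mM in auto)
  then obtain c :: nat where c: "\<And>y. y \<in> set ys \<Longrightarrow> y [^]\<^bsub>S\<^esub> c \<in> SR.mM" by (auto simp: eventually_sequentially)
  have funpow: "((\<lambda>x. y \<otimes>\<^bsub>S\<^esub> x) ^^ k) x = y [^]\<^bsub>S\<^esub> k \<otimes>\<^bsub>S\<^esub> x" if "y \<in> carrier S" "x \<in> carrier S" for y x and k :: nat
    using that by (induction k) (simp_all add: S.nat_pow_Suc S.m_ac)
  \<comment> \<open>One more than c times the number of generators, so that a monomial of degree e
    has an exponent of at least c.\<close>
  define e where "e = Suc (c * length ys)"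
  have high: "monomial_op ?fs \<beta> x \<in> SR.mM" if b: "\<beta> \<in> exps (length ?fs) e" and x: "x \<in> carrier S" for \<beta> x
  proof (rule monomial_op_power_mem[where V = "carrier S" and c = c])
    show "length \<beta> = length ?fs" "c * length ?fs < sum_list \<beta>" using b by (auto simp: exps_def e_def)
    fix f z assume f: "f \<in> set ?fs"
    then obtain y where y: "y \<in> set ys" "f = (\<lambda>x. y \<otimes>\<^bsub>S\<^esub> x)" using fsE by blast
    show "z \<in> carrier S \<Longrightarrow> f z \<in> carrier S" using y yS by simp
    show "z \<in> SR.mM \<Longrightarrow> f z \<in> SR.mM" unfolding y(2) by (rule S_closed_ideal_smult[OF SR.max_ideal_subset yS[OF y(1)]])
    assume z: "z \<in> carrier S"
    have "z \<otimes>\<^bsub>S\<^esub> y [^]\<^bsub>S\<^esub> c \<in> SR.mM" by (rule S_closed_ideal_smult[OF SR.max_ideal_subset z c[OF y(1)]])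
    then show "(f ^^ c) z \<in> SR.mM" using funpow[OF yS[OF y(1)] z] yS[OF y(1)] z by (simp add: y(2) S.m_comm)
  qed (fact x)
  have sub: "F.level (e * n) \<subseteq> SR.adic n" for n
  proof (induction n)
    case 0
    show ?case using F.level_carr by (auto simp only: SR.adic_0)
  next
    case (Suc n)
    have "F.level (e + e * n) \<subseteq> SR.adic (Suc n)"
    proof (rule F.level_least[OF SR.subm_adic])
      fix \<beta> x assume b: "\<beta> \<in> exps (length ?fs) e" and x: "x \<in> F.level (e * n)"
      let ?g = "monomial_op ?fs \<beta>"
      \<comment> \<open>A monomial of degree e sends S into \<mm> S, so by linearity it sends the
        n-th adic submodule into the next one.\<close>
      have "SR.adic n \<subseteq> {x \<in> carrier A. ?g x \<in> SR.adic (Suc n)}"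
      proof (rule SR.ideal_smult_least)
        show "subm R A {x \<in> carrier A. ?g x \<in> SR.adic (Suc n)}"
          by (rule SR.hom_vimage_subm[OF SR.module_axioms F.mono_hom SR.subm_adic])
        fix a x assume a: "a \<in> ideal_power R (max_ideal R) n" and x: "x \<in> carrier A"
        have ac: "a \<in> carrier R" using a SR.ideal_power_carr by auto
        have "SR.mM \<subseteq> {w \<in> carrier A. a \<odot>\<^bsub>A\<^esub> w \<in> SR.adic (Suc n)}"
        proof (rule SR.ideal_smult_least[OF SR.hom_vimage_subm[OF SR.module_axioms SR.smult_hom[OF ac] SR.subm_adic]])
          fix m s assume m: "m \<in> max_ideal R" and s: "s \<in> carrier A"
          have mc: "m \<in> carrier R" using m R.max_ideal_carr by auto
          have as: "a \<odot>\<^bsub>A\<^esub> s \<in> SR.adic n" by (rule SR.ideal_smult_mem[OF SR.ideal_power_carr a s])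
          have "m \<odot>\<^bsub>A\<^esub> (a \<odot>\<^bsub>A\<^esub> s) = a \<odot>\<^bsub>A\<^esub> (m \<odot>\<^bsub>A\<^esub> s)"
            using s in_S[OF ac] in_S[OF mc] by (simp add: S.m_lcomm)
          then have "a \<odot>\<^bsub>A\<^esub> (m \<odot>\<^bsub>A\<^esub> s) \<in> SR.adic (Suc n)" using SR.adic_Suc_mem[OF m as] by metis
          moreover have "m \<odot>\<^bsub>A\<^esub> s \<in> carrier A" by (rule SR.smult_closed[OF mc s])
          ultimately show "m \<odot>\<^bsub>A\<^esub> s \<in> {w \<in> carrier A. a \<odot>\<^bsub>A\<^esub> w \<in> SR.adic (Suc n)}" by blast
        qed
        moreover have "?g x \<in> SR.mM" using high[OF b] x by simp
        moreover have "?g (a \<odot>\<^bsub>A\<^esub> x) = a \<odot>\<^bsub>A\<^esub> ?g x" by (rule module_hom_smult[OF F.mono_hom ac x])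
        moreover have "a \<odot>\<^bsub>A\<^esub> x \<in> carrier A" by (rule SR.smult_closed[OF ac x])
        ultimately show "a \<odot>\<^bsub>A\<^esub> x \<in> {x \<in> carrier A. ?g x \<in> SR.adic (Suc n)}" by auto
      qed
      then show "?g x \<in> SR.adic (Suc n)" using Suc x by blast
    qed
    then show ?case by simp
  qed
  show ?thesis
  proof (rule that[OF ys(3)])
    fix n k assume "has_len R A (SR.adic n) (carrier S) k"
    then obtain D where "subm_chain R A (SR.adic n) (carrier S) D k" by (auto simp: has_len_def)
    from chain_weaken[OF this sub order_refl] have "subm_chain R A (F.level (e * n)) (carrier A) D k" by simp
    from has_len_le[OF F.level_length[OF shift] this] have "k \<le> F.len (e * n)" .
    also have "\<dots> \<le> length us * (e * n) ^ length ?fs" by (rule F.len_le)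
    also have "\<dots> = (length us * e ^ length ys) * n ^ length ys" by (simp add: power_mult_distrib)
    finally show "k \<le> (length us * e ^ length ys) * n ^ length ys" .
  qed
qed

end

section \<open>Direct powers and Ulrich modules\<close>

context power_decomp
begin

lemma ideal_smult_eq:
  "I \<subseteq> carrier R \<Longrightarrow> ideal_smult R I M = {x \<in> carrier M. \<forall>j<h. p j x \<in> ideal_smult R I N}"
  using ideal_smult_iff by blast

lemma has_len_ideal_smult:
  assumes I: "I \<subseteq> carrier R" and k: "has_len R N (ideal_smult R I N) (carrier N) k"
  shows "has_len R M (ideal_smult R I M) (carrier M) (h * k)"
  unfolding ideal_smult_eq[OF I] by (rule has_len_power[OF N.subm_ideal_smult[OF I] k])

text \<open>Both numbers are lengths, of M/\<mm>M and N/\<mm>N, and the former is computed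
  componentwise.\<close>

lemma num_gens_power:
  assumes M: "local_module R M" and N: "local_module R N"
  shows "num_gens R M = h * num_gens R N"
proof -
  interpret M': local_module R M by fact
  interpret N': local_module R N by fact
  show ?thesis
    using has_len_unique[OF M'.num_gens_length has_len_ideal_smult[OF M'.max_ideal_subset N'.num_gens_length]] .
qed

text \<open>Convergence for N ensures that \<open>lim\<close> yields actual limits, which scale with
  the factor h. The exponents in the two multiplicities agree because M and N have the same
  annihilator.\<close>

lemma multiplicity_power:
  assumes M: "local_module R M" and N: "local_module R N"
    and f: "\<And>n. has_len R N (ideal_smult R (ideal_power R (max_ideal R) n) N) (carrier N) (f n)"
    and conv: "convergent (\<lambda>n. real (f n) / real n ^ the_enat (module_dim R N))"
  shows "multiplicity R M = real h * multiplicity R N"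
proof -
  interpret M': local_module R M by fact
  interpret N': local_module R N by fact
  let ?d = "the_enat (module_dim R N)"
  have dim: "module_dim R M = module_dim R N" by (simp add: module_dim_def annihilator_eq)
  have lenN: "module_length R (quot_module N (N'.adic n)) = enat (f n)" for n
    by (rule N.quot_module_length[OF N'.subm_adic f])
  have lenM: "module_length R (quot_module M (M'.adic n)) = enat (h * f n)" for n
    by (rule M.quot_module_length[OF M'.subm_adic has_len_ideal_smult[OF M'.ideal_power_carr f]])
  from conv obtain L where L: "(\<lambda>n. real (f n) / real n ^ ?d) \<longlonglongrightarrow> L" by (auto simp: convergent_def)
  have "(\<lambda>n. real (h * f n) / real n ^ ?d) \<longlonglongrightarrow> real h * L"
    using tendsto_mult_left[OF L, of "real h"] by simp
  then have "multiplicity R M = fact ?d * (real h * L)"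
    unfolding Defs.multiplicity_def dim lenM Let_def the_enat.simps by (simp add: limI)
  moreover have "multiplicity R N = fact ?d * L"
    unfolding Defs.multiplicity_def lenN Let_def the_enat.simps using limI[OF L] by simp
  ultimately show ?thesis by simp
qed

lemma Ulrich_iff:
  assumes M: "local_module R M" and N: "local_module R N"
    and f: "\<And>n. has_len R N (ideal_smult R (ideal_power R (max_ideal R) n) N) (carrier N) (f n)"
    and conv: "convergent (\<lambda>n. real (f n) / real n ^ the_enat (module_dim R N))"
  shows "Ulrich R M \<longleftrightarrow> Ulrich R N"
proof -
  interpret M': local_module R M by fact
  interpret N': local_module R N by fact
  have "MCM R M \<longleftrightarrow> MCM R N"
    using M.fgen_fg_module[OF M'.fg] N.fgen_fg_module[OF N'.fg] by (simp add: MCM_def carrier_nontrivial depth_eq)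
  then show ?thesis
    using multiplicity_power[OF M N f conv] num_gens_power[OF M N] h by (simp add: Ulrich_def)
qed

end

text \<open>The projections are the coordinates of the isomorphism, and the injections are its
  inverse on vectors with at most one nonzero entry.\<close>

lemma power_decomp_of_iso:
  assumes "module R M" and N: "module R N" and iso: "module_iso R M (power_module N h)" and h: "h \<ge> 1"
  shows "\<exists>p q. power_decomp R M N h p q"
proof -
  interpret M: module R M by fact
  interpret N: module R N by fact
  interpret P: module R "power_module N h" by (rule N.module_power_module)
  obtain f where f: "f \<in> module_hom R M (power_module N h)" "bij_betw f (carrier M) (carrier (power_module N h))"
    using iso by (auto simp: module_iso_def)
  define g where "g = inv_into (carrier M) f"
  define e where "e j y = (\<lambda>i\<in>{..<h}. if i = j then y else \<zero>\<^bsub>N\<^esub>)" for j y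
  have fc: "f x \<in> carrier (power_module N h)" if "x \<in> carrier M" for x using module_hom_closed[OF f(1)] that by auto
  have gc: "g w \<in> carrier M" "f (g w) = w" if "w \<in> carrier (power_module N h)" for w
    using bij_betwE[OF bij_betw_inv_into[OF f(2)]] bij_betw_inv_into_right[OF f(2)] that by (auto simp: g_def)
  have gf: "g (f x) = x" if "x \<in> carrier M" for x using bij_betw_inv_into_left[OF f(2) that] by (simp add: g_def)
  have g_add: "g (v \<oplus>\<^bsub>power_module N h\<^esub> w) = g v \<oplus>\<^bsub>M\<^esub> g w"
    if "v \<in> carrier (power_module N h)" "w \<in> carrier (power_module N h)" for v w
    using module_hom_add[OF f(1) gc(1)[OF that(1)] gc(1)[OF that(2)]] gc(2)[OF that(1)] gc(2)[OF that(2)]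
      gf[OF M.add.m_closed[OF gc(1)[OF that(1)] gc(1)[OF that(2)]]] by metis
  have g_smult: "g (r \<odot>\<^bsub>power_module N h\<^esub> w) = r \<odot>\<^bsub>M\<^esub> g w" if "r \<in> carrier R" "w \<in> carrier (power_module N h)" for r w
    using module_hom_smult[OF f(1) that(1) gc(1)[OF that(2)]] gc(2)[OF that(2)]
      gf[OF M.smult_closed[OF that(1) gc(1)[OF that(2)]]] by metis
  have ec: "e j y \<in> carrier (power_module N h)" if "y \<in> carrier N" for j y using that by (simp add: e_def)
  have e_add: "e j (x \<oplus>\<^bsub>N\<^esub> y) = e j x \<oplus>\<^bsub>power_module N h\<^esub> e j y" if "x \<in> carrier N" "y \<in> carrier N" for j x y
    using that by (auto simp: e_def)
  have e_smult: "e j (r \<odot>\<^bsub>N\<^esub> y) = r \<odot>\<^bsub>power_module N h\<^esub> e j y" if "r \<in> carrier R" "y \<in> carrier N" for j r y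
    using that by (auto simp: e_def)
  have "power_decomp R M N h (\<lambda>j x. f x j) (\<lambda>j y. g (e j y))"
  proof
    fix j assume j: "j < h"
    show "(\<lambda>x. f x j) \<in> module_hom R M N"
      unfolding module_hom_def mem_Collect_eq
    proof (intro conjI allI impI)
      show "(\<lambda>x. f x j) \<in> carrier M \<rightarrow> carrier N" using fc j by (auto simp: PiE_def Pi_def)
      fix x y assume "x \<in> carrier M \<and> y \<in> carrier M"
      then show "f (x \<oplus>\<^bsub>M\<^esub> y) j = f x j \<oplus>\<^bsub>N\<^esub> f y j" using module_hom_add[OF f(1), of x y] j by simp
    next
      fix r x assume "r \<in> carrier R \<and> x \<in> carrier M"
      then show "f (r \<odot>\<^bsub>M\<^esub> x) j = r \<odot>\<^bsub>N\<^esub> f x j" using module_hom_smult[OF f(1), of r x] j by simp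
    qed
    show "(\<lambda>y. g (e j y)) \<in> module_hom R N M"
      unfolding module_hom_def mem_Collect_eq
    proof (intro conjI allI impI)
      show "(\<lambda>y. g (e j y)) \<in> carrier N \<rightarrow> carrier M" using gc(1) ec by blast
      fix x y assume "x \<in> carrier N \<and> y \<in> carrier N"
      then show "g (e j (x \<oplus>\<^bsub>N\<^esub> y)) = g (e j x) \<oplus>\<^bsub>M\<^esub> g (e j y)" using e_add g_add ec by metis
    next
      fix r x assume "r \<in> carrier R \<and> x \<in> carrier N"
      then show "g (e j (r \<odot>\<^bsub>N\<^esub> x)) = r \<odot>\<^bsub>M\<^esub> g (e j x)" using e_smult g_smult ec by metis
    qed
  next
    fix j k y assume "j < h" "k < h" "y \<in> carrier N"
    then show "f (g (e k y)) j = (if j = k then y else \<zero>\<^bsub>N\<^esub>)" using gc(2)[OF ec] by (simp add: e_def)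
  next
    fix x assume x: "x \<in> carrier M" and z: "\<And>j. j < h \<Longrightarrow> f x j = \<zero>\<^bsub>N\<^esub>"
    have "f x = \<zero>\<^bsub>power_module N h\<^esub>"
      using fc[OF x] z by (intro ext) (auto simp: PiE_def extensional_def)
    then have "f x = f \<zero>\<^bsub>M\<^esub>" using M.hom_zero[OF P.module_axioms f(1)] by simp
    then show "x = \<zero>\<^bsub>M\<^esub>" using gf[OF x] gf[OF M.zero_closed] by metis
  qed (fact h)
  then show ?thesis by blast
qed

section \<open>Dimension of S as an R-module and convergence of its Hilbert quotients\<close>

lemma krull_dim_surj:
  assumes "ring_hom_ring R S f" "cring R" "f ` carrier R = carrier S"
  shows "krull_dim S \<le> krull_dim R"
  unfolding krull_dim_def[of S]
proof (rule Sup_least)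
  interpret f: ring_hom_ring R S f by fact
  fix a assume "a \<in> {enat n | n. \<exists>C. prime_chain S C n}"
  then obtain n C where C: "a = enat n" "prime_chain S C n" by auto
  have "prime_chain R (\<lambda>i. {r \<in> carrier R. f r \<in> C i}) n"
    unfolding prime_chain_def
  proof (intro conjI allI impI)
    fix i assume "i \<le> n"
    then have "primeideal (C i) S" using C(2) by (simp add: prime_chain_def)
    from f.primeideal_vimage[OF assms(2) this] show "primeideal {r \<in> carrier R. f r \<in> C i} R" .
  next
    fix i assume i: "i < n"
    then have *: "C i \<subset> C (Suc i)" "primeideal (C (Suc i)) S" using C(2) by (auto simp: prime_chain_def)
    then obtain s where s: "s \<in> C (Suc i)" "s \<notin> C i" by blast
    have "s \<in> carrier S" using s(1) *(2) primeideal.axioms(1) ideal.Icarr by metis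
    then obtain r where "r \<in> carrier R" "s = f r" using assms(3) by auto
    then show "{r \<in> carrier R. f r \<in> C i} \<subset> {r \<in> carrier R. f r \<in> C (Suc i)}" using *(1) s by blast
  qed
  then show "a \<le> krull_dim R" using prime_chain_le_dim C(1) by blast
qed

lemma krull_dim_iso: "cring R \<Longrightarrow> cring S \<Longrightarrow> R \<simeq> S \<Longrightarrow> krull_dim S \<le> krull_dim R"
proof -
  assume R: "cring R" and S: "cring S" and "R \<simeq> S"
  then obtain f where f: "f \<in> ring_iso R S" by (auto simp: is_ring_iso_def)
  interpret R: cring R by fact
  interpret S: cring S by fact
  have "ring_hom_ring R S f" using f by (intro ring_hom_ringI2 R.ring_axioms S.ring_axioms) (simp add: ring_iso_def)
  moreover have "f ` carrier R = carrier S" using f by (simp add: ring_iso_def bij_betw_def)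
  ultimately show ?thesis using krull_dim_surj R by blast
qed

text \<open>\<open>module_dim\<close> is formed with the quotient by the annihilator, which is zero
  for S. The quotient by zero is isomorphic to R but consists of cosets.\<close>

lemma krull_dim_quot_zero: "cring R \<Longrightarrow> krull_dim (R Quot {\<zero>\<^bsub>R\<^esub>}) = krull_dim R"
proof -
  assume R: "cring R"
  interpret R: cring R by fact
  have Q: "cring (R Quot {\<zero>\<^bsub>R\<^esub>})" using ideal.quotient_is_cring[OF R.zeroideal R] .
  show ?thesis using krull_dim_iso[OF R Q R.FactRing_zeroideal(2)] krull_dim_iso[OF Q R R.FactRing_zeroideal(1)] by simp
qed

context S2_setting
begin

lemma module_dim_S: "module_dim R A = krull_dim R"
proof -
  have "annihilator R A = {\<zero>\<^bsub>R\<^esub>}"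
  proof
    show "annihilator R A \<subseteq> {\<zero>\<^bsub>R\<^esub>}"
    proof
      fix r assume r: "r \<in> annihilator R A"
      then have rS: "r \<in> carrier S" using in_S by (simp add: annihilator_def)
      have "r \<odot>\<^bsub>A\<^esub> \<one>\<^bsub>S\<^esub> = \<zero>\<^bsub>A\<^esub>" using r S.one_closed unfolding annihilator_def by force
      then have "r = \<zero>\<^bsub>S\<^esub>" using rS by simp
      then show "r \<in> {\<zero>\<^bsub>R\<^esub>}" by (simp only: R_ops(4) S_ops(4) singleton_iff)
    qed
    have "\<zero>\<^bsub>R\<^esub> \<otimes>\<^bsub>S\<^esub> x = \<zero>\<^bsub>S\<^esub>" if "x \<in> carrier S" for x
      using S.l_null[OF that] by (simp only: R_ops(4) S_ops(4))
    then show "{\<zero>\<^bsub>R\<^esub>} \<subseteq> annihilator R A" by (simp add: annihilator_def)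
  qed
  then show ?thesis unfolding module_dim_def using krull_dim_quot_zero[OF R.is_cring] by simp
qed

text \<open>The multiplicity over R divides by n^(dim R), while \<open>hilbert_growth\<close> bounds
  the lengths by a multiple of n^(dim S). Since dim S \<le> dim R,
  \<open>evpoly_bounded_convergent\<close> applies.\<close>

lemma hilbert_S:
  assumes "krull_dim R \<noteq> \<infinity>"
  shows "\<exists>f. (\<forall>n. has_len R A (SR.adic n) (carrier A) (f n)) \<and>
    convergent (\<lambda>n. real (f n) / real n ^ the_enat (module_dim R A))"
proof -
  obtain f where f: "\<And>n. has_len R A (SR.adic n) (carrier A) (f n)" "evpoly (\<lambda>n. real (f n))"
    using SR.hilbert_function by blast
  obtain t C where t: "enat t = krull_dim S" "\<And>n k. has_len R A (SR.adic n) (carrier S) k \<Longrightarrow> k \<le> C * n ^ t"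
    by (rule hilbert_growth) blast
  obtain d where d: "krull_dim R = enat d" using assms by auto
  have td: "t \<le> d" using dim_S_le t(1) d by (metis enat_ord_simps(1))
  have "convergent (\<lambda>n. real (f n) / real n ^ d)"
  proof (rule evpoly_bounded_convergent[OF f(2)])
    fix n :: nat assume n: "n \<ge> 1"
    have "f n \<le> C * n ^ t" using t(2) f(1)[of n] by simp
    also have "\<dots> \<le> C * n ^ d" using n td by (intro mult_le_mono2 power_increasing) auto
    finally have "real (f n) \<le> real (C * n ^ d)" by (simp only: of_nat_le_iff)
    then show "\<bar>real (f n)\<bar> \<le> real C * real n ^ d" by simp
  qed
  then show ?thesis using f(1) by (auto simp: module_dim_S d)
qed

lemma Ulrich_iff_of_decomp:
  assumes "krull_dim R \<noteq> \<infinity>" "local_module R M" "power_decomp R M A h p q"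
  shows "Ulrich R M \<longleftrightarrow> Ulrich R A"
proof -
  obtain f where "\<And>n. has_len R A (SR.adic n) (carrier A) (f n)"
    "convergent (\<lambda>n. real (f n) / real n ^ the_enat (module_dim R A))" using hilbert_S[OF assms(1)] by blast
  then show ?thesis by (rule power_decomp.Ulrich_iff[OF assms(3,2) SR.local_module_axioms])
qed

end

section \<open>Transfer of the Ulrich property\<close>

lemma (in MCM_setting) Ulrich_transfer: "Ulrich R M \<longleftrightarrow> Ulrich R A"
proof -
  obtain h where h: "h \<ge> 1" "module_iso R M (power_module A h)" using M_free by auto
  obtain p q where "power_decomp R M A h p q"
    using power_decomp_of_iso[OF M.module_axioms SR.module_axioms h(2,1)] by blast
  from Ulrich_iff_of_decomp[OF _ M.local_module_axioms this] show ?thesis by (simp add: dim_R)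
qed

text \<open>\<open>has_Ulrich_module\<close> fixes the type of the module elements, so S is copied
  into it: \<open>u\<close> sends x to the singleton of the constant function x. The copy is treated
  as a direct power with one summand.\<close>

lemma (in S2_setting) Ulrich_copy:
  assumes U: "Ulrich R A"
  shows "\<exists>M :: ('a, (nat \<Rightarrow> 'a) set) module. Ulrich R M"
proof -
  \<comment> \<open>S itself is maximal Cohen-Macaulay here; from the interpretation it follows that
    dim R is finite.\<close>
  interpret AS: MCM_setting R K S A by unfold_locales (use U in \<open>simp add: Ulrich_def\<close>)
  define u :: "'a \<Rightarrow> (nat \<Rightarrow> 'a) set" where "u x = {\<lambda>_. x}" for x
  define v :: "(nat \<Rightarrow> 'a) set \<Rightarrow> 'a" where "v X = the_elem X 0" for X
  have vu [simp]: "v (u x) = x" for x by (simp add: u_def v_def)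
  define M :: "('a, (nat \<Rightarrow> 'a) set) module" where
    "M = \<lparr>carrier = u ` carrier S, mult = \<lambda>X Y. X, one = u \<zero>\<^bsub>S\<^esub>, zero = u \<zero>\<^bsub>S\<^esub>,
      add = \<lambda>X Y. u (v X \<oplus>\<^bsub>S\<^esub> v Y), smult = \<lambda>r X. u (r \<otimes>\<^bsub>S\<^esub> v X)\<rparr>"
  have ops: "carrier M = u ` carrier S" "\<zero>\<^bsub>M\<^esub> = u \<zero>\<^bsub>S\<^esub>" "X \<oplus>\<^bsub>M\<^esub> Y = u (v X \<oplus>\<^bsub>S\<^esub> v Y)" "r \<odot>\<^bsub>M\<^esub> X = u (r \<otimes>\<^bsub>S\<^esub> v X)" for X Y r
    by (simp_all add: M_def)
  interpret U: semilinear_surj R A R M "\<lambda>a. a" u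
    by unfold_locales (simp_all add: ops)
  interpret M: module R M by (rule U.module_V)
  obtain us where us: "set us \<subseteq> carrier A" "carrier A = lspan R A us" using SR.fg by (rule fgenE)
  have "carrier M = lspan R M (map u us)" using U.image_lspan[OF us(1)] us(2) by (simp add: ops)
  moreover have "set (map u us) \<subseteq> carrier M" using us(1) by (auto simp: ops)
  ultimately have "fgen R M (carrier M)" unfolding fgen_def by blast
  then have M: "local_module R M" by unfold_locales
  have "power_decomp R M A 1 (\<lambda>_. v) (\<lambda>_. u)"
    by unfold_locales (auto simp: ops module_hom_def in_S)
  from Ulrich_iff_of_decomp[OF _ M this] have "Ulrich R M" using U by (simp add: AS.dim_R)
  then show ?thesis ..
qed

theorem theorem2:
  fixes R K S :: "'a ring"
  assumes "local_ring R" and "domain R"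
    and "infinite (carrier (R Quot max_ideal R))"
    and "fraction_field R K"
    and "S2_ification R K S"
    and "regular_local_ring S"
  shows "(\<forall>M :: ('a, 'm) module. MCM R M \<longrightarrow>
            (\<exists>h\<ge>1. module_iso R M (power_module (ring_as_module S) h)))
       \<and> (has_Ulrich_module R \<longleftrightarrow> Ulrich R (ring_as_module S))
       \<and> (\<forall>M :: ('a, 'm) module. Ulrich R M \<longrightarrow> Ulrich R (ring_as_module S))"
proof -
  interpret S2_setting R K S by (rule S2_setting.intro[OF assms(1,2,4-6)])
  \<comment> \<open>Stated for an arbitrary element type, since it is applied both to the type in
    \<open>has_Ulrich_module\<close> and to that of the last conjunct.\<close>
  have transfer: "Ulrich R (ring_as_module S)" if "Ulrich R M" for M :: "('a, 'n) module"
  proof -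
    interpret MCM_setting R K S M by unfold_locales (use that in \<open>simp add: Ulrich_def\<close>)
    show ?thesis using that Ulrich_transfer by simp
  qed
  have free: "\<exists>h\<ge>1. module_iso R M (power_module (ring_as_module S) h)" if "MCM R M" for M :: "('a, 'm) module"
  proof -
    interpret MCM_setting R K S M by unfold_locales fact
    show ?thesis by (rule M_free)
  qed
  have "has_Ulrich_module R \<longleftrightarrow> Ulrich R (ring_as_module S)"
    using transfer Ulrich_copy unfolding has_Ulrich_module_def by blast
  then show ?thesis using free transfer by blast
qed

end
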